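(* Let $[M_1,\dots,M_m]$ and $[E_1,\dots,E_m]$ be admissible data of $n\times n$ matrices, let $a_1,\dots,a_m\in\mathbb C$ be distinct points, and let $\varkappa_1\ge\dots\ge\varkappa_n$ be integers with $\varkappa_k-\varkappa_{k+1}=m-2$ for each $k=1,\dots,n-1$. For $k=1,\dots,m$, denote by $\varepsilon_k^{(1)},\dots,\varepsilon_k^{(n)}$ the eigenvalues of the matrix $E_k$. Then the following two statements are equivalent: (i) $[M_1,\dots,M_m]$ and $[E_1,\dots,E_m]$ is the data associated to some system of standard form $Y'(\tilde z)=A(z)Y(\tilde z)$ with singularities $a_1,\dots,a_m$ and indices $\varkappa_1,\dots,\varkappa_n$, where $$A(z)=\frac1{p(z)}\begin{pmatrix}\varkappa_1z^{m-1}+p_{11}&p_{12}&p_{13}&\dots&p_{1n}\\ \alpha_1&\varkappa_2z^{m-1}+p_{22}&p_{23}&&p_{2n}\\ 0&\alpha_2&\varkappa_3z^{m-1}+p_{33}&\ddots&\vdots\\ \vdots&&\ddots&\ddots&p_{n-1,n}\\ 0&0&\dots&\alpha_{n-1}&\varkappa_nz^{m-1}+p_{nn}\end{pmatrix},$$ $p(z)=(z-a_1)\cdots(z-a_m)$, $p_{ij}$ ($i\le j$) is a polynomial of degree at most $(m-2)(1+j-i)$, $\alpha_k\in\mathbb C$, and $\alpha_1\cdots\alpha_{n-1}\ne0$. (ii) $[M_1,\dots,M_m]$ is the monodromy of some $n$-th order linear differential equation with Fuchsian singularities at $a_1,\dots,a_m$ (and no other singularities in $\dot{\mathbb C}$)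 and local exponents given by $\{\varepsilon_k^{(1)},\dots,\varepsilon_k^{(n)}\}$ for $z=a_k$, $k=1,\dots,m-1$, and $\{\varepsilon_m^{(1)}-\varkappa_n,\dots,\varepsilon_m^{(n)}-\varkappa_n\}$ for $z=a_m$.
   Context: $\dot{\mathbb C}=\mathbb C\cup\{\infty\}$; $G\mathbb C^{n\times n}$ is the group of invertible complex $n\times n$ matrices; for single matrices $M\sim M'$ means similarity. The distinct points $a_1,\dots,a_m\in\mathbb C$ lie in this order on a fixed smooth (simple) closed positively oriented curve $\Gamma\subset\mathbb C$ (indices cyclic). Let $S=\dot{\mathbb C}\setminus\{a_1,\dots,a_m\}$, $\rho:\tilde S\to S$ its universal covering, write $z=\rho(\tilde z)$ for $\tilde z\in\tilde S$, and $\tilde S^*=\tilde S\setminus\rho^{-1}(\infty)$. For small $\delta>0$, $D_a=\{0<|z-a|<\delta\}$ ($a\in\mathbb C$), $D_\infty=\{|z|>1/\delta\}$, $\tilde D_a$ is the universal covering of $D_a$, and $(\tilde z-a)^E=\exp(E\ln(\tilde z-a))$ on $\tilde D_a$. Fix $\tilde z_0\in\tilde S$ with $\rho(\tilde z_0)$ inside $\Gamma$; for each $k$ let $\tilde z_k$ be the endpoint of a simple path in $\tilde S$ starting at $\tilde z_0$ whose projection is a closed curve based at $\rho(\tilde z_0)$ meeting $\Gamma$ exactly twice, first on the subarc joining $a_{k-1}$ and $a_k$, then on the subarc joining $a_k$ and $a_{k+1}$ (so it goes once around $a_k$ in the positive direction), and let $\sigma_k$ be the deck transformation of $\tilde S$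 with $\sigma_k(\tilde z_0)=\tilde z_k$. For a solution $Y:\tilde S^*\to G\mathbb C^{n\times n}$ of a linear system $Y'(\tilde z)=A(z)Y(\tilde z)$, the matrices $\chi(\sigma)$ are defined by $Y(\tilde z)=Y(\sigma(\tilde z))\chi(\sigma)$. Two $m$-tuples of matrices are equivalent if they are simultaneously similar; $[\cdot]_\sim$ is the equivalence class. The monodromy of the system is $[\chi(\sigma_1),\dots,\chi(\sigma_m)]_\sim$. A matrix is non-resonant if no two of its eigenvalues differ by a nonzero integer. Tuples $[M_1,\dots,M_m]$, $[E_1,\dots,E_m]$ of $n\times n$ matrices are admissible data if $M_1\cdots M_m=I$, $M_k\sim\exp(-2\pi iE_k)$ for each $k$, and all $E_k$ are non-resonant. The system $Y'(\tilde z)=A(z)Y(\tilde z)$ is of standard form with respect to these admissible data (the data is then said to be associated to the system), with singularities $a_1,\dots,a_m$ and indices $\varkappa_1\ge\dots\ge\varkappa_n$ (integers) if: (i) it has singularities only at $a_1,\dots,a_m$ and at infinity (i.e. $A$ is analytic on $\mathbb C\setminus\{a_1,\dots,a_m\}$), the singularity at infinity being apparent (solutions have no branching there); (ii) its monodromy is $[M_1,\dots,M_m]_\sim$; (iii) for each $k$ the solutions on $\tilde D_{a_k}$ can be written $Y(\tilde z)=Z_k(z)(\tilde z-a_k)^{E_k}C$ with $Z_k:D_{a_k}\cup\{a_k\}\to G\mathbb C^{n\times n}$ analytic and $C\in G\mathbb C^{n\times n}$; (iv) the solutions on $D_\infty$ can be written $Y(z)=\mathrm{diag}(z^{\varkappa_1},\dots,z^{\varkappa_n})Z_\infty(z)C$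 with $Z_\infty:D_\infty\cup\{\infty\}\to G\mathbb C^{n\times n}$ analytic and $C\in G\mathbb C^{n\times n}$. Scalar equations. An $n$-th order linear differential equation is $y^{(n)}+q_1(z)y^{(n-1)}+\dots+q_n(z)y=0$ with $q_j$ analytic on $\mathbb C$ except for finitely many points, its singularities; $\infty$ is a singularity if $0$ is a singularity of the equation obtained by the change of variables $z\mapsto1/(z-a)$ (independent of $a\in\mathbb C$). A singularity $a\in\mathbb C$ is Fuchsian if $q_k(z)=r_k(z)/(z-a)^k$ with $r_k$ analytic at $a$, $k=1,\dots,n$; its local exponents are the roots $\rho$ of $\rho(\rho-1)\cdots(\rho-n+1)+\sum_{k=1}^nr_k(a)\rho(\rho-1)\cdots(\rho-n+1+k)=0$. For linearly independent solutions $y_1,\dots,y_n$ on $\tilde S$, $\chi(\sigma)$ is defined by $(y_1(\tilde z),\dots,y_n(\tilde z))=(y_1(\sigma(\tilde z)),\dots,y_n(\sigma(\tilde z)))\chi(\sigma)$, and the monodromy of the equation is $[\chi(\sigma_1),\dots,\chi(\sigma_m)]_\sim$. *)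

theory Defs
  imports
    "HOL-Complex_Analysis.Complex_Analysis"
    "Jordan_Normal_Form.Char_Poly"
begin

section \<open>The Riemann sphere\<close>

text \<open>The one-point compactification; \<^term>\<open>None\<close> is the point at infinity.\<close>

instantiation option :: (topological_space) topological_space
begin

definition open_option :: "'a option set \<Rightarrow> bool" where
  "open_option U \<longleftrightarrow> openin (Alexandroff_compactification euclidean) U"

instance
proof
  show "open (UNIV :: 'a option set)"
    using openin_topspace[of "Alexandroff_compactification (euclidean :: 'a topology)"]
    by (simp add: open_option_def UNIV_option_conv)
  show "open (S \<inter> T)" if "open S" "open T" for S T :: "'a option set"
    using that by (simp add: open_option_def openin_Int)
  show "open (\<Union>K)" if "\<forall>S\<in>K. open S" for K :: "'a option set set"
    using that by (simp add: open_option_def openin_Union)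
qed

end

type_synonym csphere = "complex option"

fun sphere_coord :: "csphere \<Rightarrow> complex \<Rightarrow> csphere" where
  "sphere_coord (Some z) h = Some (z + h)"
| "sphere_coord None h = (if h = 0 then None else Some (1 / h))"

section \<open>Coverings and analytic functions on them\<close>

definition universal_covering ::
    "'a::topological_space set \<Rightarrow> ('a \<Rightarrow> 'b::topological_space) \<Rightarrow> 'b set \<Rightarrow> bool" where
  "universal_covering X \<rho> S \<longleftrightarrow> covering_space X \<rho> S \<and> simply_connected X"

definition deck_transformation ::
    "'a::topological_space set \<Rightarrow> ('a \<Rightarrow> 'b) \<Rightarrow> ('a \<Rightarrow> 'a) \<Rightarrow> bool" where
  "deck_transformation X \<rho> \<sigma> \<longleftrightarrow> (\<exists>\<tau>. homeomorphism X X \<sigma> \<tau>) \<and> (\<forall>x\<in>X. \<rho> (\<sigma> x) = \<rho> x)"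

text \<open>
  \<open>g\<close> is a local inverse of the projection \<open>\<rho>\<close> near \<open>x\<close>, written in the coordinate \<open>h\<close> of the sphere
  centred at \<open>\<rho> x\<close>. Since \<open>h = z - \<rho> x\<close> at finite points, derivatives of \<open>f \<circ> g\<close> at \<open>0\<close> are the
  derivatives of \<open>f\<close> with respect to \<open>z\<close>.
\<close>

definition local_lift ::
    "'a::topological_space set \<Rightarrow> ('a \<Rightarrow> csphere) \<Rightarrow> 'a \<Rightarrow> real \<Rightarrow> (complex \<Rightarrow> 'a) \<Rightarrow> bool" where
  "local_lift X \<rho> x r g \<longleftrightarrow>
     r > 0 \<and> continuous_on (ball 0 r) g \<and> g ` ball 0 r \<subseteq> X \<and> g 0 = x \<and>
     (\<forall>h\<in>ball 0 r. \<rho> (g h) = sphere_coord (\<rho> x) h)"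

definition finite_part :: "'a set \<Rightarrow> ('a \<Rightarrow> csphere) \<Rightarrow> 'a set" where
  "finite_part X \<rho> = {x \<in> X. \<rho> x \<noteq> None}"

section \<open>Matrices\<close>

abbreviation GL :: "nat \<Rightarrow> complex mat set" where
  "GL n \<equiv> {A \<in> carrier_mat n n. invertible_mat A}"

definition mat_exp :: "nat \<Rightarrow> complex mat \<Rightarrow> complex mat" where
  "mat_exp n A = Matrix.mat n n (\<lambda>(i,j). \<Sum>k. (A ^\<^sub>m k) $$ (i,j) / fact k)"

definition mat_holomorphic_on :: "nat \<Rightarrow> (complex \<Rightarrow> complex mat) \<Rightarrow> complex set \<Rightarrow> bool" where
  "mat_holomorphic_on n Z D \<longleftrightarrow> (\<forall>i<n. \<forall>j<n. (\<lambda>z. Z z $$ (i,j)) holomorphic_on D)"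

definition simultaneously_similar ::
    "nat \<Rightarrow> (nat \<Rightarrow> complex mat) \<Rightarrow> (nat \<Rightarrow> complex mat) \<Rightarrow> bool" where
  "simultaneously_similar m M N \<longleftrightarrow> (\<exists>P Q. \<forall>k\<in>{1..m}. similar_mat_wit (M k) (N k) P Q)"

definition non_resonant :: "complex mat \<Rightarrow> bool" where
  "non_resonant E \<longleftrightarrow>
     \<not> (\<exists>x y. eigenvalue E x \<and> eigenvalue E y \<and> x \<noteq> y \<and> x - y \<in> \<int>)"

definition admissible_data ::
    "nat \<Rightarrow> nat \<Rightarrow> (nat \<Rightarrow> complex mat) \<Rightarrow> (nat \<Rightarrow> complex mat) \<Rightarrow> bool" where
  "admissible_data n m M E \<longleftrightarrow>
     (\<forall>k\<in>{1..m}. M k \<in> carrier_mat n n \<and> E k \<in> carrier_mat n n) \<and>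
     foldr (\<lambda>k P. M k * P) [1..<Suc m] (1\<^sub>m n) = 1\<^sub>m n \<and>
     (\<forall>k\<in>{1..m}. similar_mat (M k) (mat_exp n ((- 2 * of_real pi * \<i>) \<cdot>\<^sub>m E k))) \<and>
     (\<forall>k\<in>{1..m}. non_resonant (E k))"

section \<open>The curve and the generating deck transformations\<close>

text \<open>
  A smooth closed curve is parametrised by a 1-periodic regular \<open>C\<^sup>1\<close> function on the whole line. The
  parameters \<open>t k\<close> of the marked points are extended to all indices by \<open>t (k + m) = t k + 1\<close>, so
  that \<open>\<gamma> (t (k + m)) = \<gamma> (t k)\<close> and the open subarc from \<open>a (k - 1)\<close> to \<open>a k\<close> (indices
  cyclic) is \<open>\<gamma> ` {t (k - 1)<..<t k}\<close>.
\<close>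

definition smooth_jordan_curve :: "(real \<Rightarrow> complex) \<Rightarrow> bool" where
  "smooth_jordan_curve \<gamma> \<longleftrightarrow>
     \<gamma> C1_differentiable_on UNIV \<and> (\<forall>s. vector_derivative \<gamma> (at s) \<noteq> 0) \<and>
     (\<forall>s. \<gamma> (s + 1) = \<gamma> s) \<and> inj_on \<gamma> {0..<1} \<and>
     (\<forall>z\<in>inside (path_image \<gamma>). winding_number \<gamma> z = 1)"

definition cyclically_ordered_on ::
    "(real \<Rightarrow> complex) \<Rightarrow> (nat \<Rightarrow> real) \<Rightarrow> nat \<Rightarrow> (nat \<Rightarrow> complex) \<Rightarrow> bool" where
  "cyclically_ordered_on \<gamma> t m a \<longleftrightarrow>
     strict_mono t \<and> (\<forall>k. t (k + m) = t k + 1) \<and> (\<forall>k\<in>{1..m}. \<gamma> (t k) = a k)"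

text \<open>
  Meeting the curve twice is understood as crossing it: between the two meeting points the projected
  path is on the outer side (which contains infinity), so that it does go around \<open>a k\<close>.
\<close>

definition encircling_path ::
    "'a::topological_space set \<Rightarrow> ('a \<Rightarrow> csphere) \<Rightarrow> (real \<Rightarrow> complex) \<Rightarrow> (nat \<Rightarrow> real) \<Rightarrow>
     'a \<Rightarrow> nat \<Rightarrow> (real \<Rightarrow> 'a) \<Rightarrow> bool" where
  "encircling_path X \<rho> \<gamma> t x0 k c \<longleftrightarrow>
     simple_path c \<and> path_image c \<subseteq> X \<and> pathstart c = x0 \<and> \<rho> (pathfinish c) = \<rho> x0 \<and>
     (\<exists>u v. u < v \<and> {s\<in>{0..1}. \<rho> (c s) \<in> Some ` path_image \<gamma>} = {u, v} \<and>
        \<rho> (c u) \<in> Some ` \<gamma> ` {t (k - 1)<..<t k} \<and>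
        \<rho> (c v) \<in> Some ` \<gamma> ` {t k<..<t (k + 1)} \<and>
        (\<forall>s\<in>{u<..<v}. \<rho> (c s) \<notin> Some ` inside (path_image \<gamma>)))"

section \<open>Linear systems\<close>

text \<open>
  Solutions of \<open>Y' = A Y\<close> with values in \<^term>\<open>GL n\<close> on a space \<open>X\<close> lying over the complex
  plane via \<open>\<rho>\<close>.
\<close>

definition system_solution ::
    "nat \<Rightarrow> (complex \<Rightarrow> complex mat) \<Rightarrow> 'a::topological_space set \<Rightarrow> ('a \<Rightarrow> csphere) \<Rightarrow>
     ('a \<Rightarrow> complex mat) \<Rightarrow> bool" where
  "system_solution n A X \<rho> Y \<longleftrightarrow>
     (\<forall>x\<in>X. Y x \<in> GL n \<and>
        (\<exists>z r g. \<rho> x = Some z \<and> local_lift X \<rho> x r g \<and>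
           (\<forall>i<n. \<forall>j<n.
              ((\<lambda>h. Y (g h) $$ (i,j)) has_field_derivative (A z * Y x) $$ (i,j)) (at 0))))"

definition system_monodromy ::
    "nat \<Rightarrow> nat \<Rightarrow> (complex \<Rightarrow> complex mat) \<Rightarrow> 'a::topological_space set \<Rightarrow> ('a \<Rightarrow> csphere) \<Rightarrow>
     (nat \<Rightarrow> 'a \<Rightarrow> 'a) \<Rightarrow> (nat \<Rightarrow> complex mat) \<Rightarrow> bool" where
  "system_monodromy n m A X \<rho> \<sigma> M \<longleftrightarrow>
     (\<exists>Y Chi. system_solution n A (finite_part X \<rho>) \<rho> Y \<and>
        (\<forall>k\<in>{1..m}. Chi k \<in> carrier_mat n n \<and>
           (\<forall>x\<in>finite_part X \<rho>. Y x = Y (\<sigma> k x) * Chi k)) \<and>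
        simultaneously_similar m Chi M)"

text \<open>
  The universal covering of the punctured disc of radius \<open>\<delta>\<close> around \<open>a\<close> is the half-plane
  \<open>Re w < ln \<delta>\<close> with projection \<open>w \<mapsto> a + exp w\<close>; thus \<open>w\<close> is a branch of \<open>ln (z - a)\<close>
  and \<^term>\<open>mat_exp n (w \<cdot>\<^sub>m E)\<close> is the power with matrix exponent \<open>E\<close>. Likewise,
  \<open>Re w > - ln \<delta>\<close> with \<open>w \<mapsto> exp w\<close> covers the punctured neighbourhood \<open>norm z > 1 / \<delta>\<close>
  of infinity. A function analytic at infinity is written as \<open>H (1 / z)\<close> with \<open>H\<close> analytic at \<open>0\<close>.
  ``For small \<open>\<delta>\<close>'' matters: for large \<open>\<delta>\<close> the regions would contain other singularities.
\<close>

definition apparent_at_infinity :: "nat \<Rightarrow> (complex \<Rightarrow> complex mat) \<Rightarrow> bool" where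
  "apparent_at_infinity n A \<longleftrightarrow>
     (\<forall>\<^sub>F \<delta> in at_right 0. \<forall>Y.
        system_solution n A {w. Re w > - ln \<delta>} (\<lambda>w. Some (exp w)) Y \<longrightarrow>
        (\<forall>w. Re w > - ln \<delta> \<longrightarrow> Y (w + 2 * of_real pi * \<i>) = Y w))"

definition local_form_at ::
    "nat \<Rightarrow> (complex \<Rightarrow> complex mat) \<Rightarrow> complex \<Rightarrow> complex mat \<Rightarrow> bool" where
  "local_form_at n A a E \<longleftrightarrow>
     (\<forall>\<^sub>F \<delta> in at_right 0. \<forall>Y.
        system_solution n A {w. Re w < ln \<delta>} (\<lambda>w. Some (a + exp w)) Y \<longrightarrow>
        (\<exists>Z C. mat_holomorphic_on n Z (ball a \<delta>) \<and> (\<forall>z\<in>ball a \<delta>. Z z \<in> GL n) \<and> C \<in> GL n \<and>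
           (\<forall>w. Re w < ln \<delta> \<longrightarrow> Y w = Z (a + exp w) * mat_exp n (w \<cdot>\<^sub>m E) * C)))"

definition local_form_at_infinity ::
    "nat \<Rightarrow> (complex \<Rightarrow> complex mat) \<Rightarrow> (nat \<Rightarrow> int) \<Rightarrow> bool" where
  "local_form_at_infinity n A \<kappa> \<longleftrightarrow>
     (\<forall>\<^sub>F \<delta> in at_right 0. \<forall>Y.
        system_solution n A {z. norm z > 1 / \<delta>} Some Y \<longrightarrow>
        (\<exists>H C. mat_holomorphic_on n H (ball 0 \<delta>) \<and> (\<forall>h\<in>ball 0 \<delta>. H h \<in> GL n) \<and> C \<in> GL n \<and>
           (\<forall>z. norm z > 1 / \<delta> \<longrightarrow>
              Y z = Matrix.mat n n (\<lambda>(i,j). if i = j then z powi \<kappa> (i + 1) else 0)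
                    * H (1 / z) * C)))"

text \<open>The tuples are indexed from \<open>1\<close>, matrix entries from \<open>0\<close>.\<close>

definition standard_form ::
    "nat \<Rightarrow> nat \<Rightarrow> (nat \<Rightarrow> complex) \<Rightarrow> 'a::topological_space set \<Rightarrow> ('a \<Rightarrow> csphere) \<Rightarrow>
     (nat \<Rightarrow> 'a \<Rightarrow> 'a) \<Rightarrow> (nat \<Rightarrow> complex mat) \<Rightarrow> (nat \<Rightarrow> complex mat) \<Rightarrow> (nat \<Rightarrow> int) \<Rightarrow>
     (complex \<Rightarrow> complex mat) \<Rightarrow> bool" where
  "standard_form n m a X \<rho> \<sigma> M E \<kappa> A \<longleftrightarrow>
     (\<forall>z. A z \<in> carrier_mat n n) \<and> mat_holomorphic_on n A (UNIV - a ` {1..m}) \<and>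
     apparent_at_infinity n A \<and>
     system_monodromy n m A X \<rho> \<sigma> M \<and>
     (\<forall>k\<in>{1..m}. local_form_at n A (a k) (E k)) \<and>
     local_form_at_infinity n A \<kappa>"

section \<open>Scalar equations\<close>

text \<open>
  The coefficients of an equation of order \<open>n\<close> are \<open>q 1, \<dots>, q n\<close>. An exceptional point of the
  coefficients is allowed to be removable, as for systems.
\<close>

definition ode_lhs ::
    "nat \<Rightarrow> (nat \<Rightarrow> complex \<Rightarrow> complex) \<Rightarrow> complex \<Rightarrow> (complex \<Rightarrow> complex) \<Rightarrow> complex \<Rightarrow> complex" where
  "ode_lhs n q z f h = (deriv ^^ n) f h + (\<Sum>k=1..n. q k z * (deriv ^^ (n - k)) f h)"

text \<open>
  \<open>Q\<close> are the coefficients of the equation which results from \<open>q\<close> by the substitution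
  \<open>w = 1 / (z - a)\<close>: near \<open>w = 0\<close>, a function \<open>u\<close> satisfies the new equation at \<open>w\<close> iff
  \<open>z \<mapsto> u (1 / (z - a))\<close> satisfies the old one at the corresponding point. As the leading
  coefficient is normalised to \<open>1\<close>, this determines \<open>Q\<close> at \<open>w\<close>.
\<close>

definition inverted_equation ::
    "nat \<Rightarrow> complex \<Rightarrow> (nat \<Rightarrow> complex \<Rightarrow> complex) \<Rightarrow> (nat \<Rightarrow> complex \<Rightarrow> complex) \<Rightarrow> bool" where
  "inverted_equation n a q Q \<longleftrightarrow>
     (\<forall>\<^sub>F w in at 0. \<forall>u. u analytic_on {w} \<longrightarrow>
        (ode_lhs n Q w u w = 0 \<longleftrightarrow>
         ode_lhs n q (a + 1 / w) (\<lambda>z. u (1 / (z - a))) (a + 1 / w) = 0))"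

text \<open>The following condition does not depend on the choice of \<open>a\<close>.\<close>

definition nonsingular_at_infinity :: "nat \<Rightarrow> (nat \<Rightarrow> complex \<Rightarrow> complex) \<Rightarrow> bool" where
  "nonsingular_at_infinity n q \<longleftrightarrow>
     (\<forall>a. \<exists>Q. inverted_equation n a q Q \<and> (\<forall>k\<in>{1..n}. Q k analytic_on {0}))"

definition falling_poly :: "nat \<Rightarrow> complex poly" where
  "falling_poly d = (\<Prod>i<d. [:- of_nat i, 1:])"

definition indicial_poly :: "nat \<Rightarrow> (nat \<Rightarrow> complex) \<Rightarrow> complex poly" where
  "indicial_poly n c = falling_poly n + (\<Sum>k=1..n. Polynomial.smult (c k) (falling_poly (n - k)))"

definition fuchsian_with_exponents ::
    "nat \<Rightarrow> (nat \<Rightarrow> complex \<Rightarrow> complex) \<Rightarrow> complex \<Rightarrow> complex multiset \<Rightarrow> bool" where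
  "fuchsian_with_exponents n q a R \<longleftrightarrow>
     (\<exists>r. (\<forall>k\<in>{1..n}. r k analytic_on {a} \<and> (\<forall>\<^sub>F z in at a. q k z = r k z / (z - a) ^ k)) \<and>
        proots (indicial_poly n (\<lambda>k. r k a)) = R)"

text \<open>
  Solutions are analytic everywhere on the covering, also over infinity; the equation itself is
  formulated over the finite points.
\<close>

definition equation_solution ::
    "nat \<Rightarrow> (nat \<Rightarrow> complex \<Rightarrow> complex) \<Rightarrow> 'a::topological_space set \<Rightarrow> ('a \<Rightarrow> csphere) \<Rightarrow>
     ('a \<Rightarrow> complex) \<Rightarrow> bool" where
  "equation_solution n q X \<rho> y \<longleftrightarrow>
     (\<forall>x\<in>X. \<exists>r g. local_lift X \<rho> x r g \<and> (\<lambda>h. y (g h)) holomorphic_on ball 0 r \<and>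
        (\<forall>z. \<rho> x = Some z \<longrightarrow> ode_lhs n q z (\<lambda>h. y (g h)) 0 = 0))"

definition equation_monodromy ::
    "nat \<Rightarrow> nat \<Rightarrow> (nat \<Rightarrow> complex \<Rightarrow> complex) \<Rightarrow> 'a::topological_space set \<Rightarrow> ('a \<Rightarrow> csphere) \<Rightarrow>
     (nat \<Rightarrow> 'a \<Rightarrow> 'a) \<Rightarrow> (nat \<Rightarrow> complex mat) \<Rightarrow> bool" where
  "equation_monodromy n m q X \<rho> \<sigma> M \<longleftrightarrow>
     (\<exists>y Chi. (\<forall>i<n. equation_solution n q X \<rho> (y i)) \<and>
        (\<forall>c. (\<forall>x\<in>X. (\<Sum>i<n. c i * y i x) = 0) \<longrightarrow> (\<forall>i<n. c i = 0)) \<and>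
        (\<forall>k\<in>{1..m}. Chi k \<in> carrier_mat n n \<and>
           (\<forall>x\<in>X. \<forall>j<n. y j x = (\<Sum>i<n. y i (\<sigma> k x) * Chi k $$ (i,j)))) \<and>
        simultaneously_similar m Chi M)"

end

theory Submission
  imports Defs "Jordan_Normal_Form.Schur_Decomposition"
begin

text \<open>
  The last component of a Hessenberg system with constant nonzero subdiagonal satisfies a scalar
  equation, and its Euler derivatives recover the other components. Normalising by
  \<open>(z - a\<^sub>m)\<close> to the power \<open>- \<kappa>\<^sub>n\<close> makes the system regular up to the gauge with exponents
  \<open>\<kappa>\<^sub>i - \<kappa>\<^sub>n\<close> at infinity; since these form an arithmetic progression with difference \<open>m - 2\<close>, the
  substitution \<open>z = 1 / w\<close> turns the Hessenberg shape into the same shape near \<open>w = 0\<close>. At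
  \<open>a\<^sub>k\<close> the indicial polynomial is the characteristic polynomial of the residue. Conversely the equation
  determines the closing row of the system, which extends to an entire function of polynomial
  growth and hence is polynomial. The local normal forms come from pulling solutions back to a
  half-plane by the exponential map: translation by one period becomes the deck transformation,
  and non-resonance removes the logarithmic obstruction, so no Frobenius series are needed.
\<close>

text \<open>Three gaps separate the two statements. The deck transformations are given by paths that
  cross the curve, while the local forms need a small loop around \<open>a k\<close>. The sphere
  minus either of two closed arcs ending at \<open>a k\<close> is simply connected and carries a
  section of \<open>\<rho>\<close>; the two sections agree outside the curve and differ by
  \<open>\<sigma> k\<close> inside, and a small circle passes from one to the other. That it crosses
  the arcs in the right order rests on the left normal pointing inside, which follows from the jump
  of the winding number. Exponents fix only the spectrum of a residue, whereas standard form
  prescribes \<open>E k\<close> itself. The missing information is the local monodromy: after a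
  constant change of basis, \<open>Y\<close> times the power with exponent \<open>- E k\<close> is
  single-valued, and non-resonance lets it extend invertibly to the puncture. A scalar equation
  determines its Hessenberg system only after all rows but the top one have been chosen. An explicit
  choice with constant subdiagonal numerators is made; regularity of the equation at the punctures
  and at infinity then controls the top row.\<close>

notation has_field_derivative (infix "hfd" 50)
notation holomorphic_on (infixl "hol" 50)
notation smult_mat (infixl "\<cdot>" 70)

abbreviation sq_mat :: "nat => 'a mat set" where
  "sq_mat n == carrier_mat n n"

abbreviation psmult :: "'a::comm_semiring_0 => 'a poly => 'a poly" where
  "psmult == Polynomial.smult"

abbreviation mat_hol :: "nat => (complex => complex mat) => complex set => bool" where
  "mat_hol == mat_holomorphic_on"

abbreviation tpi :: complex where
  "tpi == 2 * of_real pi * \<i>"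

abbreviation zmat :: "nat => 'a::zero mat" where
  "zmat n == 0\<^sub>m n n"

section \<open>Lifting to covering spaces\<close>

lemma covering_sheet:
 fixes \<rho> :: "'a::topological_space => 'b::topological_space"
 assumes "covering_space X \<rho> S" "y : S"
 obtains T v where "y : T" "openin (top_of_set S) T" "\<Union>v = X Int \<rho> -` T"
  "!!u. u : v ==> openin (top_of_set X) u"
  "!!u u'. u : v ==> u' : v ==> u ~= u' ==> u Int u' = {}"
  "!!u. u : v ==> EX q. homeomorphism u T \<rho> q"
proof -
 from assms obtain T v where "y : T & openin (top_of_set S) T & \<Union>v = X Int \<rho> -` T &
  (ALL u:v. openin (top_of_set X) u) & pairwise disjnt v & (ALL u:v. EX q. homeomorphism u T \<rho> q)"
  unfolding covering_space_def by meson
 thus thesis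
  by (intro that[of T v]) (auto simp: pairwise_def disjnt_def)
qed

text \<open>Near a point both lifts stay in sheets over one evenly covered set: in the same sheet
  they agree, in different sheets they differ throughout because sheets are disjoint. So agreement
  and disagreement are both open conditions, without any separation axiom on
  \<open>'a\<close>.\<close>

lemma covering_lift_unique:
 fixes \<rho> :: "'a::topological_space => 'b::topological_space"
  and g1 g2 :: "'c::topological_space => 'a"
 assumes cov: "covering_space X \<rho> S" and T: "connected T"
  and g1: "continuous_on T g1" "g1 ` T <= X" and g2: "continuous_on T g2" "g2 ` T <= X"
  and eq: "!!x. x : T ==> \<rho> (g1 x) = \<rho> (g2 x)"
  and a: "a : T" "g1 a = g2 a" and x: "x : T"
 shows "g1 x = g2 x"
proof -
 have loc: "EX N. openin (top_of_set T) N & x : N &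
   ((ALL x':N. g1 x' = g2 x') & g1 x = g2 x | (ALL x':N. g1 x' ~= g2 x') & g1 x ~= g2 x)"
  if x: "x : T" for x
 proof -
  have "\<rho> (g1 x) : S"
   using cov g1 x unfolding covering_space_def by auto
  then obtain B v where B: "\<rho> (g1 x) : B" "openin (top_of_set S) B" "\<Union>v = X Int \<rho> -` B"
   "!!u. u : v ==> openin (top_of_set X) u"
   "!!u u'. u : v ==> u' : v ==> u ~= u' ==> u Int u' = {}"
   "!!u. u : v ==> EX q. homeomorphism u B \<rho> q"
   by (rule covering_sheet[OF cov]) blast
  have "g1 x : \<Union>v" "g2 x : \<Union>v"
   using B(1,3) g1 g2 x eq[OF x] by auto
  then obtain u1 u2 where u: "u1 : v" "g1 x : u1" "u2 : v" "g2 x : u2" by blast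
  define N where "N = (T Int g1 -` u1) Int (T Int g2 -` u2)"
  have N: "openin (top_of_set T) N"
   unfolding N_def using g1 g2 u B(4)
   by (intro openin_Int continuous_openin_preimage[where T=X]) auto
  have inj: "g1 x' = g2 x'" if "x' : N" "u1 = u2" for x'
  proof -
   obtain q where "homeomorphism u1 B \<rho> q" using B(6) u by blast
   hence "q (\<rho> y) = y" if "y : u1" for y using that by (auto simp: homeomorphism_def)
   thus ?thesis using that eq[of x'] unfolding N_def by (metis IntD1 IntD2 vimageE)
  qed
  show ?thesis
  proof (cases "u1 = u2")
   case True
   thus ?thesis using N inj u x unfolding N_def by (intro exI[of _ N]) (auto simp: N_def)
  next
   case False
   hence "u1 Int u2 = {}" using B(5) u by blast
   thus ?thesis using N u x by (intro exI[of _ N]) (auto simp: N_def)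
  qed
 qed
 have sub: "openin (top_of_set T) A"
  if A: "!!x N. x : T ==> x : A ==> x : N ==> N <= T ==>
    (ALL x':N. g1 x' = g2 x') & g1 x = g2 x | (ALL x':N. g1 x' ~= g2 x') & g1 x ~= g2 x ==> N <= A"
   and "A <= T" for A
 proof (subst openin_subopen, intro ballI)
  fix x assume x: "x : A"
  hence "x : T" using \<open>A <= T\<close> by blast
  then obtain N where N: "openin (top_of_set T) N" "x : N"
   "(ALL x':N. g1 x' = g2 x') & g1 x = g2 x | (ALL x':N. g1 x' ~= g2 x') & g1 x ~= g2 x"
   using loc by blast
  have "N <= A" by (rule A[OF \<open>x : T\<close> x N(2) openin_imp_subset[OF N(1)] N(3)])
  thus "EX N. openin (top_of_set T) N & x : N & N <= A" using N by blast
 qed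
 have "openin (top_of_set T) {x : T. g1 x = g2 x}" by (rule sub) auto
 moreover have "openin (top_of_set T) {x : T. g1 x ~= g2 x}" by (rule sub) auto
 hence "closedin (top_of_set T) {x : T. g1 x = g2 x}"
  unfolding closedin_def by (auto simp: set_diff_eq cong: conj_cong)
 ultimately have "{x : T. g1 x = g2 x} = {} | {x : T. g1 x = g2 x} = T"
  using T connected_clopen by blast
 thus ?thesis using a x by blast
qed

lemma continuous_on_openin_locally:
 assumes "!!x. x : K ==> EX U. openin (top_of_set K) U & x : U & continuous_on U g"
 shows "continuous_on K g"
 unfolding continuous_on_topological
proof (intro ballI allI impI)
 fix x B assume x: "x : K" and B: "open B" "g x : B"
 obtain O' where O: "open O'" "x : O'" "continuous_on (K Int O') g"
  using assms[OF x] unfolding openin_open by blast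
 hence "EX A. open A & x : A & (ALL y:K Int O'. y : A --> g y : B)"
  using O(3)[unfolded continuous_on_topological, rule_format, of x B] x B by blast
 then obtain A where "open A" "x : A" "ALL y:K Int O'. y : A --> g y : B" by blast
 thus "EX A. open A & x : A & (ALL y:K. y : A --> g y : B)"
  using O by (intro exI[of _ "A Int O'"]) auto
qed

text \<open>\<open>K\<close> is contracted to \<open>d0\<close> along segments, and the contraction
  is lifted in \<open>N\<close> time steps. Each step prolongs the lift through one sheet over an
  evenly covered set, chosen locally in \<open>x\<close>; uniqueness of lifted paths glues the
  choices.\<close>

lemma covering_lift_compact_convex:
 fixes \<rho> :: "'a::topological_space => 'b::topological_space" and f :: "'c::euclidean_space => 'b"
 assumes cov: "covering_space X \<rho> S" and K: "compact K" "convex K" "d0 : K"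
  and f: "continuous_on K f" "f ` K <= S" and x0: "x0 : X" "\<rho> x0 = f d0"
 shows "EX g. continuous_on K g & g ` K <= X & (ALL x:K. \<rho> (g x) = f x) & g d0 = x0"
proof -
 define s where "s t x = d0 + t *\<^sub>R (x - d0)" for t :: real and x
 have sK: "s t x : K" if "x : K" "0 <= t" "t <= 1" for t x
 proof -
  have "s t x = (1 - t) *\<^sub>R d0 + t *\<^sub>R x" by (simp add: s_def algebra_simps)
  thus ?thesis using that K by (simp add: convexD_alt)
 qed
 define ev where "ev B v \<longleftrightarrow> openin (top_of_set S) B & \<Union>v = X Int \<rho> -` B &
  (ALL u:v. openin (top_of_set X) u & (EX q. homeomorphism u B \<rho> q))" for B v
 define \<G> where "\<G> = {G. open G & (EX B v. ev B v & f ` (K Int G) <= B)}"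
 have "K <= \<Union>\<G>"
 proof
  fix x assume x: "x : K"
  hence "f x : S" using f by blast
  then obtain B v where B: "f x : B" "openin (top_of_set S) B" "\<Union>v = X Int \<rho> -` B"
   "!!u. u : v ==> openin (top_of_set X) u" "!!u. u : v ==> EX q. homeomorphism u B \<rho> q"
   by (rule covering_sheet[OF cov]) blast
  hence "openin (top_of_set K) (K Int f -` B)"
   using f by (intro continuous_openin_preimage[where T=S]) auto
  then obtain G where "open G" "K Int f -` B = K Int G" unfolding openin_open by blast
  moreover have "ev B v" using B unfolding ev_def by auto
  ultimately have "G : \<G>" unfolding \<G>_def by blast
  thus "x : \<Union>\<G>" using x B(1) \<open>K Int f -` B = K Int G\<close> by blast
 qed
 moreover have "!!G. G : \<G> ==> open G" by (simp add: \<G>_def)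
 ultimately obtain e where e: "e > 0" "!!x. x : K ==> EX G:\<G>. ball x e <= G"
  using Heine_Borel_lemma[OF K(1), of \<G>] by blast
 have even: "EX B v. ev B v & f ` (K Int ball x e) <= B" if x: "x : K" for x
 proof -
  obtain G where "G : \<G>" "ball x e <= G" using e x by blast
  thus ?thesis unfolding \<G>_def by blast
 qed
 obtain D where D: "D > 0" "!!x. x : K ==> norm (x - d0) <= D"
 proof -
  obtain D where "!!x. x : K ==> norm x <= D" "D > 0"
   using compact_imp_bounded[OF K(1)] by (auto simp: bounded_pos)
  hence "norm (x - d0) <= D + norm d0" if "x : K" for x
   using that norm_triangle_ineq4[of x d0] by fastforce
  moreover have "D + norm d0 > 0" using \<open>D > 0\<close> by (simp add: add_pos_nonneg)
  ultimately show ?thesis using that by blast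
 qed
 \<comment> \<open>A time step moves \<open>s t x\<close> by at most \<open>D / N\<close>, and a
   change of \<open>x\<close> by less than \<open>e / 2\<close> moves it by less than
   \<open>e / 2\<close>. Together they stay within one ball of Lebesgue radius
   \<open>e\<close>.\<close>
 obtain N :: nat where N: "N > 0" "D / N < e / 2"
 proof -
  obtain N :: nat where "D / (e / 2) < N" using reals_Archimedean2 by blast
  moreover from this have "N > 0" using D e by (cases N) (auto simp: field_simps)
  ultimately show ?thesis using e by (intro that[of N]) (auto simp: field_simps)
 qed
 have scont: "continuous_on A (%t. s t x)" "continuous_on A' (s t)" for A A' t x
  unfolding s_def by (intro continuous_intros)+
 define P where "P t g \<longleftrightarrow> continuous_on K g & g ` K <= X & (ALL x:K. \<rho> (g x) = f (s t x)) & g d0 = x0" for t g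
 have step: "EX g'. P t' g'" if P: "P t g" and t: "0 <= t" "t <= t'" "t' <= 1" "t' - t <= 1 / N" for t t' g
 proof -
  define path where "path x k \<longleftrightarrow> continuous_on {t..t'} k & k ` {t..t'} <= X & k t = g x &
    (ALL ta:{t..t'}. \<rho> (k ta) = f (s ta x))" for x and k :: "real => 'a"
  \<comment> \<open>The endpoint of a path lifted over one time step. By \<open>uniq\<close> it does
    not depend on the choice, so continuity may be checked with any locally continuous family of
    such paths.\<close>
  define g' where "g' x = (SOME k. path x k) t'" for x
  have uniq: "k t' = k' t'" if "path x k" "path x k'" for x k k'
   using that t unfolding path_def
   by (intro covering_lift_unique[OF cov, of "{t..t'}" k k' t t']) auto
  have g': "path x k ==> g' x = k t'" for x k
   unfolding g'_def using someI[of "path x" k] uniq by blast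
  have close: "s ta x : ball (s t x') e" if "x : K" "ta : {t..t'}" "norm (x - x') < e / 2" for x x' ta
  proof -
   have "s t x' - s ta x = t *\<^sub>R (x' - x) - (ta - t) *\<^sub>R (x - d0)"
    by (simp add: s_def algebra_simps)
   hence "norm (s t x' - s ta x) <= \<bar>t\<bar> * norm (x' - x) + \<bar>ta - t\<bar> * norm (x - d0)"
    using norm_triangle_ineq4[of "t *\<^sub>R (x' - x)" "(ta - t) *\<^sub>R (x - d0)"] by simp
   also have "... <= 1 * norm (x' - x) + 1 / N * D"
    using t that D N by (intro add_mono mult_mono) auto
   also have "... = norm (x - x') + D / N" by (simp add: norm_minus_commute)
   also have "... < e / 2 + e / 2" using that(3) N(2) by (rule add_strict_mono)
   also have "... = e" by simp
   finally show ?thesis by (simp add: dist_norm)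
  qed
  have loc: "EX U k. openin (top_of_set K) U & x : U & continuous_on U (%x'. k x' t') & (ALL x':U. path x' (k x'))"
   if x: "x : K" for x
  proof -
   have "s t x : K" using sK[OF x, of t] t by linarith
   then obtain B v where B: "ev B v" "f ` (K Int ball (s t x) e) <= B" using even by blast
   have "f (s t x) : B" using B(2) \<open>s t x : K\<close> e by (auto simp: image_subset_iff)
   hence "g x : \<Union>v" using B P x unfolding ev_def P_def by auto
   then obtain u where u: "u : v" "g x : u" by blast
   then obtain q where q: "homeomorphism u B \<rho> q" using B unfolding ev_def by blast
   define U where "U = (K Int g -` u) Int (K Int ball x (e / 2))"
   have "openin (top_of_set X) u" using B(1) u(1) unfolding ev_def by blast
   moreover have "continuous_on K g" "g : K \<rightarrow> X" using P unfolding P_def by auto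
   ultimately have "openin (top_of_set K) (K Int g -` u)" by (intro continuous_openin_preimage[where T=X]) auto
   hence oU: "openin (top_of_set K) U" unfolding U_def
    by (rule openin_Int) (simp add: openin_open_Int)
   have xU: "x : U" using x u e by (auto simp: U_def)
   define k where "k x' ta = q (f (s ta x'))" for x' ta
   have inB: "s ta x' : K Int ball (s t x) e" if "x' : U" "ta : {t..t'}" for x' ta
   proof
    have "x' : K" "norm (x' - x) < e / 2" using that(1) by (auto simp: U_def dist_norm norm_minus_commute)
    thus "s ta x' : ball (s t x) e" "s ta x' : K"
     using close[of x' ta x] sK[of x' ta] that t by auto
   qed
   hence fB: "f (s ta x') : B" if "x' : U" "ta : {t..t'}" for x' ta
    using B that by blast
   have uX: "u <= X" using u B openin_imp_subset unfolding ev_def by blast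
   have cq: "continuous_on B q" and qim: "q ` B = u" and \<rho>q: "!!y. y : B ==> \<rho> (q y) = y"
    and q\<rho>: "!!y. y : u ==> q (\<rho> y) = y"
    using q unfolding homeomorphism_def by auto
   have "path x' (k x')" if x': "x' : U" for x'
    unfolding path_def k_def
   proof (intro conjI ballI)
    show "continuous_on {t..t'} (%ta. q (f (s ta x')))"
     using inB[OF x'] fB[OF x']
     by (intro continuous_on_compose2[OF cq] continuous_on_compose2[OF f(1)] scont) auto
    show "(%ta. q (f (s ta x'))) ` {t..t'} <= X" using fB[OF x'] qim uX by auto
    have "\<rho> (g x') = f (s t x')" "g x' : u" using x' P unfolding U_def P_def by auto
    thus "q (f (s t x')) = g x'" using q\<rho> by metis
    show "\<rho> (q (f (s ta x'))) = f (s ta x')" if "ta : {t..t'}" for ta using \<rho>q fB[OF x'] that by auto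
   qed
   moreover have "continuous_on U (%x'. k x' t')" unfolding k_def
    using inB fB t by (intro continuous_on_compose2[OF cq] continuous_on_compose2[OF f(1)] scont) auto
   ultimately show ?thesis using oU xU by blast
  qed
  have "P t' g'"
   unfolding P_def
  proof (intro conjI ballI)
   have "EX U. openin (top_of_set K) U & x : U & continuous_on U g'" if x: "x : K" for x
   proof -
    obtain U k where U: "openin (top_of_set K) U" "x : U" "continuous_on U (%x'. k x' t')"
     "ALL x':U. path x' (k x')" using loc[OF x] by blast
    hence "continuous_on U g'" using g' by (subst continuous_on_cong[of U U g' "%x'. k x' t'"]) auto
    thus ?thesis using U by blast
   qed
   thus "continuous_on K g'" by (rule continuous_on_openin_locally)
  next
   have "g' x : X & \<rho> (g' x) = f (s t' x)" if "x : K" for x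
   proof -
    obtain k where "path x k" using loc[OF \<open>x : K\<close>] by blast
    thus ?thesis using g'[of x k] t unfolding path_def by auto
   qed
   thus "g' ` K <= X" "!!x. x : K ==> \<rho> (g' x) = f (s t' x)" by auto
   have "path d0 (%_. x0)" unfolding path_def using P x0 K by (auto simp: P_def s_def)
   thus "g' d0 = x0" using g' by blast
  qed
  thus ?thesis by blast
 qed
 have "EX g. P (j / N) g" if "j <= N" for j
  using that
 proof (induction j)
  case 0
  have "P 0 (%_. x0)" unfolding P_def using x0 by (auto simp: s_def)
  thus ?case by auto
 next
  case (Suc j)
  then obtain g where "P (j / N) g" by auto
  moreover have "real (Suc j) / N - j / N <= 1 / N" by (simp add: diff_divide_distrib [symmetric])
  ultimately show ?case
   using Suc.prems N by (intro step[of "j / N" g "Suc j / N"]) (auto simp: divide_simps)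
 qed
 from this[of N] obtain g where "P 1 g" using N by auto
 thus ?thesis unfolding P_def s_def by auto
qed

text \<open>Lifting along segments from \<open>d0\<close> defines the map pointwise. For continuity
  at \<open>d\<close> it is compared with a lift on the compact convex hull of \<open>d0\<close> and
  a closed ball around \<open>d\<close>, where uniqueness forces agreement along every
  segment.\<close>

lemma covering_lift_convex:
 fixes \<rho> :: "'a::topological_space => 'b::topological_space" and f :: "'c::euclidean_space => 'b"
 assumes cov: "covering_space X \<rho> S" and D: "open D" "convex D" "d0 : D"
  and f: "continuous_on D f" "f ` D <= S" and x0: "x0 : X" "\<rho> x0 = f d0"
 shows "EX g. continuous_on D g & g ` D <= X & (ALL x:D. \<rho> (g x) = f x) & g d0 = x0"
proof -
 define L where "L C g \<longleftrightarrow> continuous_on C g & g ` C <= X & (ALL x:C. \<rho> (g x) = f x) & g d0 = x0" for C g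
 have ex: "EX g. L C g" if "compact C" "convex C" "d0 : C" "C <= D" for C
 proof -
  have "continuous_on C f" "f ` C <= S" using continuous_on_subset[OF f(1)] f(2) that by auto
  thus ?thesis
   unfolding L_def using covering_lift_compact_convex[of X \<rho> S C d0 f x0] cov that x0 by blast
 qed
 define g where "g d = (SOME h. L (closed_segment d0 d) h) d" for d
 have g: "g d = h d" if "L C h" "convex C" "d0 : C" "d : C" "C <= D" for C h d
 proof -
  have seg: "closed_segment d0 d <= C" using that by (simp add: closed_segment_subset)
  hence L1: "L (closed_segment d0 d) h"
   using that(1) continuous_on_subset[of C h] unfolding L_def by blast
  hence L2: "L (closed_segment d0 d) (SOME h. L (closed_segment d0 d) h)"
   by (rule someI[of "L (closed_segment d0 d)"])
  show ?thesis unfolding g_def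
   by (rule covering_lift_unique[OF cov, of "closed_segment d0 d" _ _ d0])
    (use L1 L2 in "auto simp: L_def")
 qed
 have seg: "L (closed_segment d0 d) h ==> d : D ==> g d = h d" for d h
  using D closed_segment_subset[of d0 D d] by (intro g[of "closed_segment d0 d"]) auto
 have exseg: "EX h. L (closed_segment d0 d) h" if "d : D" for d
  using D that closed_segment_subset[of d0 D d] by (intro ex) auto
 have "isCont g d" if "d : D" for d
 proof -
  obtain e where e: "e > 0" "cball d e <= D" using D(1) \<open>d : D\<close> open_contains_cball by blast
  define C where "C = convex hull (insert d0 (cball d e))"
  have C: "compact C" "convex C" "d0 : C" "cball d e <= C" "C <= D"
   unfolding C_def using e D
   by (auto intro!: compact_convex_hull hull_inc simp: hull_minimal)
  then obtain h where h: "L C h" using ex by blast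
  have "continuous_on (ball d e) h" using h C ball_subset_cball
   unfolding L_def by (meson continuous_on_subset)
  moreover have "continuous_on (ball d e) g = continuous_on (ball d e) h"
   using g[OF h C(2,3) _ C(5)] C(4) by (intro continuous_on_cong) (auto simp: subset_iff)
  ultimately show ?thesis using e continuous_on_eq_continuous_at[OF open_ball] by (metis centre_in_ball)
 qed
 hence "continuous_on D g" by (simp add: continuous_at_imp_continuous_on)
 moreover have "g d : X & \<rho> (g d) = f d" if "d : D" for d
  using exseg[OF that] seg[OF _ that] unfolding L_def by fastforce
 moreover have "g d0 = x0" using exseg[OF D(3)] seg[OF _ D(3)] unfolding L_def by fastforce
 ultimately show ?thesis by (intro exI[of _ g]) auto
qed

text \<open>The Riemann mapping theorem, used only for a homeomorphism with the disc, reduces this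
  to the convex case.\<close>

lemma covering_lift_simply_connected:
 fixes \<rho> :: "'a::topological_space => 'b::topological_space" and f :: "complex => 'b"
 assumes cov: "covering_space X \<rho> S" and D: "open D" "simply_connected D" "d0 : D"
  and f: "continuous_on D f" "f ` D <= S" and x0: "x0 : X" "\<rho> x0 = f d0"
 shows "EX g. continuous_on D g & g ` D <= X & (ALL x:D. \<rho> (g x) = f x) & g d0 = x0"
proof -
 have "D homeomorphic ball (0::complex) 1"
  using simply_connected_eq_homeomorphic_to_disc[OF D(1)] D by blast
 then obtain tt tt' where h: "homeomorphism D (ball (0::complex) 1) tt tt'" unfolding homeomorphic_def by blast
 hence h': "continuous_on D tt" "tt ` D = ball 0 1" "continuous_on (ball 0 1) tt'" "tt' ` ball 0 1 = D"
  "!!x. x : D ==> tt' (tt x) = x" by (auto simp: homeomorphism_def)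
 have "EX g. continuous_on (ball 0 1) g & g ` ball 0 1 <= X & (ALL x:ball 0 1. \<rho> (g x) = (f \<circ> tt') x) & g (tt d0) = x0"
  using h' f x0 D continuous_on_compose[of "ball 0 1" tt' f]
  by (intro covering_lift_convex[OF cov]) (auto simp: image_comp [symmetric])
 then obtain g where g: "continuous_on (ball 0 1) g" "g ` ball 0 1 <= X"
  "!!x. x:ball 0 1 ==> \<rho> (g x) = f (tt' x)" "g (tt d0) = x0" by auto
 have "continuous_on D (g \<circ> tt)" using g h' by (intro continuous_on_compose) auto
 moreover have "tt x : ball 0 1" if "x : D" for x using that h'(2) by blast
 hence "g (tt x) : X & \<rho> (g (tt x)) = f x" if "x : D" for x
  using that g(2) g(3)[of "tt x"] h'(5)[of x] by (metis image_subset_iff)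
 ultimately show ?thesis using g(4) by (intro exI[of _ "g \<circ> tt"]) auto
qed

section \<open>The sphere\<close>

lemma open_optionE:
 fixes U :: "'a::topological_space option set"
 assumes U: "open U"
  and 1: "!!V. open V ==> U = Some ` V ==> thesis"
  and 2: "!!C. compact C ==> closed C ==> U = insert None (Some ` (- C)) ==> thesis"
 shows thesis
proof -
 consider V where "openin (euclidean::'a topology) V" "U = Some ` V"
  | C where "compactin (euclidean::'a topology) C" "closedin (euclidean::'a topology) C" "U = insert None (Some ` (topspace euclidean - C))"
  using U unfolding open_option_def openin_Alexandroff_compactification by blast
 thus thesis
 proof cases
  case V: 1
  show thesis by (rule 1[of V]) (use V in "simp_all only: open_openin")
 next
  case C: 2
  show thesis by (rule 2[of C]) (use C in "simp_all only: closed_closedin compactin_euclidean_iff topspace_euclidean Compl_eq_Diff_UNIV")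
 qed
qed

lemma continuous_on_Some: "continuous_on A (Some :: 'a::topological_space => 'a option)"
proof -
 have "open (Some -` U :: 'a set)" if "open U" for U
  using that
 proof (rule open_optionE)
  fix V assume "open V" "U = Some ` V"
  moreover from this have "Some -` U = V" by auto
  ultimately show ?thesis by simp
 next
  fix C assume "closed C" "U = insert None (Some ` (- C))"
  moreover from this have "Some -` U = - C" by auto
  ultimately show ?thesis by (simp add: open_Compl)
 qed
 hence "continuous_on UNIV (Some :: 'a => 'a option)" by (simp add: continuous_on_open_vimage)
 thus ?thesis using continuous_on_subset by blast
qed

text \<open>The chart at infinity in which \<open>b\<close> is the omitted point. Preimages of
  neighbourhoods of infinity are open at 0 because \<open>b + 1 / ze\<close> can lie in a set
  bounded by \<open>B\<close> only if \<open>norm ze\<close> is at least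
  \<open>1 / (B + norm b)\<close>.\<close>

lemma continuous_on_inversion:
 "continuous_on A (%ze. if ze = 0 then None else Some (b + 1 / ze) :: csphere)"
proof -
 define F where "F = (%ze. if ze = 0 then None else Some (b + 1 / ze) :: csphere)"
 have "open (F -` V)" if "open V" for V
 proof -
  have o: "open {ze. ze ~= 0 & b + 1 / ze : U}" if "open U" for U
  proof -
   have "continuous_on (-{0}) (%ze. b + 1 / ze)" by (intro continuous_intros) auto
   moreover have "open (- {0::complex})" by (simp add: open_Compl)
   ultimately have "open ((%ze. b + 1 / ze) -` U Int -{0})"
    using that continuous_on_open_vimage by blast
   moreover have "(%ze. b + 1 / ze) -` U Int -{0} = {ze. ze ~= 0 & b + 1 / ze : U}" by auto
   ultimately show ?thesis by simp
  qed
  from that show ?thesis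
  proof (rule open_optionE)
   fix U assume 1: "open U" "V = Some ` U"
   hence "F -` V = {ze. ze ~= 0 & b + 1 / ze : U}" by (auto simp: F_def split: if_splits)
   thus ?thesis using o 1 by simp
  next
   fix C :: "complex set" assume 2: "compact C" "V = insert None (Some ` (- C))"
   have "bounded C" using 2(1) by (rule compact_imp_bounded)
   then obtain B where B: "B > 0" "ALL x:C. norm x <= B" unfolding bounded_pos by blast
   have "F -` V = {ze. ze ~= 0 & b + 1 / ze : - C} Un ball 0 (1 / (B + norm b))"
   proof (intro Set.set_eqI iffI)
    fix ze assume "ze : F -` V"
    thus "ze : {ze. ze ~= 0 & b + 1 / ze : - C} Un ball 0 (1 / (B + norm b))"
     using 2 B(1) by (cases "ze = 0") (auto simp: F_def add_pos_nonneg)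
   next
    fix ze assume z: "ze : {ze. ze ~= 0 & b + 1 / ze : - C} Un ball 0 (1 / (B + norm b))"
    have "b + 1 / ze ~: C" if "ze ~= 0" "norm ze < 1 / (B + norm b)"
    proof
     assume "b + 1 / ze : C"
     hence "norm (b + 1 / ze) <= B" using B by blast
     hence "norm (1 / ze) <= B + norm b"
      using norm_triangle_ineq4[of "b + 1 / ze" b] by simp
     thus False using that B(1) norm_ge_zero[of b] by (auto simp: norm_divide divide_simps mult.commute split: if_splits)
    qed
    thus "ze : F -` V" using z 2 by (auto simp: F_def)
   qed
   thus ?thesis using o[of "- C"] compact_imp_closed[OF 2(1)] by (simp add: open_Un open_Compl)
  qed
 qed
 hence "continuous_on UNIV F" by (simp add: continuous_on_open_vimage)
 thus ?thesis using continuous_on_subset unfolding F_def by blast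
qed


lemma open_sphere_minus_compact:
 fixes F :: "complex set"
 assumes "compact F"
 shows "open (UNIV - Some ` F)"
proof -
 have "UNIV - Some ` F = insert None (Some ` (topspace euclidean - F))"
 proof (rule Set.set_eqI)
  fix p show "p : UNIV - Some ` F \<longleftrightarrow> p : insert None (Some ` (topspace euclidean - F))"
   by (cases p) auto
 qed
 moreover have "compactin euclidean F" using assms by simp
 moreover have "closedin euclidean F" using compact_imp_closed[OF assms] by simp
 ultimately show ?thesis
  unfolding open_option_def openin_Alexandroff_compactification by blast
qed

lemma open_preimage_inversion:
 fixes F :: "complex set"
 assumes "compact F"
 shows "open {ze. ze = 0 | b + 1 / ze ~: F}"
proof -
 let ?f = "%ze. if ze = 0 then None else Some (b + 1 / ze) :: csphere"
 have "open (?f -` (UNIV - Some ` F))"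
  using continuous_on_inversion[of UNIV b] open_sphere_minus_compact[OF assms]
  by (simp add: continuous_on_open_vimage)
 moreover have "?f -` (UNIV - Some ` F) = {ze. ze = 0 | b + 1 / ze ~: F}"
  by auto
 ultimately show ?thesis by simp
qed

text \<open>Inverse of the chart \<open>b + 1 / ze\<close>. At \<open>Some b\<close> division by
  zero gives 0, which is already the value at infinity, so the function is a coordinate only off
  \<open>Some b\<close>.\<close>

definition inv_coord :: "complex => csphere => complex" where
 "inv_coord b p = (case p of None => 0 | Some z => 1 / (z - b))"

lemma inv_coord_simps [simp]: "inv_coord b None = 0" "inv_coord b (Some z) = 1 / (z - b)"
 by (auto simp: inv_coord_def)

lemma inv_inv_coord:
 "p ~= Some b ==> (if inv_coord b p = 0 then None else Some (b + 1 / inv_coord b p)) = p"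
 by (cases p) auto

lemma continuous_on_inv_coord: "continuous_on (- {Some b}) (inv_coord b)"
 unfolding continuous_on_open_invariant
proof (intro allI impI)
 fix U :: "complex set" assume U: "open U"
 have o: "open {z. z ~= b & 1 / (z - b) : U}"
 proof -
  have "continuous_on (-{b}) (%z. 1 / (z - b))" by (intro continuous_intros) auto
  moreover have "open (- {b})" by (simp add: open_Compl)
  ultimately have "open ((%z. 1 / (z - b)) -` U Int -{b})"
   using U continuous_on_open_vimage by blast
  moreover have "(%z. 1 / (z - b)) -` U Int -{b} = {z. z ~= b & 1 / (z - b) : U}" by auto
  ultimately show ?thesis by simp
 qed
 let ?V = "{z. z ~= b & 1 / (z - b) : U}"
 show "EX A. open A & A Int - {Some b} = inv_coord b -` U Int - {Some b}"
 proof (cases "0 : U")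
  case True
  obtain e where e: "e > 0" "ball 0 e <= U" using U True open_contains_ball by blast
  have "- ?V <= cball b (1 / e)"
  proof
   fix z assume z: "z : - ?V"
   show "z : cball b (1 / e)"
   proof (cases "z = b")
    case False
    hence "1 / (z - b) ~: ball 0 e" using z e by blast
    thus ?thesis using False e
     by (auto simp: dist_norm norm_divide norm_minus_commute field_simps)
   qed (use e in auto)
  qed
  hence "bounded (- ?V)" using bounded_subset bounded_cball by blast
  hence "compact (- ?V)" using o by (simp add: compact_eq_bounded_closed closed_def)
  hence "open (UNIV - Some ` (- ?V))" by (rule open_sphere_minus_compact)
  moreover have "(UNIV - Some ` (- ?V)) Int - {Some b} = inv_coord b -` U Int - {Some b}"
  proof (rule Set.set_eqI)
   fix p show "p : (UNIV - Some ` (- ?V)) Int - {Some b} \<longleftrightarrow> p : inv_coord b -` U Int - {Some b}"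
    using True by (cases p) auto
  qed
  ultimately show ?thesis by blast
 next
  case False
  have "open (Some ` ?V)" using o unfolding open_option_def by (metis openin_Alexandroff_compactification_image_Some open_openin)
  moreover have "Some ` ?V Int - {Some b} = inv_coord b -` U Int - {Some b}"
  proof (rule Set.set_eqI)
   fix p show "p : Some ` ?V Int - {Some b} \<longleftrightarrow> p : inv_coord b -` U Int - {Some b}"
    using False by (cases p) auto
  qed
  ultimately show ?thesis by blast
 qed
qed

section \<open>Local lifts\<close>

text \<open>A homotopy between two constant loops traces a path from one base point to the
  other.\<close>

lemma simply_connected_imp_connected':
 fixes X :: "'a::topological_space set"
 assumes "simply_connected X"
 shows "connected X"
proof (rule path_connected_imp_connected)
 show "path_connected X"
  unfolding path_connected_def
 proof (intro ballI)
  fix a b assume ab: "a : X" "b : X"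
  have "homotopic_loops X (%_. a) (%_. b)"
   by (rule assms[unfolded simply_connected_def, rule_format])
    (use ab in "auto simp: path_def pathstart_def pathfinish_def path_image_def")
  then obtain h :: "real \<times> real => 'a" where h: "continuous_on ({0..1} \<times> {0..1}) h" "h ` ({0..1} \<times> {0..1}) <= X"
   "ALL x:{0..1}. h (0, x) = a" "ALL x:{0..1}. h (1, x) = b"
   unfolding homotopic_loops by (auto simp: image_subset_iff_funcset)
  have "continuous_on {0..1} (%u. h (u, 0))"
   by (rule continuous_on_compose2[OF h(1)]) (auto intro!: continuous_intros)
  hence "path (%u. h (u, 0))" by (simp add: path_def)
  moreover have "path_image (%u. h (u, 0)) <= X" using h(2) by (auto simp: path_image_def)
  ultimately show "EX g. path g & path_image g <= X & pathstart g = a & pathfinish g = b"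
   using h(3,4) by (intro exI[of _ "%u. h (u, 0)"]) (auto simp: pathstart_def pathfinish_def)
 qed
qed

lemma continuous_on_sphere_coord: "continuous_on A (sphere_coord p)"
proof (cases p)
 case None
 have "sphere_coord None = (%h. if h = 0 then None else Some (0 + 1 / h))" by auto
 thus ?thesis using continuous_on_inversion[of A 0] None by simp
next
 case (Some z)
 have "sphere_coord (Some z) = Some \<circ> (%h. z + h)" by auto
 moreover have "continuous_on A (Some \<circ> (%h. z + h))"
  by (intro continuous_on_compose continuous_on_Some continuous_intros)
 ultimately show ?thesis using Some by simp
qed

lemma local_liftD:
 assumes "local_lift X \<rho> x r g"
 shows "r > 0" "continuous_on (ball 0 r) g" "g 0 = x"
  and "norm h < r ==> g h : X" "norm h < r ==> \<rho> (g h) = sphere_coord (\<rho> x) h"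
 using assms unfolding local_lift_def by (simp_all add: image_subset_iff)

lemma local_liftI:
 assumes "r > 0" "continuous_on (ball 0 r) g" "g 0 = x"
  and "!!h. norm h < r ==> g h : X" "!!h. norm h < r ==> \<rho> (g h) = sphere_coord (\<rho> x) h"
 shows "local_lift X \<rho> x r g"
 using assms unfolding local_lift_def by (simp add: image_subset_iff)

lemma local_lift_exists:
 fixes \<rho> :: "'a::topological_space => csphere"
 assumes cov: "covering_space X \<rho> (UNIV - Some ` F)" and F: "finite F" and x: "x : X"
 obtains r g where "local_lift X \<rho> x r g"
proof -
 have "open (sphere_coord (\<rho> x) -` (UNIV - Some ` F))"
  using continuous_on_sphere_coord[of UNIV] open_sphere_minus_compact[OF finite_imp_compact[OF F]]
  by (simp add: continuous_on_open_vimage)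
 moreover have s0: "sphere_coord (\<rho> x) 0 = \<rho> x" by (cases "\<rho> x") auto
 hence "0 : sphere_coord (\<rho> x) -` (UNIV - Some ` F)"
  using cov x unfolding covering_space_def by auto
 ultimately obtain r where r: "r > 0" "ball 0 r <= sphere_coord (\<rho> x) -` (UNIV - Some ` F)"
  using open_contains_ball by blast
 have "EX g. continuous_on (ball 0 r) g & g ` ball 0 r <= X &
   (ALL h:ball 0 r. \<rho> (g h) = sphere_coord (\<rho> x) h) & g 0 = x"
  by (rule covering_lift_convex[OF cov]) (use r x s0 continuous_on_sphere_coord in auto)
 thus thesis using that r unfolding local_lift_def by blast
qed

lemma local_lift_unique:
 fixes \<rho> :: "'a::topological_space => csphere"
 assumes cov: "covering_space X \<rho> S" and g: "local_lift X \<rho> x r g" "local_lift X \<rho> x r' g'"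
  and h: "norm h < r" "norm h < r'"
 shows "g h = g' h"
proof -
 let ?B = "ball 0 (min r r') :: complex set"
 have "continuous_on ?B g"
  using local_liftD(2)[OF g(1)] by (rule continuous_on_subset) auto
 moreover have "continuous_on ?B g'"
  using local_liftD(2)[OF g(2)] by (rule continuous_on_subset) auto
 moreover have "g k : X" "g' k : X" "\<rho> (g k) = \<rho> (g' k)" if "k : ?B" for k
  using local_liftD(4,5)[OF g(1), of k] local_liftD(4,5)[OF g(2), of k] that by auto
 moreover have "g 0 = g' 0" "0 : ?B"
  using local_liftD(1,3)[OF g(1)] local_liftD(1,3)[OF g(2)] by auto
 ultimately show ?thesis
  by (intro covering_lift_unique[OF cov, of ?B g g' 0 h]) (use h in auto)
qed

lemma local_lift_shrink:
 assumes g: "local_lift X \<rho> x r g" and r: "0 < r'" "r' <= r"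
 shows "local_lift X \<rho> x r' g"
proof -
 have "continuous_on (ball 0 r') g"
  using local_liftD(2)[OF g] by (rule continuous_on_subset) (use r in auto)
 thus ?thesis
  using r by (intro local_liftI) (simp_all add: local_liftD(3)[OF g] local_liftD(4)[OF g] local_liftD(5)[OF g])
qed

lemma local_lift_deck:
 assumes g: "local_lift X \<rho> x r g" and s: "deck_transformation X \<rho> \<sigma>" and x: "x : X"
 shows "local_lift X \<rho> (\<sigma> x) r (\<sigma> \<circ> g)"
proof -
 have "continuous_on X \<sigma>" "\<sigma> ` X <= X" "!!y. y : X ==> \<rho> (\<sigma> y) = \<rho> y"
  using s unfolding deck_transformation_def homeomorphism_def by auto
 moreover have "continuous_on (ball 0 r) (\<sigma> \<circ> g)"
  using g calculation continuous_on_subset[of X \<sigma>] unfolding local_lift_def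
  by (intro continuous_on_compose) auto
 ultimately show ?thesis using g x unfolding local_lift_def by (auto simp: image_subset_iff)
qed

text \<open>By uniqueness of lifts, every lift is near a point the local chart after
  \<open>f w - f w0\<close>. This turns derivatives along a lift into derivatives in the
  chart.\<close>

lemma lift_eq_local_lift:
 fixes \<rho> :: "'a::topological_space => csphere" and f :: "complex => complex"
 assumes cov: "covering_space X \<rho> S" and U: "open U" "w0 : U"
  and et: "continuous_on U et" "et ` U <= X" "!!w. w : U ==> \<rho> (et w) = Some (f w)"
  and f: "continuous_on U f" and g: "local_lift X \<rho> (et w0) r g"
 shows "\<forall>\<^sub>F w in nhds w0. w : U & norm (f w - f w0) < r & et w = g (f w - f w0)"
proof -
 have r: "r > 0" using g by (simp add: local_lift_def)
 have "isCont f w0" using f U continuous_on_eq_continuous_at by blast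
 then obtain d where d: "d > 0" "!!w. norm (w - w0) < d ==> norm (f w - f w0) < r"
  unfolding continuous_at_eps_delta using r by (metis dist_norm)
 obtain e where e: "e > 0" "ball w0 e <= U" using U open_contains_ball by blast
 let ?B = "ball w0 (min d e)"
 have sub: "?B <= U" using e by auto
 have fr: "f w - f w0 : ball 0 r" if "w : ?B" for w using d(2)[of w] that by (auto simp: dist_norm norm_minus_commute)
 have "continuous_on ?B (%w. g (f w - f w0))"
  by (rule continuous_on_compose2[of "ball 0 r" g])
   (use g fr continuous_on_subset[OF f sub] in "auto simp: local_lift_def intro!: continuous_intros")
 moreover have "\<rho> (g (f w - f w0)) = Some (f w)" if "w : ?B" for w
  using g fr[OF that] et(3)[OF U(2)] unfolding local_lift_def by auto
 moreover have "g (f w - f w0) : X" if "w : ?B" for w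
  using g fr[OF that] unfolding local_lift_def by auto
 moreover have "et w0 = g (f w0 - f w0)" using g unfolding local_lift_def by auto
 moreover have "continuous_on ?B et" using continuous_on_subset[OF et(1) sub] .
 moreover have "et w : X & \<rho> (et w) = Some (f w)" if "w : ?B" for w
  using et(2,3) sub that by blast
 moreover have "w0 : ?B" using d e by auto
 ultimately have "et w = g (f w - f w0)" if "w : ?B" for w
  using that by (intro covering_lift_unique[OF cov, of ?B et "%w. g (f w - f w0)" w0 w]) (simp_all add: image_subset_iff)
 hence "ALL w:?B. w : U & norm (f w - f w0) < r & et w = g (f w - f w0)"
  using sub fr by auto
 moreover have "open ?B" "w0 : ?B" using d e by auto
 ultimately show ?thesis unfolding eventually_nhds by blast
qed

section \<open>Smooth Jordan curves\<close>

locale smooth_curve =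
 fixes ga :: "real => complex"
 assumes smooth: "smooth_jordan_curve ga"
begin

lemma C1: "ga C1_differentiable_on UNIV"
 and deriv_nz: "vector_derivative ga (at s) ~= 0"
 and per: "ga (s + 1) = ga s"
 and inj01: "inj_on ga {0..<1}"
 and winding: "z : inside (path_image ga) ==> winding_number ga z = 1"
 using smooth unfolding smooth_jordan_curve_def by auto

lemma per_nat: "ga (s + real k) = ga s"
proof (induction k)
 case (Suc k)
 have "ga (s + real (Suc k)) = ga ((s + real k) + 1)" by (simp add: add_ac)
 thus ?case using Suc per by simp
qed auto

lemma per_int: "ga (s + of_int k) = ga s"
proof (cases "k >= 0")
 case True
 thus ?thesis using per_nat[of s "nat k"] by simp
next
 case False
 thus ?thesis using per_nat[of "s + of_int k" "nat (- k)"] by simp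
qed

lemma gamma_frac: "ga (frac s) = ga s"
 using per_int[of "frac s" "\<lfloor>s\<rfloor>"] by (simp add: frac_def)

lemma gamma_eq_iff: "ga s = ga s' \<longleftrightarrow> s - s' : \<int>"
proof
 assume "ga s = ga s'"
 hence "ga (frac s) = ga (frac s')" by (simp add: gamma_frac)
 hence "frac s = frac s'" using inj01 by (auto simp: inj_on_def frac_lt_1)
 hence "s - s' = of_int (\<lfloor>s\<rfloor> - \<lfloor>s'\<rfloor>)" by (simp add: frac_def)
 thus "s - s' : \<int>" by (metis Ints_of_int)
next
 assume "s - s' : \<int>"
 then obtain k where "s - s' = of_int k" by (auto elim: Ints_cases)
 thus "ga s = ga s'" using per_int[of s' k] by (simp add: algebra_simps)
qed

lemma gamma_inj: "ga s = ga s' ==> \<bar>s - s'\<bar> < 1 ==> s = s'"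
 using gamma_eq_iff Ints_nonzero_abs_less1 by fastforce

lemma cont: "continuous_on A ga"
 using C1_differentiable_imp_continuous_on[OF C1] continuous_on_subset by blast

lemma path: "path ga" by (simp add: path_def cont)

lemma closed_path: "pathfinish ga = pathstart ga"
 using per[of 0] by (simp add: pathfinish_def pathstart_def)

lemma path_image_eq: "path_image ga = ga ` {s..<s + 1}"
proof -
 have *: "range ga = ga ` {s..<s + 1}" for s
 proof
  show "range ga <= ga ` {s..<s + 1}"
  proof
   fix z assume "z : range ga"
   then obtain u where "z = ga u" by blast
   moreover have "ga (s + frac (u - s)) = ga u"
    unfolding gamma_eq_iff by (simp add: frac_def)
   ultimately show "z : ga ` {s..<s + 1}" by (auto simp: frac_lt_1 intro!: image_eqI[of _ _ "s + frac (u - s)"])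
  qed
 qed auto
 have "ga ` {0..1} = range ga"
 proof
  show "range ga <= ga ` {0..1}" using *[of 0] by (force simp: image_subset_iff)
 qed auto
 thus ?thesis using * by (simp add: path_image_def)
qed

lemma in_path_image [simp]: "ga s : path_image ga"
 using path_image_eq[of s] by auto

lemma simple: "simple_path ga"
 unfolding simple_path_def loop_free_def
proof (intro conjI path ballI impI)
 fix x y assume "x : {0..1::real}" "y : {0..1::real}" "ga x = ga y"
 thus "x = y | x = 0 & y = 1 | x = 1 & y = 0"
  using gamma_inj[of x y] by force
qed

lemma jordan:
 "inside (path_image ga) ~= {}" "open (inside (path_image ga))" "connected (inside (path_image ga))"
 "open (outside (path_image ga))" "connected (outside (path_image ga))" "bounded (inside (path_image ga))"
 "inside (path_image ga) Int outside (path_image ga) = {}"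
 "inside (path_image ga) Un outside (path_image ga) = - path_image ga"
 using Jordan_inside_outside[OF simple closed_path] by auto

lemma winding_outside: "z : outside (path_image ga) ==> winding_number ga z = 0"
 using winding_number_zero_in_outside[OF path closed_path] .

lemma compact_arc: "compact (ga ` {s..s'})"
 by (intro compact_continuous_image cont) auto

text \<open>A proper subarc is a Jordan arc, which does not separate the plane; for
  \<open>s = s'\<close> it is a single point.\<close>

lemma connected_arc_compl:
 assumes "s <= s'" "s' < s + 1"
 shows "connected (- ga ` {s..s'})"
proof (cases "s = s'")
 case True
 thus ?thesis using connected_punctured_universe[of "ga s"] by simp
next
 case False
 hence "s < s'" using assms by simp
 let ?g = "ga \<circ> linepath s s'"
 have ls: "linepath s s' ` {0..1} = {s..s'}"
  using \<open>s < s'\<close> by (metis closed_segment_eq_real_ivl1 less_imp_le path_image_def path_image_linepath)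
 have "path ?g" by (intro path_continuous_image cont) auto
 moreover have "inj_on ?g {0..1}"
 proof (rule comp_inj_on)
  show "inj_on (linepath s s') {0..1}" using \<open>s < s'\<close> inj_on_linepath[of s s'] by simp
  show "inj_on ga (linepath s s' ` {0..1})"
   unfolding ls using assms by (intro inj_onI gamma_inj) auto
 qed
 ultimately have "arc ?g" by (simp add: arc_def)
 moreover have "path_image ?g = ga ` linepath s s' ` {0..1}" by (simp add: path_image_def image_image)
 hence "path_image ?g = ga ` {s..s'}" by (simp only: ls)
 ultimately show ?thesis using connected_arc_complement[of ?g] by simp
qed

end

text \<open>The inverted set without 0 is a continuous image of \<open>U\<close>. Boundedness of the
  complement puts 0 into its closure, and a set between a connected set and its closure is
  connected.\<close>

lemma connected_inversion_insert:
 fixes b :: complex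
 assumes U: "connected U" "b ~: U" and bd: "bounded (- U)"
 shows "connected {ze. ze = 0 | b + 1 / ze : U}"
proof -
 let ?f = "%z. 1 / (z - b)"
 have "continuous_on U ?f" using U by (intro continuous_intros) auto
 hence "connected (?f ` U)" using U connected_continuous_image by blast
 moreover have sub: "?f ` U <= {ze. ze = 0 | b + 1 / ze : U}" by auto
 moreover have "{ze. ze = 0 | b + 1 / ze : U} <= closure (?f ` U)"
 proof
  fix ze assume z: "ze : {ze. ze = 0 | b + 1 / ze : U}"
  show "ze : closure (?f ` U)"
  proof (cases "ze = 0")
   case True
   obtain B where B: "B > 0" "ALL x:-U. norm x <= B" using bd unfolding bounded_pos by blast
   show ?thesis unfolding closure_approachable
   proof (intro allI impI)
    fix e :: real assume e: "e > 0"
    define p where "p = (of_real (B + norm b + 1 / e + 1) :: complex)"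
    have "0 <= B + norm b + 1 / e + 1" using B e norm_ge_zero[of b] by simp
    hence np: "norm p = B + norm b + 1 / e + 1" unfolding p_def norm_of_real by simp
    moreover have "1 / e > 0" using e by simp
    ultimately have "norm p > B" "norm p - norm b > 1 / e" using norm_ge_zero[of b] B(1) by linarith+
    hence "p : U" using B(2)[rule_format, of p] by (cases "p : U") auto
    have "norm (p - b) > 1 / e" using \<open>norm p - norm b > 1 / e\<close> norm_triangle_ineq2[of p b] by linarith
    hence "norm (?f p) < e"
     using e by (simp add: norm_divide) (smt (verit) divide_less_eq mult.commute zero_less_divide_1_iff)
    thus "EX y:?f ` U. dist y ze < e" using \<open>p : U\<close> True by (auto simp: dist_norm)
   qed
  next
   case False
   have "ze = ?f (b + 1 / ze)" by simp
   moreover have "b + 1 / ze : U" using z False by simp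
   ultimately have "ze : ?f ` U" by (rule image_eqI)
   thus ?thesis by (rule subsetD[OF closure_subset])
  qed
 qed
 ultimately show ?thesis by (rule connected_intermediate_closure)
qed

context smooth_curve
begin

text \<open>The sphere minus an arc, in a coordinate that sends an endpoint of the arc to infinity.
  The rest of the arc becomes a connected set, unbounded unless empty, so no component of the
  complement of \<open>V\<close> is bounded.\<close>

lemma simply_connected_arc_compl:
 assumes s: "s <= s'" "s' < s + 1" and e: "e = s | e = s'"
 defines "V \<equiv> {ze. ze = 0 | ga e + 1 / ze : - ga ` {s..s'}}"
 shows "simply_connected V" "open V"
proof -
 let ?b = "ga e"
 have bK: "?b : ga ` {s..s'}" using s e by auto
 show oV: "open V"
  using open_preimage_inversion[OF compact_arc[of s s'], of ?b] by (simp add: V_def)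
 have cV: "connected V" unfolding V_def
  by (rule connected_inversion_insert)
   (use connected_arc_compl[OF s] bK compact_arc[of s s'] in "auto simp: compact_imp_bounded")
 let ?f = "%z. 1 / (z - ?b)"
 define I where "I = {s..s'} - {e}"
 have I: "connected I"
 proof -
  have "I = {s<..s'} | I = {s..<s'}" using e unfolding I_def by auto
  thus ?thesis by auto
 qed
 have Ib: "ga u ~= ?b" if "u : I" for u
  using gamma_inj[of u e] that s e by (auto simp: I_def)
 have eq: "- V = (?f \<circ> ga) ` I"
 proof (intro equalityI subsetI)
  fix ze assume "ze : - V"
  hence "ze ~= 0" "?b + 1 / ze : ga ` {s..s'}" by (auto simp: V_def)
  then obtain u where u: "u : {s..s'}" "?b + 1 / ze = ga u" by blast
  hence "ga u ~= ?b" using \<open>ze ~= 0\<close> by (metis add_cancel_left_right divide_eq_0_iff zero_neq_one)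
  hence "u : I" using u by (auto simp: I_def)
  moreover have "ze = ?f (ga u)" using u(2) \<open>ze ~= 0\<close> by (simp flip: u(2))
  ultimately show "ze : (?f \<circ> ga) ` I" by auto
 next
  fix ze assume "ze : (?f \<circ> ga) ` I"
  then obtain u where "u : I" "ze = ?f (ga u)" by auto
  thus "ze : - V" using Ib[of u] by (auto simp: V_def I_def)
 qed
 have "continuous_on I (?f \<circ> ga)" unfolding o_def
  using Ib by (intro continuous_intros cont) auto
 hence conn: "connected (- V)" unfolding eq using I connected_continuous_image by blast
 have "~ bounded C" if C: "C : components (- V)" for C
 proof
  assume "bounded C"
  have "- V ~= {}" using C by auto
  hence "components (- V) = {- V}" using conn components_eq_sing_iff[of "- V"] by simp
  hence "C = - V" using C by blast
  then obtain B where B: "B > 0" "ALL x:-V. norm x <= B" using \<open>bounded C\<close> unfolding bounded_pos by blast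
  have "I ~= {}" using \<open>- V ~= {}\<close> eq by auto
  hence "s < s'" using e s by (auto simp: I_def)
  have "isCont ga e" using cont continuous_on_eq_continuous_at open_UNIV by blast
  then obtain d where d: "d > 0" "!!u. \<bar>u - e\<bar> < d ==> norm (ga u - ?b) < 1 / B"
   unfolding continuous_at_eps_delta using B by (metis dist_norm real_norm_def zero_less_divide_1_iff)
  obtain u where u: "u : I" "\<bar>u - e\<bar> < d"
  proof (cases "e = s")
   case True
   thus ?thesis using \<open>s < s'\<close> d by (intro that[of "min s' (s + d / 2)"]) (auto simp: I_def)
  next
   case False
   thus ?thesis using e \<open>s < s'\<close> d by (intro that[of "max s (s' - d / 2)"]) (auto simp: I_def)
  qed
  have "norm (?f (ga u)) > B"
   using d(2)[OF u(2)] Ib[OF u(1)] B(1) by (simp add: norm_divide field_simps)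
  moreover have "?f (ga u) : - V" using u eq by auto
  ultimately show False using B(2)[rule_format, of "?f (ga u)"] by linarith
 qed
 thus "simply_connected V"
  using simply_connected_eq_unbounded_complement_components[OF oV] cV by blast
qed


section \<open>Inner and outer side of the curve at one of its points\<close>

lemma winding_number_shifted:
 fixes s :: real
 assumes z: "z ~: path_image ga"
 defines "g \<equiv> %x. ga (s + x)"
 shows "winding_number ga z = 1 / tpi * integral {0..1} (%x. vector_derivative ga (at (s + x)) / (ga (s + x) - z))"
  and "(%x. vector_derivative ga (at (s + x)) / (ga (s + x) - z)) integrable_on {0..1}"
proof -
 have shift: "shiftpath (frac s) ga = g"
 proof
  fix x
  have "ga (frac s + x) = ga (s + x)" "ga (frac s + x - 1) = ga (s + x)"
   unfolding gamma_eq_iff by (auto simp: frac_def)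
  thus "shiftpath (frac s) ga x = g x" by (simp add: shiftpath_def g_def)
 qed
 have vd: "(g has_vector_derivative vector_derivative ga (at (s + x))) (at x)" for x
 proof -
  have "(ga has_vector_derivative vector_derivative ga (at (s + x))) (at (s + x))"
   using C1 C1_differentiable_on_eq vector_derivative_works by blast
  hence "(ga \<circ> (%x. s + x) has_vector_derivative (1 *\<^sub>R vector_derivative ga (at (s + x)))) (at x)"
   by (intro vector_diff_chain_at) (auto intro!: derivative_eq_intros)
  thus ?thesis by (simp add: g_def o_def)
 qed
 have cd: "continuous_on UNIV (%x. vector_derivative ga (at x))"
  using C1 C1_differentiable_on_eq by blast
 have "valid_path g"
  unfolding valid_path_def
 proof (rule C1_differentiable_imp_piecewise)
  have "continuous_on {0..1} (%x. vector_derivative ga (at (s + x)))"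
   by (rule continuous_on_compose2[OF cd]) (auto intro!: continuous_intros)
  thus "g C1_differentiable_on {0..1}"
   unfolding C1_differentiable_on_def using vd
   by (intro exI[of _ "%x. vector_derivative ga (at (s + x))"]) simp
 qed
 have pi: "path_image g <= path_image ga"
  unfolding path_image_def[of g] using in_path_image by (auto simp: g_def)
 have "winding_number ga z = winding_number g z"
  unfolding shift[symmetric]
  by (rule winding_number_shiftpath[OF path z closed_path, symmetric]) (simp add: frac_lt_1 less_imp_le)
 also have "... = 1 / tpi * contour_integral g (%w. 1 / (w - z))"
 proof -
  have "z ~: path_image g" using z pi by (meson subsetD)
  thus ?thesis using winding_number_valid_path[OF \<open>valid_path g\<close>, of z] by simp
 qed
 also have "contour_integral g (%w. 1 / (w - z)) = integral {0..1} (%x. 1 / (g x - z) * vector_derivative g (at x))"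
  by (simp add: contour_integral_integral)
 also have "(%x. 1 / (g x - z) * vector_derivative g (at x)) = (%x. vector_derivative ga (at (s + x)) / (ga (s + x) - z))"
  using vector_derivative_at[OF vd] by (auto simp: g_def)
 finally show "winding_number ga z = 1 / tpi * integral {0..1} (%x. vector_derivative ga (at (s + x)) / (ga (s + x) - z))" .
 show "(%x. vector_derivative ga (at (s + x)) / (ga (s + x) - z)) integrable_on {0..1}"
 proof (intro integrable_continuous_real continuous_on_divide ballI)
  show "continuous_on {0..1} (%x. vector_derivative ga (at (s + x)))"
   by (rule continuous_on_compose2[OF cd]) (auto intro!: continuous_intros)
  show "continuous_on {0..1} (%x. ga (s + x) - z)"
   by (intro continuous_intros continuous_on_compose2[OF cont[of UNIV]]) auto
  show "ga (s + x) - z ~= 0" for x using z in_path_image[of "s + x"] by auto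
 qed
qed

text \<open>Continuity of the derivative at \<open>ta\<close> with tolerance one tenth; the mean
  value inequality for the deviation from the tangent line gives the same relative error for the
  curve itself.\<close>

lemma local_straight:
 obtains d where "0 < d" "d <= 1 / 2"
  "!!u. \<bar>u\<bar> <= d ==> EX e. norm e <= 1 / 10 & ga (ta + u) - ga ta = vector_derivative ga (at ta) * of_real u * (1 + e)"
  "!!u. \<bar>u\<bar> <= d ==> EX e. norm e <= 1 / 10 & vector_derivative ga (at (ta + u)) = vector_derivative ga (at ta) * (1 + e)"
proof -
 define T where "T = vector_derivative ga (at ta)"
 have T: "T ~= 0" using deriv_nz by (simp add: T_def)
 have cd: "continuous_on UNIV (%x. vector_derivative ga (at x))"
  using C1 C1_differentiable_on_eq by blast
 hence "isCont (%x. vector_derivative ga (at x)) ta"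
  using continuous_on_eq_continuous_at open_UNIV by blast
 then obtain d0 where d0: "d0 > 0" "!!x. dist x ta < d0 ==> dist (vector_derivative ga (at x)) T < norm T / 10"
  unfolding continuous_at_eps_delta T_def[symmetric] using T by (metis divide_pos_pos zero_less_norm_iff zero_less_numeral)
 define d where "d = min (d0 / 2) (1 / 2)"
 have d: "0 < d" "d <= 1 / 2" "d < d0" using d0 by (auto simp: d_def)
 have der: "norm (vector_derivative ga (at (ta + u)) - T) <= norm T / 10" if "\<bar>u\<bar> <= d" for u
  using d0(2)[of "ta + u"] that d by (simp add: dist_norm less_imp_le)
 have B: "EX e. norm e <= 1 / 10 & vector_derivative ga (at (ta + u)) = T * (1 + e)" if "\<bar>u\<bar> <= d" for u
  using der[OF that] T
  by (intro exI[of _ "(vector_derivative ga (at (ta + u)) - T) / T"]) (simp add: norm_divide field_simps)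
 have A: "EX e. norm e <= 1 / 10 & ga (ta + u) - ga ta = T * of_real u * (1 + e)" if u: "\<bar>u\<bar> <= d" for u
 proof (cases "u = 0")
  case True
  thus ?thesis by (intro exI[of _ 0]) simp
 next
  case False
  define h where "h x = ga (ta + x) - of_real x * T" for x
  have hd: "(h has_vector_derivative (vector_derivative ga (at (ta + x)) - T)) (at x)" for x
  proof -
   have "(ga has_vector_derivative vector_derivative ga (at (ta + x))) (at (ta + x))"
    using C1 C1_differentiable_on_eq vector_derivative_works by blast
   hence "(ga \<circ> (%x. ta + x) has_vector_derivative (1 *\<^sub>R vector_derivative ga (at (ta + x)))) (at x)"
    by (intro vector_diff_chain_at) (auto intro!: derivative_eq_intros)
   hence "((%x. ga (ta + x)) has_vector_derivative vector_derivative ga (at (ta + x))) (at x)"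
    by (simp add: o_def)
   moreover have "((%x. of_real x * T) has_vector_derivative T) (at x)"
    using has_vector_derivative_scaleR[OF DERIV_ident[of "at x"] has_vector_derivative_const[of T "at x"]]
    by (simp add: scaleR_conv_of_real)
   ultimately show ?thesis unfolding h_def by (auto intro!: derivative_eq_intros)
  qed
  have "norm (h u - h 0) <= norm T / 10 * norm (u - 0)"
  proof (rule differentiable_bound[of "{-d..d}" h "%x v. v *\<^sub>R (vector_derivative ga (at (ta + x)) - T)"])
   show "(h has_derivative (%v. v *\<^sub>R (vector_derivative ga (at (ta + x)) - T))) (at x within {-d..d})" for x
    using hd[of x] unfolding has_vector_derivative_def by (rule has_derivative_at_withinI)
   show "onorm (%v. v *\<^sub>R (vector_derivative ga (at (ta + x)) - T)) <= norm T / 10" if "x : {-d..d}" for x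
   proof (rule onorm_le)
    fix v :: real
    have "\<bar>x\<bar> <= d" using that by auto
    thus "norm (v *\<^sub>R (vector_derivative ga (at (ta + x)) - T)) <= norm T / 10 * norm v"
     using mult_left_mono[OF der[of x], of "\<bar>v\<bar>"] by (simp add: mult.commute)
   qed
  qed (use u d in auto)
  hence "norm (ga (ta + u) - ga ta - of_real u * T) <= norm T / 10 * \<bar>u\<bar>"
   by (simp add: h_def algebra_simps)
  thus ?thesis using T False
   by (intro exI[of _ "(ga (ta + u) - ga ta - of_real u * T) / (of_real u * T)"]) (simp add: norm_divide norm_mult field_simps)
 qed
 show thesis using that[OF d(1,2)] A B unfolding T_def by blast
qed

text \<open>The distance from \<open>ga ta\<close> attains a minimum on the compact set of
  parameters whose distance from \<open>ta\<close> lies between \<open>d\<close> and half a period,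
  and injectivity makes this minimum positive.\<close>

lemma local_param:
 assumes "0 < d"
 obtains r where "r > 0" "!!u. \<bar>u\<bar> <= 1 / 2 ==> norm (ga (ta + u) - ga ta) < r ==> \<bar>u\<bar> < d"
proof -
 define K where "K = {u. d <= \<bar>u\<bar> & \<bar>u\<bar> <= 1 / 2}"
 have "K = cball 0 (1/2) - ball 0 d" by (auto simp: K_def dist_norm)
 hence K: "compact K" by (simp add: compact_diff)
 show thesis
 proof (cases "K = {}")
  case True
  thus ?thesis using that[of 1] by (force simp: K_def)
 next
  case False
  have "continuous_on K (%u. norm (ga (ta + u) - ga ta))"
   by (intro continuous_intros continuous_on_compose2[OF cont[of UNIV]]) auto
  then obtain u0 where u0: "u0 : K" "!!u. u : K ==> norm (ga (ta + u0) - ga ta) <= norm (ga (ta + u) - ga ta)"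
   using continuous_attains_inf[OF K False] by blast
  have "ga (ta + u0) ~= ga ta" using gamma_inj[of "ta + u0" ta] u0(1) assms by (auto simp: K_def)
  show ?thesis
  proof (rule that)
   show "norm (ga (ta + u0) - ga ta) > 0" using \<open>ga (ta + u0) ~= ga ta\<close> by simp
   fix u :: real assume "\<bar>u\<bar> <= 1 / 2" "norm (ga (ta + u) - ga ta) < norm (ga (ta + u0) - ga ta)"
   hence "u ~: K" using u0(2)[of u] by linarith
   thus "\<bar>u\<bar> < d" using \<open>\<bar>u\<bar> <= 1 / 2\<close> by (auto simp: K_def)
  qed
 qed
qed


end

lemma Re_complex_of_real_times: "Re (of_real x * z) = x * Re z"
 by simp

text \<open>The kernel \<open>1 / (u^2 + ep^2)\<close> perturbed by the relative errors of curve and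
  tangent. Writing the denominator as \<open>S * (1 + g)\<close>, tolerance one tenth gives
  \<open>norm g <= 21 / 100\<close>, and the resulting error \<open>31 / 79\<close> stays below one
  half.\<close>

lemma Re_quotient_bound:
 fixes e e' :: complex and u ep :: real
 assumes e: "norm e <= 1 / 10" "norm e' <= 1 / 10" and ep: "ep > 0"
 shows "Re ((1 + e') / ((of_real u)\<^sup>2 * (1 + e)\<^sup>2 + (of_real ep)\<^sup>2)) >= 1 / (2 * (u\<^sup>2 + ep\<^sup>2))"
proof -
 define S where "S = u\<^sup>2 + ep\<^sup>2"
 have S: "S > 0" "u\<^sup>2 <= S" using ep by (auto simp: S_def add_nonneg_pos)
 define g where "g = of_real (u\<^sup>2 / S) * (2 * e + e\<^sup>2)"
 have "norm (2 * e + e\<^sup>2) <= 2 * (1/10) + (1/10)\<^sup>2"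
 proof (rule norm_triangle_le, rule add_mono)
  show "norm (2 * e) <= 2 * (1 / 10)" using e by (simp add: norm_mult)
  show "norm (e\<^sup>2) <= (1 / 10)\<^sup>2" unfolding norm_power using e by (intro power_mono) auto
 qed
 hence "norm g <= 1 * (21 / 100)"
  unfolding g_def norm_mult norm_of_real using S by (intro mult_mono) (auto simp: power2_eq_square)
 hence g: "norm g <= 21 / 100" by simp
 have g1: "norm (1 + g) >= 79 / 100" using norm_triangle_ineq2[of 1 "- g"] g by simp
 have "(of_real u)\<^sup>2 * (1 + e)\<^sup>2 + (of_real ep)\<^sup>2 = of_real S * (1 + g)"
 proof -
  have "of_real S * (1 + g) = of_real S + of_real (u\<^sup>2) * (2 * e + e\<^sup>2)"
   using S by (simp add: g_def distrib_left)
  thus ?thesis by (simp add: S_def power2_eq_square algebra_simps)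
 qed
 hence "(1 + e') / ((of_real u)\<^sup>2 * (1 + e)\<^sup>2 + (of_real ep)\<^sup>2) = of_real (1 / S) * ((1 + e') / (1 + g))"
  by simp
 hence eq: "Re ((1 + e') / ((of_real u)\<^sup>2 * (1 + e)\<^sup>2 + (of_real ep)\<^sup>2)) = 1 / S * Re ((1 + e') / (1 + g))"
  by (simp only: Re_complex_of_real_times)
 have "1 + g ~= 0" using g1 by auto
 hence "(1 + e') / (1 + g) = 1 + (e' - g) / (1 + g)" by (simp add: field_simps)
 hence "Re ((1 + e') / (1 + g)) = 1 + Re ((e' - g) / (1 + g))" by simp
 moreover have "norm ((e' - g) / (1 + g)) <= (31 / 100) / (79 / 100)"
  unfolding norm_divide using g1 g e norm_triangle_ineq4[of e' g] by (intro frac_le) auto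
 hence "\<bar>Re ((e' - g) / (1 + g))\<bar> <= 31 / 100 / (79 / 100)"
  by (rule order_trans[OF abs_Re_le_cmod])
 hence "\<bar>Re ((e' - g) / (1 + g))\<bar> <= 1 / 2" by (rule order_trans) simp
 ultimately have "Re ((1 + e') / (1 + g)) >= 1 / 2" by (simp only: abs_le_iff) linarith
 hence "1 / S * Re ((1 + e') / (1 + g)) >= 1 / S * (1 / 2)" using S by (intro mult_left_mono) auto
 also have "1 / S * (1 / 2) = 1 / (2 * (u\<^sup>2 + ep\<^sup>2))" by (simp add: S_def)
 finally show ?thesis using eq by simp
qed

context smooth_curve
begin

text \<open>Points of the curve close to \<open>ga ta\<close> come from small parameters, so in the
  tangent coordinate \<open>y\<close> they lie in a narrow sector about the real axis, with real
  part of the sign of \<open>u\<close>.\<close>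

lemma sides_off_curve:
 assumes d: "!!u. \<bar>u\<bar> <= d ==> EX e. norm e <= 1 / 10 & ga (ta + u) - ga ta = T * of_real u * (1 + e)"
  and r: "!!u. \<bar>u\<bar> <= 1 / 2 ==> norm (ga (ta + u) - ga ta) < r ==> \<bar>u\<bar> < d"
  and T: "T ~= 0" and y: "norm (T * y) < r" and on: "ga ta + T * y : path_image ga"
 obtains u e where "\<bar>u\<bar> < d" "norm e <= 1 / 10" "y = of_real u * (1 + e)" "ga ta + T * y = ga (ta + u)"
proof -
 obtain s where s: "s : {ta - 1 / 2..<ta - 1 / 2 + 1}" "ga ta + T * y = ga s"
  using on path_image_eq[of "ta - 1 / 2"] by blast
 define u where "u = s - ta"
 have u: "\<bar>u\<bar> <= 1 / 2" "ga ta + T * y = ga (ta + u)" using s by (auto simp: u_def abs_if)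
 hence "norm (ga (ta + u) - ga ta) < r" using y by (metis add_diff_cancel_left')
 hence ud: "\<bar>u\<bar> < d" using r u by blast
 then obtain e where e: "norm e <= 1 / 10" "ga (ta + u) - ga ta = T * of_real u * (1 + e)"
  using d[of u] by auto
 hence "T * y = T * (of_real u * (1 + e))" using u(2) by (metis add_diff_cancel_left' mult.assoc)
 hence "y = of_real u * (1 + e)" using T by simp
 thus thesis using that ud e u by blast
qed

lemma Re_one_plus:
 fixes e :: complex
 assumes "norm e <= 1 / 10"
 shows "Re (1 + e) > 0"
 using assms abs_Re_le_cmod[of e] by simp

text \<open>The difference of the winding numbers at two opposite points of the normal is the
  integral of a difference of Cauchy kernels. Near \<open>ta\<close> its real part is bounded below
  by a Poisson kernel that contributes at least \<open>1 / (2 * pi)\<close>; elsewhere it is of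
  order \<open>ep\<close>. As winding numbers are 1 inside and 0 outside, a positive difference
  decides both sides at once.\<close>

lemma sides:
 fixes ta :: real
 defines "T \<equiv> vector_derivative ga (at ta)"
 obtains ep0 where "ep0 > 0"
  "!!ep. 0 < ep ==> ep < ep0 ==> ga ta + T * (\<i> * of_real ep) : inside (path_image ga) &
    ga ta + T * (- \<i> * of_real ep) : outside (path_image ga)"
proof -
 have T: "T ~= 0" using deriv_nz by (simp add: T_def)
 obtain d where d: "0 < d" "d <= 1 / 2"
  "!!u. \<bar>u\<bar> <= d ==> EX e. norm e <= 1 / 10 & ga (ta + u) - ga ta = T * of_real u * (1 + e)"
  "!!u. \<bar>u\<bar> <= d ==> EX e. norm e <= 1 / 10 & vector_derivative ga (at (ta + u)) = T * (1 + e)"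
  unfolding T_def by (rule local_straight[of ta]) blast
 obtain r where r: "r > 0" "!!u. \<bar>u\<bar> <= 1 / 2 ==> norm (ga (ta + u) - ga ta) < r ==> \<bar>u\<bar> < d"
  by (rule local_param[OF d(1), of ta]) blast
 have cd: "continuous_on UNIV (%x. vector_derivative ga (at x))"
  using C1 C1_differentiable_on_eq by blast
 have "bounded ((%x. vector_derivative ga (at x)) ` {ta - 1 / 2..ta + 1 / 2})"
  by (intro compact_imp_bounded compact_continuous_image continuous_on_subset[OF cd]) auto
 then obtain B where B: "B > 0" "!!x. x : {ta - 1 / 2..ta + 1 / 2} ==> norm (vector_derivative ga (at x)) <= B"
  unfolding bounded_pos by auto
 \<comment> \<open>Bounds the kernel difference away from \<open>ta\<close> by
   \<open>C * ep\<close>: the denominator there is at least three quarters of the square of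
   \<open>r\<close>.\<close>
 define C where "C = B * (2 * norm T) / (3 / 4 * r\<^sup>2)"
 have C: "C > 0" using B T r by (simp add: C_def)
 \<comment> \<open>The first bound keeps the central window inside the straight part, the second
   keeps the test points within \<open>r / 2\<close> of \<open>ga ta\<close>, the third makes the
   error \<open>C * ep\<close> smaller than the gain \<open>1 / (2 * pi)\<close>.\<close>
 define ep0 where "ep0 = Min {d, r / (2 * norm T), 1 / (2 * pi * C)}"
 have ep0: "ep0 > 0" using d r T C by (simp add: ep0_def)
 show thesis
 proof (rule that[OF ep0])
  fix ep assume ep: "0 < ep" "ep < ep0"
  hence epd: "ep < d" and epr: "norm T * ep < r / 2" and epC: "C * ep < 1 / (2 * pi)"
   using T C by (auto simp: ep0_def field_simps)
  define P where "P = ga ta + T * (\<i> * of_real ep)"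
  define Q where "Q = ga ta + T * (- \<i> * of_real ep)"
  have off: "ga ta + T * (\<i> * of_real x) ~: path_image ga" if "\<bar>x\<bar> = ep" for x
  proof
   assume on: "ga ta + T * (\<i> * of_real x) : path_image ga"
   have "norm (T * (\<i> * of_real x)) < r" using epr that r by (simp add: norm_mult)
   from sides_off_curve[OF d(3) r(2) T this on] obtain u e where
    ue: "norm e <= 1 / 10" "\<i> * of_real x = of_real u * (1 + e)" by blast
   hence "Re (of_real u * (1 + e)) = 0" by (metis Re_i_times Im_complex_of_real neg_equal_zero)
   hence "u = 0" using Re_one_plus[OF ue(1)] by auto
   thus False using ue ep that by auto
  qed
  have PQ: "P ~: path_image ga" "Q ~: path_image ga"
   using off[of ep] off[of "- ep"] ep by (auto simp: P_def Q_def)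
  \<comment> \<open>Half a period before \<open>ta\<close>, so that \<open>ta\<close> is the
    midpoint \<open>x = 1 / 2\<close> of the integration interval.\<close>
  define s where "s = ta - 1 / 2"
  define F where "F z x = vector_derivative ga (at (s + x)) / (ga (s + x) - z)" for z x
  define G where "G x = 1 / tpi * (F P x - F Q x)" for x
  have int: "F P integrable_on {0..1}" "F Q integrable_on {0..1}"
   unfolding F_def using winding_number_shifted(2)[of _ s] PQ by auto
  have "winding_number ga P - winding_number ga Q = integral {0..1} G"
   unfolding G_def using winding_number_shifted(1)[OF PQ(1), of s] winding_number_shifted(1)[OF PQ(2), of s] int
   by (simp add: F_def[symmetric] integral_diff right_diff_distrib)
  moreover have Gi: "G integrable_on {0..1}"
   unfolding G_def by (intro integrable_on_mult_right integrable_diff) (use int in simp_all)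
  ultimately have W: "Re (winding_number ga P - winding_number ga Q) = integral {0..1} (%x. Re (G x))"
   using has_integral_Re[OF integrable_integral[OF Gi]] by (simp add: integral_unique)
  define J where "J = {1 / 2 - ep..1 / 2 + ep}"
  \<comment> \<open>On the window \<open>J\<close> the bound from \<open>Re_quotient_bound\<close>
    is smallest at the edge, where it gives \<open>1 / (4 * pi * ep)\<close>; integrated over
    \<open>J\<close> this is the gain \<open>1 / (2 * pi)\<close>. Subtracting \<open>C * ep\<close>
    everywhere covers the far part of the curve.\<close>
  define L where "L x = (if x : J then 1 / (4 * pi * ep) else 0) - C * ep" for x
  have "J <= {0..1}" using epd d by (auto simp: J_def)
  moreover have "((%x::real. 1 / (4 * pi * ep)) has_integral (1 / 2 + ep - (1 / 2 - ep)) *\<^sub>R (1 / (4 * pi * ep))) J"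
   unfolding J_def using ep has_integral_const_real[of "1 / (4 * pi * ep)" "1 / 2 - ep" "1 / 2 + ep"] by simp
  ultimately have "((%x. if x : J then 1 / (4 * pi * ep) else 0) has_integral 1 / (2 * pi)) {0..1}"
   using ep by (subst has_integral_restrict) (auto simp: field_simps)
  moreover have "((%x::real. C * ep) has_integral C * ep) {0..1}"
   using has_integral_const_real[of "C * ep" 0 1] by simp
  ultimately have Lint: "(L has_integral 1 / (2 * pi) - C * ep) {0..1}"
   unfolding L_def by (rule has_integral_diff)
  have lower: "L x <= Re (G x)" if x: "x : {0..1}" for x
  proof -
   define u where "u = x - 1 / 2"
   have sx: "s + x = ta + u" by (simp add: s_def u_def)
   define y where "y = ga (ta + u) - ga ta"
   define D where "D = vector_derivative ga (at (ta + u))"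
   have nz: "y - T * (\<i> * of_real ep) ~= 0" "y + T * (\<i> * of_real ep) ~= 0"
   proof -
    have "ga (ta + u) ~= P" "ga (ta + u) ~= Q" using PQ in_path_image[of "ta + u"] by metis+
    moreover have "y - T * (\<i> * of_real ep) = ga (ta + u) - P" "y + T * (\<i> * of_real ep) = ga (ta + u) - Q"
     by (simp_all add: P_def Q_def y_def)
    ultimately show "y - T * (\<i> * of_real ep) ~= 0" "y + T * (\<i> * of_real ep) ~= 0" by simp_all
   qed
   have den: "(y - T * (\<i> * of_real ep)) * (y + T * (\<i> * of_real ep)) = y\<^sup>2 + T\<^sup>2 * (of_real ep)\<^sup>2"
    by (simp add: power2_eq_square algebra_simps)
   have "F P x - F Q x = D / (y - T * (\<i> * of_real ep)) - D / (y + T * (\<i> * of_real ep))"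
    unfolding F_def sx D_def y_def P_def Q_def by (simp add: algebra_simps)
   also have "... = D * (2 * \<i> * T * of_real ep) / ((y - T * (\<i> * of_real ep)) * (y + T * (\<i> * of_real ep)))"
    using nz by (simp add: divide_simps) (simp add: algebra_simps)
   finally have Gx: "G x = of_real (1 / pi) * (D * T * of_real ep / (y\<^sup>2 + T\<^sup>2 * (of_real ep)\<^sup>2))"
    unfolding den G_def by simp
   show ?thesis
   proof (cases "\<bar>u\<bar> <= d")
    case True
    obtain e where e: "norm e <= 1 / 10" "y = T * of_real u * (1 + e)" using d(3)[OF True] by (auto simp: y_def)
    obtain e' where e': "norm e' <= 1 / 10" "D = T * (1 + e')" using d(4)[OF True] by (auto simp: D_def)
    have "y\<^sup>2 + T\<^sup>2 * (of_real ep)\<^sup>2 = T\<^sup>2 * ((of_real u)\<^sup>2 * (1 + e)\<^sup>2 + (of_real ep)\<^sup>2)"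
     unfolding e(2) power_mult_distrib by (simp only: distrib_left mult.assoc)
    hence "G x = of_real (ep / pi) * ((1 + e') / ((of_real u)\<^sup>2 * (1 + e)\<^sup>2 + (of_real ep)\<^sup>2))"
     unfolding Gx e'(2) using T by (simp add: power2_eq_square)
    hence "Re (G x) = ep / pi * Re ((1 + e') / ((of_real u)\<^sup>2 * (1 + e)\<^sup>2 + (of_real ep)\<^sup>2))"
     by (simp only: Re_complex_of_real_times)
    moreover have "ep / pi * Re ((1 + e') / ((of_real u)\<^sup>2 * (1 + e)\<^sup>2 + (of_real ep)\<^sup>2)) >= ep / pi * (1 / (2 * (u\<^sup>2 + ep\<^sup>2)))"
     using Re_quotient_bound[OF e(1) e'(1) ep(1)] ep by (intro mult_left_mono) auto
    ultimately have G1: "Re (G x) >= ep / pi * (1 / (2 * (u\<^sup>2 + ep\<^sup>2)))" by simp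
    show ?thesis
    proof (cases "x : J")
     case True
     hence "\<bar>u\<bar> <= ep" by (auto simp: J_def u_def abs_le_iff)
     hence "u\<^sup>2 <= ep\<^sup>2" using ep by (simp add: abs_le_square_iff[symmetric])
     hence "1 / (2 * (u\<^sup>2 + ep\<^sup>2)) >= 1 / (2 * (ep\<^sup>2 + ep\<^sup>2))"
      using ep by (intro divide_left_mono) (auto intro!: mult_pos_pos add_nonneg_pos)
     hence "ep / pi * (1 / (2 * (u\<^sup>2 + ep\<^sup>2))) >= ep / pi * (1 / (2 * (ep\<^sup>2 + ep\<^sup>2)))"
      using ep by (intro mult_left_mono) auto
     also have "ep / pi * (1 / (2 * (ep\<^sup>2 + ep\<^sup>2))) = 1 / (4 * pi * ep)"
      using ep by (simp add: power2_eq_square field_simps)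
     finally have "Re (G x) >= 1 / (4 * pi * ep)" using G1 by linarith
     thus ?thesis using True C ep by (simp add: L_def) (smt (verit) mult_pos_pos)
    next
     case False
     have "ep / pi * (1 / (2 * (u\<^sup>2 + ep\<^sup>2))) >= 0" using ep by simp
     moreover have "C * ep > 0" using C ep by simp
     ultimately show ?thesis using G1 False by (simp add: L_def)
    qed
   next
    case False
    have ux: "\<bar>u\<bar> <= 1 / 2" using x by (auto simp: u_def abs_if)
    hence "norm y >= r" using r(2)[of u] False unfolding y_def by linarith
    hence "norm y ^ 2 >= r\<^sup>2" using r by (intro power_mono) auto
    moreover have "(norm T * ep)\<^sup>2 <= (r / 2)\<^sup>2" using epr ep by (intro power_mono) auto
    moreover have "norm (y\<^sup>2 + T\<^sup>2 * (of_real ep)\<^sup>2) >= norm (y\<^sup>2) - norm (T\<^sup>2 * (of_real ep)\<^sup>2)"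
     using norm_triangle_ineq2[of "y\<^sup>2" "- (T\<^sup>2 * (of_real ep)\<^sup>2)"] by simp
    ultimately have dn: "norm (y\<^sup>2 + T\<^sup>2 * (of_real ep)\<^sup>2) >= 3 / 4 * r\<^sup>2"
     using ep by (simp add: norm_power norm_mult power_mult_distrib power_divide)
    have "ta + u : {ta - 1 / 2..ta + 1 / 2}" using ux by (auto simp: abs_le_iff)
    hence DB: "norm D <= B" using B by (simp add: D_def)
    have "norm (G x) = 1 / pi * (norm D * norm T * ep / norm (y\<^sup>2 + T\<^sup>2 * (of_real ep)\<^sup>2))"
     unfolding Gx using ep by (simp add: norm_mult norm_divide)
    also have "... <= 1 * (B * (2 * norm T) * ep / (3 / 4 * r\<^sup>2))"
    proof (rule mult_mono)
     show "1 / pi <= 1" using pi_gt3 by simp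
     show "norm D * norm T * ep / norm (y\<^sup>2 + T\<^sup>2 * (of_real ep)\<^sup>2) <= B * (2 * norm T) * ep / (3 / 4 * r\<^sup>2)"
      using DB dn r B ep by (intro frac_le mult_right_mono mult_mono) auto
    qed (use ep in auto)
    also have "... = C * ep" by (simp add: C_def)
    finally have "\<bar>Re (G x)\<bar> <= C * ep" using abs_Re_le_cmod[of "G x"] by linarith
    moreover have "x ~: J" using False epd by (auto simp: J_def u_def abs_le_iff)
    ultimately show ?thesis by (simp add: L_def)
   qed
  qed
  have "(%x. Re (G x)) integrable_on {0..1}"
   using has_integral_Re[OF integrable_integral[OF Gi]] by blast
  hence "1 / (2 * pi) - C * ep <= integral {0..1} (%x. Re (G x))"
   using has_integral_le[OF Lint integrable_integral] lower by blast
  hence pos: "Re (winding_number ga P) - Re (winding_number ga Q) > 0" using W epC by simp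
  have cases: "z : inside (path_image ga) & winding_number ga z = 1 | z : outside (path_image ga) & winding_number ga z = 0"
   if "z ~: path_image ga" for z
   using that jordan(8) winding winding_outside by blast
  have "P : inside (path_image ga) & Q : outside (path_image ga)"
   using cases[OF PQ(1)] cases[OF PQ(2)] pos by auto
  thus "ga ta + T * (\<i> * of_real ep) : inside (path_image ga) &
    ga ta + T * (- \<i> * of_real ep) : outside (path_image ga)" by (simp add: P_def Q_def)
 qed
qed

end

section \<open>The deck transformation of a loop around a puncture\<close>

context smooth_curve
begin

text \<open>A half-plane covers a punctured neighbourhood of a marked point; the translation by one period
  lifts to the deck transformation which belongs to a loop crossing the two adjacent arcs.\<close>

lemma encircling_deck:
 fixes \<rho> :: "'a::topological_space => csphere" and X :: "'a set"
 assumes cov: "covering_space X \<rho> (UNIV - Some ` F)"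
  and F: "finite F" "F <= ga ` {t k..t (k - 1) + 1}" "F <= ga ` {t (k + 1)..t k + 1}" "ga (t k) : F"
  and t: "t (k - 1) < t k" "t k < t (k + 1)" "t k <= t (k - 1) + 1" "t (k + 1) <= t k + 1"
  and x0: "x0 : X" "\<rho> x0 : Some ` inside (path_image ga)"
  and \<sigma>: "deck_transformation X \<rho> \<sigma>"
  and c: "encircling_path X \<rho> ga t x0 k c" "\<sigma> x0 = pathfinish c"
  and dl: "dl > 0" "ball (ga (t k)) dl Int F <= {ga (t k)}"
 shows "EX et. continuous_on {w. Re w < ln dl} et & et ` {w. Re w < ln dl} <= X &
  (ALL w. Re w < ln dl --> \<rho> (et w) = Some (ga (t k) + exp w) & et (w + tpi) = \<sigma> (et w))"
proof -
 define b where "b = ga (t k)"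
 \<comment> \<open>\<open>K\<close> is what remains of the curve without the open subarc before
   \<open>b\<close>, \<open>K'\<close> without the one after it. Both contain all punctures and end
   at \<open>b\<close>, so their complements in the sphere, read in the coordinate
   \<open>1 / (z - b)\<close>, are simply connected and free of punctures.\<close>
 define K where "K = ga ` {t k..t (k - 1) + 1}"
 define K' where "K' = ga ` {t (k + 1)..t k + 1}"
 define V where "V = {ze. ze = 0 | b + 1 / ze : - K}"
 define V' where "V' = {ze. ze = 0 | b + 1 / ze : - K'}"
 define f where "f = (%ze. if ze = 0 then None else Some (b + 1 / ze) :: csphere)"
 have b1: "b = ga (t k + 1)" using per by (simp add: b_def)
 have "b : K" unfolding b_def K_def by (rule imageI) (use t in auto)
 moreover have "b : K'" unfolding b1 K'_def by (rule imageI) (use t in auto)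
 ultimately have bK: "b : K" "b : K'" by auto
 have KG: "K <= path_image ga" "K' <= path_image ga" by (auto simp: K_def K'_def)
 have V: "simply_connected V" "open V"
  using simply_connected_arc_compl[of "t k" "t (k - 1) + 1" "t k"] t unfolding V_def K_def b_def by auto
 have V': "simply_connected V'" "open V'"
  using simply_connected_arc_compl[of "t (k + 1)" "t k + 1" "t k + 1"] t unfolding V'_def K'_def b1 by auto
 have fc: "continuous_on A f" for A unfolding f_def by (rule continuous_on_inversion)
 have fV: "f ` V <= UNIV - Some ` F" "f ` V' <= UNIV - Some ` F"
  using F by (auto simp: f_def V_def V'_def K_def K'_def split: if_splits)
 have finv: "f (inv_coord b p) = p" if "p ~= Some b" for p
  unfolding f_def by (rule inv_inv_coord[OF that])
 have inV: "inv_coord b p : V" if "p ~: Some ` K" for p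
  using that bK by (cases p) (auto simp: V_def)
 have inV': "inv_coord b p : V'" if "p ~: Some ` K'" for p
  using that bK by (cases p) (auto simp: V'_def)
 from c obtain u v where uv: "simple_path c" "path_image c <= X" "pathstart c = x0" "\<rho> (pathfinish c) = \<rho> x0"
  "u < v" "{s:{0..1}. \<rho> (c s) : Some ` path_image ga} = {u, v}"
  "\<rho> (c u) : Some ` ga ` {t (k - 1)<..<t k}" "\<rho> (c v) : Some ` ga ` {t k<..<t (k + 1)}"
  "ALL s:{u<..<v}. \<rho> (c s) ~: Some ` inside (path_image ga)"
  unfolding encircling_path_def by blast
 have uv01: "0 <= u" "v <= 1" using uv(6) by auto
 have cc: "continuous_on {0..1} c" using uv(1) by (simp add: simple_path_def path_def)
 have cX: "c s : X" if "s : {0..1}" for s using uv(2) that by (auto simp: path_image_def)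
 have c01: "c 0 = x0" "c 1 = \<sigma> x0" using uv(3) c(2) by (auto simp: pathstart_def pathfinish_def)
 have \<rho>c: "continuous_on {0..1} (%s. \<rho> (c s))"
  by (rule continuous_on_compose2[of X \<rho>]) (use cov cc cX in "auto simp: covering_space_def")
 have arcK: "ga s ~: K" if "t (k - 1) < s" "s < t k" for s
 proof
  assume "ga s : K"
  then obtain s' where s': "s' : {t k..t (k - 1) + 1}" "ga (s + 1) = ga s'" by (auto simp: K_def per)
  have "s + 1 = s'" by (rule gamma_inj[OF s'(2)]) (use that t s' in auto)
  thus False using that s' by auto
 qed
 have arcK': "ga s ~: K'" if "t k < s" "s < t (k + 1)" for s
 proof
  assume "ga s : K'"
  then obtain s' where s': "s' : {t (k + 1)..t k + 1}" "ga s = ga s'" by (auto simp: K'_def)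
  have "s = s'" by (rule gamma_inj[OF s'(2)]) (use that t s' in auto)
  thus False using that s' by auto
 qed
 have nK: "\<rho> (c s) ~: Some ` K" if "s : {0..<v}" for s
 proof (cases "s = u")
  case True
  thus ?thesis using uv(7) arcK by auto
 next
  case False
  hence "s ~: {u, v}" "s : {0..1}" using that uv01 by auto
  thus ?thesis using uv(6) KG by blast
 qed
 have nK': "\<rho> (c s) ~: Some ` K'" if "s : {u<..1}" for s
 proof (cases "s = v")
  case True
  thus ?thesis using uv(8) arcK' by auto
 next
  case False
  hence "s ~: {u, v}" "s : {0..1}" using that uv01 by auto
  thus ?thesis using uv(6) KG by blast
 qed
 define q where "q s = inv_coord b (\<rho> (c s))" for s
 have "continuous_on {0..<v} q" unfolding q_def
 proof (rule continuous_on_compose2[OF continuous_on_inv_coord])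
  show "continuous_on {0..<v} (%s. \<rho> (c s))" using \<rho>c by (rule continuous_on_subset) (use uv01 in auto)
  show "(%s. \<rho> (c s)) ` {0..<v} <= - {Some b}" using nK bK by fastforce
 qed
 moreover have "continuous_on {u<..1} q" unfolding q_def
 proof (rule continuous_on_compose2[OF continuous_on_inv_coord])
  show "continuous_on {u<..1} (%s. \<rho> (c s))" using \<rho>c by (rule continuous_on_subset) (use uv01 in auto)
  show "(%s. \<rho> (c s)) ` {u<..1} <= - {Some b}" using nK' bK by fastforce
 qed
 ultimately have qc: "continuous_on {0..<v} q" "continuous_on {u<..1} q" by auto
 have fq: "f (q s) = \<rho> (c s)" if "s : {0..<v} Un {u<..1}" for s
  unfolding q_def by (rule finv) (use that nK[of s] nK'[of s] bK in auto)
 have qV: "q s : V" if "s : {0..<v}" for s unfolding q_def by (rule inV[OF nK[OF that]])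
 have qV': "q s : V'" if "s : {u<..1}" for s unfolding q_def by (rule inV'[OF nK'[OF that]])
 have v0: "0 < v" "u < 1" using uv01 uv(5) by auto
 \<comment> \<open>Sections of \<open>\<rho>\<close> over the two complements: \<open>sec\<close>
   follows the path from its start until the second crossing, \<open>sec'\<close> follows it from
   the first crossing to its end.\<close>
 obtain sec where sec: "continuous_on V sec" "sec ` V <= X" "!!ze. ze : V ==> \<rho> (sec ze) = f ze" "sec (q 0) = x0"
  using covering_lift_simply_connected[OF cov V(2,1) qV[of 0] fc fV(1) x0(1)] fq[of 0] c01 v0 by auto
 have sx0: "\<sigma> x0 : X" using cX[of 1] c01 by simp
 obtain sec' where sec': "continuous_on V' sec'" "sec' ` V' <= X" "!!ze. ze : V' ==> \<rho> (sec' ze) = f ze" "sec' (q 1) = \<sigma> x0"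
  using covering_lift_simply_connected[OF cov V'(2,1) qV'[of 1] fc fV(2) sx0] fq[of 1] c01 v0 by auto
 have A1: "sec (q s) = c s" if "s : {0..<v}" for s
 proof (rule covering_lift_unique[OF cov, of "{0..<v}" "%s. sec (q s)" c 0 s])
  show "continuous_on {0..<v} (%s. sec (q s))"
   by (rule continuous_on_compose2[OF sec(1) qc(1)]) (use qV in auto)
  show "continuous_on {0..<v} c" using cc by (rule continuous_on_subset) (use uv01 in auto)
  show "(%s. sec (q s)) ` {0..<v} <= X" using sec(2) qV by auto
  show "c ` {0..<v} <= X" using cX uv01 by auto
  show "\<rho> (sec (q x)) = \<rho> (c x)" if "x : {0..<v}" for x using sec(3)[OF qV[OF that]] fq[of x] that by simp
 qed (use that sec(4) c01 v0 in auto)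
 have A2: "sec' (q s) = c s" if "s : {u<..1}" for s
 proof (rule covering_lift_unique[OF cov, of "{u<..1}" "%s. sec' (q s)" c 1 s])
  show "continuous_on {u<..1} (%s. sec' (q s))"
   by (rule continuous_on_compose2[OF sec'(1) qc(2)]) (use qV' in auto)
  show "continuous_on {u<..1} c" using cc by (rule continuous_on_subset) (use uv01 in auto)
  show "(%s. sec' (q s)) ` {u<..1} <= X" using sec'(2) qV' by auto
  show "c ` {u<..1} <= X" using cX uv01 by auto
  show "\<rho> (sec' (q x)) = \<rho> (c x)" if "x : {u<..1}" for x using sec'(3)[OF qV'[OF that]] fq[of x] that by simp
 qed (use that sec'(4) c01 v0 in auto)
 define Out where "Out = {ze. ze = 0 | b + 1 / ze : outside (path_image ga)}"
 have disj: "z ~: path_image ga" if "z : inside (path_image ga) | z : outside (path_image ga)" for z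
  using that jordan(8) by blast
 have "- outside (path_image ga) <= path_image ga Un inside (path_image ga)" using jordan(8) by blast
 hence bdd: "bounded (- outside (path_image ga))"
  using bounded_subset[of "path_image ga Un inside (path_image ga)"] jordan(6) bounded_path_image[OF path] by simp
 have "connected Out"
  unfolding Out_def
  by (rule connected_inversion_insert[OF jordan(5) _ bdd]) (use disj[of b] in "auto simp: b_def")
 have OutV: "Out <= V" "Out <= V'" using disj KG by (auto simp: Out_def V_def V'_def)
 \<comment> \<open>Between the two crossings the path is outside the curve and lies over both
   domains. Hence the sections agree at one point of \<open>Out\<close>, and \<open>Out\<close> is
   connected.\<close>
 have A3: "sec ze = sec' ze" if "ze : Out" for ze
 proof (rule covering_lift_unique[OF cov \<open>connected Out\<close>, of sec sec' "q ((u + v) / 2)" ze])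
  have m: "(u + v) / 2 : {0..<v}" "(u + v) / 2 : {u<..1}" "(u + v) / 2 : {u<..<v}" using uv(5) uv01 by auto
  have "(u + v) / 2 : {0..1}" "(u + v) / 2 ~= u" "(u + v) / 2 ~= v" using m by auto
  hence n1: "\<rho> (c ((u + v) / 2)) ~: Some ` path_image ga" using uv(6) by blast
  have n2: "\<rho> (c ((u + v) / 2)) ~: Some ` inside (path_image ga)" using uv(9) m(3) by blast
  have "\<rho> (c ((u + v) / 2)) = None | \<rho> (c ((u + v) / 2)) : Some ` outside (path_image ga)"
  proof (cases "\<rho> (c ((u + v) / 2))")
   case (Some y)
   hence "y ~: path_image ga" "y ~: inside (path_image ga)" using n1 n2 by auto
   thus ?thesis using jordan(8) Some by blast
  qed auto
  thus "q ((u + v) / 2) : Out"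
   using fq[of "(u + v) / 2"] m by (auto simp: Out_def f_def split: if_splits)
  show "sec (q ((u + v) / 2)) = sec' (q ((u + v) / 2))" using A1[OF m(1)] A2[OF m(2)] by simp
  show "continuous_on Out sec" "continuous_on Out sec'"
   using continuous_on_subset[OF sec(1) OutV(1)] continuous_on_subset[OF sec'(1) OutV(2)] by auto
  show "sec ` Out <= X" "sec' ` Out <= X" using sec(2) sec'(2) OutV by blast+
  show "\<rho> (sec x) = \<rho> (sec' x)" if "x : Out" for x
   using sec(3)[OF subsetD[OF OutV(1) that]] sec'(3)[OF subsetD[OF OutV(2) that]] by simp
 qed (rule that)
 have \<sigma>': "continuous_on X \<sigma>" "\<sigma> ` X <= X" "!!x. x : X ==> \<rho> (\<sigma> x) = \<rho> x"
  using \<sigma> unfolding deck_transformation_def homeomorphism_def by auto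
 define In where "In = (%z. 1 / (z - b)) ` inside (path_image ga)"
 have bin: "b ~: inside (path_image ga)" using disj[of b] by (auto simp: b_def)
 have "continuous_on (inside (path_image ga)) (%z. 1 / (z - b))" using bin by (intro continuous_intros) auto
 hence "connected In" unfolding In_def using jordan(3) connected_continuous_image by blast
 have InV: "In <= V" "In <= V'" using disj KG by (auto simp: In_def V_def V'_def)
 \<comment> \<open>The projected path is closed, so at the base point \<open>sec\<close> gives the
   start \<open>x0\<close> and \<open>sec'\<close> the end \<open>\<sigma> x0\<close>; on the
   connected inner side the sections therefore differ by \<open>\<sigma>\<close>.\<close>
 have A4: "sec' ze = \<sigma> (sec ze)" if "ze : In" for ze
 proof (rule covering_lift_unique[OF cov \<open>connected In\<close>, of sec' "%ze. \<sigma> (sec ze)" "q 0" ze])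
  have q01: "q 1 = q 0" using c01 \<sigma>'(3)[OF x0(1)] by (simp add: q_def)
  show "q 0 : In" using x0(2) c01 by (auto simp: q_def In_def)
  show "sec' (q 0) = \<sigma> (sec (q 0))" using sec(4) sec'(4) q01 by simp
  show "continuous_on In sec'" using continuous_on_subset[OF sec'(1) InV(2)] .
  show "continuous_on In (%ze. \<sigma> (sec ze))"
   by (rule continuous_on_compose2[OF \<sigma>'(1) continuous_on_subset[OF sec(1) InV(1)]]) (use sec(2) InV in auto)
  show "sec' ` In <= X" "(%ze. \<sigma> (sec ze)) ` In <= X" using sec(2) sec'(2) \<sigma>'(2) InV by blast+
  show "\<rho> (sec' x) = \<rho> (\<sigma> (sec x))" if "x : In" for x
  proof -
   have "sec x : X" using sec(2) InV that by blast
   thus ?thesis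
    using sec(3)[OF subsetD[OF InV(1) that]] sec'(3)[OF subsetD[OF InV(2) that]] \<sigma>'(3) by simp
  qed
 qed (rule that)
 define T where "T = vector_derivative ga (at (t k))"
 have T: "T ~= 0" using deriv_nz by (simp add: T_def)
 obtain d0 where d0: "0 < d0" "d0 <= 1 / 2"
  "!!u. \<bar>u\<bar> <= d0 ==> EX e. norm e <= 1 / 10 & ga (t k + u) - ga (t k) = T * of_real u * (1 + e)"
  unfolding T_def by (rule local_straight[of "t k"]) blast
 define d where "d = min d0 (min (t k - t (k - 1)) (t (k + 1) - t k))"
 have d: "0 < d" "d <= d0" "d <= t k - t (k - 1)" "d <= t (k + 1) - t k" using d0 t by (auto simp: d_def)
 obtain r where r: "r > 0" "!!u. \<bar>u\<bar> <= 1 / 2 ==> norm (ga (t k + u) - ga (t k)) < r ==> \<bar>u\<bar> < d"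
  by (rule local_param[OF d(1), of "t k"]) blast
 obtain ep0 where ep0: "ep0 > 0" "!!ep. 0 < ep ==> ep < ep0 ==> b + T * (\<i> * of_real ep) : inside (path_image ga) &
    b + T * (- \<i> * of_real ep) : outside (path_image ga)"
  unfolding T_def b_def by (rule sides[of "t k"]) blast
 \<comment> \<open>Small enough for the test points on the normal, for the curve to be nearly
   straight within the circle, and for the circle to lie in the punctured disc.\<close>
 define ep where "ep = Min {ep0, r / norm T, dl / norm T} / 2"
 have ep: "0 < ep" "ep < ep0" "norm T * ep < r" "norm T * ep < dl"
 proof -
  have M: "Min {ep0, r / norm T, dl / norm T} > 0" using ep0 r T dl by simp
  thus "0 < ep" by (simp add: ep_def)
  have "ep < Min {ep0, r / norm T, dl / norm T}" using M unfolding ep_def by linarith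
  hence "ep < ep0" "ep < r / norm T" "ep < dl / norm T" by auto
  thus "ep < ep0" "norm T * ep < r" "norm T * ep < dl" using T by (auto simp: field_simps)
 qed
 \<comment> \<open>The circle starts on the left normal, hence inside. By \<open>on\<close>, for
   angles in \<open>{0..pi}\<close> it can meet only the subarc before \<open>b\<close>, and in
   \<open>{pi..2 * pi}\<close> only the subarc after it.\<close>
 define w0 where "w0 = Ln (T * (\<i> * of_real ep))"
 have ew0: "exp (w0 + \<i> * of_real tt) = T * (\<i> * of_real ep * cis tt)" for tt
  unfolding exp_add w0_def using T ep by (simp add: cis_conv_exp)
 have norm_w0: "norm (T * (\<i> * of_real ep * cis tt)) < min r dl" for tt
  using ep by (simp add: norm_mult)
 have Re_w0: "Re (w0 + \<i> * of_real tt) < ln dl" for tt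
 proof -
  have "exp (Re (w0 + \<i> * of_real tt)) < dl"
   using norm_w0[of tt] unfolding ew0[symmetric] norm_exp_eq_Re by simp
  thus ?thesis using dl(1) by (metis exp_less_cancel_iff exp_ln)
 qed
 have on: "EX s. z = ga s & (t (k - 1) < s & s < t k & sin tt > 0 | t k < s & s < t (k + 1) & sin tt < 0)"
  if z: "z : path_image ga" "z = b + T * (\<i> * of_real ep * cis tt)" for z tt
 proof -
  have dd: "!!u. \<bar>u\<bar> <= d ==> EX e. norm e <= 1 / 10 & ga (t k + u) - ga (t k) = T * of_real u * (1 + e)"
   using d0(3) d(2) by force
  have nr: "norm (T * (\<i> * of_real ep * cis tt)) < r" using norm_w0[of tt] by simp
  have on: "ga (t k) + T * (\<i> * of_real ep * cis tt) : path_image ga" using z by (simp add: b_def)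
  obtain u e where ue: "\<bar>u\<bar> < d" "norm e <= 1 / 10" "\<i> * of_real ep * cis tt = of_real u * (1 + e)"
   "ga (t k) + T * (\<i> * of_real ep * cis tt) = ga (t k + u)"
   using sides_off_curve[OF dd r(2) T nr on] by blast
  have "Re (\<i> * of_real ep * cis tt) = - (ep * sin tt)" by simp
  hence eq: "- (ep * sin tt) = u * Re (1 + e)" unfolding ue(3) Re_complex_of_real_times by simp
  have "u ~= 0"
  proof
   assume "u = 0"
   hence "norm (\<i> * of_real ep * cis tt) = 0" using ue(3) by simp
   thus False using ep by (simp add: norm_mult)
  qed
  then consider "u < 0" | "u > 0" by linarith
  thus ?thesis
  proof cases
   case 1
   hence "u * Re (1 + e) < 0" using Re_one_plus[OF ue(2)] by (rule mult_neg_pos)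
   hence "sin tt > 0" using eq ep(1) by (metis neg_less_0_iff_less zero_less_mult_pos)
   thus ?thesis using ue(1,4) 1 d z by (intro exI[of _ "t k + u"]) (auto simp: b_def)
  next
   case 2
   hence "u * Re (1 + e) > 0" using Re_one_plus[OF ue(2)] by (rule mult_pos_pos)
   hence "sin tt < 0" using eq ep(1) by (metis mult_pos_pos neg_0_less_iff_less not_less_iff_gr_or_eq mult_zero_right)
   thus ?thesis using ue(1,4) 2 d z by (intro exI[of _ "t k + u"]) (auto simp: b_def)
  qed
 qed
 define HP where "HP = {w. Re w < ln dl}"
 have HP: "open HP" "convex HP" "connected HP"
  unfolding HP_def using open_halfspace_Re_lt convex_halfspace_Re_lt convex_connected by blast+
 define E where "E w = Some (b + exp w) " for w :: complex
 define m where "m tt = 1 / (T * (\<i> * of_real ep * cis tt))" for tt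
 have nz: "T * (\<i> * of_real ep * cis tt) ~= 0" for tt using T ep by simp
 have fm: "f (m tt) = E (w0 + \<i> * of_real tt)" for tt
  using nz[of tt] by (simp add: f_def m_def E_def ew0)
 have mc: "continuous_on A m" for A
  unfolding m_def using nz by (intro continuous_intros continuous_on_cis) auto
 have mV: "m tt : V" if "tt : {0..pi}" for tt
 proof -
  have "b + T * (\<i> * of_real ep * cis tt) ~: K"
  proof
   assume K: "b + T * (\<i> * of_real ep * cis tt) : K"
   then obtain s where "b + T * (\<i> * of_real ep * cis tt) = ga s"
    "t (k - 1) < s & s < t k & sin tt > 0 | t k < s & s < t (k + 1) & sin tt < 0"
    using on[OF _ refl] KG by blast
   moreover have "sin tt >= 0" using that sin_ge_zero by auto
   ultimately show False using arcK[of s] K by auto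
  qed
  thus ?thesis by (simp add: V_def m_def)
 qed
 have mV': "m tt : V'" if "tt : {pi..2 * pi}" for tt
 proof -
  have "b + T * (\<i> * of_real ep * cis tt) ~: K'"
  proof
   assume K: "b + T * (\<i> * of_real ep * cis tt) : K'"
   then obtain s where "b + T * (\<i> * of_real ep * cis tt) = ga s"
    "t (k - 1) < s & s < t k & sin tt > 0 | t k < s & s < t (k + 1) & sin tt < 0"
    using on[OF _ refl] KG by blast
   moreover have "sin tt <= 0" using that sin_le_zero[of tt] by (cases "tt = 2 * pi") auto
   ultimately show False using arcK'[of s] K by auto
  qed
  thus ?thesis by (simp add: V'_def m_def)
 qed
 have Ec: "continuous_on A E" for A
  unfolding E_def
  by (rule continuous_on_compose2[OF continuous_on_Some[of UNIV]]) (auto intro!: continuous_intros)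
 have ES: "E ` HP <= UNIV - Some ` F"
 proof
  fix p assume "p : E ` HP"
  then obtain w where w: "Re w < ln dl" "p = Some (b + exp w)" by (auto simp: HP_def E_def)
  have "exp (Re w) < dl" using w(1) dl(1) by (metis exp_less_cancel_iff exp_ln)
  hence "b + exp w : ball b dl" by (simp add: dist_norm norm_exp_eq_Re)
  moreover have "b + exp w ~= b" by simp
  ultimately have "b + exp w ~: F" using dl(2) unfolding b_def by blast
  thus "p : UNIV - Some ` F" using w by auto
 qed
 have w0HP: "w0 + \<i> * of_real tt : HP" for tt using Re_w0 by (simp add: HP_def)
 have m0V: "m 0 : V" using mV[of 0] by simp
 obtain et where et: "continuous_on HP et" "et ` HP <= X" "!!w. w : HP ==> \<rho> (et w) = E w" "et w0 = sec (m 0)"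
 proof -
  have "sec (m 0) : X" "\<rho> (sec (m 0)) = E w0" using sec(2) sec(3)[OF m0V] m0V fm[of 0] by auto
  moreover have "w0 : HP" using w0HP[of 0] by simp
  ultimately show thesis
   using covering_lift_convex[OF cov HP(1,2) _ Ec ES, of w0 "sec (m 0)"] that by blast
 qed
 have etc: "continuous_on A (%tt. et (w0 + \<i> * of_real tt))" for A
  by (rule continuous_on_compose2[OF et(1)]) (use w0HP in "auto intro!: continuous_intros")
 \<comment> \<open>The first half circle stays in \<open>V\<close>, so the lift equals
   \<open>sec\<close>. At \<open>pi\<close> it is outside, where \<open>sec\<close> may be exchanged
   for \<open>sec'\<close>; after the second half it is inside again, where \<open>sec'\<close> is
   \<open>\<sigma>\<close> after \<open>sec\<close>.\<close>
 have B1: "et (w0 + \<i> * of_real tt) = sec (m tt)" if "tt : {0..pi}" for tt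
 proof (rule covering_lift_unique[OF cov, of "{0..pi}" "%tt. et (w0 + \<i> * of_real tt)" "%tt. sec (m tt)" 0 tt])
  show "continuous_on {0..pi} (%tt. sec (m tt))"
   by (rule continuous_on_compose2[OF sec(1) mc]) (use mV in auto)
  show "(%tt. et (w0 + \<i> * of_real tt)) ` {0..pi} <= X" using et(2) w0HP by blast
  show "(%tt. sec (m tt)) ` {0..pi} <= X" using sec(2) mV by blast
  show "\<rho> (et (w0 + \<i> * of_real x)) = \<rho> (sec (m x))" if "x : {0..pi}" for x
   using et(3)[OF w0HP[of x]] sec(3)[OF mV[OF that]] fm[of x] by simp
 qed (use et(4) etc that in auto)
 have mpi: "m pi : Out"
 proof -
  have "b + T * (- \<i> * of_real ep) : outside (path_image ga)" using ep0(2)[OF ep(1,2)] by blast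
  thus ?thesis by (simp add: Out_def m_def)
 qed
 have B2: "et (w0 + \<i> * of_real tt) = sec' (m tt)" if "tt : {pi..2 * pi}" for tt
 proof (rule covering_lift_unique[OF cov, of "{pi..2 * pi}" "%tt. et (w0 + \<i> * of_real tt)" "%tt. sec' (m tt)" pi tt])
  show "continuous_on {pi..2 * pi} (%tt. sec' (m tt))"
   by (rule continuous_on_compose2[OF sec'(1) mc]) (use mV' in auto)
  show "(%tt. et (w0 + \<i> * of_real tt)) ` {pi..2 * pi} <= X" using et(2) w0HP by blast
  show "(%tt. sec' (m tt)) ` {pi..2 * pi} <= X" using sec'(2) mV' by blast
  show "\<rho> (et (w0 + \<i> * of_real x)) = \<rho> (sec' (m x))" if "x : {pi..2 * pi}" for x
   using et(3)[OF w0HP[of x]] sec'(3)[OF mV'[OF that]] fm[of x] by simp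
  show "et (w0 + \<i> * of_real pi) = sec' (m pi)" using B1[of pi] A3[OF mpi] by simp
 qed (use etc that in auto)
 have m0: "m 0 : In"
 proof -
  have "b + T * (\<i> * of_real ep) : inside (path_image ga)" using ep0(2)[OF ep(1,2)] by blast
  thus ?thesis unfolding In_def m_def by (intro image_eqI[of _ _ "b + T * (\<i> * of_real ep)"]) simp_all
 qed
 have "m (2 * pi) = m 0" by (simp add: m_def)
 hence start: "et (w0 + tpi) = \<sigma> (et w0)"
  using B2[of "2 * pi"] A4[OF m0] et(4) by (simp add: mult_ac)
 have shiftHP: "w + tpi : HP" if "w : HP" for w using that by (simp add: HP_def)
 have "et (w + tpi) = \<sigma> (et w)" if "w : HP" for w
 proof (rule covering_lift_unique[OF cov HP(3), of "%w. et (w + tpi)" "%w. \<sigma> (et w)" w0 w])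
  show "continuous_on HP (%w. et (w + tpi))"
   by (rule continuous_on_compose2[OF et(1)]) (use shiftHP in "auto intro!: continuous_intros")
  show "continuous_on HP (%w. \<sigma> (et w))"
   by (rule continuous_on_compose2[OF \<sigma>'(1) et(1)]) (use et(2) in auto)
  show "(%w. et (w + tpi)) ` HP <= X" using et(2) shiftHP by blast
  show "(%w. \<sigma> (et w)) ` HP <= X" using et(2) \<sigma>'(2) by blast
  show "\<rho> (et (x + tpi)) = \<rho> (\<sigma> (et x))" if "x : HP" for x
  proof -
   have "exp (x + tpi) = exp x" by (simp add: exp_add exp_two_pi_i mult_ac)
   moreover have "et x : X" using et(2) that by blast
   ultimately show ?thesis
    using et(3)[OF that] et(3)[OF shiftHP[OF that]] \<sigma>'(3) by (simp add: E_def)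
  qed
 qed (use start that w0HP[of 0] in auto)
 thus ?thesis using et(1-3) unfolding HP_def E_def b_def by (intro exI[of _ et]) auto
qed

end

section \<open>Matrix differential equations\<close>

lemma mult_mat_entry:
 assumes "A : sq_mat n" "B : sq_mat n" "i < n" "j < n"
 shows "(A * B) $$ (i,j) = (\<Sum>k<n. A $$ (i,k) * B $$ (k,j))"
 using assms by (auto simp: scalar_prod_def lessThan_atLeast0 intro!: sum.cong)

lemma smult_mat_entry:
 "A : sq_mat n ==> i < n ==> j < n ==> (c \<cdot> A) $$ (i,j) = c * A $$ (i,j)"
 by auto

lemma minus_mat_entry:
 "A : sq_mat n ==> B : sq_mat n ==> i < n ==> j < n ==> (A - B) $$ (i,j) = A $$ (i,j) - B $$ (i,j)"
 by auto

lemma smult_minus_distrib_mat: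
 fixes A B :: "'a::comm_ring_1 mat"
 assumes "A : sq_mat n" "B : sq_mat n"
 shows "c \<cdot> A - c \<cdot> B = c \<cdot> (A - B)"
 using assms by (intro eq_matI) (auto simp: right_diff_distrib)

text \<open>The adjugate formula makes holomorphic dependence of the inverse on the entries
  visible.\<close>

definition minv :: "complex mat => complex mat" where
 "minv A = (1 / det A) \<cdot> adj_mat A"

lemma minv_mult:
 assumes A: "A : sq_mat n" "det A ~= 0"
 shows "A * minv A = 1\<^sub>m n" "minv A * A = 1\<^sub>m n" "minv A : sq_mat n"
proof -
 have *: "(1 / det A) \<cdot> (det A \<cdot> 1\<^sub>m n) = 1\<^sub>m n"
  using A(2) by (intro eq_matI) auto
 show "A * minv A = 1\<^sub>m n" "minv A * A = 1\<^sub>m n" "minv A : sq_mat n"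
  using adj_mat[OF A(1)] A * unfolding minv_def
  by (simp_all add: mult_smult_distrib[of _ n n _ n] mult_smult_assoc_mat[of _ n n _ n])
qed

lemma GL_iff_det: "A : GL n \<longleftrightarrow> A : sq_mat n & det A ~= 0"
proof
 assume "A : GL n"
 hence A: "A : sq_mat n" and "invertible_mat A" by auto
 then obtain B where B: "inverts_mat A B" "inverts_mat B A" unfolding invertible_mat_def by blast
 have "B : sq_mat n"
  using A B unfolding inverts_mat_def
  by (metis carrier_matD carrier_matI index_mult_mat(2,3) index_one_mat(2,3))
 hence "det A * det B = 1" using A B by (metis det_mult det_one inverts_mat_def carrier_matD(1))
 thus "A : sq_mat n & det A ~= 0" using A by auto
next
 assume A: "A : sq_mat n & det A ~= 0"
 have "inverts_mat A (minv A)" "inverts_mat (minv A) A"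
  using A minv_mult[of A n] unfolding inverts_mat_def by auto
 thus "A : GL n" using A unfolding invertible_mat_def by auto
qed

lemma minv:
 assumes "A : GL n"
 shows "minv A : GL n" "A * minv A = 1\<^sub>m n" "minv A * A = 1\<^sub>m n" "minv A : sq_mat n"
proof -
 have A: "A : sq_mat n" "det A ~= 0" using assms GL_iff_det by auto
 show i: "A * minv A = 1\<^sub>m n" "minv A * A = 1\<^sub>m n" and c: "minv A : sq_mat n"
  using minv_mult[OF A] by auto
 have "det A * det (minv A) = 1" using det_mult[OF A(1) c] i by simp
 thus "minv A : GL n" using c GL_iff_det by force
qed

lemma GL_mult: "A : GL n ==> B : GL n ==> A * B : GL n"
 unfolding GL_iff_det by (auto simp: det_mult)

lemma GL_one: "1\<^sub>m n : GL n" using GL_iff_det[of "1\<^sub>m n" n] by simp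

lemma GL_cancel:
 assumes "A : GL n" "B : sq_mat n"
 shows "minv A * (A * B) = B" "A * (minv A * B) = B"
proof -
 have A: "A : sq_mat n" using assms by blast
 have "minv A * (A * B) = (minv A * A) * B"
  using assoc_mult_mat[OF minv(4)[OF assms(1)] A assms(2)] by simp
 thus "minv A * (A * B) = B" using minv(3)[OF assms(1)] assms(2) by simp
 have "A * (minv A * B) = (A * minv A) * B"
  using assoc_mult_mat[OF A minv(4)[OF assms(1)] assms(2)] by simp
 thus "A * (minv A * B) = B" using minv(2)[OF assms(1)] assms(2) by simp
qed

lemma GL_I:
 assumes "A : sq_mat n" "B : sq_mat n" "A * B = 1\<^sub>m n"
 shows "A : GL n" "B : GL n" "minv A = B"
proof -
 have "det A * det B = 1" using det_mult[OF assms(1,2)] assms(3) by simp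
 thus G: "A : GL n" "B : GL n" using assms GL_iff_det by force+
 have "minv A * (A * B) = B" using GL_cancel(1)[OF G(1) assms(2)] .
 thus "minv A = B" using minv(4)[OF G(1)] assms(3) by simp
qed

lemma det_holomorphic:
 assumes "mat_hol n G U" "!!w. w : U ==> G w : sq_mat n"
 shows "(%w. det (G w)) hol U"
proof -
 have "(%w. SUM p:{p. p permutes {0..<n}}. signof p * (\<Prod>i = 0..<n. G w $$ (i, p i))) hol U"
 proof (intro holomorphic_intros)
  fix p i assume "p : {p. p permutes {0..<n}}" "i : {0..<n}"
  hence "i < n" "p i < n" using permutes_in_image[of p "{0..<n}" i] by auto
  thus "(%w. G w $$ (i, p i)) hol U" using assms(1) unfolding mat_holomorphic_on_def by blast
 qed
 thus ?thesis by (rule holomorphic_transform) (simp add: det_def'[OF assms(2)])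
qed

lemma minv_holomorphic:
 assumes G: "mat_hol n G U" "!!w. w : U ==> G w : GL n"
 shows "mat_hol n (%w. minv (G w)) U"
 unfolding mat_holomorphic_on_def
proof (intro allI impI)
 fix i j assume ij: "i < n" "j < n"
 have c: "!!w. w : U ==> G w : sq_mat n" using G by blast
 have "mat_hol (n - 1) (%w. mat_delete (G w) j i) U"
  unfolding mat_holomorphic_on_def
 proof (intro allI impI)
  fix k l assume kl: "k < n - 1" "l < n - 1"
  define k' l' where kl': "k' = (if k < j then k else Suc k)" "l' = (if l < i then l else Suc l)"
  have "k' < n" "l' < n" using kl by (auto simp: kl')
  hence "(%w. G w $$ (k', l')) hol U"
   using G(1) unfolding mat_holomorphic_on_def by blast
  thus "(%w. mat_delete (G w) j i $$ (k, l)) hol U"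
  proof (rule holomorphic_transform)
   fix w assume "w : U"
   hence "dim_row (G w) = n" "dim_col (G w) = n" using c[of w] by auto
   thus "G w $$ (k', l') = mat_delete (G w) j i $$ (k, l)"
    using kl by (simp add: mat_delete_def kl')
  qed
 qed
 moreover have "mat_delete (G w) j i : carrier_mat (n - 1) (n - 1)" if "w : U" for w
  using mat_delete_carrier[OF c[OF that]] .
 ultimately have "(%w. det (mat_delete (G w) j i)) hol U" by (rule det_holomorphic)
 hence "(%w. (1 / det (G w)) * ((-1) ^ (j + i) * det (mat_delete (G w) j i))) hol U"
 proof (intro holomorphic_on_mult holomorphic_on_divide holomorphic_on_const)
  show "(%w. det (G w)) hol U" using G(1) c by (rule det_holomorphic)
  show "det (G w) ~= 0" if "w : U" for w using G(2)[OF that] unfolding GL_iff_det by blast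
 qed
 thus "(%w. minv (G w) $$ (i, j)) hol U"
 proof (rule holomorphic_transform)
  fix w assume "w : U"
  hence d: "dim_row (G w) = n" "dim_col (G w) = n" using c[of w] by auto
  show "1 / det (G w) * ((- 1) ^ (j + i) * det (mat_delete (G w) j i)) = minv (G w) $$ (i, j)"
   using d ij by (simp add: minv_def adj_mat_def cofactor_def)
 qed
qed

lemma mult_entry_deriv:
 assumes c: "G w : sq_mat n" "H w : sq_mat n" "G' : sq_mat n" "H' : sq_mat n"
  and G: "!!i j. i < n ==> j < n ==> ((%w. G w $$ (i,j)) hfd G' $$ (i,j)) (at w)"
  and H: "!!i j. i < n ==> j < n ==> ((%w. H w $$ (i,j)) hfd H' $$ (i,j)) (at w)"
  and ij: "i < n" "j < n"
 shows "((%w. \<Sum>k<n. G w $$ (i,k) * H w $$ (k,j)) hfd (G' * H w + G w * H') $$ (i,j)) (at w)"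
proof -
 have "((%w. \<Sum>k<n. G w $$ (i,k) * H w $$ (k,j)) hfd
   (\<Sum>k<n. G' $$ (i,k) * H w $$ (k,j) + H' $$ (k,j) * G w $$ (i,k))) (at w)"
  using ij by (intro DERIV_sum DERIV_mult G H) auto
 also have "(\<Sum>k<n. G' $$ (i,k) * H w $$ (k,j) + H' $$ (k,j) * G w $$ (i,k)) = (G' * H w) $$ (i,j) + (G w * H') $$ (i,j)"
  unfolding sum.distrib mult_mat_entry[OF c(3,2) ij] mult_mat_entry[OF c(1,4) ij]
  by (simp add: mult.commute)
 also have "... = (G' * H w + G w * H') $$ (i,j)" using c ij by simp
 finally show ?thesis .
qed

text \<open>The derivative of \<open>G\<close> is \<open>B1 * G - G * B2\<close>: an intertwiner of
  two linear systems. With \<open>B2\<close> zero this is an ordinary linear system. The two-sided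
  form is closed under products and, with the roles exchanged, under inverses, which covers gauge
  changes and the comparison of solutions alike.\<close>

definition mat_ode ::
  "nat => complex set => (complex => complex mat) => (complex => complex mat) => (complex => complex mat) => bool" where
 "mat_ode n U B1 B2 G \<longleftrightarrow> (ALL w:U. B1 w : sq_mat n & B2 w : sq_mat n & G w : sq_mat n &
   (ALL i<n. ALL j<n. ((%w. G w $$ (i,j)) hfd (B1 w * G w - G w * B2 w) $$ (i,j)) (at w)))"

lemma mat_odeD:
 assumes "mat_ode n U B1 B2 G" "w : U"
 shows "B1 w : sq_mat n" "B2 w : sq_mat n" "G w : sq_mat n"
  "i < n ==> j < n ==> ((%w. G w $$ (i,j)) hfd (B1 w * G w - G w * B2 w) $$ (i,j)) (at w)"
 using assms unfolding mat_ode_def by auto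

lemma mat_ode_holomorphic: "mat_ode n U B1 B2 G ==> open U ==> mat_hol n G U"
 unfolding mat_holomorphic_on_def mat_ode_def
 by (metis field_differentiable_def holomorphic_on_def field_differentiable_at_within)

lemma mat_ode_cong:
 assumes "mat_ode n U B1 B2 G" "open U" "!!w. w : U ==> B1 w = B1' w" "!!w. w : U ==> B2 w = B2' w"
  "!!w. w : U ==> G w = G' w"
 shows "mat_ode n U B1' B2' G'"
 unfolding mat_ode_def
proof (intro ballI conjI allI impI)
 fix w i j assume w: "w : U" and ij: "i < n" "j < n"
 show "((%w. G' w $$ (i,j)) hfd (B1' w * G' w - G' w * B2' w) $$ (i,j)) (at w)"
  using mat_odeD(4)[OF assms(1) w ij] assms(3-5)[OF w]
   has_field_derivative_transform_within_open[OF _ assms(2) w, of "%w. G w $$ (i,j)" _ "%w. G' w $$ (i,j)"] assms(5)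
  by simp
qed (use assms in "auto simp: mat_ode_def")

lemma mat_ode_const:
 assumes "B1 : sq_mat n" "B2 : sq_mat n" "C : sq_mat n" "B1 * C = C * B2"
 shows "mat_ode n U (%_. B1) (%_. B2) (%_. C)"
 unfolding mat_ode_def using assms by auto

lemma mat_ode_const0: "C : sq_mat n ==> mat_ode n U (%_. zmat n) (%_. zmat n) (%_. C)"
 by (rule mat_ode_const) auto

text \<open>In the product rule the two terms containing \<open>B2\<close> cancel.\<close>

lemma mat_ode_mult:
 assumes G: "mat_ode n U B1 B2 G" and H: "mat_ode n U B2 B3 H" and U: "open U"
 shows "mat_ode n U B1 B3 (%w. G w * H w)"
 unfolding mat_ode_def
proof (intro ballI conjI allI impI)
 fix w assume w: "w : U"
 note c = mat_odeD(1-3)[OF G w] mat_odeD(1-3)[OF H w]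
 show "B1 w : sq_mat n" "B3 w : sq_mat n" "G w * H w : sq_mat n"
  using c by auto
 fix i j assume ij: "i < n" "j < n"
 have e: "(B1 w * G w - G w * B2 w) * H w + G w * (B2 w * H w - H w * B3 w)
   = B1 w * (G w * H w) - (G w * H w) * B3 w"
 proof -
  have "G w * (B2 w * H w - H w * B3 w) = G w * (B2 w * H w) - G w * (H w * B3 w)"
   using c by (intro mult_minus_distrib_mat) auto
  moreover have "(B1 w * G w - G w * B2 w) * H w = B1 w * (G w * H w) - G w * (B2 w * H w)"
   using c by (subst minus_mult_distrib_mat[of _ n n]) (auto simp: assoc_mult_mat[of _ n n _ n _ n])
  moreover have "(G w * H w) * B3 w = G w * (H w * B3 w)" using c by (intro assoc_mult_mat) auto
  ultimately show ?thesis using c by (intro eq_matI) auto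
 qed
 have "B1 w * G w - G w * B2 w : sq_mat n" "B2 w * H w - H w * B3 w : sq_mat n"
  using c by auto
 from mult_entry_deriv[OF c(3,6) this mat_odeD(4)[OF G w] mat_odeD(4)[OF H w] ij]
 have "((%w. \<Sum>k<n. G w $$ (i,k) * H w $$ (k,j)) hfd
   (B1 w * (G w * H w) - (G w * H w) * B3 w) $$ (i,j)) (at w)" unfolding e .
 thus "((%w. (G w * H w) $$ (i,j)) hfd
   (B1 w * (G w * H w) - (G w * H w) * B3 w) $$ (i,j)) (at w)"
  by (rule has_field_derivative_transform_within_open[OF _ U w])
   (simp only: mult_mat_entry[OF mat_odeD(3)[OF G] mat_odeD(3)[OF H] ij])
qed

lemma diff_add_eq_0: "(a::complex) - b + c = 0 ==> c = b - a"
 by (metis add.commute eq_neg_iff_add_eq_0 minus_diff_eq)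

text \<open>Differentiability of the inverse comes from the adjugate formula; differentiating
  \<open>G * minv G = 1\<close> then determines its derivative \<open>D\<close>.\<close>

lemma mat_ode_minv:
 assumes G: "mat_ode n U B1 B2 G" and U: "open U" and inv: "!!w. w : U ==> G w : GL n"
 shows "mat_ode n U B2 B1 (%w. minv (G w))"
 unfolding mat_ode_def
proof (intro ballI conjI allI impI)
 fix w assume w: "w : U"
 note c = mat_odeD(1-3)[OF G w] minv[OF inv[OF w]]
 show "B2 w : sq_mat n" "B1 w : sq_mat n" "minv (G w) : sq_mat n"
  using c by auto
 define D where "D = Matrix.mat n n (%(i,j). deriv (%w. minv (G w) $$ (i,j)) w)"
 have Dc: "D : sq_mat n" by (simp add: D_def)
 have hol: "mat_hol n (%w. minv (G w)) U"
  using minv_holomorphic[OF mat_ode_holomorphic[OF G U] inv] by blast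
 have d: "((%w. minv (G w) $$ (i,j)) hfd D $$ (i,j)) (at w)" if "i < n" "j < n" for i j
  using hol that U w unfolding mat_holomorphic_on_def D_def by (auto intro!: holomorphic_derivI)
 have Gc: "B1 w * G w - G w * B2 w : sq_mat n" using c by auto
 have z: "((B1 w * G w - G w * B2 w) * minv (G w) + G w * D) $$ (i,j) = 0" if ij: "i < n" "j < n" for i j
 proof -
  have "((%w. \<Sum>k<n. G w $$ (i,k) * minv (G w) $$ (k,j)) hfd
   ((B1 w * G w - G w * B2 w) * minv (G w) + G w * D) $$ (i,j)) (at w)"
   by (rule mult_entry_deriv[OF c(3,7) Gc Dc mat_odeD(4)[OF G w] d ij])
  moreover have "((%w. \<Sum>k<n. G w $$ (i,k) * minv (G w) $$ (k,j)) hfd 0) (at w)"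
  proof (rule has_field_derivative_transform_within_open[OF _ U w])
   show "((%w. 1\<^sub>m n $$ (i,j) :: complex) hfd 0) (at w)" by simp
   show "1\<^sub>m n $$ (i,j) = (\<Sum>k<n. G w $$ (i,k) * minv (G w) $$ (k,j))" if "w : U" for w
    using mult_mat_entry[OF mat_odeD(3)[OF G that] minv(4)[OF inv[OF that]] ij] minv(2)[OF inv[OF that]] by simp
  qed
  ultimately show ?thesis using DERIV_unique by blast
 qed
 have "(B1 w * G w - G w * B2 w) * minv (G w) + G w * D = zmat n"
 proof (rule eq_matI)
  fix i j assume "i < dim_row (zmat n :: complex mat)" "j < dim_col (zmat n :: complex mat)"
  thus "((B1 w * G w - G w * B2 w) * minv (G w) + G w * D) $$ (i,j) = zmat n $$ (i,j)"
   using z[of i j] by simp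
 qed (use c Dc in auto)
 moreover have "(B1 w * G w - G w * B2 w) * minv (G w) = B1 w - G w * (B2 w * minv (G w))"
  using c by (subst minus_mult_distrib_mat[of _ n n]) (auto simp: assoc_mult_mat[of _ n n _ n _ n])
 ultimately have e: "B1 w - G w * (B2 w * minv (G w)) + G w * D = zmat n" by simp
 have "G w * D = G w * (B2 w * minv (G w)) - B1 w"
 proof (rule eq_matI)
  fix i j assume ij: "i < dim_row (G w * (B2 w * minv (G w)) - B1 w)" "j < dim_col (G w * (B2 w * minv (G w)) - B1 w)"
  hence ij: "i < n" "j < n" using c by auto
  have "(B1 w - G w * (B2 w * minv (G w)) + G w * D) $$ (i,j) = 0" unfolding e using ij by simp
  moreover have "(B1 w - G w * (B2 w * minv (G w)) + G w * D) $$ (i,j)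
    = B1 w $$ (i,j) - (G w * (B2 w * minv (G w))) $$ (i,j) + (G w * D) $$ (i,j)"
   using ij c Dc by (simp del: index_mult_mat(1))
  moreover have "(G w * (B2 w * minv (G w)) - B1 w) $$ (i,j) = (G w * (B2 w * minv (G w))) $$ (i,j) - B1 w $$ (i,j)"
   using ij c Dc by (simp del: index_mult_mat(1))
  ultimately show "(G w * D) $$ (i,j) = (G w * (B2 w * minv (G w)) - B1 w) $$ (i,j)"
   using diff_add_eq_0 by presburger
 qed (use c Dc in auto)
 hence "minv (G w) * (G w * D) = minv (G w) * (G w * (B2 w * minv (G w)) - B1 w)" by simp
 also have "... = minv (G w) * (G w * (B2 w * minv (G w))) - minv (G w) * B1 w"
  using c by (intro mult_minus_distrib_mat) auto
 also have "minv (G w) * (G w * (B2 w * minv (G w))) = B2 w * minv (G w)"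
  using GL_cancel(1)[OF inv[OF w], of "B2 w * minv (G w)"] c by simp
 also have "minv (G w) * (G w * D) = D"
  using GL_cancel(1)[OF inv[OF w] Dc] .
 finally have "D = B2 w * minv (G w) - minv (G w) * B1 w" .
 thus "((%w. minv (G w) $$ (i,j)) hfd (B2 w * minv (G w) - minv (G w) * B1 w) $$ (i,j)) (at w)"
  if "i < n" "j < n" for i j using d that by simp
qed

lemma mat_ode_zero_const:
 assumes G: "mat_ode n U (%_. zmat n) (%_. zmat n) G" and U: "open U" "connected U"
 obtains C where "C : sq_mat n" "!!w. w : U ==> G w = C"
proof (cases "U = {}")
 case True
 thus ?thesis using that[of "zmat n"] by auto
next
 case False
 then obtain w0 where w0: "w0 : U" by blast
 have "G w = G w0" if w: "w : U" for w
 proof (rule eq_matI)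
  show "dim_row (G w) = dim_row (G w0)" "dim_col (G w) = dim_col (G w0)"
   using mat_odeD(3)[OF G w] mat_odeD(3)[OF G w0] by auto
  fix i j assume ij: "i < dim_row (G w0)" "j < dim_col (G w0)"
  hence ij: "i < n" "j < n" using mat_odeD(3)[OF G w0] by auto
  have "((%w. G w $$ (i,j)) hfd 0) (at x)" if "x : U" for x
   using mat_odeD(4)[OF G that ij] mat_odeD(3)[OF G that] ij by simp
  note d = this
  have cU: "continuous_on U (%w. G w $$ (i,j))"
   using d by (intro continuous_at_imp_continuous_on ballI DERIV_isCont) blast
  obtain c where "!!x. x : U ==> G x $$ (i,j) = c"
   by (rule DERIV_zero_connected_constant[OF U(2,1) finite.emptyI cU]) (use d in auto)
  thus "G w $$ (i,j) = G w0 $$ (i,j)" using w w0 by simp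
 qed
 thus ?thesis using that[of "G w0"] mat_odeD(3)[OF G w0] by blast
qed

text \<open>\<open>minv Y * Y'\<close> intertwines the zero system with itself, so its derivative
  vanishes on a connected set.\<close>

lemma solutions_differ_by_constant:
 assumes Y: "mat_ode n U B (%_. zmat n) Y" "mat_ode n U B (%_. zmat n) Y'"
  and U: "open U" "connected U" "U ~= {}" and inv: "!!w. w : U ==> Y w : GL n" "!!w. w : U ==> Y' w : GL n"
 obtains C where "C : GL n" "!!w. w : U ==> Y' w = Y w * C"
proof -
 have "mat_ode n U (%_. zmat n) (%_. zmat n) (%w. minv (Y w) * Y' w)"
  using mat_ode_mult[OF mat_ode_minv[OF Y(1) U(1) inv(1)] Y(2) U(1)] by blast
 then obtain C where C: "C : sq_mat n" "!!w. w : U ==> minv (Y w) * Y' w = C"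
  using mat_ode_zero_const[OF _ U(1,2)] by blast
 obtain w where "w : U" using U(3) by blast
 hence "C : GL n" using C(2)[of w] GL_mult[OF minv(1)[OF inv(1)] inv(2)] by metis
 moreover have "Y' w = Y w * C" if w: "w : U" for w
  unfolding C(2)[OF w, symmetric] using GL_cancel(2)[OF inv(1)[OF w] mat_odeD(3)[OF Y(2) w]] by simp
 ultimately show thesis using that by blast
qed


section \<open>The matrix exponential\<close>

lemma smult_pow_mat:
 assumes "(E :: complex mat) : sq_mat n"
 shows "(c \<cdot> E) ^\<^sub>m k = c ^ k \<cdot> (E ^\<^sub>m k)"
proof (induction k)
 case (Suc k)
 have "(c \<cdot> E) ^\<^sub>m Suc k = (c ^ k \<cdot> (E ^\<^sub>m k)) * (c \<cdot> E)" using Suc by simp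
 also have "... = c \<cdot> (c ^ k \<cdot> (E ^\<^sub>m k * E))"
  using assms by (simp add: mult_smult_assoc_mat[of _ n n _ n] mult_smult_distrib[of _ n n _ n])
 also have "... = c ^ Suc k \<cdot> (E ^\<^sub>m Suc k)" by (intro eq_matI) (auto simp: mult.assoc mult.left_commute)
 finally show ?case .
qed (use assms in auto)

text \<open>If \<open>be\<close> bounds all entries, each further factor sums \<open>n\<close>
  products, whence the base \<open>n * be\<close>.\<close>

lemma pow_mat_entry_bound:
 fixes E :: "complex mat"
 assumes E: "E : sq_mat n"
 obtains b where "b >= 0" "!!k i j. i < n ==> j < n ==> norm ((E ^\<^sub>m k) $$ (i,j)) <= b ^ k"
proof -
 define be where "be = (\<Sum>i<n. \<Sum>j<n. norm (E $$ (i,j)))"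
 have be: "norm (E $$ (i,j)) <= be" if "i < n" "j < n" for i j
 proof -
  have "norm (E $$ (i,j)) <= (\<Sum>j<n. norm (E $$ (i,j)))" using that by (intro member_le_sum) auto
  also have "... <= be" unfolding be_def using that
   by (intro member_le_sum[of i _ "%i. \<Sum>j<n. norm (E $$ (i,j))"]) (auto intro: sum_nonneg)
  finally show ?thesis .
 qed
 have be0: "be >= 0" unfolding be_def by (intro sum_nonneg) auto
 have "norm ((E ^\<^sub>m k) $$ (i,j)) <= (real n * be) ^ k" if "i < n" "j < n" for k i j
  using that
 proof (induction k arbitrary: i j)
  case (Suc k)
  have "(E ^\<^sub>m Suc k) $$ (i,j) = (\<Sum>l<n. (E ^\<^sub>m k) $$ (i,l) * E $$ (l,j))"
   using mult_mat_entry[of "E ^\<^sub>m k" n E i j] Suc.prems E by simp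
  also have "norm ... <= (\<Sum>l<n. (real n * be) ^ k * be)"
   unfolding norm_mult[symmetric]
   by (rule sum_norm_le) (use Suc be be0 in "auto simp: norm_mult intro!: mult_mono")
  also have "... = (real n * be) ^ Suc k" by simp
  finally show ?case .
 qed (use E in "auto simp: one_mat_def")
 thus thesis using be0 by (intro that[of "real n * be"]) auto
qed

lemma mat_exp_carrier [simp]: "mat_exp n A : sq_mat n"
 by (simp add: mat_exp_def)

lemma mat_exp_dim [simp]: "dim_row (mat_exp n A) = n" "dim_col (mat_exp n A) = n"
 by (simp_all add: mat_exp_def)

lemma mat_exp_entry:
 assumes "E : sq_mat n" "i < n" "j < n"
 shows "mat_exp n (w \<cdot> E) $$ (i,j) = (\<Sum>k. (E ^\<^sub>m k) $$ (i,j) / fact k * w ^ k)"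
proof -
 have "((w \<cdot> E) ^\<^sub>m k) $$ (i,j) = w ^ k * (E ^\<^sub>m k) $$ (i,j)" for k
  using assms by (subst smult_pow_mat[of _ n]) auto
 thus ?thesis using assms by (simp add: mat_exp_def mult.commute)
qed

lemma mat_exp_summable:
 assumes E: "E : sq_mat n" "i < n" "j < n"
 shows "summable (%k. (E ^\<^sub>m k) $$ (i,j) / fact k * (w :: complex) ^ k)"
proof -
 obtain b where b: "b >= 0" "!!k i j. i < n ==> j < n ==> norm ((E ^\<^sub>m k) $$ (i,j)) <= b ^ k"
  by (rule pow_mat_entry_bound[OF E(1)]) blast
 have "summable (%k. (b * norm w) ^ k / fact k)"
  using summable_exp[of "b * norm w"] by (simp add: field_simps)
 thus ?thesis
 proof (rule summable_comparison_test'[where N=0])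
  fix k
  have "norm ((E ^\<^sub>m k) $$ (i,j) / fact k * w ^ k) = norm ((E ^\<^sub>m k) $$ (i,j)) * norm w ^ k / fact k"
   by (simp add: norm_mult norm_divide norm_power)
  also have "... <= b ^ k * norm w ^ k / fact k"
   using b(2)[OF E(2,3), of k] by (intro divide_right_mono mult_right_mono) auto
  finally show "norm ((E ^\<^sub>m k) $$ (i,j) / fact k * w ^ k) <= (b * norm w) ^ k / fact k"
   by (simp add: power_mult_distrib)
 qed
qed

lemma mat_exp_commute:
 assumes E: "E : sq_mat n"
 shows "E * mat_exp n (w \<cdot> E) = mat_exp n (w \<cdot> E) * E"
proof (rule eq_matI)
 fix i j assume "i < dim_row (mat_exp n (w \<cdot> E) * E)" "j < dim_col (mat_exp n (w \<cdot> E) * E)"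
 hence ij: "i < n" "j < n" using E by auto
 have pc: "E * E ^\<^sub>m k = E ^\<^sub>m k * E" for k
 proof (induction k)
  case (Suc k)
  have "E * E ^\<^sub>m Suc k = (E * E ^\<^sub>m k) * E" using E by (simp add: assoc_mult_mat[of _ n n _ n _ n])
  thus ?case using Suc by simp
 qed (use E in auto)
 have "(E * mat_exp n (w \<cdot> E)) $$ (i,j) = (\<Sum>l<n. E $$ (i,l) * (\<Sum>k. (E ^\<^sub>m k) $$ (l,j) / fact k * w ^ k))"
  unfolding mult_mat_entry[OF E mat_exp_carrier ij] using mat_exp_entry[OF E _ ij(2)] by simp
 also have "... = (\<Sum>l<n. \<Sum>k. E $$ (i,l) * ((E ^\<^sub>m k) $$ (l,j) / fact k * w ^ k))"
  using mat_exp_summable[OF E _ ij(2)] by (intro sum.cong refl suminf_mult[symmetric]) auto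
 also have "... = (\<Sum>k. \<Sum>l<n. E $$ (i,l) * ((E ^\<^sub>m k) $$ (l,j) / fact k * w ^ k))"
  using mat_exp_summable[OF E _ ij(2)] by (intro suminf_sum[symmetric] summable_mult) auto
 also have "... = (\<Sum>k. \<Sum>l<n. ((E ^\<^sub>m k) $$ (i,l) / fact k * w ^ k) * E $$ (l,j))"
 proof (rule suminf_cong)
  fix k
  have "(\<Sum>l<n. E $$ (i,l) * ((E ^\<^sub>m k) $$ (l,j) / fact k * w ^ k)) = (\<Sum>l<n. E $$ (i,l) * (E ^\<^sub>m k) $$ (l,j)) * (w ^ k / fact k)"
   by (simp add: sum_distrib_left sum_distrib_right sum_divide_distrib mult_ac)
  also have "(\<Sum>l<n. E $$ (i,l) * (E ^\<^sub>m k) $$ (l,j)) = (E * E ^\<^sub>m k) $$ (i,j)"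
   using mult_mat_entry[OF E _ ij] E by simp
  also have "... = (\<Sum>l<n. (E ^\<^sub>m k) $$ (i,l) * E $$ (l,j))"
   unfolding pc using mult_mat_entry[OF _ E ij] E by simp
  finally show "(\<Sum>l<n. E $$ (i,l) * ((E ^\<^sub>m k) $$ (l,j) / fact k * w ^ k))
    = (\<Sum>l<n. ((E ^\<^sub>m k) $$ (i,l) / fact k * w ^ k) * E $$ (l,j))"
   by (simp add: sum_distrib_left sum_distrib_right sum_divide_distrib mult_ac)
 qed
 also have "... = (\<Sum>l<n. \<Sum>k. ((E ^\<^sub>m k) $$ (i,l) / fact k * w ^ k) * E $$ (l,j))"
  using mat_exp_summable[OF E ij(1)] by (intro suminf_sum summable_mult2) auto
 also have "... = (\<Sum>l<n. (\<Sum>k. (E ^\<^sub>m k) $$ (i,l) / fact k * w ^ k) * E $$ (l,j))"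
  using mat_exp_summable[OF E ij(1)] by (intro sum.cong refl suminf_mult2[symmetric]) auto
 also have "... = (mat_exp n (w \<cdot> E) * E) $$ (i,j)"
  unfolding mult_mat_entry[OF mat_exp_carrier E ij] using mat_exp_entry[OF E ij(1)] by simp
 finally show "(E * mat_exp n (w \<cdot> E)) $$ (i,j) = (mat_exp n (w \<cdot> E) * E) $$ (i,j)" .
qed (use E in auto)

lemma mat_exp_deriv:
 assumes E: "E : sq_mat n" and ij: "i < n" "j < n"
 shows "((%w. mat_exp n (w \<cdot> E) $$ (i,j)) hfd (mat_exp n (w \<cdot> E) * E) $$ (i,j)) (at w)"
proof -
 have "((%w. \<Sum>k. (E ^\<^sub>m k) $$ (i,j) / fact k * w ^ k) hfd
   (\<Sum>k. diffs (%k. (E ^\<^sub>m k) $$ (i,j) / fact k) k * w ^ k)) (at w)"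
  by (rule termdiffs_strong_converges_everywhere) (rule mat_exp_summable[OF assms])
 moreover have "diffs (%k. (E ^\<^sub>m k) $$ (i,j) / fact k) k * w ^ k
   = (\<Sum>l<n. ((E ^\<^sub>m k) $$ (i,l) / fact k * w ^ k) * E $$ (l,j))" for k
 proof -
  have "diffs (%k. (E ^\<^sub>m k) $$ (i,j) / fact k) k * w ^ k = (E ^\<^sub>m k * E) $$ (i,j) / fact k * w ^ k"
  proof -
   have "(of_nat (Suc k) :: complex) ~= 0" by (simp only: of_nat_eq_0_iff)
   thus ?thesis by (simp add: diffs_def field_simps del: of_nat_Suc index_mult_mat(1))
  qed
  thus ?thesis using mult_mat_entry[OF _ E ij, of "E ^\<^sub>m k"] E
   by (simp add: sum_distrib_left sum_distrib_right sum_divide_distrib mult_ac)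
 qed
 moreover have "(\<Sum>k. \<Sum>l<n. ((E ^\<^sub>m k) $$ (i,l) / fact k * w ^ k) * E $$ (l,j)) = (mat_exp n (w \<cdot> E) * E) $$ (i,j)"
 proof -
  have "(\<Sum>k. \<Sum>l<n. ((E ^\<^sub>m k) $$ (i,l) / fact k * w ^ k) * E $$ (l,j)) = (\<Sum>l<n. \<Sum>k. ((E ^\<^sub>m k) $$ (i,l) / fact k * w ^ k) * E $$ (l,j))"
   using mat_exp_summable[OF E ij(1)] by (intro suminf_sum summable_mult2) auto
  also have "... = (\<Sum>l<n. (\<Sum>k. (E ^\<^sub>m k) $$ (i,l) / fact k * w ^ k) * E $$ (l,j))"
   using mat_exp_summable[OF E ij(1)] by (intro sum.cong refl suminf_mult2[symmetric]) auto
  also have "... = (mat_exp n (w \<cdot> E) * E) $$ (i,j)"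
   unfolding mult_mat_entry[OF mat_exp_carrier E ij] using mat_exp_entry[OF E ij(1)] by simp
  finally show ?thesis .
 qed
 ultimately show ?thesis using mat_exp_entry[OF assms] by simp
qed

lemma mat_exp_ode:
 assumes E: "E : sq_mat n"
 shows "mat_ode n U (%_. E) (%_. zmat n) (%w. mat_exp n (w \<cdot> E))"
 unfolding mat_ode_def
proof (intro ballI conjI allI impI)
 fix w i j assume ij: "i < n" "j < n"
 have "E * mat_exp n (w \<cdot> E) - mat_exp n (w \<cdot> E) * zmat n = mat_exp n (w \<cdot> E) * E"
  using E by (subst mat_exp_commute[OF E]) auto
 thus "((%w. mat_exp n (w \<cdot> E) $$ (i,j)) hfd
   (E * mat_exp n (w \<cdot> E) - mat_exp n (w \<cdot> E) * zmat n) $$ (i,j)) (at w)"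
  using mat_exp_deriv[OF E ij] by simp
qed (use E in auto)

lemma mat_exp_neg_ode:
 assumes E: "E : sq_mat n"
 shows "mat_ode n U (%_. zmat n) (%_. E) (%w. mat_exp n ((- w) \<cdot> E))"
 unfolding mat_ode_def
proof (intro ballI conjI allI impI)
 fix w i j assume ij: "i < n" "j < n"
 have "((%w. mat_exp n ((- w) \<cdot> E) $$ (i,j)) hfd (mat_exp n ((- w) \<cdot> E) * E) $$ (i,j) * (-1)) (at w)"
  by (rule DERIV_chain2[where f="%w. mat_exp n (w \<cdot> E) $$ (i,j)"]) (use mat_exp_deriv[OF E ij] in "auto intro!: derivative_eq_intros")
 moreover have "(zmat n * mat_exp n ((- w) \<cdot> E) - mat_exp n ((- w) \<cdot> E) * E) $$ (i,j) = (mat_exp n ((- w) \<cdot> E) * E) $$ (i,j) * (-1)"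
  using E ij mat_exp_carrier[of n "(- w) \<cdot> E"] by (simp del: mat_exp_carrier)
 ultimately show "((%w. mat_exp n ((- w) \<cdot> E) $$ (i,j)) hfd
   (zmat n * mat_exp n ((- w) \<cdot> E) - mat_exp n ((- w) \<cdot> E) * E) $$ (i,j)) (at w)" by simp
qed (use E in auto)

lemma mat_exp_zero:
 assumes E: "E : sq_mat n"
 shows "mat_exp n (0 \<cdot> E) = 1\<^sub>m n"
proof (rule eq_matI)
 fix i j assume "i < dim_row (1\<^sub>m n :: complex mat)" "j < dim_col (1\<^sub>m n :: complex mat)"
 hence ij: "i < n" "j < n" by auto
 show "mat_exp n (0 \<cdot> E) $$ (i,j) = 1\<^sub>m n $$ (i,j)"
  unfolding mat_exp_entry[OF E ij] powser_zero using E ij by simp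
qed auto

text \<open>The left side has zero derivative in \<open>w\<close>, because its factors intertwine
  the zero system with \<open>E\<close> and \<open>E\<close> with the zero system; its value at
  \<open>w = 0\<close> is the right side. Inverses and the addition law follow from this one
  identity.\<close>

lemma mat_exp_add:
 assumes E: "E : sq_mat n"
 shows "mat_exp n ((- w) \<cdot> E) * mat_exp n ((w + u) \<cdot> E) = mat_exp n (u \<cdot> E)"
proof -
 have "mat_ode n UNIV (%_. E) (%_. zmat n) (%w. mat_exp n ((w + u) \<cdot> E))"
  unfolding mat_ode_def
 proof (intro ballI conjI allI impI)
  fix w i j assume ij: "i < n" "j < n"
  have "((%w. mat_exp n (w \<cdot> E) $$ (i,j)) hfd
   (E * mat_exp n ((w + u) \<cdot> E) - mat_exp n ((w + u) \<cdot> E) * zmat n) $$ (i,j)) (at (w + u))"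
   using mat_odeD(4)[OF mat_exp_ode[OF E, of UNIV] _ ij, of "w + u"] by simp
  thus "((%w. mat_exp n ((w + u) \<cdot> E) $$ (i,j)) hfd
   (E * mat_exp n ((w + u) \<cdot> E) - mat_exp n ((w + u) \<cdot> E) * zmat n) $$ (i,j)) (at w)"
   by (simp only: DERIV_shift)
 qed (use E in auto)
 from mat_ode_mult[OF mat_exp_neg_ode[OF E] this open_UNIV]
 obtain C where C: "!!w. w : UNIV ==> mat_exp n ((- w) \<cdot> E) * mat_exp n ((w + u) \<cdot> E) = C"
  by (rule mat_ode_zero_const[OF _ open_UNIV connected_UNIV]) blast
 have "C = mat_exp n (u \<cdot> E)" using C[of 0] mat_exp_zero[OF E] by simp
 thus ?thesis using C by simp
qed

lemma mat_exp_GL: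
 assumes E: "E : sq_mat n"
 shows "mat_exp n (w \<cdot> E) : GL n" "minv (mat_exp n (w \<cdot> E)) = mat_exp n ((- w) \<cdot> E)"
proof -
 have "mat_exp n (w \<cdot> E) * mat_exp n ((- w) \<cdot> E) = 1\<^sub>m n"
  using mat_exp_add[OF E, of "- w" 0] mat_exp_zero[OF E] by simp
 thus "mat_exp n (w \<cdot> E) : GL n" "minv (mat_exp n (w \<cdot> E)) = mat_exp n ((- w) \<cdot> E)"
  using GL_I[OF mat_exp_carrier mat_exp_carrier] by auto
qed

lemma mat_exp_sum:
 assumes E: "E : sq_mat n"
 shows "mat_exp n ((w + u) \<cdot> E) = mat_exp n (w \<cdot> E) * mat_exp n (u \<cdot> E)"
 using GL_cancel(2)[OF mat_exp_GL(1)[OF E, of w] mat_exp_carrier[of n "(w + u) \<cdot> E"]]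
 unfolding mat_exp_GL(2)[OF E] mat_exp_add[OF E] by simp


section \<open>Periodic solutions\<close>

text \<open>For \<open>l = 0\<close> the solution is affine in \<open>w\<close>, and periodicity
  kills the slope \<open>d\<close>. Otherwise the homogeneous part is a multiple of
  \<open>exp (l * w)\<close>, which has period \<open>tpi\<close> only for integral
  \<open>l\<close>.\<close>

lemma periodic_affine_ode_const:
 fixes f :: "complex => complex"
 assumes f: "!!w. Re w < c ==> (f hfd l * f w + d) (at w)"
  and per: "!!w. Re w < c ==> f (w + tpi) = f w"
  and l: "l : \<int> ==> l = 0"
 shows "EX k. ALL w. Re w < c --> f w = k"
proof -
 let ?U = "{w. Re w < c}"
 have U: "open ?U" "connected ?U" using open_halfspace_Re_lt convex_halfspace_Re_lt convex_connected by blast+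
 have const: "EX k. ALL w. Re w < c --> g w = k"
  if g: "!!w. Re w < c ==> (g hfd 0) (at w)" for g :: "complex => complex"
 proof -
  have cU: "continuous_on ?U g"
   using g by (intro continuous_at_imp_continuous_on ballI DERIV_isCont) blast
  obtain k where "!!x. x : ?U ==> g x = k"
   by (rule DERIV_zero_connected_constant[OF U(2,1) finite.emptyI cU]) (use g in auto)
  thus ?thesis by auto
 qed
 define w0 :: complex where "w0 = of_real (c - 1)"
 have w0: "Re w0 < c" by (simp add: w0_def)
 have w1: "Re (w0 + tpi) < c" using w0 by simp
 show ?thesis
 proof (cases "l = 0")
  case True
  have "EX k. ALL w. Re w < c --> f w - d * w = k"
   by (rule const) (use f True in "auto intro!: derivative_eq_intros")
  then obtain k where k: "!!w. Re w < c ==> f w - d * w = k" by blast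
  have "d * tpi = 0" using k[OF w0] k[OF w1] per[OF w0] by (simp add: algebra_simps)
  hence "d = 0" by simp
  thus ?thesis using k by auto
 next
  case False
  have "EX k. ALL w. Re w < c --> (f w + d / l) * exp (- (l * w)) = k"
   by (rule const) (use f False in "auto intro!: derivative_eq_intros simp: algebra_simps")
  then obtain k where "!!w. Re w < c ==> (f w + d / l) * exp (- (l * w)) = k" by blast
  hence "(f w + d / l) * exp (- (l * w)) * exp (l * w) = k * exp (l * w)" if "Re w < c" for w using that by simp
  hence k: "f w + d / l = k * exp (l * w)" if "Re w < c" for w using that by (simp add: mult.assoc exp_minus_inverse flip: exp_add)
  have "k * exp (l * (w0 + tpi)) = k * exp (l * w0)"
   using k[OF w0] k[OF w1] per[OF w0] by metis
  hence "k * exp (l * w0) * (exp (l * tpi) - 1) = 0"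
   by (simp add: distrib_left exp_add algebra_simps)
  moreover have "exp (l * tpi) ~= 1"
  proof
   assume "exp (l * tpi) = 1"
   then obtain m :: int where "Re (l * tpi) = 0" "Im (l * tpi) = of_int (2 * m) * pi"
    unfolding exp_eq_1 by blast
   hence "l = of_int m" by (auto simp: complex_eq_iff)
   thus False using l False by auto
  qed
  ultimately have "k = 0" by simp
  thus ?thesis using k by (intro exI[of _ "- (d / l)"]) (auto simp: add_eq_0_iff2)
 qed
qed

lemma Re_less_half_plane: "open {w. Re w < c}" "connected {w. Re w < c}" "{w. Re w < c} ~= {}"
proof -
 show "open {w. Re w < c}" "connected {w. Re w < c}"
  using open_halfspace_Re_lt convex_halfspace_Re_lt convex_connected by blast+
 have "of_real (c - 1) : {w. Re w < c}" by simp
 thus "{w. Re w < c} ~= {}" by blast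
qed

text \<open>For triangular \<open>R\<close> and \<open>E\<close> the entry at \<open>(i, j)\<close>
  couples only to entries below it in its column and to the left of it in its row. The measure
  \<open>(n - i) + j\<close> is smaller for those, so a scalar affine equation remains.\<close>

lemma periodic_triangular:
 assumes F: "mat_ode n {w. Re w < c} (%_. R) (%_. E) F"
  and R: "R : sq_mat n" "upper_triangular R" and E: "E : sq_mat n" "upper_triangular E"
  and per: "!!w. Re w < c ==> F (w + tpi) = F w"
  and nonres: "!!i j. i < n ==> j < n ==> R $$ (i,i) - E $$ (j,j) : \<int> ==> R $$ (i,i) = E $$ (j,j)"
  and ij: "i < n" "j < n"
 shows "EX k. ALL w. Re w < c --> F w $$ (i,j) = k"
 using ij
proof (induction "(n - i) + j" arbitrary: i j rule: less_induct)
 case less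
 have Fc: "F w : sq_mat n" if "Re w < c" for w using mat_odeD(3)[OF F] that by blast
 obtain kc where kc: "!!l w. i < l ==> l < n ==> Re w < c ==> F w $$ (l,j) = kc l"
 proof -
  have "ALL l. EX k. i < l --> l < n --> (ALL w. Re w < c --> F w $$ (l,j) = k)"
   using less.hyps less.prems by (metis add_less_cancel_right diff_less_mono2)
  thus thesis using that by metis
 qed
 obtain kr where kr: "!!l w. l < j ==> Re w < c ==> F w $$ (i,l) = kr l"
 proof -
  have "ALL l. EX k. l < j --> (ALL w. Re w < c --> F w $$ (i,l) = k)"
   using less.hyps less.prems by (metis add_less_cancel_left less_trans)
  thus thesis using that by metis
 qed
 define d where "d = (SUM l:{i<..<n}. R $$ (i,l) * kc l) - (\<Sum>l<j. kr l * E $$ (l,j))"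
 have eq: "(R * F w - F w * E) $$ (i,j) = (R $$ (i,i) - E $$ (j,j)) * F w $$ (i,j) + d" if w: "Re w < c" for w
 proof -
  have "(R * F w) $$ (i,j) = (\<Sum>l<n. R $$ (i,l) * F w $$ (l,j))"
   by (rule mult_mat_entry[OF R(1) Fc[OF w] less.prems])
  also have "... = (SUM l:insert i {i<..<n}. R $$ (i,l) * F w $$ (l,j))"
   using R less.prems by (intro sum.mono_neutral_right) auto
  also have "... = R $$ (i,i) * F w $$ (i,j) + (SUM l:{i<..<n}. R $$ (i,l) * kc l)"
   using kc w by simp
  finally have 1: "(R * F w) $$ (i,j) = R $$ (i,i) * F w $$ (i,j) + (SUM l:{i<..<n}. R $$ (i,l) * kc l)" .
  have "(F w * E) $$ (i,j) = (\<Sum>l<n. F w $$ (i,l) * E $$ (l,j))"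
   by (rule mult_mat_entry[OF Fc[OF w] E(1) less.prems])
  also have "... = (SUM l:insert j {..<j}. F w $$ (i,l) * E $$ (l,j))"
  proof (rule sum.mono_neutral_right)
   have "E $$ (l,j) = 0" if "l < n" "l ~: insert j {..<j}" for l
    using upper_triangularD[OF E(2), of j l] that E(1) by auto
   thus "ALL l:{..<n} - insert j {..<j}. F w $$ (i,l) * E $$ (l,j) = 0" by auto
  qed (use less.prems in auto)
  also have "... = F w $$ (i,j) * E $$ (j,j) + (\<Sum>l<j. kr l * E $$ (l,j))"
   using kr w by simp
  finally have 2: "(F w * E) $$ (i,j) = F w $$ (i,j) * E $$ (j,j) + (\<Sum>l<j. kr l * E $$ (l,j))" .
  have "(R * F w - F w * E) $$ (i,j) = (R * F w) $$ (i,j) - (F w * E) $$ (i,j)"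
   using R E Fc[OF w] less.prems by simp
  thus ?thesis unfolding 1 2 d_def by (simp add: algebra_simps)
 qed
 show ?case
 proof (rule periodic_affine_ode_const)
  fix w assume w: "Re w < c"
  show "((%w. F w $$ (i,j)) hfd (R $$ (i,i) - E $$ (j,j)) * F w $$ (i,j) + d) (at w)"
   using mat_odeD(4)[OF F _ less.prems, of w] w eq[OF w] by simp
  show "F (w + tpi) $$ (i,j) = F w $$ (i,j)" using per[OF w] by simp
 qed (use nonres[OF less.prems] in auto)
qed

lemma upper_triangular_similar:
 assumes A: "(A :: complex mat) : sq_mat n"
 obtains B P Q where "B : sq_mat n" "upper_triangular B" "P : sq_mat n" "Q : sq_mat n"
  "P * Q = 1\<^sub>m n" "Q * P = 1\<^sub>m n" "A * P = P * B" "Q * A = B * Q" "!!i. i < n ==> eigenvalue A (B $$ (i,i))"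
proof -
 obtain as where as: "char_poly A = (\<Prod>a\<leftarrow>as. [:- a, 1:])"
  using char_poly_factorized[OF A] by blast
 obtain B P Q where B: "schur_decomposition A as = (B,P,Q)" by (cases "schur_decomposition A as") auto
 have "similar_mat_wit A B P Q" and ut: "upper_triangular B" and diag: "diag_mat B = as"
  using schur_decomposition[OF A as B] by auto
 note w = similar_mat_witD2[OF A this(1)]
 have c: "B : sq_mat n" "P : sq_mat n" "Q : sq_mat n" using w by auto
 have "A * P = P * B * (Q * P)" using w(3) c by (simp add: assoc_mult_mat[of _ n n _ n _ n])
 hence AP: "A * P = P * B" using w(2) c by simp
 have "Q * A = (Q * P) * (B * Q)" using w(3) c by (simp add: assoc_mult_mat[of _ n n _ n _ n])
 hence QA: "Q * A = B * Q" using w(2) c by simp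
 have "eigenvalue A (B $$ (i,i))" if "i < n" for i
 proof -
  have "B $$ (i,i) : set as" using that c diag[symmetric] by (auto simp: diag_mat_def)
  hence "poly (char_poly A) (B $$ (i,i)) = 0" unfolding as by (induction as) auto
  thus ?thesis using eigenvalue_root_char_poly[OF A] by simp
 qed
 thus thesis using that[OF c(1) ut c(2,3) w(1,2) AP QA] by blast
qed

text \<open>Both matrices are brought to Schur form, whose diagonals consist of eigenvalues, and the
  triangular case applies to the conjugated intertwiner. Every later use of non-resonance goes
  through this statement.\<close>

lemma periodic_nonresonant:
 assumes F: "mat_ode n {w. Re w < c} (%_. R) (%_. E) F"
  and R: "R : sq_mat n" and E: "E : sq_mat n"
  and per: "!!w. Re w < c ==> F (w + tpi) = F w"
  and nonres: "!!x y. eigenvalue R x ==> eigenvalue E y ==> x - y : \<int> ==> x = y"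
 shows "EX K : sq_mat n. R * K = K * E & (ALL w. Re w < c --> F w = K)"
proof -
 let ?U = "{w. Re w < c}"
 obtain B P Q where B: "B : sq_mat n" "upper_triangular B" "P : sq_mat n" "Q : sq_mat n"
  "P * Q = 1\<^sub>m n" "Q * P = 1\<^sub>m n" "R * P = P * B" "Q * R = B * Q" "!!i. i < n ==> eigenvalue R (B $$ (i,i))"
  by (rule upper_triangular_similar[OF R]) blast
 obtain B' P' Q' where B': "B' : sq_mat n" "upper_triangular B'" "P' : sq_mat n" "Q' : sq_mat n"
  "P' * Q' = 1\<^sub>m n" "Q' * P' = 1\<^sub>m n" "E * P' = P' * B'" "Q' * E = B' * Q'" "!!i. i < n ==> eigenvalue E (B' $$ (i,i))"
  by (rule upper_triangular_similar[OF E]) blast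
 define F' where "F' w = Q * (F w * P')" for w
 have F': "mat_ode n ?U (%_. B) (%_. B') F'"
 proof -
  have "mat_ode n ?U (%_. E) (%_. B') (%_. P')" "mat_ode n ?U (%_. B) (%_. R) (%_. Q)"
   by (rule mat_ode_const; use B B' R E in simp)+
  thus ?thesis
   unfolding F'_def using mat_ode_mult[OF _ mat_ode_mult[OF F _ Re_less_half_plane(1)] Re_less_half_plane(1)] by blast
 qed
 have "EX k. ALL w. Re w < c --> F' w $$ (i,j) = k" if "i < n" "j < n" for i j
  by (rule periodic_triangular[OF F' B(1,2) B'(1,2) _ _ that])
   (use per nonres B(9) B'(9) in "auto simp: F'_def")
 then obtain k where k: "!!i j w. i < n ==> j < n ==> Re w < c ==> F' w $$ (i,j) = k i j" by metis
 obtain w0 where w0: "w0 : ?U" using Re_less_half_plane(3) by blast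
 have Fc: "F w : sq_mat n" if "w : ?U" for w using mat_odeD(3)[OF F that] .
 have "F' w = F' w0" if w: "w : ?U" for w
  using k w w0 mat_odeD(3)[OF F' w] mat_odeD(3)[OF F' w0] by (intro eq_matI) auto
 moreover have "F w = P * (F' w * Q')" if w: "w : ?U" for w
 proof -
  have "F' w * Q' = Q * (F w * (P' * Q'))"
   unfolding F'_def using B B' Fc[OF w] by (simp add: assoc_mult_mat[of _ n n _ n _ n])
  also have "... = Q * F w" using B' Fc[OF w] by simp
  finally have "P * (F' w * Q') = P * (Q * F w)" by simp
  thus ?thesis using assoc_mult_mat[OF B(3,4) Fc[OF w]] B(5) Fc[OF w] by simp
 qed
 ultimately have const: "F w = F w0" if "w : ?U" for w using that w0 by metis
 have "(R * F w0 - F w0 * E) $$ (i,j) = 0" if ij: "i < n" "j < n" for i j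
 proof -
  have "((%w. F w $$ (i,j)) hfd 0) (at w0)"
   by (rule has_field_derivative_transform_within_open[OF _ Re_less_half_plane(1) w0, of "%_. F w0 $$ (i,j)"])
    (use const in auto)
  thus ?thesis using mat_odeD(4)[OF F w0 ij] DERIV_unique by blast
 qed
 hence "R * F w0 - F w0 * E = zmat n" using R E Fc[OF w0] by (intro eq_matI) auto
 hence "R * F w0 = F w0 * E"
 proof -
  assume z: "R * F w0 - F w0 * E = zmat n"
  show ?thesis
  proof (rule eq_matI)
   fix i j assume "i < dim_row (F w0 * E)" "j < dim_col (F w0 * E)"
   hence ij: "i < n" "j < n" using E Fc[OF w0] by auto
   have "(R * F w0 - F w0 * E) $$ (i,j) = (R * F w0) $$ (i,j) - (F w0 * E) $$ (i,j)"
    using ij R E Fc[OF w0] by (simp del: index_mult_mat(1))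
   thus "(R * F w0) $$ (i,j) = (F w0 * E) $$ (i,j)" using z ij by simp
  qed (use R E Fc[OF w0] in auto)
 qed
 thus ?thesis using const Fc[OF w0] by blast
qed


section \<open>Singularities of the first kind\<close>

lemma deriv_norm_square:
 fixes g :: "real => complex"
 assumes "(g has_vector_derivative g') (at x)"
 shows "((%x. (norm (g x))\<^sup>2) has_real_derivative 2 * (g x \<bullet> g')) (at x)"
proof -
 have "((%x. g x \<bullet> g x) has_derivative (%h. g x \<bullet> (h *\<^sub>R g') + (h *\<^sub>R g') \<bullet> g x)) (at x)"
  using assms unfolding has_vector_derivative_def by (intro has_derivative_inner) auto
 hence d: "((%x. (norm (g x))\<^sup>2) has_derivative (%h. g x \<bullet> (h *\<^sub>R g') + (h *\<^sub>R g') \<bullet> g x)) (at x)"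
  by (simp only: power2_norm_eq_inner)
 show ?thesis
  unfolding has_field_derivative_def
  by (rule has_derivative_eq_rhs[OF d]) (auto simp: inner_commute fun_eq_iff)
qed

text \<open>Gronwall's inequality along the rays to the origin.\<close>

lemma intertwiner_growth:
 assumes dl: "dl > 0"
  and B1: "mat_hol n B1 (ball 0 dl)" and B2: "mat_hol n B2 (ball 0 dl)"
  and c: "!!z. z : ball 0 dl ==> B1 z : sq_mat n & B2 z : sq_mat n"
  and Gc: "!!z. z : ball 0 dl - {0} ==> G z : sq_mat n"
  and G: "!!z i j. z : ball 0 dl - {0} ==> i < n ==> j < n ==>
    ((%z. G z $$ (i,j)) hfd (B1 z * G z - G z * B2 z) $$ (i,j) / z) (at z)"
 shows "EX m C. ALL z i j. 0 < norm z --> norm z < dl / 2 --> i < n --> j < n --> norm (z ^ m * G z $$ (i,j)) <= C"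
proof -
 define r where "r = dl / 2"
 have r: "0 < r" "r < dl" using dl by (auto simp: r_def)
 have bounded_entries: "EX b>=0. ALL z:K. ALL i<n. ALL j<n. norm (B z $$ (i,j)) <= b"
  if K: "compact K" and B: "!!i j. i < n ==> j < n ==> continuous_on K (%z. B z $$ (i,j))"
  for K and B :: "complex => complex mat"
 proof -
  have "EX b. ALL z:K. norm (B z $$ (i,j)) <= b" if "i < n" "j < n" for i j
   using compact_imp_bounded[OF compact_continuous_image[OF B[OF that] K]] unfolding bounded_iff by auto
  then obtain b where b: "!!i j z. i < n ==> j < n ==> z : K ==> norm (B z $$ (i,j)) <= b i j" by metis
  have "norm (B z $$ (i,j)) <= (\<Sum>i<n. \<Sum>j<n. \<bar>b i j\<bar>)" if "z : K" "i < n" "j < n" for z i j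
  proof -
   have "norm (B z $$ (i,j)) <= \<bar>b i j\<bar>" using b[OF that(2,3,1)] by linarith
   also have "... <= (\<Sum>j<n. \<bar>b i j\<bar>)" using that by (intro member_le_sum) auto
   also have "... <= (\<Sum>i<n. \<Sum>j<n. \<bar>b i j\<bar>)" using that
    by (intro member_le_sum[of i _ "%i. \<Sum>j<n. \<bar>b i j\<bar>"]) (auto intro: sum_nonneg)
   finally show ?thesis .
  qed
  thus ?thesis by (intro exI[of _ "\<Sum>i<n. \<Sum>j<n. \<bar>b i j\<bar>"]) (auto intro!: sum_nonneg)
 qed
 have sub: "cball 0 r <= ball 0 dl" using r by auto
 obtain b1 where b1: "b1 >= 0" "ALL z:cball 0 r. ALL i<n. ALL j<n. norm (B1 z $$ (i,j)) <= b1"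
  using bounded_entries[of "cball 0 r" B1] B1 continuous_on_subset[OF holomorphic_on_imp_continuous_on sub]
  unfolding mat_holomorphic_on_def by auto
 obtain b2 where b2: "b2 >= 0" "ALL z:cball 0 r. ALL i<n. ALL j<n. norm (B2 z $$ (i,j)) <= b2"
  using bounded_entries[of "cball 0 r" B2] B2 continuous_on_subset[OF holomorphic_on_imp_continuous_on sub]
  unfolding mat_holomorphic_on_def by auto
 define be where "be = b1 + b2"
 have be: "be >= 0" using b1 b2 by (simp add: be_def)
 have "sphere 0 r <= ball (0::complex) dl - {0}" using r by auto
 hence "continuous_on (sphere 0 r) (%z. G z $$ (i,j))" if "i < n" "j < n" for i j
  using G that by (intro continuous_at_imp_continuous_on ballI DERIV_isCont) blast
 then obtain M where M: "M >= 0" "ALL z:sphere 0 r. ALL i<n. ALL j<n. norm (G z $$ (i,j)) <= M"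
  using bounded_entries[of "sphere 0 r" G] by auto
 \<comment> \<open>The squared Frobenius norm; unlike the norm it is differentiable also where
   \<open>G\<close> vanishes.\<close>
 define N where "N z = (\<Sum>i<n. \<Sum>j<n. (norm (G z $$ (i,j)))\<^sup>2)" for z
 have N0: "N z >= 0" for z unfolding N_def by (intro sum_nonneg) auto
 have GN: "(norm (G z $$ (i,j)))\<^sup>2 <= N z" if "i < n" "j < n" for i j z
 proof -
  have "(norm (G z $$ (i,j)))\<^sup>2 <= (\<Sum>j<n. (norm (G z $$ (i,j)))\<^sup>2)" using that by (intro member_le_sum) auto
  also have "... <= N z" unfolding N_def using that
   by (intro member_le_sum[of i _ "%i. \<Sum>j<n. (norm (G z $$ (i,j)))\<^sup>2"]) (auto intro: sum_nonneg)
  finally show ?thesis .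
 qed
 have GN': "norm (G z $$ (i,j)) <= sqrt (N z)" if "i < n" "j < n" for i j z
  using GN[OF that, of z] by (simp add: real_le_rsqrt)
 define D where "D z i j = (B1 z * G z - G z * B2 z) $$ (i,j)" for z i j
 have D: "norm (D z i j) <= real n * be * sqrt (N z)" if z: "z ~= 0" "norm z <= r" and ij: "i < n" "j < n" for z i j
 proof -
  have zz: "z : ball 0 dl" "z : ball 0 dl - {0}" "z : cball 0 r" using z r by auto
  have "D z i j = (\<Sum>k<n. B1 z $$ (i,k) * G z $$ (k,j)) - (\<Sum>k<n. G z $$ (i,k) * B2 z $$ (k,j))"
  proof -
   have "B1 z : sq_mat n" "B2 z : sq_mat n" "G z : sq_mat n"
    using c[OF zz(1)] Gc[OF zz(2)] by auto
   moreover from this have "dim_row (G z) = n" "dim_col (B2 z) = n" by auto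
   ultimately show ?thesis
    unfolding D_def using ij by (simp add: mult_mat_entry[symmetric] del: index_mult_mat(1))
  qed
  also have "norm ... <= (\<Sum>k<n. b1 * sqrt (N z)) + (\<Sum>k<n. sqrt (N z) * b2)"
  proof (rule norm_triangle_le_diff, rule add_mono)
   show "norm (\<Sum>k<n. B1 z $$ (i,k) * G z $$ (k,j)) <= (\<Sum>k<n. b1 * sqrt (N z))"
    by (rule sum_norm_le) (use b1 zz GN' ij in "auto simp: norm_mult N0 intro!: mult_mono")
   show "norm (\<Sum>k<n. G z $$ (i,k) * B2 z $$ (k,j)) <= (\<Sum>k<n. sqrt (N z) * b2)"
    by (rule sum_norm_le) (use b2 zz GN' ij in "auto simp: norm_mult N0 intro!: mult_mono")
  qed
  also have "... = real n * be * sqrt (N z)" by (simp add: be_def algebra_simps)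
  finally show ?thesis .
 qed
 \<comment> \<open>Along a ray the derivative of \<open>N\<close> is a sum of \<open>n * n\<close>
   terms, each at most \<open>2 * n * be * N\<close>; this is the origin of
   \<open>2 * n ^ 3 * be\<close>. A natural number is taken so that \<open>z ^ K\<close> is
   holomorphic.\<close>
 obtain K :: nat where K: "2 * real n ^ 3 * be <= real K" using real_arch_simple by blast
 have main: "N (exp (of_real x + \<i> * of_real tt)) <= exp (K * (ln r - x)) * N (exp (of_real (ln r) + \<i> * of_real tt))"
  if x: "x <= ln r" for x tt
 proof -
  define e where "e x = exp (of_real x + \<i> * of_real tt)" for x :: real
  have ne: "norm (e x) = exp x" "e x ~= 0" for x by (auto simp: e_def norm_exp_eq_Re)
  have er: "norm (e x) <= r" if "x <= ln r" for x unfolding ne using that r by (metis exp_le_cancel_iff exp_ln)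
  have eb: "e x : ball 0 dl - {0}" if "x <= ln r" for x using er[OF that] ne(2) r by auto
  have ed: "(e has_vector_derivative e x) (at x)" for x
   unfolding e_def by (auto intro!: derivative_eq_intros has_vector_derivative_real_field)
  \<comment> \<open>This product is nondecreasing along a ray, so towards the origin
    \<open>N\<close> grows at most like \<open>norm z\<close> to the power
    \<open>- K\<close>.\<close>
  define f where "f x = exp (K * x) * N (e x)" for x :: real
  have fd: "EX y. (f has_real_derivative y) (at x) & y >= 0" if x: "x <= ln r" for x
  proof -
   have gd: "((%x. G (e x) $$ (i,j)) has_vector_derivative D (e x) i j) (at x)" if "i < n" "j < n" for i j
   proof -
    have "((%z. G z $$ (i,j)) \<circ> e has_vector_derivative e x * (D (e x) i j / e x)) (at x)"
     by (rule field_vector_diff_chain_at[OF ed]) (use G[OF eb[OF x] that] in "simp add: D_def")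
    thus ?thesis using ne(2)[of x] by (simp add: o_def)
   qed
   define N' where "N' = (\<Sum>i<n. \<Sum>j<n. 2 * (G (e x) $$ (i,j) \<bullet> D (e x) i j))"
   have Nd: "((%x. N (e x)) has_real_derivative N') (at x)"
    unfolding N_def N'_def by (intro DERIV_sum deriv_norm_square gd) auto
   have "\<bar>N'\<bar> <= (\<Sum>i<n. \<Sum>j<n. 2 * (sqrt (N (e x)) * (real n * be * sqrt (N (e x)))))"
    unfolding N'_def
   proof (rule order_trans[OF sum_abs sum_mono], rule order_trans[OF sum_abs sum_mono])
    fix i j assume ij: "i : {..<n}" "j : {..<n}"
    have "\<bar>G (e x) $$ (i,j) \<bullet> D (e x) i j\<bar> <= norm (G (e x) $$ (i,j)) * norm (D (e x) i j)"
     by (rule Cauchy_Schwarz_ineq2)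
    also have "... <= sqrt (N (e x)) * (real n * be * sqrt (N (e x)))"
     using ij GN' D[OF ne(2) er[OF x]] N0 by (intro mult_mono) auto
    finally show "\<bar>2 * (G (e x) $$ (i,j) \<bullet> D (e x) i j)\<bar> <= 2 * (sqrt (N (e x)) * (real n * be * sqrt (N (e x))))"
     by (simp add: abs_mult)
   qed
   also have "... = 2 * real n ^ 3 * be * (sqrt (N (e x)) * sqrt (N (e x)))"
    by (simp add: power3_eq_cube mult_ac)
   also have "... = 2 * real n ^ 3 * be * N (e x)" using N0 by simp
   also have "... <= K * N (e x)" using K N0 by (intro mult_right_mono) auto
   finally have "K * N (e x) + N' >= 0" by linarith
   moreover have "(f has_real_derivative exp (K * x) * (K * N (e x) + N')) (at x)"
    unfolding f_def by (rule derivative_eq_intros Nd refl)+ (simp add: algebra_simps)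
   ultimately show ?thesis by (intro exI[of _ "exp (K * x) * (K * N (e x) + N')"]) simp
  qed
  have "f x <= f (ln r)"
   by (rule DERIV_nonneg_imp_nondecreasing[OF x]) (use fd in auto)
  hence "exp (- (K * x)) * (exp (K * x) * N (e x)) <= exp (- (K * x)) * (exp (K * ln r) * N (e (ln r)))"
   unfolding f_def by (intro mult_left_mono) auto
  thus ?thesis by (simp add: e_def mult.assoc[symmetric] right_diff_distrib flip: exp_add)
 qed
 define C where "C = r ^ K * (r ^ K * (real n * (real n * M\<^sup>2)))"
 have "norm (z ^ K * G z $$ (i,j)) <= sqrt C" if z: "0 < norm z" "norm z < dl / 2" and ij: "i < n" "j < n" for z i j
 proof -
  define x tt where "x = ln (norm z)" and "tt = Im (Ln z)"
  have z0: "z ~= 0" using z by auto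
  have zx: "z = exp (of_real x + \<i> * of_real tt)"
   using exp_Ln[OF z0] Re_Ln[OF z0] by (metis complex_eq x_def tt_def)
  have xr: "x <= ln r" using z r by (simp add: x_def r_def)
  let ?w = "exp (of_real (ln r) + \<i> * of_real tt) :: complex"
  have "norm ?w = r" using r by (simp add: norm_exp_eq_Re)
  hence "N ?w <= (\<Sum>i<n. \<Sum>j<n. M\<^sup>2)"
   unfolding N_def using M by (intro sum_mono power_mono) auto
  hence Nw: "N ?w <= real n * (real n * M\<^sup>2)" by simp
  have "exp (K * (ln r - x)) = (r / norm z) ^ K"
   using r z unfolding x_def exp_of_nat_mult by (simp add: exp_diff)
  hence "N z <= (r / norm z) ^ K * N ?w" using main[OF xr, of tt] unfolding zx[symmetric] by simp
  moreover have "(r / norm z) ^ K * N ?w <= (r / norm z) ^ K * (real n * (real n * M\<^sup>2))"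
   by (rule mult_left_mono[OF Nw]) (use r in simp)
  ultimately have "N z <= (r / norm z) ^ K * (real n * (real n * M\<^sup>2))" by (rule order_trans)
  hence "norm z ^ K * N z <= norm z ^ K * ((r / norm z) ^ K * (real n * (real n * M\<^sup>2)))"
   by (intro mult_left_mono) auto
  also have "... = r ^ K * (real n * (real n * M\<^sup>2))" using z by (simp add: power_divide)
  finally have 1: "norm z ^ K * N z <= r ^ K * (real n * (real n * M\<^sup>2))" .
  have "(norm (z ^ K * G z $$ (i,j)))\<^sup>2 = norm z ^ K * (norm z ^ K * (norm (G z $$ (i,j)))\<^sup>2)"
   by (simp add: norm_mult norm_power power_mult_distrib power2_eq_square)
  also have "... <= norm z ^ K * (norm z ^ K * N z)"
   using GN[OF ij, of z] by (intro mult_left_mono) auto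
  also have "... <= r ^ K * (r ^ K * (real n * (real n * M\<^sup>2)))"
  proof (rule mult_mono[OF _ 1])
   show "norm z ^ K <= r ^ K" by (rule power_mono) (use z in "auto simp: r_def")
  qed (use r N0 in auto)
  finally show ?thesis unfolding C_def by (rule real_le_rsqrt)
 qed
 thus ?thesis by blast
qed


section \<open>Extension of intertwiners across a puncture\<close>

lemma holomorphic_zero_outside_point:
 assumes f: "f hol ball 0 dl" "dl > 0" and z: "!!z. z : ball 0 dl - {0} ==> f z = 0"
 shows "f 0 = 0"
proof -
 have "isCont f 0" using f holomorphic_on_imp_continuous_on continuous_on_eq_continuous_at[of "ball 0 dl" f] by auto
 hence "(f \<longlongrightarrow> f 0) (at 0)" by (simp add: isCont_def)
 moreover have "(f \<longlongrightarrow> 0) (at 0)"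
 proof (rule tendsto_eventually)
  show "\<forall>\<^sub>F x in at 0. f x = 0"
   unfolding eventually_at_topological
   by (intro exI[of _ "ball 0 dl"]) (use f z in auto)
 qed
 ultimately show ?thesis using LIM_unique by blast
qed

lemma mult_entry_holomorphic:
 assumes "mat_hol n A U" "mat_hol n B U"
  "!!z. z : U ==> A z : sq_mat n" "!!z. z : U ==> B z : sq_mat n" "i < n" "j < n"
 shows "(%z. (A z * B z) $$ (i,j)) hol U"
proof -
 have "(%z. \<Sum>k<n. A z $$ (i,k) * B z $$ (k,j)) hol U"
  using assms(1,2,5,6) unfolding mat_holomorphic_on_def by (intro holomorphic_intros) auto
 thus ?thesis
  by (rule holomorphic_transform) (simp only: mult_mat_entry[OF assms(3,4,5,6)])
qed

text \<open>Multiplied by \<open>z\<close>, the equation equates \<open>z\<close> times the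
  derivative of \<open>H\<close> with the expression of the conclusion. Both sides are holomorphic
  at 0, where the first one vanishes.\<close>

lemma intertwiner_at_zero:
 assumes dl: "dl > 0"
  and B1: "mat_hol n B1 (ball 0 dl)" and B2: "mat_hol n B2 (ball 0 dl)"
  and H: "mat_hol n H (ball 0 dl)"
  and c: "!!z. z : ball 0 dl ==> B1 z : sq_mat n & B2 z : sq_mat n & H z : sq_mat n"
  and ode: "!!z i j. z : ball 0 dl - {0} ==> i < n ==> j < n ==>
    ((%z. H z $$ (i,j)) hfd (l * H z $$ (i,j) + (B1 z * H z - H z * B2 z) $$ (i,j)) / z) (at z)"
  and ij: "i < n" "j < n"
 shows "l * H 0 $$ (i,j) + (B1 0 * H 0 - H 0 * B2 0) $$ (i,j) = 0"
proof -
 define f where "f z = l * H z $$ (i,j) + ((B1 z * H z) $$ (i,j) - (H z * B2 z) $$ (i,j)) - z * deriv (%z. H z $$ (i,j)) z" for z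
 have Hh: "(%z. H z $$ (i,j)) hol ball 0 dl" using H ij unfolding mat_holomorphic_on_def by blast
 have h1: "(%z. (B1 z * H z) $$ (i,j)) hol ball 0 dl"
  by (rule mult_entry_holomorphic[OF B1 H _ _ ij]) (use c in auto)
 have h2: "(%z. (H z * B2 z) $$ (i,j)) hol ball 0 dl"
  by (rule mult_entry_holomorphic[OF H B2 _ _ ij]) (use c in auto)
 have h3: "deriv (%z. H z $$ (i,j)) hol ball 0 dl"
  by (rule holomorphic_deriv[OF Hh open_ball])
 have "f hol ball 0 dl"
  unfolding f_def
  by (rule holomorphic_on_diff[OF holomorphic_on_add[OF holomorphic_on_mult[OF holomorphic_on_const Hh]
   holomorphic_on_diff[OF h1 h2]] holomorphic_on_mult[OF holomorphic_on_ident h3]])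
 moreover have minus: "(B1 z * H z - H z * B2 z) $$ (i,j) = (B1 z * H z) $$ (i,j) - (H z * B2 z) $$ (i,j)" if "z : ball 0 dl" for z
 proof -
  have "dim_row (H z) = n" "dim_col (B2 z) = n" using c[OF that] by auto
  thus ?thesis using ij by (simp del: index_mult_mat(1))
 qed
 have fz: "f z = 0" if "z : ball 0 dl - {0}" for z
 proof -
  have "z ~= 0" "z : ball 0 dl" using that by auto
  thus ?thesis
   unfolding f_def DERIV_imp_deriv[OF ode[OF that ij]] minus[OF \<open>z : ball 0 dl\<close>] by (simp del: index_mult_mat(1))
 qed
 ultimately have "f 0 = 0" using holomorphic_zero_outside_point[of f dl] dl by blast
 thus ?thesis using minus[of 0] dl by (simp add: f_def)
qed

text \<open>A Sylvester equation with the spectrum shifted by \<open>m\<close>. The function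
  \<open>exp (- (of_nat m * w))\<close> times \<open>H\<close> is a periodic intertwiner of the
  constant systems \<open>R\<close> and \<open>E\<close>, hence constant by non-resonance; as
  \<open>m > 0\<close>, this forces \<open>H\<close> to vanish.\<close>

lemma intertwiner_nonresonant_zero:
 fixes R E H :: "complex mat"
 assumes R: "R : sq_mat n" and E: "E : sq_mat n" and H: "H : sq_mat n"
  and eq: "!!i j. i < n ==> j < n ==> of_nat m * H $$ (i,j) + (R * H - H * E) $$ (i,j) = 0" and m: "m > 0"
  and nonres: "!!x y. eigenvalue R x ==> eigenvalue E y ==> x - y : \<int> ==> x = y"
 shows "H = zmat n"
proof -
 define F where "F w = exp (- (of_nat m * w)) \<cdot> H" for w :: complex
 have ode: "mat_ode n {w. Re w < 0} (%_. R) (%_. E) F"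
  unfolding mat_ode_def
 proof (intro ballI conjI allI impI)
  fix w i j assume ij: "i < n" "j < n"
  have "R * F w - F w * E = exp (- (of_nat m * w)) \<cdot> (R * H - H * E)"
  proof -
   have "R * F w = exp (- (of_nat m * w)) \<cdot> (R * H)" unfolding F_def by (rule mult_smult_distrib[OF R H])
   moreover have "F w * E = exp (- (of_nat m * w)) \<cdot> (H * E)" unfolding F_def by (rule mult_smult_assoc_mat[OF H E])
   moreover have "R * H : sq_mat n" "H * E : sq_mat n" using R H E by auto
   ultimately show ?thesis using smult_minus_distrib_mat by metis
  qed
  moreover have "R * H - H * E : sq_mat n" using R H E by auto
  ultimately have "(R * F w - F w * E) $$ (i,j) = exp (- (of_nat m * w)) * (R * H - H * E) $$ (i,j)"
   by (simp only: smult_mat_entry[OF _ ij])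
  also have "(R * H - H * E) $$ (i,j) = - (of_nat m * H $$ (i,j))" using eq[OF ij] by (metis add.commute eq_neg_iff_add_eq_0)
  finally have e: "(R * F w - F w * E) $$ (i,j) = exp (- (of_nat m * w)) * - (of_nat m * H $$ (i,j))" .
  have "(%w. F w $$ (i,j)) = (%w. exp (- (of_nat m * w)) * H $$ (i,j))" using H ij by (auto simp: F_def)
  thus "((%w. F w $$ (i,j)) hfd (R * F w - F w * E) $$ (i,j)) (at w)"
   unfolding e by (auto intro!: derivative_eq_intros)
 qed (use R E H in "auto simp: F_def")
 have per: "F (w + tpi) = F w" for w
 proof -
  have "exp (- (of_nat m * (w + tpi))) = exp (- (of_nat m * w)) * exp (2 * of_int (- int m) * of_real pi * \<i>)"
   by (simp add: algebra_simps flip: exp_add)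
  also have "exp (2 * of_int (- int m) * of_real pi * \<i>) = 1" using exp_integer_2pi[of "of_int (- int m)"] by (simp add: mult_ac)
  finally show ?thesis by (simp add: F_def)
 qed
 obtain K where K: "!!w. Re w < 0 ==> F w = K"
  using periodic_nonresonant[OF ode R E per nonres] by blast
 show ?thesis
 proof (rule eq_matI)
  fix i j assume "i < dim_row (zmat n :: complex mat)" "j < dim_col (zmat n :: complex mat)"
  hence ij: "i < n" "j < n" by auto
  have "F (-1) $$ (i,j) = F (-2) $$ (i,j)" using K[of "-1"] K[of "-2"] by simp
  hence "exp (of_nat m) * H $$ (i,j) = exp (of_nat m * 2) * H $$ (i,j)"
   unfolding F_def smult_mat_entry[OF H ij] by simp
  moreover have "norm (exp (of_nat m :: complex)) < norm (exp (of_nat m * 2 :: complex))" using m by (simp add: norm_exp_eq_Re)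
  hence "exp (of_nat m :: complex) ~= exp (of_nat m * 2)" by (metis less_irrefl)
  ultimately have "H $$ (i,j) = 0" by (metis mult_cancel_right)
  thus "H $$ (i,j) = zmat n $$ (i,j)" using ij by simp
 qed (use H in auto)
qed

text \<open>By the growth bound \<open>z ^ m0 * G\<close> extends over 0. As long as the exponent is
  positive, the extension solves at 0 a Sylvester equation with only the zero solution, so a factor
  \<open>z\<close> can be divided out. Repeating this reaches \<open>G\<close> itself.\<close>

lemma intertwiner_extends:
 assumes dl: "dl > 0"
  and B1: "mat_hol n B1 (ball 0 dl)" and B2: "mat_hol n B2 (ball 0 dl)"
  and c: "!!z. z : ball 0 dl ==> B1 z : sq_mat n & B2 z : sq_mat n"
  and Gc: "!!z. z : ball 0 dl - {0} ==> G z : sq_mat n"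
  and G: "!!z i j. z : ball 0 dl - {0} ==> i < n ==> j < n ==>
    ((%z. G z $$ (i,j)) hfd (B1 z * G z - G z * B2 z) $$ (i,j) / z) (at z)"
  and nonres: "!!x y. eigenvalue (B1 0) x ==> eigenvalue (B2 0) y ==> x - y : \<int> ==> x = y"
 shows "EX H. mat_hol n H (ball 0 dl) & (ALL z:ball 0 dl. H z : sq_mat n) &
  (ALL z:ball 0 dl - {0}. H z = G z)"
proof -
 define P where "P m H \<longleftrightarrow> (ALL i<n. ALL j<n. H i j hol ball 0 dl & (ALL z:ball 0 dl - {0}. H i j z = z ^ m * G z $$ (i,j)))"
  for m and H :: "nat => nat => complex => complex"
 have Gh: "(%z. z ^ m * G z $$ (i,j)) hol ball 0 dl - {0}" if "i < n" "j < n" for i j m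
 proof -
  have "(%z. G z $$ (i,j)) field_differentiable at z within ball 0 dl - {0}" if z: "z : ball 0 dl - {0}" for z
   using G[OF z \<open>i < n\<close> \<open>j < n\<close>] has_field_derivative_at_within field_differentiable_def by blast
  hence "(%z. G z $$ (i,j)) hol ball 0 dl - {0}" unfolding holomorphic_on_def by blast
  thus ?thesis by (intro holomorphic_on_mult holomorphic_on_power holomorphic_on_ident)
 qed
 obtain m0 C where m0: "!!z i j. 0 < norm z ==> norm z < dl / 2 ==> i < n ==> j < n ==> norm (z ^ m0 * G z $$ (i,j)) <= C"
  using intertwiner_growth[OF dl B1 B2 c Gc G] by blast
 define h where "h i j = (SOME H. H hol ball 0 dl & (ALL z:ball 0 dl - {0}. H z = z ^ m0 * G z $$ (i,j)))" for i j
 have ex: "EX H. H hol ball 0 dl & (ALL z:ball 0 dl - {0}. H z = z ^ m0 * G z $$ (i,j))" if ij: "i < n" "j < n" for i j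
 proof -
  have "\<forall>\<^sub>F z in at 0. norm (z ^ m0 * G z $$ (i,j)) <= C"
   unfolding eventually_at using m0[OF _ _ ij] dl by (intro exI[of _ "dl / 2"]) auto
  moreover have "(0::complex) : interior (ball 0 dl)" using dl by simp
  ultimately show ?thesis using holomorphic_on_extend_bounded[OF Gh[OF ij, of m0]] by blast
 qed
 have "h i j hol ball 0 dl & (ALL z:ball 0 dl - {0}. h i j z = z ^ m0 * G z $$ (i,j))" if "i < n" "j < n" for i j
  unfolding h_def by (rule someI_ex[OF ex[OF that]])
 hence "P m0 h" unfolding P_def by blast
 hence start: "EX H. P m0 H" by blast
 have step: "EX H. P m H" if P: "P (Suc m) H" for m H
 proof -
  define H' where "H' z = Matrix.mat n n (%(i,j). H i j z)" for z
  have H'c: "H' z : sq_mat n" for z by (simp add: H'_def)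
  have H'h: "mat_hol n H' (ball 0 dl)" using P unfolding P_def mat_holomorphic_on_def H'_def by auto
  have H'G: "H' z = z ^ Suc m \<cdot> G z" if "z : ball 0 dl - {0}" for z
   using that Gc[OF that] P unfolding P_def H'_def by (intro eq_matI) auto
  have ode: "((%z. H' z $$ (i,j)) hfd (of_nat (Suc m) * H' z $$ (i,j) + (B1 z * H' z - H' z * B2 z) $$ (i,j)) / z) (at z)"
   if z: "z : ball 0 dl - {0}" and ij: "i < n" "j < n" for z i j
  proof -
   have cc: "B1 z : sq_mat n" "B2 z : sq_mat n" "G z : sq_mat n" using c z Gc by auto
   have "B1 z * H' z - H' z * B2 z = z ^ Suc m \<cdot> (B1 z * G z - G z * B2 z)"
   proof -
    have "B1 z * H' z = z ^ Suc m \<cdot> (B1 z * G z)" unfolding H'G[OF z] by (rule mult_smult_distrib[OF cc(1,3)])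
    moreover have "H' z * B2 z = z ^ Suc m \<cdot> (G z * B2 z)" unfolding H'G[OF z] by (rule mult_smult_assoc_mat[OF cc(3,2)])
    moreover have "B1 z * G z : sq_mat n" "G z * B2 z : sq_mat n" using cc by auto
    ultimately show ?thesis using smult_minus_distrib_mat by metis
   qed
   moreover have "B1 z * G z - G z * B2 z : sq_mat n" using cc by auto
   ultimately have e: "(B1 z * H' z - H' z * B2 z) $$ (i,j) = z ^ Suc m * (B1 z * G z - G z * B2 z) $$ (i,j)"
    by (simp only: smult_mat_entry[OF _ ij])
   have "((%z. z ^ Suc m * G z $$ (i,j)) hfd
     of_nat (Suc m) * z ^ m * G z $$ (i,j) + (B1 z * G z - G z * B2 z) $$ (i,j) / z * z ^ Suc m) (at z)"
   proof -
    have "((%z. z ^ Suc m) hfd of_nat (Suc m) * z ^ m) (at z)"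
     by (rule DERIV_cong[OF DERIV_power[OF DERIV_ident, of "Suc m"]]) simp
    from DERIV_mult[OF this G[OF z ij]] show ?thesis .
   qed
   also have "of_nat (Suc m) * z ^ m * G z $$ (i,j) + (B1 z * G z - G z * B2 z) $$ (i,j) / z * z ^ Suc m
     = (of_nat (Suc m) * H' z $$ (i,j) + (B1 z * H' z - H' z * B2 z) $$ (i,j)) / z"
    unfolding e using z cc(3) ij by (simp add: H'G[OF z] field_simps del: of_nat_Suc)
   finally show ?thesis
    by (rule has_field_derivative_transform_within_open[of _ _ _ "ball 0 dl - {0}"])
     (use z H'G smult_mat_entry[OF Gc ij] in "auto simp: open_delete")
  qed
  have "H' 0 = zmat n"
  proof (rule intertwiner_nonresonant_zero[where m="Suc m"])
   show "of_nat (Suc m) * H' 0 $$ (i,j) + (B1 0 * H' 0 - H' 0 * B2 0) $$ (i,j) = 0" if "i < n" "j < n" for i j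
    by (rule intertwiner_at_zero[OF dl B1 B2 H'h _ ode that]) (use c H'c in auto)
   show "B1 0 : sq_mat n" "B2 0 : sq_mat n" using c dl by auto
  qed (use nonres H'c in auto)
  hence H0: "H i j 0 = 0" if "i < n" "j < n" for i j
  proof -
   have "H i j 0 = H' 0 $$ (i,j)" using that by (simp add: H'_def)
   also have "... = 0" unfolding \<open>H' 0 = zmat n\<close> using that by simp
   finally show ?thesis .
  qed
  define H2 where "H2 i j z = (if z = 0 then deriv (H i j) 0 else (H i j z - H i j 0) / (z - 0))" for i j z
  have "H2 i j hol ball 0 dl" if "i < n" "j < n" for i j
   unfolding H2_def by (rule pole_lemma) (use P that dl in "auto simp: P_def")
  hence "P m H2" using P H0 unfolding P_def H2_def by auto
  thus ?thesis by blast
 qed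
 have "EX H. P 0 H" if "EX H. P k H" for k
  using that by (induction k) (use step in blast)+
 then obtain H where H: "P 0 H" using start by blast
 define H' where "H' z = Matrix.mat n n (%(i,j). H i j z)" for z
 have "mat_hol n H' (ball 0 dl)" using H unfolding P_def mat_holomorphic_on_def H'_def by auto
 moreover have "H' z = G z" if "z : ball 0 dl - {0}" for z
  using that Gc[OF that] H unfolding P_def H'_def by (intro eq_matI) auto
 ultimately show ?thesis by (intro exI[of _ H']) (auto simp: H'_def)
qed

section \<open>Descent from the half-plane and local normal forms\<close>

lemma mult_assoc_4:
 assumes "A : sq_mat n" "B : sq_mat n" "C : sq_mat n" "D : sq_mat n"
 shows "A * B * (C * D) = A * (B * C) * D" "A * (B * C) * D = A * B * C * D"
 using assms by (simp_all add: assoc_mult_mat[of _ n n _ n _ n])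

lemma mult_assoc_5:
 assumes "A : sq_mat n" "B : sq_mat n" "C : sq_mat n" "D : sq_mat n" "F : sq_mat n"
 shows "A * B * C * D * F = A * (B * (C * D * F))"
 using assms by (simp add: assoc_mult_mat[of _ n n _ n _ n])

text \<open>Periodicity makes \<open>W\<close> a function of \<open>exp w\<close>. Its derivative at
  \<open>z\<close> is computed with a branch of the logarithm centred at \<open>z\<close>, which
  avoids the cut of \<open>Ln\<close>; the factor \<open>1 / z\<close> is the derivative of that
  branch.\<close>

lemma half_plane_solution_descends:
 assumes dl: "dl > 0" and W: "mat_ode n {w. Re w < ln dl} (%w. B1 (exp w)) (%w. B2 (exp w)) W"
  and per: "!!w. Re w < ln dl ==> W (w + tpi) = W w"
 shows "EX G. (ALL z:ball 0 dl - {0}. G z : sq_mat n & (ALL i<n. ALL j<n.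
   ((%z. G z $$ (i,j)) hfd (B1 z * G z - G z * B2 z) $$ (i,j) / z) (at z))) &
  (ALL w. Re w < ln dl --> W w = G (exp w))"
proof -
 define G where "G z = W (Ln z)" for z
 have per_nat: "W (w + of_nat k * tpi) = W w" if "Re w < ln dl" for w k
 proof (induction k)
  case (Suc k)
  have "W (w + of_nat (Suc k) * tpi) = W ((w + of_nat k * tpi) + tpi)"
   by (simp add: algebra_simps)
  also have "... = W (w + of_nat k * tpi)" by (rule per) (use that in simp)
  finally show ?case using Suc by simp
 qed auto
 have per_int: "W (w + of_int k * tpi) = W w" if w: "Re w < ln dl" for w k
 proof (cases "k >= 0")
  case True
  thus ?thesis using per_nat[OF w, of "nat k"] by simp
 next
  case False
  have "Re (w + of_int k * tpi) < ln dl" using w by simp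
  from per_nat[OF this, of "nat (- k)"] False show ?thesis by simp
 qed
 have WG: "W w = G (exp w)" if w: "Re w < ln dl" for w
 proof -
  have "exp (Ln (exp w)) = exp w" by simp
  then obtain k :: int where "Ln (exp w) = w + of_real (real_of_int (2 * k) * pi) * \<i>" unfolding exp_eq by blast
  hence "Ln (exp w) = w + of_int k * tpi" by (simp add: mult_ac)
  thus ?thesis using per_int[OF w, of k] by (simp add: G_def)
 qed
 have "G z : sq_mat n & (ALL i<n. ALL j<n.
   ((%z. G z $$ (i,j)) hfd (B1 z * G z - G z * B2 z) $$ (i,j) / z) (at z))"
  if z: "z : ball 0 dl - {0}" for z
 proof -
  have z0: "z ~= 0" "norm z < dl" using z by auto
  define w where "w = Ln z"
  have ew: "exp w = z" using z0 by (simp add: w_def)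
  have w: "Re w < ln dl" using z0 dl by (simp add: w_def)
  define L where "L u = w + Ln (u / z)" for u :: complex
  have eL: "exp (L u) = u" if "u ~= 0" for u :: complex using that z0 ew by (simp add: L_def exp_add)
  have Lz: "L z = w" using z0 by (simp add: L_def)
  have dL: "(L hfd 1 / z) (at z)"
   unfolding L_def using z0 by (auto intro!: derivative_eq_intros simp: complex_nonpos_Reals_iff)
  have GL': "\<forall>\<^sub>F u in nhds z. G u = W (L u)"
   unfolding eventually_nhds
  proof (intro exI[of _ "ball (0::complex) dl - {0}"] conjI ballI)
   fix u assume u: "u : ball (0::complex) dl - {0}"
   hence "exp (Re (L u)) < dl" using eL[of u] by (metis DiffD1 DiffD2 mem_ball_0 norm_exp_eq_Re singletonI)
   hence "Re (L u) < ln dl" using dl by (metis exp_less_cancel_iff exp_ln)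
   thus "G u = W (L u)" using WG[of "L u"] eL[of u] u by auto
  qed (use z in "auto simp: open_delete")
  have Gz: "G z = W w" by (simp add: G_def w_def)
  have "((%z. G z $$ (i,j)) hfd (B1 z * G z - G z * B2 z) $$ (i,j) / z) (at z)" if ij: "i < n" "j < n" for i j
  proof -
   have "((%u. W u $$ (i,j)) hfd (B1 z * G z - G z * B2 z) $$ (i,j)) (at (L z))"
    using mat_odeD(4)[OF W _ ij, of w] w unfolding Lz Gz ew by simp
   from DERIV_chain2[OF this dL]
   have "((%u. W (L u) $$ (i,j)) hfd (B1 z * G z - G z * B2 z) $$ (i,j) / z) (at z)" by simp
   moreover have "\<forall>\<^sub>F u in nhds z. W (L u) $$ (i,j) = G u $$ (i,j)" using GL' by eventually_elim simp
   ultimately show ?thesis using DERIV_cong_ev[OF refl _ refl, of "%u. W (L u) $$ (i,j)" "%u. G u $$ (i,j)" z] by blast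
  qed
  thus ?thesis using mat_odeD(3)[OF W, of w] w Gz by auto
 qed
 thus ?thesis using WG by blast
qed

text \<open>The inverse of \<open>G\<close> solves the equation with \<open>B1\<close> and
  \<open>B2\<close> exchanged, so it extends as well. The product of the two extensions is the
  identity off 0 and, by continuity, at 0.\<close>

lemma intertwiner_extends_GL:
 assumes dl: "dl > 0"
  and B1: "mat_hol n B1 (ball 0 dl)" and B2: "mat_hol n B2 (ball 0 dl)"
  and c: "!!z. z : ball 0 dl ==> B1 z : sq_mat n & B2 z : sq_mat n"
  and Gc: "!!z. z : ball 0 dl - {0} ==> G z : GL n"
  and G: "!!z i j. z : ball 0 dl - {0} ==> i < n ==> j < n ==>
    ((%z. G z $$ (i,j)) hfd (B1 z * G z - G z * B2 z) $$ (i,j) / z) (at z)"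
  and nonres: "!!x y. eigenvalue (B1 0) x ==> eigenvalue (B2 0) y ==> x - y : \<int> ==> x = y"
 shows "EX H. mat_hol n H (ball 0 dl) & (ALL z:ball 0 dl. H z : GL n) &
  (ALL z:ball 0 dl - {0}. H z = G z)"
proof -
 have Gc': "!!z. z : ball 0 dl - {0} ==> G z : sq_mat n" using Gc by blast
 obtain H where H: "mat_hol n H (ball 0 dl)" "ALL z:ball 0 dl. H z : sq_mat n"
  "ALL z:ball 0 dl - {0}. H z = G z"
  using intertwiner_extends[OF dl B1 B2 c Gc' G nonres] by blast
 have U: "open (ball (0::complex) dl - {0})" by (simp add: open_delete)
 have q: "c \<cdot> B * A - A * (c \<cdot> B') = c \<cdot> (B * A - A * B')"
  if "B : sq_mat n" "B' : sq_mat n" "A : sq_mat n" for c :: complex and A B B'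
 proof -
  have "c \<cdot> B * A = c \<cdot> (B * A)" by (rule mult_smult_assoc_mat[OF that(1,3)])
  moreover have "A * (c \<cdot> B') = c \<cdot> (A * B')" by (rule mult_smult_distrib[OF that(3,2)])
  moreover have "B * A : sq_mat n" "A * B' : sq_mat n" using that by auto
  ultimately show ?thesis using smult_minus_distrib_mat by metis
 qed
 have ode: "mat_ode n (ball 0 dl - {0}) (%z. (1 / z) \<cdot> B1 z) (%z. (1 / z) \<cdot> B2 z) G"
  unfolding mat_ode_def
 proof (intro ballI conjI allI impI)
  fix z i j assume z: "z : ball (0::complex) dl - {0}" and ij: "i < n" "j < n"
  have cc: "B1 z : sq_mat n" "B2 z : sq_mat n" "G z : sq_mat n" using c z Gc' by auto
  have "((1 / z) \<cdot> B1 z * G z - G z * ((1 / z) \<cdot> B2 z)) $$ (i,j) = (B1 z * G z - G z * B2 z) $$ (i,j) / z"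
   unfolding q[OF cc] using cc ij by (subst smult_mat_entry[of _ n]) (auto simp del: index_mult_mat(1))
  thus "((%w. G w $$ (i,j)) hfd ((1 / z) \<cdot> B1 z * G z - G z * ((1 / z) \<cdot> B2 z)) $$ (i,j)) (at z)"
   using G[OF z ij] by simp
 qed (use c Gc' in auto)
 define V where "V z = minv (G z)" for z :: complex
 have odeV: "mat_ode n (ball 0 dl - {0}) (%z. (1 / z) \<cdot> B2 z) (%z. (1 / z) \<cdot> B1 z) V"
  unfolding V_def by (rule mat_ode_minv[OF ode U Gc])
 have Vc: "V z : sq_mat n" if "z : ball 0 dl - {0}" for z using minv(4)[OF Gc[OF that]] by (simp add: V_def)
 have V: "((%z. V z $$ (i,j)) hfd (B2 z * V z - V z * B1 z) $$ (i,j) / z) (at z)"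
  if z: "z : ball 0 dl - {0}" and ij: "i < n" "j < n" for z i j
 proof -
  have cc: "B1 z : sq_mat n" "B2 z : sq_mat n" "V z : sq_mat n" using c z Vc by auto
  have "((1 / z) \<cdot> B2 z * V z - V z * ((1 / z) \<cdot> B1 z)) $$ (i,j) = (B2 z * V z - V z * B1 z) $$ (i,j) / z"
   unfolding q[OF cc(2,1,3)] using cc ij by (subst smult_mat_entry[of _ n]) (auto simp del: index_mult_mat(1))
  thus ?thesis using mat_odeD(4)[OF odeV z ij] by simp
 qed
 have c': "!!z. z : ball 0 dl ==> B2 z : sq_mat n & B1 z : sq_mat n" using c by blast
 have nonres': "x = y" if "eigenvalue (B2 0) x" "eigenvalue (B1 0) y" "x - y : \<int>" for x y
  using nonres[OF that(2,1)] that(3) by (metis Ints_minus minus_diff_eq)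
 obtain K where K: "mat_hol n K (ball 0 dl)" "ALL z:ball 0 dl. K z : sq_mat n"
  "ALL z:ball 0 dl - {0}. K z = V z"
  using intertwiner_extends[OF dl B2 B1 c' Vc V nonres'] by blast
 have HK: "H z * K z = 1\<^sub>m n" if z: "z : ball 0 dl" for z
 proof (cases "z = 0")
  case False
  hence "z : ball 0 dl - {0}" using z by blast
  thus ?thesis using bspec[OF H(3)] bspec[OF K(3)] minv(2)[OF Gc] by (simp add: V_def)
 next
  case True
  show ?thesis
  proof (rule eq_matI)
   fix i j assume "i < dim_row (1\<^sub>m n :: complex mat)" "j < dim_col (1\<^sub>m n :: complex mat)"
   hence ij: "i < n" "j < n" by auto
   define f where "f z = (H z * K z) $$ (i,j) - 1\<^sub>m n $$ (i,j)" for z :: complex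
   have "(%z. (H z * K z) $$ (i,j)) hol ball 0 dl"
    by (rule mult_entry_holomorphic[OF H(1) K(1) _ _ ij]) (use H K in auto)
   hence "f hol ball 0 dl" unfolding f_def by (rule holomorphic_on_diff[OF _ holomorphic_on_const])
   moreover have "f z = 0" if "z : ball 0 dl - {0}" for z
    using bspec[OF H(3) that] bspec[OF K(3) that] minv(2)[OF Gc[OF that]] unfolding f_def V_def by simp
   ultimately have "f 0 = 0" using holomorphic_zero_outside_point[of f dl] dl by blast
   thus "(H z * K z) $$ (i,j) = 1\<^sub>m n $$ (i,j)" using True by (simp add: f_def del: index_mult_mat(1))
  qed (use H K z in auto)
 qed
 have "H z : GL n" if "z : ball 0 dl" for z using GL_I(1)[OF _ _ HK[OF that]] H K that by blast
 thus ?thesis using H by blast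
qed

text \<open>\<open>Y * P\<close> times the exponential of \<open>- w E\<close> is periodic:
  translation replaces \<open>Y\<close> by \<open>Y\<close> times the inverse of \<open>Chi\<close>,
  and \<open>P\<close> conjugates \<open>Chi\<close> to the exponential of \<open>- tpi E\<close>.
  It therefore descends to the punctured disc, and it extends to \<open>Z\<close> because residue
  and exponent matrix are not resonant with each other.\<close>

lemma local_form_solution:
 assumes dl: "dl > 0" and B: "mat_hol n B (ball 0 dl)" "!!z. z : ball 0 dl ==> B z : sq_mat n"
  and E: "E : sq_mat n"
  and Y: "mat_ode n {w. Re w < ln dl} (%w. B (exp w)) (%_. zmat n) Y" "!!w. Re w < ln dl ==> Y w : GL n"
  and Chi: "Chi : sq_mat n" "!!w. Re w < ln dl ==> Y w = Y (w + tpi) * Chi"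
  and sim: "similar_mat Chi (mat_exp n ((- 2 * of_real pi * \<i>) \<cdot> E))"
  and nonres: "!!x y. eigenvalue (B 0) x ==> eigenvalue E y ==> x - y : \<int> ==> x = y"
 shows "EX Z C. mat_hol n Z (ball 0 dl) & (ALL z:ball 0 dl. Z z : GL n) & C : GL n &
  (ALL w. Re w < ln dl --> Y w = Z (exp w) * mat_exp n (w \<cdot> E) * C)"
proof -
 let ?U = "{w. Re w < ln dl}"
 let ?X = "mat_exp n ((- 2 * of_real pi * \<i>) \<cdot> E)"
 obtain P Q where PQ: "similar_mat_wit Chi ?X P Q" using sim unfolding similar_mat_def by blast
 note w = similar_mat_witD2[OF Chi(1) PQ]
 have c: "P : sq_mat n" "Q : sq_mat n" "?X : sq_mat n" using w by auto
 have ChiP: "Chi * P = P * ?X"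
 proof -
  have "Chi * P = P * ?X * Q * P" using w(3) by simp
  also have "... = P * ?X * (Q * P)" using c by (intro assoc_mult_mat) auto
  finally show ?thesis using w(2) right_mult_one_mat[OF mult_carrier_mat[OF c(1,3)]] by simp
 qed
 define W where "W w = Y w * P * mat_exp n ((- w) \<cdot> E)" for w
 have odeYP: "mat_ode n ?U (%w. B (exp w)) (%_. zmat n) (%w. Y w * P)"
  by (rule mat_ode_mult[OF Y(1) mat_ode_const0[OF c(1)] Re_less_half_plane(1)])
 have W: "mat_ode n ?U (%w. B (exp w)) (%w. (%_. E) (exp w)) W"
  unfolding W_def using mat_ode_mult[OF odeYP mat_exp_neg_ode[OF E] Re_less_half_plane(1)] by simp
 have Yc: "Y w : sq_mat n" if "Re w < ln dl" for w using Y(2)[OF that] by blast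
 have per: "W (w + tpi) = W w" if w: "Re w < ln dl" for w
 proof -
  let ?w = "w + tpi"
  have w': "Re ?w < ln dl" using w by simp
  have "- ?w = (- 2 * of_real pi * \<i>) + (- w)" by simp
  hence "mat_exp n ((- ?w) \<cdot> E) = ?X * mat_exp n ((- w) \<cdot> E)" using mat_exp_sum[OF E] by metis
  hence "W ?w = Y ?w * P * (?X * mat_exp n ((- w) \<cdot> E))" by (simp add: W_def)
  also have "... = Y ?w * (P * ?X) * mat_exp n ((- w) \<cdot> E)"
   by (rule mult_assoc_4(1)[OF Yc[OF w'] c(1,3) mat_exp_carrier])
  also have "... = Y ?w * (Chi * P) * mat_exp n ((- w) \<cdot> E)" unfolding ChiP ..
  also have "... = (Y ?w * Chi) * P * mat_exp n ((- w) \<cdot> E)"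
   by (rule mult_assoc_4(2)[OF Yc[OF w'] Chi(1) c(1) mat_exp_carrier])
  also have "... = W w" using Chi(2)[OF w] by (simp add: W_def)
  finally show ?thesis .
 qed
 obtain G where G: "!!z i j. z : ball 0 dl - {0} ==> i < n ==> j < n ==>
   ((%z. G z $$ (i,j)) hfd (B z * G z - G z * E) $$ (i,j) / z) (at z)"
  and WG: "!!w. Re w < ln dl ==> W w = G (exp w)"
  using half_plane_solution_descends[OF dl W per] by blast
 have PGL: "P : GL n" by (rule GL_I(1)[OF c(1,2) w(1)])
 have WGL: "W w : GL n" if "Re w < ln dl" for w
  unfolding W_def by (intro GL_mult Y(2)[OF that] PGL mat_exp_GL(1)[OF E])
 have GGL: "G z : GL n" if z: "z : ball 0 dl - {0}" for z
 proof -
  have "Re (Ln z) < ln dl" "exp (Ln z) = z" using z dl by auto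
  thus ?thesis using WGL WG by metis
 qed
 have Eh: "mat_hol n (%_. E) (ball 0 dl)" unfolding mat_holomorphic_on_def by auto
 obtain Z where Z: "mat_hol n Z (ball 0 dl)" "ALL z:ball 0 dl. Z z : GL n" "ALL z:ball 0 dl - {0}. Z z = G z"
  using intertwiner_extends_GL[OF dl B(1) Eh _ GGL G nonres] B(2) E by blast
 have "Y w = Z (exp w) * mat_exp n (w \<cdot> E) * Q" if w: "Re w < ln dl" for w
 proof -
  have "norm (exp w) < dl" using w dl by (metis exp_less_cancel_iff exp_ln norm_exp_eq_Re)
  hence "Z (exp w) = W w" using Z(3) WG[OF w] by simp
  hence "Z (exp w) * mat_exp n (w \<cdot> E) * Q = Y w * P * (mat_exp n ((- w) \<cdot> E) * mat_exp n (w \<cdot> E)) * Q"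
   using assoc_mult_mat[OF mult_carrier_mat[OF Yc[OF w] c(1)] mat_exp_carrier mat_exp_carrier] by (simp add: W_def)
  also have "mat_exp n ((- w) \<cdot> E) * mat_exp n (w \<cdot> E) = 1\<^sub>m n"
   using mat_exp_add[OF E, of w 0] mat_exp_zero[OF E] by simp
  also have "Y w * P * 1\<^sub>m n * Q = Y w * (P * Q)"
   using c Yc[OF w] by (simp add: assoc_mult_mat[of _ n n _ n _ n])
  also have "... = Y w" using \<open>P * Q = 1\<^sub>m n\<close> Yc[OF w] by simp
  finally show ?thesis ..
 qed
 moreover have "Q : GL n" by (rule GL_I(2)[OF c(1,2) \<open>P * Q = 1\<^sub>m n\<close>])
 ultimately show ?thesis using Z by blast
qed

text \<open>The factor \<open>Z\<close> intertwines \<open>B\<close> with the constant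
  \<open>E\<close>. Evaluated at 0, this equation says that \<open>Z 0\<close> conjugates
  \<open>E\<close> to the residue \<open>B 0\<close>.\<close>

lemma local_form_residue:
 assumes dl: "dl > 0" and B: "mat_hol n B (ball 0 dl)" "!!z. z : ball 0 dl ==> B z : sq_mat n"
  and E: "E : sq_mat n"
  and Y: "mat_ode n {w. Re w < ln dl} (%w. B (exp w)) (%_. zmat n) Y"
  and Z: "mat_hol n Z (ball 0 dl)" "!!z. z : ball 0 dl ==> Z z : GL n" and C: "C : GL n"
  and form: "!!w. Re w < ln dl ==> Y w = Z (exp w) * mat_exp n (w \<cdot> E) * C"
 shows "char_poly (B 0) = char_poly E"
proof -
 let ?U = "{w. Re w < ln dl}"
 have Zc: "!!z. z : ball 0 dl ==> Z z : sq_mat n" using Z(2) by blast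
 have Cc: "C : sq_mat n" "minv C : sq_mat n" using C minv(4)[OF C] by auto
 define W where "W w = Y w * minv C * mat_exp n ((- w) \<cdot> E)" for w
 have odeYP: "mat_ode n ?U (%w. B (exp w)) (%_. zmat n) (%w. Y w * minv C)"
  by (rule mat_ode_mult[OF Y(1) mat_ode_const0[OF Cc(2)] Re_less_half_plane(1)])
 have W: "mat_ode n ?U (%w. B (exp w)) (%w. (%_. E) (exp w)) W"
  unfolding W_def using mat_ode_mult[OF odeYP mat_exp_neg_ode[OF E] Re_less_half_plane(1)] by simp
 have ball: "exp w : ball 0 dl" if "Re w < ln dl" for w
  using that dl by (metis exp_less_cancel_iff exp_ln mem_ball_0 norm_exp_eq_Re)
 have WZ: "W w = Z (exp w)" if w: "Re w < ln dl" for w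
 proof -
  note z = Zc[OF ball[OF w]]
  have "W w = Z (exp w) * (mat_exp n (w \<cdot> E) * ((C * minv C) * mat_exp n ((- w) \<cdot> E)))"
   unfolding W_def form[OF w] by (rule mult_assoc_5[OF z mat_exp_carrier Cc mat_exp_carrier])
  also have "(C * minv C) * mat_exp n ((- w) \<cdot> E) = mat_exp n ((- w) \<cdot> E)" unfolding minv(2)[OF C] by (rule left_mult_one_mat[OF mat_exp_carrier])
  also have "mat_exp n (w \<cdot> E) * mat_exp n ((- w) \<cdot> E) = 1\<^sub>m n"
   using mat_exp_add[OF E, of "- w" 0] mat_exp_zero[OF E] by simp
  finally show ?thesis using z by simp
 qed
 have per: "W (w + tpi) = W w" if w: "Re w < ln dl" for w
 proof -
  have "exp (w + tpi) = exp w" by (simp add: exp_add exp_two_pi_i mult_ac)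
  moreover have "Re (w + tpi) < ln dl" using w by simp
  ultimately show ?thesis using WZ w by metis
 qed
 obtain G where G: "!!z i j. z : ball 0 dl - {0} ==> i < n ==> j < n ==>
   ((%z. G z $$ (i,j)) hfd (B z * G z - G z * E) $$ (i,j) / z) (at z)"
  and WG: "!!w. Re w < ln dl ==> W w = G (exp w)"
  using half_plane_solution_descends[OF dl W per] by blast
 have GZ: "G z = Z z" if z: "z : ball 0 dl - {0}" for z
 proof -
  have "Re (Ln z) < ln dl" "exp (Ln z) = z" using z dl by auto
  thus ?thesis using WZ WG by metis
 qed
 have U: "open (ball (0::complex) dl - {0})" by (simp add: open_delete)
 have dZ: "((%z. Z z $$ (i,j)) hfd (0 * Z z $$ (i,j) + (B z * Z z - Z z * E) $$ (i,j)) / z) (at z)"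
  if z: "z : ball 0 dl - {0}" and ij: "i < n" "j < n" for z i j
  using has_field_derivative_transform_within_open[OF G[OF z ij] U z, of "%z. Z z $$ (i,j)"] GZ GZ[OF z] by simp
 have z0: "(0::complex) : ball 0 dl" using dl by simp
 note cc = B(2)[OF z0] Zc[OF z0]
 have e: "(B 0 * Z 0 - Z 0 * E) $$ (i,j) = 0" if ij: "i < n" "j < n" for i j
 proof -
  have "0 * Z 0 $$ (i,j) + (B 0 * Z 0 - Z 0 * (%_. E) 0) $$ (i,j) = 0"
   by (rule intertwiner_at_zero[OF dl B(1) _ Z(1) _ dZ ij])
    (use B(2) E Zc in "auto simp: mat_holomorphic_on_def")
  thus ?thesis by simp
 qed
 have "B 0 * Z 0 = Z 0 * E"
 proof (rule eq_matI)
  fix i j assume "i < dim_row (Z 0 * E)" "j < dim_col (Z 0 * E)"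
  hence ij: "i < n" "j < n" using cc E by auto
  show "(B 0 * Z 0) $$ (i,j) = (Z 0 * E) $$ (i,j)"
   using e[OF ij] minus_mat_entry[of "B 0 * Z 0" n "Z 0 * E" i j] cc E ij by (simp del: index_mult_mat(1))
 qed (use cc E in auto)
 hence "B 0 * (Z 0 * minv (Z 0)) = Z 0 * E * minv (Z 0)"
  using assoc_mult_mat[OF cc minv(4)[OF Z(2)[OF z0]]] by simp
 hence "B 0 = Z 0 * E * minv (Z 0)" using minv(2)[OF Z(2)[OF z0]] cc by simp
 hence "similar_mat (B 0) E"
  unfolding similar_mat_def similar_mat_wit_def using minv[OF Z(2)[OF z0]] cc E
  by (intro exI[of _ "Z 0"] exI[of _ "minv (Z 0)"]) (auto simp: Let_def)
 thus ?thesis by (rule char_poly_similar)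
qed

section \<open>Hessenberg systems and scalar equations\<close>

text \<open>
  \<open>chain \<phi> e b g l i\<close> is the coefficient of \<open>\<phi>\<^sup>i y\<^sup>(\<^sup>i\<^sup>)\<close> in the \<open>l\<close>-th function
  \<open>u\<^sub>l\<close> obtained from \<open>u\<^sub>0 = y\<close> by solving \<open>\<phi> u\<^sub>l' = (\<Sum>j\<le>l. b\<^sub>l\<^sub>j u\<^sub>j) + g\<^sub>l u\<^sub>l\<^sub>+\<^sub>1\<close>
  for \<open>u\<^sub>l\<^sub>+\<^sub>1\<close>, where \<open>e\<close> is the constant derivative of \<open>\<phi>\<close>. Regular points use
  \<open>\<phi> = 1\<close>, Fuchsian points \<open>\<phi> = z - a\<close>. A Hessenberg system becomes such a chain by reversing
  the order of the components.
\<close>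

fun chain :: "(complex => complex) => complex => (nat => nat => complex => complex) =>
  (nat => complex => complex) => nat => nat => complex => complex" where
 "chain \<phi> e b g 0 i = (%z. if i = 0 then 1 else 0)"
| "chain \<phi> e b g (Suc l) i = (%z. (\<phi> z * deriv (chain \<phi> e b g l i) z + e * of_nat i * chain \<phi> e b g l i z
   + (if i = 0 then 0 else chain \<phi> e b g l (i - 1) z) - (SUM j<=l. b l j z * chain \<phi> e b g j i z)) / g l z)"

abbreviation chain1 where "chain1 == chain (%_. 1) 0"

declare chain.simps(2) [simp del]

definition chain_apply where
 "chain_apply \<phi> e b g y l z = (SUM i<=l. chain \<phi> e b g l i z * (\<phi> z ^ i * (deriv ^^ i) y z))"

lemma chain_above: "l < i ==> chain \<phi> e b g l i = (%z. 0)"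
proof (induction l arbitrary: i rule: less_induct)
 case (less l)
 show ?case
 proof (cases l)
  case 0
  thus ?thesis using less.prems by simp
 next
  case (Suc k)
  have "chain \<phi> e b g k i = (%z. 0)" "chain \<phi> e b g k (i - 1) = (%z. 0)"
   using less.IH[of k i] less.IH[of k "i - 1"] less.prems Suc by auto
  moreover have "(SUM j<=k. b k j z * chain \<phi> e b g j i z) = 0" for z
   using less.IH less.prems Suc by (intro sum.neutral) auto
  ultimately show ?thesis using Suc less.prems by (simp add: chain.simps(2) del: One_nat_def)
 qed
qed

text \<open>Only the term that shifts the order of derivation contributes to the leading
  coefficient.\<close>

lemma chain_top: "chain \<phi> e b g l l z = (\<Prod>j<l. 1 / g j z)"
proof (induction l)
 case (Suc l)
 have "(SUM j<=l. b l j z * chain \<phi> e b g j (Suc l) z) = 0"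
  by (intro sum.neutral) (auto simp: chain_above)
 thus ?case using Suc by (simp add: chain.simps(2) chain_above)
qed auto

lemma chain_holomorphic:
 assumes "open U" "\<phi> hol U" "!!l j. l < N ==> j <= l ==> b l j hol U"
  "!!l. l < N ==> g l hol U" "!!l z. l < N ==> z : U ==> g l z ~= 0"
 shows "l <= N ==> chain \<phi> e b g l i hol U"
proof (induction l arbitrary: i rule: less_induct)
 case (less l)
 show ?case
 proof (cases l)
  case (Suc k)
  have k: "k < N" using Suc less.prems by simp
  have "!!j i. j <= k ==> chain \<phi> e b g j i hol U" using less Suc by auto
  hence "(%z. (\<phi> z * deriv (chain \<phi> e b g k i) z + e * of_nat i * chain \<phi> e b g k i z
   + (if i = 0 then 0 else chain \<phi> e b g k (i - 1) z) - (SUM j<=k. b k j z * chain \<phi> e b g j i z)) / g k z) hol U"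
   using assms k by (cases "i = 0") (auto intro!: holomorphic_intros holomorphic_deriv)
  thus ?thesis unfolding Suc chain.simps(2) .
 qed (simp add: holomorphic_on_const)
qed

lemma chain_apply_holomorphic:
 assumes "open U" "\<phi> hol U" "y hol U" "!!i. i <= l ==> chain \<phi> e b g l i hol U"
 shows "chain_apply \<phi> e b g y l hol U"
 unfolding chain_apply_def using assms
 by (intro holomorphic_on_sum holomorphic_on_mult holomorphic_on_power holomorphic_higher_deriv) auto

lemma chain_apply_0 [simp]: "chain_apply \<phi> e b g y 0 z = y z"
 by (simp add: chain_apply_def)

text \<open>The recursion of \<open>chain\<close> is the comparison of coefficients in this
  identity: differentiating the power of \<open>\<phi>\<close> yields the term with
  \<open>e * of_nat i\<close>, and differentiating the derivative of \<open>y\<close> raises its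
  order by one.\<close>

lemma chain_apply_step:
 assumes U: "open U" "z : U" and \<phi>: "!!z. z : U ==> (\<phi> hfd e) (at z)" and y: "y hol U"
  and c: "!!i. i <= l ==> chain \<phi> e b g l i hol U" and g: "g l z ~= 0"
 shows "g l z * chain_apply \<phi> e b g y (Suc l) z
  = \<phi> z * deriv (chain_apply \<phi> e b g y l) z - (SUM j<=l. b l j z * chain_apply \<phi> e b g y j z)"
proof -
 let ?c = "chain \<phi> e b g"
 let ?d = "%i. \<phi> z ^ i * (deriv ^^ i) y z"
 have dy: "((deriv ^^ i) y hfd (deriv ^^ Suc i) y z) (at z)" for i
  using holomorphic_higher_deriv[OF y U(1), of i] U by (simp add: holomorphic_derivI)
 have dc: "(?c l i hfd deriv (?c l i) z) (at z)" if "i <= l" for i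
  using c[OF that] U by (simp add: holomorphic_derivI)
 have dp: "((%z. \<phi> z ^ i * (deriv ^^ i) y z) hfd
   (of_nat i * (e * \<phi> z ^ (i - 1)) * (deriv ^^ i) y z + (deriv ^^ Suc i) y z * \<phi> z ^ i)) (at z)" for i
  by (rule DERIV_cong[OF DERIV_mult[OF DERIV_power[OF \<phi>[OF U(2)], of i] dy]]) simp
 have "((%z. chain_apply \<phi> e b g y l z) hfd
   (SUM i<=l. deriv (?c l i) z * ?d i + (of_nat i * (e * \<phi> z ^ (i - 1)) * (deriv ^^ i) y z + (deriv ^^ Suc i) y z * \<phi> z ^ i) * ?c l i z)) (at z)"
  unfolding chain_apply_def by (intro DERIV_sum DERIV_mult dc dp) auto
 hence "\<phi> z * deriv (chain_apply \<phi> e b g y l) z = \<phi> z *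
   (SUM i<=l. deriv (?c l i) z * ?d i + (of_nat i * (e * \<phi> z ^ (i - 1)) * (deriv ^^ i) y z + (deriv ^^ Suc i) y z * \<phi> z ^ i) * ?c l i z)"
  by (simp add: DERIV_imp_deriv)
 also have "... = (SUM i<=l. (\<phi> z * deriv (?c l i) z + e * of_nat i * ?c l i z) * ?d i + ?c l i z * ?d (Suc i))"
 proof -
  have *: "of_nat i * (e * (\<phi> z * \<phi> z ^ (i - 1))) = of_nat i * (e * \<phi> z ^ i)" for i
   by (cases i) auto
  have "\<phi> z * (deriv (?c l i) z * ?d i + (of_nat i * (e * \<phi> z ^ (i - 1)) * (deriv ^^ i) y z + (deriv ^^ Suc i) y z * \<phi> z ^ i) * ?c l i z)
   = \<phi> z * deriv (?c l i) z * ?d i + (of_nat i * (e * (\<phi> z * \<phi> z ^ (i - 1)))) * (deriv ^^ i) y z * ?c l i z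
     + ?c l i z * ?d (Suc i)" for i
   by (simp add: algebra_simps)
  thus ?thesis unfolding sum_distrib_left * by (intro sum.cong) (simp_all add: algebra_simps)
 qed
 also have "... = (SUM i<=l. (\<phi> z * deriv (?c l i) z + e * of_nat i * ?c l i z) * ?d i) + (SUM i<=l. ?c l i z * ?d (Suc i))"
  by (rule sum.distrib)
 also have "(SUM i<=l. (\<phi> z * deriv (?c l i) z + e * of_nat i * ?c l i z) * ?d i)
   = (SUM i<=Suc l. (\<phi> z * deriv (?c l i) z + e * of_nat i * ?c l i z) * ?d i)"
  by (simp add: chain_above)
 also have "(SUM i<=l. ?c l i z * ?d (Suc i)) = (SUM i<=Suc l. (if i = 0 then 0 else ?c l (i - 1) z) * ?d i)"
  by (subst sum.atMost_Suc_shift) simp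
 finally have 1: "\<phi> z * deriv (chain_apply \<phi> e b g y l) z
   = (SUM i<=Suc l. (\<phi> z * deriv (?c l i) z + e * of_nat i * ?c l i z) * ?d i)
    + (SUM i<=Suc l. (if i = 0 then 0 else ?c l (i - 1) z) * ?d i)" .
 have ext: "chain_apply \<phi> e b g y j z = (SUM i<=Suc l. ?c j i z * ?d i)" if "j <= l" for j
  unfolding chain_apply_def using that by (intro sum.mono_neutral_left) (auto simp: chain_above)
 have "(SUM j<=l. b l j z * chain_apply \<phi> e b g y j z) = (SUM j<=l. SUM i<=Suc l. b l j z * ?c j i z * ?d i)"
 proof (intro sum.cong refl)
  fix j assume "j : {..l}"
  hence "j <= l" by simp
  thus "b l j z * chain_apply \<phi> e b g y j z = (SUM i<=Suc l. b l j z * ?c j i z * ?d i)"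
   by (simp only: ext sum_distrib_left mult.assoc)
 qed
 also have "... = (SUM i<=Suc l. (SUM j<=l. b l j z * ?c j i z) * ?d i)"
  unfolding sum_distrib_right by (rule sum.swap)
 finally have 2: "(SUM j<=l. b l j z * chain_apply \<phi> e b g y j z) = (SUM i<=Suc l. (SUM j<=l. b l j z * ?c j i z) * ?d i)" .
 have "g l z * chain_apply \<phi> e b g y (Suc l) z = (SUM i<=Suc l. g l z * ?c (Suc l) i z * ?d i)"
  unfolding chain_apply_def sum_distrib_left by (intro sum.cong) (simp_all add: mult.assoc)
 also have "... = (SUM i<=Suc l. (\<phi> z * deriv (?c l i) z + e * of_nat i * ?c l i z) * ?d i
    + (if i = 0 then 0 else ?c l (i - 1) z) * ?d i - (SUM j<=l. b l j z * ?c j i z) * ?d i)"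
 proof (intro sum.cong refl)
  fix i
  have gc: "g l z * ?c (Suc l) i z = \<phi> z * deriv (?c l i) z + e * of_nat i * ?c l i z
    + (if i = 0 then 0 else ?c l (i - 1) z) - (SUM j<=l. b l j z * ?c j i z)"
   using g by (simp add: chain.simps(2))
  show "g l z * ?c (Suc l) i z * ?d i = (\<phi> z * deriv (?c l i) z + e * of_nat i * ?c l i z) * ?d i
    + (if i = 0 then 0 else ?c l (i - 1) z) * ?d i - (SUM j<=l. b l j z * ?c j i z) * ?d i"
   unfolding gc by (simp only: distrib_right left_diff_distrib)
 qed
 also have "... = \<phi> z * deriv (chain_apply \<phi> e b g y l) z - (SUM j<=l. b l j z * chain_apply \<phi> e b g y j z)"
  unfolding 1 2 sum_subtractf sum.distrib ..
 finally show ?thesis .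
qed

text \<open>As \<open>g l\<close> has no zeros, each step determines the next function, so
  everything is generated by \<open>u 0\<close>.\<close>

lemma chain_apply_unique:
 assumes U: "open U" and \<phi>: "!!z. z : U ==> (\<phi> hfd e) (at z)" and y: "u 0 hol U"
  and c: "!!l i. l < N ==> chain \<phi> e b g l i hol U" and g: "!!l z. l < N ==> z : U ==> g l z ~= 0"
  and u: "!!l z. l < N ==> z : U ==> g l z * u (Suc l) z = \<phi> z * deriv (u l) z - (SUM j<=l. b l j z * u j z)"
 shows "l <= N ==> z : U ==> u l z = chain_apply \<phi> e b g (u 0) l z"
proof (induction l arbitrary: z rule: less_induct)
 case (less l)
 show ?case
 proof (cases l)
  case (Suc k)
  have k: "k < N" using Suc less.prems by simp
  have IH: "!!j z. j <= k ==> z : U ==> u j z = chain_apply \<phi> e b g (u 0) j z" using less Suc by auto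
  have "deriv (u k) z = deriv (chain_apply \<phi> e b g (u 0) k) z"
   using IH[of k] U less.prems(2) by (intro deriv_cong_ev) (auto simp: eventually_nhds)
  moreover have "(SUM j<=k. b k j z * u j z) = (SUM j<=k. b k j z * chain_apply \<phi> e b g (u 0) j z)"
   using IH less.prems(2) by (intro sum.cong) auto
  ultimately have "g k z * u (Suc k) z = g k z * chain_apply \<phi> e b g (u 0) (Suc k) z"
   unfolding u[OF k less.prems(2)]
   using chain_apply_step[OF U less.prems(2) \<phi> y c[OF k] g[OF k less.prems(2)]] by simp
  thus ?thesis using g[OF k less.prems(2)] Suc by simp
 qed simp
qed

lemma chain_cong:
 assumes U: "open U" and b: "!!l j z. l < N ==> j <= l ==> z : U ==> b l j z = b' l j z"
  and g: "!!l z. l < N ==> z : U ==> g l z = g' l z"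
 shows "l <= N ==> z : U ==> chain \<phi> e b g l i z = chain \<phi> e b' g' l i z"
proof (induction l arbitrary: i z rule: less_induct)
 case (less l)
 show ?case
 proof (cases l)
  case (Suc k)
  have k: "k < N" using Suc less.prems by simp
  have IH: "!!j i z. j <= k ==> z : U ==> chain \<phi> e b g j i z = chain \<phi> e b' g' j i z" using less Suc by auto
  have "deriv (chain \<phi> e b g k i) z = deriv (chain \<phi> e b' g' k i) z"
   using IH[of k] U less.prems(2) by (intro deriv_cong_ev) (auto simp: eventually_nhds)
  moreover have "(SUM j<=k. b k j z * chain \<phi> e b g j i z) = (SUM j<=k. b' k j z * chain \<phi> e b' g' j i z)"
   using IH less.prems(2) b[OF k] by (intro sum.cong) auto
  ultimately show ?thesis using IH less.prems(2) g[OF k] Suc by (simp add: chain.simps(2))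
 qed simp
qed

text \<open>Multiplying each equation of the chain by \<open>z - a\<close> replaces
  \<open>\<phi> = 1\<close> by \<open>\<phi> = z - a\<close> without changing the functions.
  Comparing coefficients of the plain derivatives gives the factor \<open>(z - a) ^ i\<close>, from
  which the Fuchsian form of the scalar equation is read off.\<close>

lemma chain_euler:
 assumes U: "open U" "a ~: U" and b: "!!l j z. l < N ==> j <= l ==> z : U ==> b' l j z = (z - a) * b l j z"
  and g: "!!l z. l < N ==> z : U ==> g' l z = (z - a) * g l z"
  and c: "!!l i. l < N ==> chain (%z. z - a) 1 b' g' l i hol U"
 shows "l <= N ==> z : U ==> chain1 b g l i z = chain (%z. z - a) 1 b' g' l i z * (z - a) ^ i"
proof (induction l arbitrary: i z rule: less_induct)
 case (less l)
 have za: "z - a ~= 0" using U less.prems by auto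
 show ?case
 proof (cases l)
  case (Suc k)
  let ?c = "chain (%z. z - a) 1 b' g'" and ?L = "chain1 b g"
  have k: "k < N" using Suc less.prems by simp
  have IH: "!!j i z. j <= k ==> z : U ==> ?L j i z = ?c j i z * (z - a) ^ i" using less Suc by auto
  have "deriv (?L k i) z = deriv (%z. ?c k i z * (z - a) ^ i) z"
   using IH[of k] U less.prems(2) by (intro deriv_cong_ev) (auto simp: eventually_nhds)
  also have "... = deriv (?c k i) z * (z - a) ^ i + of_nat i * (z - a) ^ (i - 1) * ?c k i z"
  proof (rule DERIV_imp_deriv)
   have "(?c k i hfd deriv (?c k i) z) (at z)"
    by (rule holomorphic_derivI[OF c[OF k] U(1) less.prems(2)])
   moreover have "((%z. (z - a) ^ i) hfd of_nat i * (z - a) ^ (i - 1)) (at z)"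
    by (auto intro!: derivative_eq_intros)
   ultimately show "((%z. ?c k i z * (z - a) ^ i) hfd
     deriv (?c k i) z * (z - a) ^ i + of_nat i * (z - a) ^ (i - 1) * ?c k i z) (at z)"
    by (rule DERIV_mult)
  qed
  finally have d0: "deriv (?L k i) z = deriv (?c k i) z * (z - a) ^ i + of_nat i * (z - a) ^ (i - 1) * ?c k i z" .
  have e: "(z - a) * (of_nat i * (z - a) ^ (i - 1)) = of_nat i * (z - a) ^ i" by (cases i) auto
  have "(z - a) * deriv (?L k i) z = (z - a) * deriv (?c k i) z * (z - a) ^ i + (z - a) * (of_nat i * (z - a) ^ (i - 1)) * ?c k i z"
   unfolding d0 by (simp only: distrib_left mult_ac)
  hence d: "(z - a) * deriv (?L k i) z = ((z - a) * deriv (?c k i) z + of_nat i * ?c k i z) * (z - a) ^ i"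
   unfolding e by (simp only: distrib_left mult_ac)
  have s: "(z - a) * (SUM j<=k. b k j z * ?L j i z) = (SUM j<=k. b' k j z * ?c j i z) * (z - a) ^ i"
   unfolding sum_distrib_left sum_distrib_right
   using IH less.prems(2) b[OF k] by (intro sum.cong) (auto simp: mult_ac)
  have i: "(z - a) * (if i = 0 then 0 else ?L k (i - 1) z) = (if i = 0 then 0 else ?c k (i - 1) z) * (z - a) ^ i"
   using IH[of k] less.prems(2) by (cases i) auto
  have "?L (Suc k) i z = ((z - a) * deriv (?L k i) z + (z - a) * (if i = 0 then 0 else ?L k (i - 1) z)
    - (z - a) * (SUM j<=k. b k j z * ?L j i z)) / g' k z"
   unfolding g[OF k less.prems(2)] using za by (simp add: chain.simps(2) flip: distrib_left right_diff_distrib)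
  also have "... = ?c (Suc k) i z * (z - a) ^ i"
   unfolding d s i by (simp add: chain.simps(2) ring_distribs diff_divide_distrib add_divide_distrib)
  finally show ?thesis unfolding Suc .
 qed simp
qed

lemma falling_poly_Suc: "falling_poly (Suc i) = falling_poly i * [:- of_nat i, 1:]"
 by (simp add: falling_poly_def)

text \<open>On \<open>z - a\<close> to the power \<open>x\<close>, the operator with coefficient
  \<open>\<phi> ^ i\<close> and derivative of order \<open>i\<close> acts as the falling factorial
  of \<open>x\<close> of order \<open>i\<close>, and the Euler operator as \<open>x\<close>. At
  \<open>z = a\<close> the derivatives of the coefficients drop out with \<open>\<phi>\<close>, so
  the chain step becomes a recursion of polynomials in \<open>x\<close>.\<close>

lemma chain_indicial:
 assumes U: "open U" "a : U" and g: "!!l. l < N ==> g l a ~= 0" and l: "l < N"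
 shows "psmult (g l a) (SUM i<=Suc l. psmult (chain (%z. z - a) 1 b g (Suc l) i a) (falling_poly i))
  = [:0, 1:] * (SUM i<=l. psmult (chain (%z. z - a) 1 b g l i a) (falling_poly i))
   - (SUM j<=l. psmult (b l j a) (SUM i<=j. psmult (chain (%z. z - a) 1 b g j i a) (falling_poly i)))"
proof -
 let ?c = "%l i. chain (%z. z - a) 1 b g l i a"
 have x: "[:0, 1:] * falling_poly i = falling_poly (Suc i) + psmult (of_nat i) (falling_poly i)" for i
  unfolding falling_poly_Suc by simp
 have "[:0, 1:] * (SUM i<=l. psmult (?c l i) (falling_poly i))
   = (SUM i<=l. psmult (?c l i) ([:0, 1:] * falling_poly i))"
  unfolding sum_distrib_left by (intro sum.cong) (auto simp del: mult_pCons_left)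
 also have "... = (SUM i<=l. psmult (?c l i) (falling_poly (Suc i))) + (SUM i<=l. psmult (of_nat i * ?c l i) (falling_poly i))"
  unfolding x smult_add_right sum.distrib by (simp add: mult.commute)
 also have "(SUM i<=l. psmult (?c l i) (falling_poly (Suc i)))
   = (SUM i<=Suc l. psmult (if i = 0 then 0 else ?c l (i - 1)) (falling_poly i))"
  by (subst sum.atMost_Suc_shift) simp
 also have "(SUM i<=l. psmult (of_nat i * ?c l i) (falling_poly i)) = (SUM i<=Suc l. psmult (of_nat i * ?c l i) (falling_poly i))"
  by (simp add: chain_above)
 finally have 1: "[:0, 1:] * (SUM i<=l. psmult (?c l i) (falling_poly i)) = (SUM i<=Suc l. psmult (if i = 0 then 0 else ?c l (i - 1)) (falling_poly i))
   + (SUM i<=Suc l. psmult (of_nat i * ?c l i) (falling_poly i))" .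
 have ext: "(SUM i<=j. psmult (?c j i) (falling_poly i)) = (SUM i<=Suc l. psmult (?c j i) (falling_poly i))" if "j <= l" for j
  using that by (intro sum.mono_neutral_left) (auto simp: chain_above)
 have "(SUM j<=l. psmult (b l j a) (SUM i<=j. psmult (?c j i) (falling_poly i)))
   = (SUM j<=l. SUM i<=Suc l. psmult (b l j a * ?c j i) (falling_poly i))"
 proof (intro sum.cong refl)
  fix j assume "j : {..l}"
  hence "j <= l" by simp
  thus "psmult (b l j a) (SUM i<=j. psmult (?c j i) (falling_poly i))
    = (SUM i<=Suc l. psmult (b l j a * ?c j i) (falling_poly i))"
   by (simp only: ext smult_sum2 smult_smult)
 qed
 also have "... = (SUM i<=Suc l. psmult (SUM j<=l. b l j a * ?c j i) (falling_poly i))"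
  unfolding smult_sum by (rule sum.swap)
 finally have 2: "(SUM j<=l. psmult (b l j a) (SUM i<=j. psmult (?c j i) (falling_poly i)))
   = (SUM i<=Suc l. psmult (SUM j<=l. b l j a * ?c j i) (falling_poly i))" .
 have "psmult (g l a) (SUM i<=Suc l. psmult (?c (Suc l) i) (falling_poly i))
   = (SUM i<=Suc l. psmult (g l a * ?c (Suc l) i) (falling_poly i))"
  unfolding smult_sum2 by (simp del: sum.atMost_Suc atMost_Suc)
 also have "... = (SUM i<=Suc l. psmult (if i = 0 then 0 else ?c l (i - 1)) (falling_poly i)
   + psmult (of_nat i * ?c l i) (falling_poly i) - psmult (SUM j<=l. b l j a * ?c j i) (falling_poly i))"
  unfolding smult_add_left[symmetric] smult_diff_left[symmetric]
  using g[OF l] by (intro sum.cong refl arg_cong2[where f=psmult]) (simp add: chain.simps(2))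
 finally show ?thesis unfolding 1 2 sum_subtractf sum.distrib .
qed

text \<open>The unipotent matrix \<open>X\<close> has \<open>v\<close> in reversed order as its last
  column. By the recursion, the last column of the characteristic matrix times \<open>X\<close>
  vanishes except for its top entry. The remaining minor is triangular with the entries
  \<open>- ga\<close> on its diagonal, and its sign cancels that of the cofactor.\<close>

lemma hessenberg_char_poly:
 fixes B :: "complex mat" and v :: "nat => complex poly"
 assumes B: "B : sq_mat n" and n: "n > 0" and v0: "v 0 = 1"
  and v: "!!l. l < n ==> psmult (ga l) (v (Suc l)) = [:0, 1:] * v l - (SUM j<=l. psmult (B $$ (n - 1 - l, n - 1 - j)) (v j))"
  and hess: "!!k. 0 < k ==> k < n ==> B $$ (k, k - 1) = ga (n - 1 - k)" "!!k j. k < n ==> j + 1 < k ==> B $$ (k,j) = 0"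
 shows "char_poly B = psmult (\<Prod>l<n. ga l) (v n)"
proof -
 let ?H = "char_poly_matrix B"
 have H: "?H : sq_mat n" using B by simp
 have He: "?H $$ (k,j) = (if k = j then [:0, 1:] else 0) - [:B $$ (k,j):]" if "k < n" "j < n" for k j
  using that B by (auto simp: char_poly_matrix_def)
 define X where "X = Matrix.mat n n (%(k,j). if j = n - 1 then v (n - 1 - k) else if k = j then 1 else 0)"
 have X: "X : sq_mat n" by (simp add: X_def)
 have "upper_triangular X" unfolding X_def using n by (auto intro!: upper_triangularI)
 hence "det X = prod_list (diag_mat X)" using det_upper_triangular X by blast
 also have "diag_mat X = map (%_. 1) [0..<n]" using n v0 by (auto simp: diag_mat_def X_def intro!: map_cong)
 also have "prod_list (map (%_. 1 :: complex poly) [0..<n]) = 1" by (induction n) auto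
 finally have dX: "det X = 1" .
 define K where "K = ?H * X"
 have K: "K : sq_mat n" using H X by (simp add: K_def)
 have n1: "n - 1 < n" using n by simp
 have Kl: "K $$ (k, n - 1) = (if k = 0 then psmult (ga (n - 1)) (v n) else 0)" if k: "k < n" for k
 proof -
  define l where "l = n - 1 - k"
  have l: "l < n" "k = n - 1 - l" using k by (auto simp: l_def)
  have "K $$ (k, n - 1) = (\<Sum>j<n. ?H $$ (k,j) * v (n - 1 - j))"
   unfolding K_def mult_mat_entry[OF H X k n1] by (intro sum.cong refl) (use n in "simp add: X_def")
  also have "... = (\<Sum>j<n. ?H $$ (k, n - 1 - j) * v j)"
   by (subst sum.nat_diff_reindex[symmetric]) (intro sum.cong, auto)
  also have "... = (\<Sum>j<n. (if j = l then [:0,1:] * v j else 0)) - (\<Sum>j<n. psmult (B $$ (k, n - 1 - j)) (v j))"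
   unfolding sum_subtractf[symmetric]
  proof (intro sum.cong refl)
   fix j assume "j : {..<n}"
   hence j: "n - 1 - j < n" "k = n - 1 - j \<longleftrightarrow> j = l" using k by (auto simp: l_def)
   have c: "[:c:] * p = psmult c p" for c and p :: "complex poly" by simp
   show "?H $$ (k, n - 1 - j) * v j = (if j = l then [:0,1:] * v j else 0) - psmult (B $$ (k, n - 1 - j)) (v j)"
    unfolding He[OF k j(1)] j(2) left_diff_distrib c by (cases "j = l") (simp_all only: if_True if_False mult_zero_left simp_thms)
  qed
  also have "(\<Sum>j<n. (if j = l then [:0,1:] * v j else 0)) = [:0,1:] * v l" using l by (simp del: mult_pCons_left)
  also have "(\<Sum>j<n. psmult (B $$ (k, n - 1 - j)) (v j))
    = (SUM j<=l. psmult (B $$ (n - 1 - l, n - 1 - j)) (v j)) + (if k = 0 then 0 else psmult (ga l) (v (Suc l)))"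
  proof (cases "k = 0")
   case True
   hence "{..<n} = {..l}" using l k by auto
   thus ?thesis using True l by simp
  next
   case False
   have 2: "B $$ (k, n - 1 - Suc l) = ga l"
   proof -
    have "n - 1 - Suc l = k - 1" "n - 1 - k = l" "0 < k" using k False by (auto simp: l_def)
    thus ?thesis using hess(1)[of k] k by simp
   qed
   have "(\<Sum>j<n. psmult (B $$ (k, n - 1 - j)) (v j)) = (SUM j<=Suc l. psmult (B $$ (k, n - 1 - j)) (v j))"
   proof (rule sum.mono_neutral_right)
    show "ALL j:{..<n} - {..Suc l}. psmult (B $$ (k, n - 1 - j)) (v j) = 0"
     using hess(2)[OF k] l by auto
   qed (use False k in "auto simp: l_def")
   also have "... = (SUM j<=l. psmult (B $$ (k, n - 1 - j)) (v j)) + psmult (B $$ (k, n - 1 - Suc l)) (v (Suc l))"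
    by (rule sum.atMost_Suc)
   finally show ?thesis unfolding 2 l(2)[symmetric] if_not_P[OF False] .
  qed
  finally have "K $$ (k, n - 1) = [:0,1:] * v l - ((SUM j<=l. psmult (B $$ (n - 1 - l, n - 1 - j)) (v j)) + (if k = 0 then 0 else psmult (ga l) (v (Suc l))))" .
  also have "... = psmult (ga l) (v (Suc l)) - (if k = 0 then 0 else psmult (ga l) (v (Suc l)))"
   unfolding v[OF l(1)] by (rule diff_diff_eq[symmetric])
  finally have fin: "K $$ (k, n - 1) = psmult (ga l) (v (Suc l)) - (if k = 0 then 0 else psmult (ga l) (v (Suc l)))" .
  show ?thesis
  proof (cases "k = 0")
   case True
   hence "l = n - 1" "Suc l = n" using n by (auto simp: l_def)
   thus ?thesis using fin True by simp
  qed (use fin in simp)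
 qed
 have Ko: "K $$ (k,j) = ?H $$ (k,j)" if "k < n" "j < n - 1" for k j
 proof -
  have "K $$ (k,j) = (\<Sum>i<n. ?H $$ (k,i) * (if i = j then 1 else 0))"
   unfolding K_def mult_mat_entry[OF H X that(1) less_trans[OF that(2) n1]]
   by (intro sum.cong refl) (use that in "simp add: X_def")
  thus ?thesis using that by (simp add: if_distrib[of "%x. _ * x"] cong: if_cong)
 qed
 have "det K = (\<Sum>i<n. K $$ (i,n - 1) * cofactor K i (n - 1))" by (rule laplace_expansion_column[OF K n1])
 also have "... = (\<Sum>i<n. if i = 0 then psmult (ga (n - 1)) (v n) * cofactor K 0 (n - 1) else 0)"
  by (intro sum.cong refl) (use Kl in "simp del: One_nat_def")
 also have "... = psmult (ga (n - 1)) (v n) * cofactor K 0 (n - 1)" using n by simp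
 also have "cofactor K 0 (n - 1) = [:\<Prod>l<n - 1. ga l:]"
 proof -
  define D where "D = mat_delete K 0 (n - 1)"
  have D: "D : carrier_mat (n - 1) (n - 1)" using mat_delete_carrier[OF K] by (simp add: D_def)
  have De: "D $$ (i,j) = ?H $$ (Suc i, j)" if "i < n - 1" "j < n - 1" for i j
   using that K Ko[of "Suc i" j] by (simp add: D_def mat_delete_def)
  have "upper_triangular D"
  proof (rule upper_triangularI)
   fix i j assume "j < i" "i < dim_row D"
   hence ij: "j < i" "i < n - 1" using D by auto
   thus "D $$ (i,j) = 0" using De[of i j] He[of "Suc i" j] hess(2)[of "Suc i" j] by simp
  qed
  hence "det D = prod_list (diag_mat D)" using det_upper_triangular D by blast
  also have "... = (\<Prod>i<n - 1. D $$ (i,i))" using D by (simp add: diag_mat_def interv_sum_list_conv_sum_set_nat prod.list_conv_set_nth lessThan_atLeast0)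
  also have "... = (\<Prod>i<n - 1. - [:ga (n - 1 - Suc i):])"
  proof (intro prod.cong refl)
   fix i assume "i : {..<n - 1}"
   thus "D $$ (i,i) = - [:ga (n - 1 - Suc i):]" using De[of i i] He[of "Suc i" i] hess(1)[of "Suc i"] by simp
  qed
  also have "... = (\<Prod>i<n - 1. - [:ga i:])" by (rule prod.nat_diff_reindex)
  also have "... = (-1) ^ (n - 1) * [:\<Prod>l<n - 1. ga l:]"
  proof (induction "n - 1" arbitrary: n)
   show "(\<Prod>i<k. - [:ga i:]) = (- 1) ^ k * [:\<Prod>l<k. ga l:]" for k
    by (induction k) (auto simp: mult_ac)
   thus "(\<Prod>i<n - 1. - [:ga i:]) = (- 1) ^ (n - 1) * [:\<Prod>l<n - 1. ga l:]" for n by blast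
  qed
  finally show ?thesis by (simp add: cofactor_def D_def power_add[symmetric] flip: mult.assoc)
 qed
 finally have "det K = psmult (ga (n - 1)) (v n) * [:\<Prod>l<n - 1. ga l:]" .
 also have "... = psmult (\<Prod>l<n. ga l) (v n)"
  using n by (cases n) (auto simp: mult.commute)
 finally have "det K = psmult (\<Prod>l<n. ga l) (v n)" .
 moreover have "det K = det ?H" unfolding K_def det_mult[OF H X] dX by simp
 ultimately show ?thesis by (simp add: char_poly_def)
qed

section \<open>Exponents as roots of characteristic polynomials\<close>

lemma proots_linear_factors: "proots (\<Prod>x\<in>#R. [:- x, 1:]) = (R :: complex multiset)"
proof (induction R)
 case (add x R)
 have "(\<Prod>x\<in>#R. [:- x, 1:]) ~= 0" by (auto simp: prod_mset_zero_iff)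
 hence "proots ([:- x, 1:] * (\<Prod>x\<in>#R. [:- x, 1:])) = {#x#} + R"
  using add by (subst proots_mult) (auto simp del: mult_pCons_left)
 thus ?case by (simp del: mult_pCons_left)
qed simp

lemma pcompose_linear_factors:
 "pcompose (\<Prod>x\<in>#R. [:- x, 1:]) [:c, 1:] = (\<Prod>x\<in>#image_mset (%x. x - c) R. [:- x, 1:] :: complex poly)"
 by (induction R) (auto simp: pcompose_mult pcompose_pCons simp del: mult_pCons_left)

text \<open>The characteristic polynomial is composed with \<open>[:c, 1:]\<close>; since it splits
  over the complex numbers, the roots are shifted factor by factor.\<close>

lemma proots_char_poly_shift:
 fixes B :: "complex mat"
 assumes B: "B : sq_mat n"
 shows "proots (char_poly (B - c \<cdot> 1\<^sub>m n)) = image_mset (%x. x - c) (proots (char_poly B))"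
proof -
 let ?C = "B - c \<cdot> 1\<^sub>m n"
 have C: "?C : sq_mat n" using B by auto
 have "poly (char_poly ?C) x = poly (pcompose (char_poly B) [:c, 1:]) x" for x
 proof -
  have "char_matrix ?C x = char_matrix B (c + x)"
   using B C by (intro eq_matI) (auto simp: char_matrix_def)
  hence "poly (char_poly ?C) x = poly (char_poly B) (c + x)"
   using char_poly_matrix[OF C] char_poly_matrix[OF B] by metis
  thus ?thesis by (simp add: poly_pcompose)
 qed
 hence e: "char_poly ?C = pcompose (char_poly B) [:c, 1:]"
  by (simp add: poly_eq_poly_eq_iff[symmetric] fun_eq_iff)
 have m: "lead_coeff (char_poly B) = 1" using degree_monic_char_poly[OF B] by simp
 hence "char_poly B ~= 0" by auto
 from alg_closed_imp_factorization[OF this] obtain R where R: "char_poly B = (\<Prod>x\<in>#R. [:- x, 1:])"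
  using m by auto
 show ?thesis unfolding e R pcompose_linear_factors proots_linear_factors ..
qed

lemma eigenvalue_iff_proots:
 fixes B :: "complex mat"
 assumes B: "B : sq_mat n"
 shows "eigenvalue B x \<longleftrightarrow> x \<in># proots (char_poly B)"
proof -
 have "lead_coeff (char_poly B) = 1" using degree_monic_char_poly[OF B] by simp
 hence "char_poly B ~= 0" by auto
 thus ?thesis using eigenvalue_root_char_poly[OF B] by (simp add: set_count_proots)
qed

lemma sum_falling_indicial:
 assumes "c n ~= 0"
 shows "(SUM i<=n. psmult (c i) (falling_poly i)) = psmult (c n) (indicial_poly n (%k. c (n - k) / c n))"
proof -
 have "(\<Sum>k=1..n. psmult (c (n - k)) (falling_poly (n - k))) = (\<Sum>i<n. psmult (c i) (falling_poly i))"
  using sum.nat_diff_reindex[of "%i. psmult (c i) (falling_poly i)" n] by (simp add: sum.atLeast1_atMost_eq)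
 thus ?thesis using assms
  by (simp add: indicial_poly_def smult_add_right smult_sum2 flip: lessThan_Suc_atMost)
qed

text \<open>The recursion of \<open>chain_indicial\<close> is the one that computes the
  characteristic polynomial of a Hessenberg matrix; dividing by the leading chain coefficient makes
  the result the monic indicial polynomial.\<close>

lemma euler_char_poly:
 assumes U: "open U" "a : U" and g: "!!l. l < n ==> g l a ~= 0" and n: "n > 0" and B: "B : sq_mat n"
  and Bb: "!!l j. l < n ==> j <= l ==> B $$ (n - 1 - l, n - 1 - j) = b l j a"
  and hess: "!!k. 0 < k ==> k < n ==> B $$ (k, k - 1) = g (n - 1 - k) a" "!!k j. k < n ==> j + 1 < k ==> B $$ (k,j) = 0"
 shows "char_poly B = indicial_poly n (%k. chain (%z. z - a) 1 b g n (n - k) a / chain (%z. z - a) 1 b g n n a)"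
proof -
 let ?c = "chain (%z. z - a) 1 b g"
 define v where "v l = (SUM i<=l. psmult (?c l i a) (falling_poly i))" for l
 have v0: "v 0 = 1" by (simp add: v_def falling_poly_def)
 have step: "psmult (g l a) (v (Suc l)) = [:0, 1:] * v l - (SUM j<=l. psmult (B $$ (n - 1 - l, n - 1 - j)) (v j))"
  if l: "l < n" for l
 proof -
  have "(SUM j<=l. psmult (B $$ (n - 1 - l, n - 1 - j)) (v j)) = (SUM j<=l. psmult (b l j a) (v j))"
   by (intro sum.cong refl) (use Bb[OF l] in simp)
  thus ?thesis using chain_indicial[where g=g and b=b, OF U g l] unfolding v_def by simp
 qed
 have t: "?c n n a = (\<Prod>l<n. 1 / g l a)" by (rule chain_top)
 have t1: "(\<Prod>l<n. g l a) * ?c n n a = 1" "?c n n a ~= 0"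
  unfolding t prod.distrib[symmetric] using g by auto
 have "char_poly B = psmult (\<Prod>l<n. g l a) (v n)"
  by (rule hessenberg_char_poly[where ga="%l. g l a", OF B n v0 step hess])
 also have "v n = psmult (?c n n a) (indicial_poly n (%k. ?c n (n - k) a / ?c n n a))"
  unfolding v_def by (rule sum_falling_indicial[of "%i. ?c n i a", OF t1(2)])
 finally show ?thesis using t1(1) by simp
qed

lemma row_times_inverse:
 assumes T: "T : GL n"
 shows "(ALL i<n. (\<Sum>j<n. be j * T $$ (j,i)) = ta i) \<longleftrightarrow> (ALL j<n. be j = (\<Sum>i<n. ta i * minv T $$ (i,j)))"
proof -
 have Tc: "T : sq_mat n" "minv T : sq_mat n" using T minv(4) by auto
 have 1: "(\<Sum>i<n. (\<Sum>j<n. x j * A $$ (j,i)) * B $$ (i,k)) = x k"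
  if AB: "A * B = 1\<^sub>m n" "A : sq_mat n" "B : sq_mat n" and k: "k < n" for x k and A B :: "complex mat"
 proof -
  have "(\<Sum>i<n. (\<Sum>j<n. x j * A $$ (j,i)) * B $$ (i,k)) = (\<Sum>i<n. \<Sum>j<n. x j * (A $$ (j,i) * B $$ (i,k)))"
   by (simp add: sum_distrib_right mult.assoc)
  also have "... = (\<Sum>j<n. x j * (\<Sum>i<n. A $$ (j,i) * B $$ (i,k)))"
   by (subst sum.swap) (simp add: sum_distrib_left)
  also have "... = (\<Sum>j<n. x j * (1\<^sub>m n $$ (j,k)))"
   unfolding AB(1)[symmetric] by (intro sum.cong refl) (use mult_mat_entry[OF AB(2,3) _ k] in simp)
  also have "... = (\<Sum>j<n. if j = k then x k else 0)" using k by (intro sum.cong) auto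
  finally show ?thesis using k by simp
 qed
 show ?thesis
 proof (intro iffI allI impI)
  fix k assume a: "ALL i<n. (\<Sum>j<n. be j * T $$ (j,i)) = ta i" and k: "k < n"
  have "be k = (\<Sum>i<n. (\<Sum>j<n. be j * T $$ (j,i)) * minv T $$ (i,k))" by (rule 1[OF minv(2)[OF T] Tc k, symmetric])
  thus "be k = (\<Sum>i<n. ta i * minv T $$ (i,k))" using a by simp
 next
  fix i assume a: "ALL j<n. be j = (\<Sum>i<n. ta i * minv T $$ (i,j))" and k: "i < n"
  have "(\<Sum>j<n. (\<Sum>i<n. ta i * minv T $$ (i,j)) * T $$ (j,i)) = ta i" by (rule 1[OF minv(3)[OF T] Tc(2,1) k])
  thus "(\<Sum>j<n. be j * T $$ (j,i)) = ta i" using a by simp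
 qed
qed

text \<open>In the last step of a chain the entries \<open>b N j\<close> enter linearly, through the
  matrix \<open>T\<close> of the earlier chain coefficients. \<open>T\<close> is triangular with
  nonzero diagonal, so prescribed monic coefficients \<open>Q\<close> determine the row uniquely and
  holomorphically. Only the rows below \<open>N\<close> influence \<open>T\<close>, hence one
  \<open>be\<close> serves for all \<open>b'\<close>.\<close>

lemma chain_closing_row:
 assumes V: "open V" and \<phi>: "\<phi> hol V"
  and b: "!!l j. l < N ==> j <= l ==> b l j hol V"
  and g: "!!l. l <= N ==> g l hol V" "!!l z. l <= N ==> z : V ==> g l z ~= 0"
  and Q: "!!i. i <= N ==> Q i hol V"
 shows "EX be. (ALL j<=N. be j hol V) & (ALL b' z. (ALL l<N. ALL j<=l. ALL z. b' l j z = b l j z) --> z : V -->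
  ((ALL i<=N. chain \<phi> e b' g (Suc N) i z = chain \<phi> e b' g (Suc N) (Suc N) z * Q i z) \<longleftrightarrow> (ALL j<=N. b' N j z = be j z)))"
proof -
 let ?n = "Suc N" and ?c = "chain \<phi> e b g"
 have hol: "?c l i hol V" if "l <= N" for l i
  by (rule chain_holomorphic[OF V \<phi> b, of N]) (use g that in auto)
 define T where "T z = Matrix.mat ?n ?n (%(j,i). ?c j i z)" for z
 have T: "T z : carrier_mat ?n ?n" for z by (simp add: T_def)
 have TGL: "T z : GL ?n" if z: "z : V" for z
 proof -
  have "det (T z) = prod_list (diag_mat (T z))"
   by (rule det_lower_triangular[OF _ T]) (auto simp: T_def chain_above)
  moreover have "0 ~: set (diag_mat (T z))"
   using g(2)[OF _ z] by (auto simp: diag_mat_def T_def chain_top)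
  ultimately have "det (T z) ~= 0" by (simp add: prod_list_zero_iff)
  thus ?thesis using T GL_iff_det by blast
 qed
 have Th: "mat_hol ?n T V" using hol by (auto simp: mat_holomorphic_on_def T_def)
 define D where "D i z = \<phi> z * deriv (?c N i) z + e * of_nat i * ?c N i z + (if i = 0 then 0 else ?c N (i - 1) z)" for i z
 define G where "G z = (\<Prod>j<N. 1 / g j z)" for z
 define ta where "ta i z = D i z - G z * Q i z" for i z
 have Dh: "D i hol V" for i
  unfolding D_def using hol[of N] \<phi> V by (cases "i = 0") (auto intro!: holomorphic_intros holomorphic_deriv)
 have tah: "ta i hol V" if "i <= N" for i
  unfolding ta_def G_def using Dh Q[OF that] g by (auto intro!: holomorphic_intros)
 define be where "be j z = (\<Sum>i<?n. ta i z * minv (T z) $$ (i,j))" for j z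
 have "be j hol V" if "j <= N" for j
  unfolding be_def using minv_holomorphic[OF Th TGL] tah that
  by (intro holomorphic_on_sum holomorphic_on_mult) (auto simp: mat_holomorphic_on_def)
 moreover have "(ALL i<=N. chain \<phi> e b' g ?n i z = chain \<phi> e b' g ?n ?n z * Q i z) \<longleftrightarrow> (ALL j<=N. b' N j z = be j z)"
  if b': "ALL l<N. ALL j<=l. ALL z. b' l j z = b l j z" and z: "z : V" for b' z
 proof -
  have c: "chain \<phi> e b' g l i = ?c l i" if "l <= N" for l i
   using chain_cong[OF open_UNIV, of N b' b g g l _ \<phi> e i] b' that by auto
  have gN: "g N z ~= 0" using g(2)[OF _ z] by simp
  have top: "chain \<phi> e b' g ?n ?n z = G z / g N z" by (simp add: chain_top G_def)
  have 1: "chain \<phi> e b' g ?n i z = (D i z - (SUM j<=N. b' N j z * ?c j i z)) / g N z" for i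
   by (simp add: chain.simps(2) D_def c)
  have q: "(x - s) / y = t / y * q \<longleftrightarrow> s = x - t * q" if "y ~= 0" for x s y t q :: complex
  proof -
   have "(x - s) / y = t / y * q \<longleftrightarrow> x - s = t * q" using that by simp
   thus ?thesis by (auto simp: algebra_simps)
  qed
  have 2: "(SUM j<=N. b' N j z * ?c j i z) = (\<Sum>j<?n. b' N j z * T z $$ (j,i))" if "i <= N" for i
   using that by (auto simp: T_def lessThan_Suc_atMost intro!: sum.cong)
  have "chain \<phi> e b' g ?n i z = chain \<phi> e b' g ?n ?n z * Q i z \<longleftrightarrow> (\<Sum>j<?n. b' N j z * T z $$ (j,i)) = ta i z"
   if "i <= N" for i
   unfolding top 1[of i] 2[OF that] ta_def by (rule q[OF gN])
  thus ?thesis using row_times_inverse[OF TGL[OF z], of "%j. b' N j z" "%i. ta i z"]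
   by (simp add: be_def less_Suc_eq_le)
 qed
 ultimately show ?thesis by (intro exI[of _ be]) blast
qed

section \<open>The change of coordinate at infinity\<close>

text \<open>
  The chain in the coordinate \<open>w = 1 / (z - a)\<close>, with \<open>u\<^sub>l\<close> rescaled by \<open>w powi (d l)\<close>.
\<close>

definition binf :: "int => complex => (nat => nat => complex => complex) => nat => nat => complex => complex" where
 "binf d a b l j w = (if l = j then of_int (d * int l) / w else 0) - w powi (d * (int l - int j) - 2) * b l j (a + 1 / w)"

definition ginf :: "int => complex => (nat => complex => complex) => nat => complex => complex" where
 "ginf d a g l w = - (w powi (- d - 2) * g l (a + 1 / w))"

text \<open>The rescaled functions satisfy the chain equations with \<open>binf\<close> and
  \<open>ginf\<close>: the factor \<open>- 1 / w ^ 2\<close> is the derivative of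
  \<open>a + 1 / w\<close>, and the extra diagonal term comes from differentiating the power of
  \<open>w\<close>. Uniqueness of the chain identifies them.\<close>

lemma chain_inversion:
 assumes U: "open U" and W: "open W" "!!w. w : W ==> w ~= 0 & a + 1 / w : U" and y: "y hol U"
  and c: "!!l i. l < N ==> chain1 b g l i hol U" and g: "!!l z. l < N ==> z : U ==> g l z ~= 0"
  and c': "!!l i. l < N ==> chain1 (binf d a b) (ginf d a g) l i hol W"
 shows "l <= N ==> w : W ==> w powi (d * int l) * chain_apply (%_. 1) 0 b g y l (a + 1 / w)
  = chain_apply (%_. 1) 0 (binf d a b) (ginf d a g) (%w. y (a + 1 / w)) l w"
proof -
 define F where "F = chain_apply (%_. 1) 0 b g y"
 define u where "u l w = w powi (d * int l) * F l (a + 1 / w)" for l w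
 have u0: "u 0 = (%w. y (a + 1 / w))" by (simp add: u_def F_def fun_eq_iff)
 have "(%w. y (a + 1 / w)) hol W"
  by (rule holomorphic_on_compose_gen[of "%w. a + 1 / w" W y U, unfolded o_def])
   (use y W(2) in "auto intro!: holomorphic_intros")
 hence hol0: "u 0 hol W" unfolding u0 .
 have step: "ginf d a g l w * u (Suc l) w = 1 * deriv (u l) w - (SUM j<=l. binf d a b l j w * u j w)"
  if l: "l < N" and w: "w : W" for l w
 proof -
  let ?z = "a + 1 / w"
  have w0: "w ~= 0" and z: "?z : U" using W(2)[OF w] by auto
  have F: "g l ?z * F (Suc l) ?z = 1 * deriv (F l) ?z - (SUM j<=l. b l j ?z * F j ?z)"
   unfolding F_def by (rule chain_apply_step[OF U z _ y c[OF l] g[OF l z]]) auto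
  have "F l hol U" unfolding F_def by (rule chain_apply_holomorphic[OF U _ y c[OF l]]) auto
  hence dF: "(F l hfd deriv (F l) ?z) (at ?z)" using U z by (rule holomorphic_derivI)
  have "((%w. a + 1 / w) hfd - (1 / w ^ 2)) (at w)"
   using w0 by (auto intro!: derivative_eq_intros simp: power2_eq_square)
  from DERIV_chain2[of "F l" _ "%w. a + 1 / w" w, OF dF this]
  have d1: "((%w. F l (a + 1 / w)) hfd deriv (F l) ?z * - (1 / w ^ 2)) (at w)" .
  have "((%w. w powi (d * int l)) hfd of_int (d * int l) * w powi (d * int l - 1)) (at w)"
   using w0 by (auto intro!: derivative_eq_intros)
  from DERIV_mult[OF this d1]
  have "deriv (u l) w = of_int (d * int l) * w powi (d * int l - 1) * F l ?z + deriv (F l) ?z * - (1 / w ^ 2) * w powi (d * int l)"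
   unfolding u_def by (rule DERIV_imp_deriv)
  also have "... = of_int (d * int l) / w * u l w - w powi (d * int l - 2) * deriv (F l) ?z"
   using w0 by (simp add: u_def power_int_diff power2_eq_square mult_ac)
  finally have du: "deriv (u l) w = of_int (d * int l) / w * u l w - w powi (d * int l - 2) * deriv (F l) ?z" .
  have "(SUM j<=l. binf d a b l j w * u j w) = (SUM j<=l. if j = l then of_int (d * int l) / w * u l w else 0)
    - (SUM j<=l. w powi (d * (int l - int j) - 2) * b l j ?z * u j w)"
   unfolding sum_subtractf[symmetric] by (intro sum.cong refl) (simp add: binf_def left_diff_distrib)
  also have "(SUM j<=l. if j = l then of_int (d * int l) / w * u l w else 0) = of_int (d * int l) / w * u l w" by simp
  also have "(SUM j<=l. w powi (d * (int l - int j) - 2) * b l j ?z * u j w) = (SUM j<=l. w powi (d * int l - 2) * (b l j ?z * F j ?z))"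
  proof (intro sum.cong refl)
   fix j
   have p: "w powi (d * (int l - int j) - 2) * w powi (d * int j) = w powi (d * int l - 2)"
    using w0 by (simp add: right_diff_distrib flip: power_int_add)
   show "w powi (d * (int l - int j) - 2) * b l j ?z * u j w = w powi (d * int l - 2) * (b l j ?z * F j ?z)"
    unfolding u_def p[symmetric] by (simp only: mult_ac)
  qed
  finally have s: "(SUM j<=l. binf d a b l j w * u j w)
    = of_int (d * int l) / w * u l w - w powi (d * int l - 2) * (SUM j<=l. b l j ?z * F j ?z)" by (simp add: sum_distrib_left)
  have p: "w powi (- d - 2) * w powi (d * int (Suc l)) = w powi (d * int l - 2)"
   using w0 by (simp add: algebra_simps flip: power_int_add)
  have "ginf d a g l w * u (Suc l) w = - (w powi (d * int l - 2) * (g l ?z * F (Suc l) ?z))"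
   unfolding u_def ginf_def p[symmetric] by (simp only: mult_minus_left mult_minus_right mult_ac)
  also have "... = 1 * deriv (u l) w - (SUM j<=l. binf d a b l j w * u j w)"
   unfolding F du s by (simp add: algebra_simps)
  finally show ?thesis .
 qed
 have gi: "ginf d a g l w ~= 0" if "l < N" "w : W" for l w
  using g[OF that(1), of "a + 1 / w"] W(2)[OF that(2)] by (simp add: ginf_def)
 have "u l w = chain_apply (%_. 1) 0 (binf d a b) (ginf d a g) (u 0) l w" if "l <= N" "w : W" for l w
  by (rule chain_apply_unique[OF W(1) _ hol0 c' gi step that]) auto
 thus "l <= N ==> w : W ==> w powi (d * int l) * chain_apply (%_. 1) 0 b g y l (a + 1 / w)
  = chain_apply (%_. 1) 0 (binf d a b) (ginf d a g) (%w. y (a + 1 / w)) l w" unfolding u0 by (simp add: u_def F_def)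
qed

lemma prod_inversion:
 fixes a :: "nat => complex"
 assumes "w ~= 0"
 shows "(\<Prod>k=1..m. c + 1 / w - a k) = (\<Prod>k=1..m. 1 + (c - a k) * w) / w ^ m"
proof -
 have "(\<Prod>k=1..m. c + 1 / w - a k) = (\<Prod>k=1..m. (1 + (c - a k) * w) / w)"
  using assms by (intro prod.cong refl) (simp add: field_simps)
 thus ?thesis by (simp add: prod_dividef)
qed

lemma poly_inversion:
 fixes P :: "complex poly"
 assumes "P = 0 | int (degree P) <= D"
 obtains R where "!!w. w ~= 0 ==> w powi D * poly P (c + 1 / w) = poly R w"
proof (cases "P = 0")
 case True
 thus ?thesis using that[of 0] by simp
next
 case False
 define S where "S = pcompose P [:c, 1:]"
 have deg: "degree S = degree P" by (simp add: S_def)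
 define R where "R = (SUM i<=degree S. monom (coeff S i) (nat D - i))"
 have D: "degree S <= nat D" "D = int (nat D)" using assms False deg by auto
 have "w powi D * poly P (c + 1 / w) = poly R w" if w: "w ~= 0" for w
 proof -
  have "poly P (c + 1 / w) = poly S (1 / w)" by (simp add: S_def poly_pcompose)
  also have "... = (SUM i<=degree S. coeff S i * (1 / w) ^ i)" by (rule poly_altdef)
  finally have "w powi D * poly P (c + 1 / w) = (SUM i<=degree S. w ^ nat D * (coeff S i * (1 / w) ^ i))"
   by (subst D(2)) (simp only: power_int_of_nat sum_distrib_left)
  also have "... = (SUM i<=degree S. coeff S i * w ^ (nat D - i))"
   using D(1) w by (intro sum.cong refl) (simp add: power_diff power_one_over)
  finally show ?thesis by (simp add: R_def poly_sum poly_monom)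
 qed
 thus ?thesis using that by blast
qed

text \<open>The reversed polynomial: \<open>w ^ m\<close> times the product of the factors
  \<open>z - a k\<close> at \<open>z = c + 1 / w\<close>. Its constant term is 1, so it has no zeros
  near \<open>w = 0\<close>.\<close>

definition pinf :: "nat => (nat => complex) => complex => complex poly" where
 "pinf m a c = (\<Prod>k=1..m. [:1, c - a k:])"

lemma poly_pinf: "poly (pinf m a c) w = (\<Prod>k=1..m. 1 + (c - a k) * w)"
 by (simp add: pinf_def poly_prod mult.commute)

text \<open>Both polynomials take the value 1 at \<open>w = 0\<close>.\<close>

lemma pinf_divides:
 obtains R where "!!w. poly (pinf m a c) w - (1 + c * w) ^ (m - 1) = w * poly R w"
proof -
 let ?P = "pinf m a c - [:1, c:] ^ (m - 1)"
 have "poly ?P 0 = 0" by (simp add: poly_pinf)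
 hence "[:0, 1:] dvd ?P" by (metis minus_zero poly_eq_0_iff_dvd)
 then obtain R where "?P = [:0, 1:] * R" by (elim dvdE)
 hence "poly ?P w = w * poly R w" for w by simp
 thus ?thesis using that[of R] by (simp add: mult.commute)
qed

text \<open>The pole \<open>d * l / w\<close> produced by the rescaling is cancelled by the leading
  part \<open>d * l * z ^ (m - 1)\<close> of the diagonal numerator, since the remaining difference
  is divisible by \<open>w\<close> by \<open>pinf_divides\<close>. The value
  \<open>d = m - 2\<close> makes the powers of \<open>w\<close> match.\<close>

lemma binf_eq:
 assumes w: "w ~= 0" "poly (pinf m a c) w ~= 0" and m: "m >= 1" and d: "d = int m - 2"
  and b: "b l j (c + 1 / w) = ((if l = j then of_int (d * int l) * (c + 1 / w) ^ (m - 1) else 0) + x) / (\<Prod>k=1..m. c + 1 / w - a k)"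
 shows "binf d c b l j w = ((if l = j then of_int (d * int l) * ((poly (pinf m a c) w - (1 + c * w) ^ (m - 1)) / w) else 0)
  - w powi (d * (1 + int l - int j)) * x) / poly (pinf m a c) w"
proof -
 let ?p = "poly (pinf m a c) w"
 have p: "(\<Prod>k=1..m. c + 1 / w - a k) = ?p / w ^ m" unfolding poly_pinf by (rule prod_inversion[OF w(1)])
 have e: "w powi (d * (int l - int j) - 2) * w ^ m = w powi (d * (1 + int l - int j))"
  using w(1) by (simp add: d algebra_simps flip: power_int_add power_int_of_nat)
 have z: "w powi (- 2) * w ^ m * (c + 1 / w) ^ (m - 1) = (1 + c * w) ^ (m - 1) / w"
 proof -
  have "1 + c * w = w * (c + 1 / w)" using w(1) by (simp add: field_simps)
  moreover have "w powi (- 2) * w ^ m = w ^ (m - 1) / w"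
   using w(1) m by (cases m) (auto simp: power_int_minus field_simps power2_eq_square)
  ultimately show ?thesis by (simp add: power_mult_distrib)
 qed
 have "binf d c b l j w = (if l = j then of_int (d * int l) / w else 0)
   - w powi (d * (int l - int j) - 2) * w ^ m * ((if l = j then of_int (d * int l) * (c + 1 / w) ^ (m - 1) else 0) + x) / ?p"
  unfolding binf_def b p by simp
 also have "... = (if l = j then of_int (d * int l) / w - of_int (d * int l) * (w powi (- 2) * w ^ m * (c + 1 / w) ^ (m - 1)) / ?p else 0)
   - w powi (d * (int l - int j) - 2) * w ^ m * x / ?p"
  by (simp add: algebra_simps add_divide_distrib)
 also have "... = ((if l = j then of_int (d * int l) * ((?p - (1 + c * w) ^ (m - 1)) / w) else 0)
  - w powi (d * (1 + int l - int j)) * x) / ?p"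
  unfolding e z using w by (simp add: field_simps)
 finally show ?thesis .
qed

lemma pinf_nonzero:
 obtains r where "r > 0" "!!w. norm w < r ==> poly (pinf m a c) w ~= 0"
  "!!w. norm w < r ==> w ~= 0 ==> c + 1 / w ~: a ` {1..m}"
proof -
 have "poly (pinf m a c) 0 ~= 0" by (simp add: poly_pinf)
 moreover have "isCont (poly (pinf m a c)) 0" by simp
 ultimately have "\<forall>\<^sub>F w in nhds 0. poly (pinf m a c) w ~= 0"
  by (metis isCont_def tendsto_at_iff_tendsto_nhds tendsto_imp_eventually_ne)
 then obtain r where r: "r > 0" "!!w. norm w < r ==> poly (pinf m a c) w ~= 0"
  by (auto simp: eventually_nhds_metric)
 have "c + 1 / w ~: a ` {1..m}" if w: "norm w < r" "w ~= 0" for w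
 proof
  assume "c + 1 / w : a ` {1..m}"
  then obtain k where k: "k : {1..m}" "c + 1 / w = a k" by blast
  hence "1 + (c - a k) * w = 0" using w(2) by (simp add: field_simps)
  hence "poly (pinf m a c) w = 0" unfolding poly_pinf using k(1) by (intro prod_zero) auto
  thus False using r(2)[OF w(1)] by simp
 qed
 thus ?thesis using that r by blast
qed

text \<open>The degree bound is exactly what lets the available power of \<open>w\<close> clear the
  pole of \<open>poly P (c + 1 / w)\<close> at 0.\<close>

lemma binf_holomorphic:
 fixes P :: "complex poly"
 assumes m: "m >= 1" and d: "d = int m - 2" and r: "!!w. norm w < r ==> poly (pinf m a c) w ~= 0"
  "!!w. norm w < r ==> w ~= 0 ==> c + 1 / w ~: a ` {1..m}"
  and b: "!!z. z ~: a ` {1..m} ==> b l j z = ((if l = j then of_int (d * int l) * z ^ (m - 1) else 0) + poly P z) / (\<Prod>k=1..m. z - a k)"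
  and P: "P = 0 | int (degree P) <= d * (1 + int l - int j)"
 shows "EX B. B hol ball 0 r & (ALL w:ball 0 r - {0}. binf d c b l j w = B w)"
proof -
 obtain R where R: "!!w. w ~= 0 ==> w powi (d * (1 + int l - int j)) * poly P (c + 1 / w) = poly R w"
  using poly_inversion[OF P] by blast
 obtain S where S: "!!w. poly (pinf m a c) w - (1 + c * w) ^ (m - 1) = w * poly S w" using pinf_divides by blast
 let ?B = "%w. ((if l = j then of_int (d * int l) * poly S w else 0) - poly R w) / poly (pinf m a c) w"
 have "?B hol ball 0 r"
  using r(1) by (cases "l = j") (auto intro!: holomorphic_intros)
 moreover have "binf d c b l j w = ?B w" if w: "w : ball 0 r - {0}" for w
 proof -
  have w: "w ~= 0" "norm w < r" using w by auto
  show ?thesis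
   using binf_eq[where b=b and x="poly P (c + 1 / w)", OF w(1) r(1)[OF w(2)] m d b[OF r(2)[OF w(2,1)]]] w(1) unfolding S R[OF w(1)] by simp
 qed
 ultimately show ?thesis by blast
qed

lemma ginf_eq:
 assumes w: "w ~= 0" "poly (pinf m a c) w ~= 0" and d: "d = int m - 2"
  and g: "g l (c + 1 / w) = \<alpha> / (\<Prod>k=1..m. c + 1 / w - a k)"
 shows "ginf d c g l w = - \<alpha> / poly (pinf m a c) w"
proof -
 have "(\<Prod>k=1..m. c + 1 / w - a k) = poly (pinf m a c) w / w ^ m" unfolding poly_pinf by (rule prod_inversion[OF w(1)])
 moreover have "w powi (- d - 2) * w ^ m = 1"
  using w(1) by (simp add: d flip: power_int_add power_int_of_nat)
 hence "w powi (- d - 2) * (\<alpha> / (poly (pinf m a c) w / w ^ m)) = \<alpha> / poly (pinf m a c) w"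
  by (simp add: mult.assoc[symmetric] mult.commute)
 ultimately show ?thesis unfolding ginf_def g by simp
qed

text \<open>The hypothesis is growth of order \<open>D\<close> at infinity, so Liouville's theorem
  applies. \<open>D\<close> is an integer because the orders that occur are negative for
  \<open>m = 1\<close>; in that case \<open>P\<close> is constant and tends to 0.\<close>

lemma entire_growth_polynomial:
 fixes P :: "complex => complex"
 assumes P: "P hol UNIV" and r: "r > 0" and C: "!!w. w ~= 0 ==> norm w < r ==> norm (w powi D * P (1 / w)) <= C"
 obtains S where "!!z. P z = poly S z" "S = 0 | int (degree S) <= D"
proof -
 have C': "norm (P z) <= C * norm z powi D" if z: "norm z >= 2 / r" for z
 proof -
  have nz: "norm z > 0" using z r by (smt (verit) divide_pos_pos)
  hence z0: "z ~= 0" by auto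
  have "norm (1 / z) < r" using z r nz by (simp add: norm_divide field_simps)
  from C[OF _ this] z0 have "norm ((1 / z) powi D * P z) <= C" by simp
  thus ?thesis using nz by (simp add: norm_mult norm_power_int norm_divide power_int_divide_distrib field_simps)
 qed
 show thesis
 proof (cases "D >= 0")
  case True
  hence D: "D = int (nat D)" by simp
  define S where "S = (SUM k<=nat D. monom ((deriv ^^ k) P 0 / fact k) k)"
  have "P z = poly S z" for z
  proof -
   have "P z = (SUM k<=nat D. (deriv ^^ k) P 0 / fact k * z ^ k)"
    by (rule Liouville_polynomial[OF P, of "2 / r" C]) (use C' D in "metis power_int_of_nat")
   thus ?thesis by (simp add: S_def poly_sum poly_monom)
  qed
  moreover have "degree S <= nat D" unfolding S_def
   by (intro degree_sum_le) (auto intro: order.trans[OF degree_monom_le])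
  ultimately show thesis using D True by (intro that[of S]) auto
 next
  case False
  have C0: "0 <= C * norm z powi D" if "norm z >= 2 / r" for z :: complex using C'[OF that] norm_ge_zero order_trans by blast
  have small: "norm z powi D <= 1 / norm z" if z: "norm z >= 1" for z :: complex
  proof -
   have "norm z powi D <= norm z powi (- 1)" using z False by (intro power_int_increasing) auto
   thus ?thesis by (simp add: power_int_minus divide_inverse)
  qed
  have Cp: "C >= 0"
  proof -
   have n: "norm (of_real (2 / r) :: complex) = 2 / r" using r by (simp only: norm_of_real) simp
   have "0 <= C * (2 / r) powi D" using C0[of "of_real (2 / r)"] unfolding n by simp
   moreover have "(2 / r) powi D > 0" using r by (simp add: zero_less_power_int)
   ultimately show ?thesis by (simp add: zero_le_mult_iff)
  qed
  have b: "norm (P z) <= C / norm z" if "norm z >= max 1 (2 / r)" for z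
  proof -
   have "norm (P z) <= C * norm z powi D" using that by (intro C') simp
   also have "... <= C * (1 / norm z)" using small[of z] that Cp by (intro mult_left_mono) auto
   finally show ?thesis by simp
  qed
  have "P z = P 0" for z
  proof -
   have "P z = (SUM k<=0. (deriv ^^ k) P 0 / fact k * z ^ k)"
   proof (rule Liouville_polynomial[OF P, of "max 1 (2 / r)" C])
    fix z :: complex assume z: "max 1 (2 / r) <= norm z"
    have "C / norm z <= C / 1" using z Cp by (intro divide_left_mono) auto
    thus "norm (P z) <= C * norm z ^ 0" using b[OF z] by simp
   qed
   thus ?thesis by simp
  qed
  moreover have "P 0 = 0"
  proof (rule ccontr)
   assume n0: "P 0 ~= 0"
   define x where "x = max (max 1 (2 / r)) (2 * C / norm (P 0)) "
   have x: "x >= max 1 (2 / r)" "x > 0" "x >= 2 * C / norm (P 0)" unfolding x_def by auto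
   have "norm (P 0) <= C / x" using b[of "of_real x"] x(1,2) \<open>!!z. P z = P 0\<close>[of "of_real x"] by simp
   hence "norm (P 0) * x <= C" using x(2) by (simp add: field_simps)
   moreover have "2 * C <= norm (P 0) * x" using x(3) n0 by (simp add: field_simps)
   ultimately have "C = 0" using Cp by linarith
   with \<open>norm (P 0) * x <= C\<close> x(2) n0 show False by (simp add: mult_le_0_iff)
  qed
  ultimately have "P z = poly 0 z" for z by simp
  thus thesis using that[of 0] by simp
 qed
qed

section \<open>Functions on the covering\<close>

lemma higher_deriv_shift: "(deriv ^^ k) (%h. f (c + h)) h = (deriv ^^ k) f (c + h :: complex)"
proof (induction k arbitrary: h)
 case (Suc k)
 have "deriv (%h. u (h + c)) h = deriv u (h + c)" for u :: "complex => complex"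
  by (simp add: deriv_def DERIV_shift)
 hence d: "deriv (%h. u (c + h)) h = deriv u (c + h)" for u :: "complex => complex" by (simp only: add.commute)
 have "(deriv ^^ k) (%h. f (c + h)) = (%h. (deriv ^^ k) f (c + h))" using Suc by blast
 thus ?case using d[of "(deriv ^^ k) f"] by simp
qed simp

lemma add_in_ball: "norm h < r ==> z + h : ball z r" for z h :: complex
 unfolding mem_ball dist_norm by simp

lemma continuous_on_translate:
 fixes z :: complex
 assumes "continuous_on U G" "!!h. norm h < r ==> z + h : U"
 shows "continuous_on (ball 0 r) (%h. G (z + h))"
proof (rule continuous_on_compose2[OF assms(1)])
 show "(%h. z + h) ` ball 0 r <= U" by (rule image_subsetI) (use assms(2) in simp)
qed (intro continuous_intros)

lemma linear_ode_rhs_entry: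
 assumes "A : sq_mat n" "Y : sq_mat n" "i < n" "j < n"
 shows "(c \<cdot> A * Y - Y * zmat n) $$ (i,j) = (c :: complex) * (A * Y) $$ (i,j)"
proof -
 have "c \<cdot> A * Y = c \<cdot> (A * Y)" by (rule mult_smult_assoc_mat[OF assms(1,2)])
 moreover have "Y * zmat n = zmat n" using assms(2) by simp
 moreover have "(c \<cdot> P - zmat n) $$ (i,j) = c * P $$ (i,j)" if "P : sq_mat n" for P
  using that assms(3,4) by auto
 ultimately show ?thesis using assms(1,2) by (simp del: index_mult_mat(1))
qed

text \<open>A chart over the projection \<open>f\<close> is a local inverse of \<open>f\<close>, as
  \<open>f (g h) = f w + h\<close>. The chain rule, used in both directions, trades derivatives in
  \<open>h\<close> for derivatives in \<open>w\<close>.\<close>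

lemma planar_lift_deriv:
 assumes U: "open U" "w : U" and f: "f hol U" "deriv f w ~= 0"
  and g: "local_lift U (%w. Some (f w)) w r g"
 shows "((%h. F (g h)) hfd D) (at 0) \<longleftrightarrow> (F hfd deriv f w * D) (at w)"
proof -
 note gD = local_liftD[OF g]
 have fg: "f (g h) = f w + h" if "norm h < r" for h using gD(5)[OF that] by simp
 obtain \<rho> where \<rho>: "\<rho> > 0" "ball w \<rho> <= U" "inj_on f (ball w \<rho>)"
  using has_complex_derivative_locally_injective[OF f(1) U(2,1) f(2)] by blast
 have df: "(f hfd deriv f w) (at w)" using f(1) U by (simp add: holomorphic_derivI)
 have gc: "isCont g 0" using gD(1,2) by (simp add: continuous_on_eq_continuous_at)
 have "\<forall>\<^sub>F h in nhds 0. g h : ball w \<rho>"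
  using gc gD(3) \<rho>(1) by (intro topological_tendstoD) (auto simp: isCont_def tendsto_at_iff_tendsto_nhds)
 moreover have "\<forall>\<^sub>F h in nhds 0. h : ball (0::complex) r" by (rule eventually_nhds_in_open) (use gD(1) in auto)
 ultimately have ev0: "\<forall>\<^sub>F h in nhds 0. g h : ball w \<rho> & norm h < r" by eventually_elim simp
 have fc: "((%w'. f w' - f w) \<longlongrightarrow> 0) (nhds w)"
  using DERIV_isCont[OF df] by (simp add: isCont_def tendsto_at_iff_tendsto_nhds tendsto_diff[of f "f w" _ "%_. f w", simplified] LIM_zero_iff)
 have "\<forall>\<^sub>F w' in nhds w. g (f w' - f w) : ball w \<rho> & norm (f w' - f w) < r"
  using ev0 fc by (rule eventually_compose_filterlim)
 moreover have "\<forall>\<^sub>F w' in nhds w. w' : ball w \<rho>" by (rule eventually_nhds_in_open) (use \<rho>(1) in auto)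
 ultimately have ev: "\<forall>\<^sub>F w' in nhds w. g (f w' - f w) = w'"
 proof eventually_elim
  case (elim w')
  hence "f (g (f w' - f w)) = f w'" using fg by simp
  thus ?case using \<rho>(3) elim by (auto dest: inj_onD)
 qed
 show ?thesis
 proof
  assume d: "((%h. F (g h)) hfd D) (at 0)"
  have "((%w'. f w' - f w) hfd deriv f w) (at w)" using df by (auto intro!: derivative_eq_intros)
  from DERIV_chain2[of "%h. F (g h)" D "%w'. f w' - f w", OF _ this] d
  have "((%w'. F (g (f w' - f w))) hfd D * deriv f w) (at w)" by simp
  moreover have "\<forall>\<^sub>F w' in nhds w. F (g (f w' - f w)) = F w'" using ev by eventually_elim simp
  ultimately show "(F hfd deriv f w * D) (at w)"
   using DERIV_cong_ev[OF refl _ refl, of "%w'. F (g (f w' - f w))" F w] by (simp add: mult.commute)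
 next
  assume d: "(F hfd deriv f w * D) (at w)"
  have "(g hfd inverse (deriv f w)) (at 0)"
  proof (rule has_field_derivative_inverse_basic[where f="%w'. f w' - f w" and g=g and y=0 and t="ball 0 r"])
   show "((%w'. f w' - f w) hfd deriv f w) (at (g 0))"
    unfolding gD(3) using df by (auto intro!: derivative_eq_intros)
  qed (use f(2) gc gD(1) fg in auto)
  hence "((%h. F (g h)) hfd deriv f w * D * inverse (deriv f w)) (at 0)"
   using d gD(3) by (intro DERIV_chain2[where f=F and g=g and Da="deriv f w * D"]) simp_all
  moreover have "deriv f w * D * inverse (deriv f w) = D" using f(2) by simp
  ultimately show "((%h. F (g h)) hfd D) (at 0)" by (simp only:)
 qed
qed

lemma planar_lift_exists:
 assumes U: "open U" "w : U" and f: "f hol U" "deriv f w ~= 0"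
 obtains r g where "local_lift U (%w. Some (f w)) w r g"
proof -
 obtain \<rho> where \<rho>: "\<rho> > 0" "ball w \<rho> <= U" "inj_on f (ball w \<rho>)"
  using has_complex_derivative_locally_injective[OF f(1) U(2,1) f(2)] by blast
 let ?B = "ball w \<rho>"
 have fh: "f hol ?B" using f(1) \<rho>(2) holomorphic_on_subset by blast
 obtain g where g: "g hol f ` ?B" "!!z. z : ?B ==> g (f z) = z"
 proof (rule holomorphic_has_inverse[OF fh open_ball \<rho>(3)])
  fix g assume a: "g hol f ` ?B" and c: "!!z. z : ?B ==> g (f z) = z"
  show thesis by (rule that[OF a c])
 qed
 have "open (f ` ?B)" by (rule open_mapping_thm3[OF fh open_ball \<rho>(3)])
 moreover have "f w : f ` ?B" using \<rho>(1) by simp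
 ultimately obtain r where r: "r > 0" "ball (f w) r <= f ` ?B" using open_contains_ball by blast
 have h: "f w + h : f ` ?B" if "norm h < r" for h by (rule subsetD[OF r(2) add_in_ball[OF that]])
 have "continuous_on (ball 0 r) (%h. g (f w + h))"
  by (rule continuous_on_translate[OF holomorphic_on_imp_continuous_on[OF g(1)] h])
 moreover have "g (f w + h) : U & f (g (f w + h)) = f w + h" if "norm h < r" for h
 proof -
  have "f w + h : f ` ?B" by (rule h[OF that])
  then obtain u where u: "u : ?B" "f w + h = f u" by (elim imageE)
  thus ?thesis using g(2)[OF u(1)] subsetD[OF \<rho>(2) u(1)] by simp
 qed
 ultimately have "local_lift U (%w. Some (f w)) w r (%h. g (f w + h))"
  using r(1) g(2)[of w] \<rho>(1) by (intro local_liftI) auto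
 thus ?thesis using that by blast
qed

text \<open>Pulling back by \<open>f\<close> multiplies the coefficient matrix by
  \<open>deriv f\<close>. The instances are exponential maps on half-planes and the identity near
  infinity.\<close>

lemma system_solution_planar:
 assumes U: "open U" and f: "f hol U" "!!w. w : U ==> deriv f w ~= 0" and A: "!!z. A z : sq_mat n"
 shows "system_solution n A U (%w. Some (f w)) Y \<longleftrightarrow>
  (ALL w:U. Y w : GL n) & mat_ode n U (%w. deriv f w \<cdot> A (f w)) (%_. zmat n) Y"
proof -
 note e = linear_ode_rhs_entry[OF A, of "Y _"]
 have key: "(EX z r g. Some (f w) = Some z & local_lift U (%w. Some (f w)) w r g & (ALL i<n. ALL j<n.
       ((%h. Y (g h) $$ (i,j)) hfd (A z * Y w) $$ (i,j)) (at 0)))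
  \<longleftrightarrow> (ALL i<n. ALL j<n. ((%w. Y w $$ (i,j)) hfd (deriv f w \<cdot> A (f w) * Y w - Y w * zmat n) $$ (i,j)) (at w))"
  if w: "w : U" and Y: "Y w : sq_mat n" for w
 proof -
  obtain r g where g: "local_lift U (%w. Some (f w)) w r g" using planar_lift_exists[OF U w f(1) f(2)[OF w]] by blast
  have "((%h. Y (g h) $$ (i,j)) hfd D) (at 0) \<longleftrightarrow> ((%w. Y w $$ (i,j)) hfd deriv f w * D) (at w)"
   if "local_lift U (%w. Some (f w)) w r g" for i j r g D
   using planar_lift_deriv[OF U w f(1) f(2)[OF w] that, of "%w. Y w $$ (i,j)"] by blast
  note p = this
  show ?thesis
  proof
   assume "EX z r g. Some (f w) = Some z & local_lift U (%w. Some (f w)) w r g & (ALL i<n. ALL j<n.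
       ((%h. Y (g h) $$ (i,j)) hfd (A z * Y w) $$ (i,j)) (at 0))"
   thus "ALL i<n. ALL j<n. ((%w. Y w $$ (i,j)) hfd (deriv f w \<cdot> A (f w) * Y w - Y w * zmat n) $$ (i,j)) (at w)"
    using p e[OF Y] by (metis option.inject)
  next
   assume "ALL i<n. ALL j<n. ((%w. Y w $$ (i,j)) hfd (deriv f w \<cdot> A (f w) * Y w - Y w * zmat n) $$ (i,j)) (at w)"
   hence "ALL i<n. ALL j<n. ((%h. Y (g h) $$ (i,j)) hfd (A (f w) * Y w) $$ (i,j)) (at 0)"
    using p[OF g] e[OF Y] by simp
   thus "EX z r g. Some (f w) = Some z & local_lift U (%w. Some (f w)) w r g & (ALL i<n. ALL j<n.
       ((%h. Y (g h) $$ (i,j)) hfd (A z * Y w) $$ (i,j)) (at 0))" using g by blast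
  qed
 qed
 show ?thesis
 proof
  assume s: "system_solution n A U (%w. Some (f w)) Y"
  hence c: "Y w : GL n" if "w : U" for w using that unfolding system_solution_def by blast
  have "ALL i<n. ALL j<n. ((%w. Y w $$ (i,j)) hfd (deriv f w \<cdot> A (f w) * Y w - Y w * zmat n) $$ (i,j)) (at w)"
   if w: "w : U" for w
   using s key[OF w] c[OF w] w unfolding system_solution_def by blast
  thus "(ALL w:U. Y w : GL n) & mat_ode n U (%w. deriv f w \<cdot> A (f w)) (%_. zmat n) Y"
   using c A unfolding mat_ode_def by auto
 next
  assume s: "(ALL w:U. Y w : GL n) & mat_ode n U (%w. deriv f w \<cdot> A (f w)) (%_. zmat n) Y"
  show "system_solution n A U (%w. Some (f w)) Y"
   unfolding system_solution_def
  proof (intro ballI conjI)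
   fix w assume w: "w : U"
   show "Y w : GL n" using s w by blast
   hence c: "Y w : sq_mat n" by blast
   have "ALL i<n. ALL j<n. ((%w. Y w $$ (i,j)) hfd (deriv f w \<cdot> A (f w) * Y w - Y w * zmat n) $$ (i,j)) (at w)"
    using s w unfolding mat_ode_def by blast
   thus "EX z r g. Some (f w) = Some z & local_lift U (%w. Some (f w)) w r g & (ALL i<n. ALL j<n.
       ((%h. Y (g h) $$ (i,j)) hfd (A z * Y w) $$ (i,j)) (at 0))"
    using key[OF w c] by blast
  qed
 qed
qed

lemma local_lift_finite_part: "local_lift (finite_part X \<rho>) \<rho> x r g ==> local_lift X \<rho> x r g"
 unfolding local_lift_def finite_part_def by auto

text \<open>A local section of \<open>\<rho>\<close> over an open plane set, through which functions
  on the surface become functions of \<open>z\<close>.\<close>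

definition sect :: "'a::topological_space set => ('a => csphere) => complex set => (complex => 'a) => bool" where
 "sect X \<rho> U G \<longleftrightarrow> open U & continuous_on U G & (ALL z:U. G z : X & \<rho> (G z) = Some z)"

lemma sect_finite: "sect X \<rho> U G ==> z : U ==> G z : finite_part X \<rho>"
 unfolding sect_def finite_part_def by auto

lemma sect_deck:
 assumes G: "sect X \<rho> U G" and s: "deck_transformation X \<rho> \<sigma>"
 shows "sect X \<rho> U (%z. \<sigma> (G z))"
proof -
 have "continuous_on X \<sigma>" "\<sigma> ` X <= X" "!!y. y : X ==> \<rho> (\<sigma> y) = \<rho> y"
  using s unfolding deck_transformation_def homeomorphism_def by auto
 moreover have "continuous_on U (%z. \<sigma> (G z))"
  using G calculation(1) unfolding sect_def by (intro continuous_on_compose2[of X \<sigma> U G]) auto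
 ultimately show ?thesis using G unfolding sect_def by (auto simp: image_subset_iff)
qed

lemma local_lift_sect:
 assumes g: "local_lift X \<rho> x r g" and x: "\<rho> x = Some z"
 shows "sect X \<rho> (ball z r) (%z'. g (z' - z))"
 unfolding sect_def
proof (intro conjI ballI)
 note gD = local_liftD[OF g]
 show "continuous_on (ball z r) (%z'. g (z' - z))"
  by (rule continuous_on_compose2[OF gD(2)]) (auto intro!: continuous_intros simp: dist_norm norm_minus_commute)
 fix z' assume "z' : ball z r"
 hence n: "norm (z' - z) < r" by (simp add: dist_norm norm_minus_commute)
 show "g (z' - z) : X" "\<rho> (g (z' - z)) = Some z'" using gD(4,5)[OF n] x by simp_all
qed simp

lemma local_lift_sect_infinity:
 assumes g: "local_lift X \<rho> x r g" and x: "\<rho> x = None"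
 shows "sect X \<rho> {z. norm z > 1 / r} (%z. g (1 / z))"
 unfolding sect_def
proof (intro conjI ballI)
 note gD = local_liftD[OF g]
 have n: "norm (1 / z) < r & z ~= 0" if "z : {z :: complex. norm z > 1 / r}" for z
 proof -
  have "norm z > 0" using that gD(1) by (smt (verit) divide_pos_pos mem_Collect_eq)
  thus ?thesis using that gD(1) by (auto simp: norm_divide field_simps)
 qed
 show "open {z :: complex. norm z > 1 / r}" by (intro open_Collect_less continuous_intros)
 show "continuous_on {z. norm z > 1 / r} (%z. g (1 / z))"
  by (rule continuous_on_compose2[OF gD(2)]) (use n in "auto intro!: continuous_intros")
 fix z :: complex assume "z : {z. norm z > 1 / r}"
 from n[OF this] show "g (1 / z) : X" "\<rho> (g (1 / z)) = Some z" using gD(4,5)[of "1 / z"] x by simp_all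
qed

lemma open_sphere_coord_ball: "open (sphere_coord p ` ball 0 r)"
proof (cases p)
 case None
 have n: "h ~= 0 ==> norm h < r \<longleftrightarrow> norm (1 / h) > 1 / r & r > 0" for h :: complex
  by (cases "r > 0") (auto simp: norm_divide field_simps intro: order.strict_trans1[OF norm_ge_zero])
 show ?thesis
 proof (cases "r > 0")
  case True
  have "sphere_coord None ` ball 0 r = UNIV - Some ` cball 0 (1 / r)"
  proof (rule Set.set_eqI)
   fix q show "q : sphere_coord None ` ball 0 r \<longleftrightarrow> q : UNIV - Some ` cball 0 (1 / r)"
   proof (cases q)
    case None
    thus ?thesis using True by (auto intro!: image_eqI[of _ _ 0])
   next
    case (Some z)
    have "Some z : sphere_coord None ` ball 0 r \<longleftrightarrow> norm z > 1 / r"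
    proof
     assume "Some z : sphere_coord None ` ball 0 r"
     then obtain h where "norm h < r" "sphere_coord None h = Some z" by auto
     thus "norm z > 1 / r" using n[of h] by (auto split: if_splits)
    next
     assume z: "norm z > 1 / r"
     hence "norm z > 0" using True by (smt (verit) divide_pos_pos)
     hence "norm (1 / z) < r" "sphere_coord None (1 / z) = Some z" using n[of "1 / z"] z True by auto
     thus "Some z : sphere_coord None ` ball 0 r" by (metis image_eqI mem_ball_0)
    qed
    thus ?thesis using Some by auto
   qed
  qed
  thus ?thesis using None open_sphere_minus_compact[OF compact_cball] by metis
 qed (simp add: ball_empty)
next
 case (Some z)
 have "sphere_coord p ` ball 0 r = Some ` ball z r"
 proof -
  have "(%h. z + h) ` ball 0 r = ball z r" using ball_translation[of z 0 r] by simp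
  moreover have "sphere_coord p ` ball 0 r = Some ` ((%h. z + h) ` ball 0 r)" unfolding Some image_image by simp
  ultimately show ?thesis by simp
 qed
 thus ?thesis unfolding open_option_def openin_Alexandroff_compactification
  by (metis open_ball open_openin)
qed

text \<open>A chart is only required to be continuous; that its image contains an open set comes
  from the homeomorphism between a sheet and its base.\<close>

lemma local_lift_neighbourhood:
 fixes \<rho> :: "'a::topological_space => csphere"
 assumes cov: "covering_space X \<rho> S" and g: "local_lift X \<rho> x r g" and x: "x : X"
 obtains N where "openin (top_of_set X) N" "x : N" "N <= g ` ball 0 r"
proof -
 note gD = local_liftD[OF g]
 have "\<rho> x : S" using cov x unfolding covering_space_def by auto
 from covering_sheet[OF cov this] obtain T v where T: "\<rho> x : T" "openin (top_of_set S) T" "\<Union>v = X Int \<rho> -` T"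
  and v: "!!u. u : v ==> openin (top_of_set X) u" "!!u. u : v ==> EX q. homeomorphism u T \<rho> q"
  by metis
 have "x : \<Union>v" using T x by auto
 then obtain u where u: "u : v" "x : u" by blast
 obtain q where q: "homeomorphism u T \<rho> q" using v(2)[OF u(1)] by blast
 have "openin (top_of_set (ball 0 r)) (ball 0 r Int g -` u)"
  by (rule continuous_openin_preimage[OF gD(2) _ v(1)[OF u(1)]]) (use gD(4) in auto)
 hence "open (ball 0 r Int g -` u)" by (simp add: openin_open_eq)
 moreover have "0 : ball 0 r Int g -` u" using gD(1,3) u(2) by simp
 ultimately obtain r' where r': "r' > 0" "ball 0 r' <= ball 0 r Int g -` u" using open_contains_ball by blast
 define W where "W = sphere_coord (\<rho> x) ` ball 0 r'"
 have gq: "sphere_coord (\<rho> x) h : T & g h = q (sphere_coord (\<rho> x) h)" if "h : ball 0 r'" for h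
 proof -
  have h: "norm h < r" "g h : u" using r'(2) that by auto
  thus ?thesis using gD(5)[OF h(1)] q unfolding homeomorphism_def by force
 qed
 hence WT: "W <= T" by (auto simp: W_def)
 moreover have "open W" unfolding W_def by (rule open_sphere_coord_ball)
 ultimately have "openin (top_of_set T) W" by (metis inf.absorb_iff2 openin_open_Int)
 hence "openin (top_of_set u) (q ` W)" using homeomorphism_imp_open_map[OF homeomorphism_symD[OF q]] by blast
 hence "openin (top_of_set X) (q ` W)" using v(1)[OF u(1)] openin_trans by blast
 moreover have "q ` W = g ` ball 0 r'" using gq by (auto simp: W_def image_image)
 moreover have "x : g ` ball 0 r'" using r'(1) gD(3) by (auto intro!: image_eqI[of _ _ 0])
 ultimately show ?thesis using that[of "q ` W"] r'(2) by auto
qed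

text \<open>The interior of the zero set has an open complement: in a chart that meets it, a
  holomorphic function vanishes on a nonempty open part of a disc, hence on the whole disc.\<close>

lemma surface_identity_principle:
 fixes \<rho> :: "'a::topological_space => csphere" and y :: "'a => complex"
 assumes cov: "covering_space X \<rho> S" and X: "connected X"
  and hol: "!!x. x : X ==> EX r g. local_lift X \<rho> x r g & (%h. y (g h)) hol ball 0 r"
  and x1: "x1 : X" "local_lift X \<rho> x1 r1 g1" "!!h. norm h < r1 ==> y (g1 h) = 0" and x: "x : X"
 shows "y x = 0"
proof -
 define Z where "Z = {x : X. EX N. openin (top_of_set X) N & x : N & (ALL x':N. y x' = 0)}"
 have "openin (top_of_set X) Z"
 proof (subst openin_subopen, intro ballI)
  fix x assume "x : Z"
  then obtain N where N: "openin (top_of_set X) N" "x : N" "ALL x':N. y x' = 0" unfolding Z_def by blast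
  hence "N <= Z" using openin_imp_subset unfolding Z_def by blast
  thus "EX T. openin (top_of_set X) T & x : T & T <= Z" using N by blast
 qed
 moreover have "openin (top_of_set X) (X - Z)"
 proof (subst openin_subopen, intro ballI)
  fix x assume x: "x : X - Z"
  then obtain r g where g: "local_lift X \<rho> x r g" and h: "(%h. y (g h)) hol ball 0 r" using hol by blast
  note gD = local_liftD[OF g]
  obtain N where N: "openin (top_of_set X) N" "x : N" "N <= g ` ball 0 r"
   using local_lift_neighbourhood[OF cov g] x by blast
  have "N Int Z = {}"
  proof (rule ccontr)
   assume "N Int Z ~= {}"
   then obtain k where k: "k : ball 0 r" "g k : Z" using N(3) by blast
   then obtain N' where N': "openin (top_of_set X) N'" "g k : N'" "ALL x':N'. y x' = 0" unfolding Z_def by blast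
   have "openin (top_of_set (ball 0 r)) (ball 0 r Int g -` N')"
    by (rule continuous_openin_preimage[OF gD(2) _ N'(1)]) (use gD(4) in auto)
   hence o: "open (ball 0 r Int g -` N')" by (simp add: openin_open_eq)
   have ne: "ball 0 r Int g -` N' ~= {}" using k N'(2) by auto
   have "y (g h') = 0" if "h' : ball 0 r" for h'
    by (rule analytic_continuation_open[of "ball 0 r Int g -` N'" "ball 0 r" "%h. y (g h)" "%_. 0"])
     (use o ne h that N'(3) in auto)
   hence "ALL x':N. y x' = 0" using N(3) by blast
   thus False using N x unfolding Z_def by blast
  qed
  moreover have "N <= X" using openin_imp_subset[OF N(1)] .
  ultimately show "EX T. openin (top_of_set X) T & x : T & T <= X - Z" using N(1,2) by (intro exI[of _ N]) auto
 qed
 moreover have "Z <= X" by (auto simp: Z_def)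
 moreover have "x1 : Z"
 proof -
  obtain N where "openin (top_of_set X) N" "x1 : N" "N <= g1 ` ball 0 r1"
   using local_lift_neighbourhood[OF cov x1(2,1)] by blast
  thus ?thesis using x1 unfolding Z_def by (auto intro!: exI[of _ N])
 qed
 ultimately have "Z = X" using X unfolding connected_clopen closedin_def by auto
 thus ?thesis using x unfolding Z_def by (auto)
qed

section \<open>Solutions and derivatives on a covered surface\<close>

locale covered_surface =
 fixes X :: "'a::topological_space set" and \<rho> :: "'a => csphere" and F :: "complex set"
 assumes cov: "covering_space X \<rho> (UNIV - Some ` F)" and finF: "finite F"
begin

lemma section_exists:
 assumes "x : X" "\<rho> x = Some z"
 obtains r G where "r > 0" "sect X \<rho> (ball z r) G" "G z = x"
proof -
 obtain r g where g: "local_lift X \<rho> x r g" using local_lift_exists[OF cov finF assms(1)] by blast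
 show ?thesis using that[OF local_liftD(1)[OF g] local_lift_sect[OF g assms(2)]] local_liftD(3)[OF g] by simp
qed

lemma section_avoids:
 assumes "sect X \<rho> U G" "z : U"
 shows "z ~: F"
proof -
 have "G z : X" "\<rho> (G z) = Some z" using assms unfolding sect_def by auto
 thus ?thesis using cov unfolding covering_space_def by (metis DiffD2 image_eqI)
qed

lemma lift_eq_near:
 fixes f :: "complex => complex"
 assumes "open U" "w0 : U" "continuous_on U et" "et ` U <= X" "!!w. w : U ==> \<rho> (et w) = Some (f w)"
  "continuous_on U f" "local_lift X \<rho> (et w0) r g"
 shows "\<forall>\<^sub>F w in nhds w0. w : U & norm (f w - f w0) < r & et w = g (f w - f w0)"
 by (rule lift_eq_local_lift[OF cov assms])

lemma sect_eq_near:
 assumes G: "sect X \<rho> U G" and z: "z : U" and g: "local_lift X \<rho> (G z) r g"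
 shows "\<forall>\<^sub>F z' in nhds z. G z' = g (z' - z)"
proof -
 have "\<forall>\<^sub>F w in nhds z. w : U & norm (w - z) < r & G w = g (w - z)"
  by (rule lift_eq_near[of U z G "%z. z"]) (use assms in "auto simp: sect_def")
 thus ?thesis by eventually_elim simp
qed

lemma equation_solution_sect:
 assumes y: "equation_solution n q X \<rho> y" and G: "sect X \<rho> U G"
 shows "(%z. y (G z)) hol U" "z : U ==> ode_lhs n q z (%z. y (G z)) z = 0"
proof -
 have *: "(%z. y (G z)) field_differentiable at z & ode_lhs n q z (%z. y (G z)) z = 0" if z: "z : U" for z
 proof -
  have x: "G z : X" "\<rho> (G z) = Some z" using G z unfolding sect_def by auto
  then obtain r g where g: "local_lift X \<rho> (G z) r g" "(%h. y (g h)) hol ball 0 r"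
   "ode_lhs n q z (%h. y (g h)) 0 = 0" using y unfolding equation_solution_def by metis
  have ev: "\<forall>\<^sub>F z' in nhds z. y (G z') = y (g (- z + z'))"
   using sect_eq_near[OF G z g(1)] by eventually_elim simp
  have d: "(deriv ^^ k) (%z. y (G z)) z = (deriv ^^ k) (%h. y (g h)) 0" for k
  proof -
   have "(deriv ^^ k) (%z. y (G z)) z = (deriv ^^ k) (%z'. y (g (- z + z'))) z"
    by (rule higher_deriv_cong_ev[OF ev refl])
   also have "... = (deriv ^^ k) (%h. y (g h)) (- z + z)" by (rule higher_deriv_shift)
   finally show ?thesis by simp
  qed
  have "(%h. y (g h)) field_differentiable at 0"
   using g(2) local_liftD(1)[OF g(1)] by (simp add: holomorphic_on_imp_differentiable_at)
  then obtain D where D: "((%h. y (g h)) hfd D) (at (- z + z))"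
   unfolding field_differentiable_def by auto
  have "((%z'. y (g (- z + z'))) hfd D * 1) (at z)"
   by (rule DERIV_chain2[where f="%h. y (g h)" and g="%z'. - z + z'", OF D]) (auto intro!: derivative_eq_intros)
  hence "((%z. y (G z)) hfd D) (at z)"
   using DERIV_cong_ev[OF refl ev refl] by simp
  thus ?thesis using g(3) unfolding ode_lhs_def d field_differentiable_def by blast
 qed
 thus "(%z. y (G z)) hol U" unfolding holomorphic_on_def
  using field_differentiable_at_within by blast
 show "z : U ==> ode_lhs n q z (%z. y (G z)) z = 0" using * by blast
qed

text \<open>Over the finite plane sections are enough; a chart is asked for only at points over
  infinity.\<close>

lemma equation_solutionI:
 assumes fin: "!!x z. x : X ==> \<rho> x = Some z ==> EX U G. sect X \<rho> U G & z : U & G z = x &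
   (%z. y (G z)) hol U & ode_lhs n q z (%z. y (G z)) z = 0"
  and inf: "!!x. x : X ==> \<rho> x = None ==> EX r g. local_lift X \<rho> x r g & (%h. y (g h)) hol ball 0 r"
 shows "equation_solution n q X \<rho> y"
 unfolding equation_solution_def
proof
 fix x assume x: "x : X"
 show "EX r g. local_lift X \<rho> x r g & (%h. y (g h)) hol ball 0 r &
    (ALL z. \<rho> x = Some z --> ode_lhs n q z (%h. y (g h)) 0 = 0)"
 proof (cases "\<rho> x")
  case None
  thus ?thesis using inf[OF x] by auto
 next
  case (Some z)
  obtain U G where G: "sect X \<rho> U G" "z : U" "G z = x" "(%z. y (G z)) hol U"
   "ode_lhs n q z (%z. y (G z)) z = 0" using fin[OF x Some] by blast
  have "open U" using G(1) by (simp add: sect_def)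
  then obtain r where r: "r > 0" "ball z r <= U" using G(2) open_contains_ball by blast
  have in_U: "z + h : U" if "norm h < r" for h by (rule subsetD[OF r(2) add_in_ball[OF that]])
  have "continuous_on (ball 0 r) (%h. G (z + h))"
   by (rule continuous_on_translate[of U]) (use G(1) in_U in "auto simp: sect_def")
  hence "local_lift X \<rho> x r (%h. G (z + h))"
   using G(1,3) r(1) in_U Some by (intro local_liftI) (auto simp: sect_def)
  moreover have "(%h. y (G (z + h))) hol ball 0 r"
   by (rule holomorphic_on_compose_gen[of "%h. z + h" _ "%z. y (G z)" U, unfolded o_def])
    (use G(4) in_U in "auto intro!: holomorphic_intros simp del: image_add_ball")
  moreover have "ode_lhs n q z (%h. y (G (z + h))) 0 = 0"
   using G(5) higher_deriv_shift[of _ "%z. y (G z)" z 0] unfolding ode_lhs_def by simp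
  ultimately show ?thesis using Some by (intro exI[of _ r] exI[of _ "%h. G (z + h)"]) auto
 qed
qed

text \<open>Near each point \<open>et\<close> is the chart after a difference of values of
  \<open>f\<close>, so the chain rule turns the derivative in the chart into one in \<open>w\<close>
  with factor \<open>deriv f\<close>.\<close>

lemma system_solution_ode:
 fixes f :: "complex => complex"
 assumes Y: "system_solution n A (finite_part X \<rho>) \<rho> Y" and A: "!!z. A z : sq_mat n"
  and U: "open U" and et: "continuous_on U et" "et ` U <= X" "!!w. w : U ==> \<rho> (et w) = Some (f w)" and f: "f hol U"
 shows "mat_ode n U (%w. deriv f w \<cdot> A (f w)) (%_. zmat n) (%w. Y (et w))" "w : U ==> Y (et w) : GL n"
proof -
 have fp: "et w : finite_part X \<rho>" if "w : U" for w using et(2,3) that by (auto simp: finite_part_def)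
 show GLn: "Y (et w) : GL n" if "w : U" for w using Y fp[OF that] unfolding system_solution_def by blast
 show "mat_ode n U (%w. deriv f w \<cdot> A (f w)) (%_. zmat n) (%w. Y (et w))"
  unfolding mat_ode_def
 proof (intro ballI conjI allI impI)
  fix w i j assume w: "w : U" and ij: "i < n" "j < n"
  have Yc: "Y (et w) : sq_mat n" using GLn[OF w] by blast
  obtain z r g where g: "\<rho> (et w) = Some z" "local_lift (finite_part X \<rho>) \<rho> (et w) r g"
   "((%h. Y (g h) $$ (i,j)) hfd (A z * Y (et w)) $$ (i,j)) (at 0)"
   using Y fp[OF w] ij unfolding system_solution_def by blast
  have z: "z = f w" using g(1) et(3)[OF w] by simp
  have "\<forall>\<^sub>F w' in nhds w. w' : U & norm (f w' - f w) < r & et w' = g (f w' - f w)"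
   by (rule lift_eq_near[OF U w et holomorphic_on_imp_continuous_on[OF f] local_lift_finite_part[OF g(2)]])
  hence ev: "\<forall>\<^sub>F w' in nhds w. Y (et w') $$ (i,j) = Y (g (f w' - f w)) $$ (i,j)" by eventually_elim simp
  have "((%w'. f w' - f w) hfd deriv f w) (at w)"
   using holomorphic_derivI[OF f U w] by (auto intro!: derivative_eq_intros)
  from DERIV_chain2[of "%h. Y (g h) $$ (i,j)" _ "%w'. f w' - f w", OF _ this] g(3)
  have "((%w'. Y (g (f w' - f w)) $$ (i,j)) hfd (A z * Y (et w)) $$ (i,j) * deriv f w) (at w)" by simp
  moreover have "(deriv f w \<cdot> A (f w) * Y (et w) - Y (et w) * zmat n) $$ (i,j) = (A z * Y (et w)) $$ (i,j) * deriv f w"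
   unfolding linear_ode_rhs_entry[OF A Yc ij] z by (rule mult.commute)
  ultimately show "((%w. Y (et w) $$ (i,j)) hfd
    (deriv f w \<cdot> A (f w) * Y (et w) - Y (et w) * zmat n) $$ (i,j)) (at w)"
   using DERIV_cong_ev[OF refl ev refl] by simp
 qed (use A GLn in auto)
qed

lemma system_solution_sect:
 assumes Y: "system_solution n A (finite_part X \<rho>) \<rho> Y" and A: "!!z. A z : sq_mat n" and G: "sect X \<rho> U G"
 shows "mat_ode n U A (%_. zmat n) (%z. Y (G z))"
proof -
 have U: "open U" using G by (simp add: sect_def)
 have "mat_ode n U (%w. deriv (%z. z) w \<cdot> A w) (%_. zmat n) (%w. Y (G w))"
  by (rule system_solution_ode(1)[OF Y A]) (use G in "auto simp: sect_def")
 thus ?thesis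
  by (rule mat_ode_cong[OF _ U]) (use A in auto)
qed

lemma system_solutionI:
 assumes GLn: "!!x. x : X ==> \<rho> x ~= None ==> Y x : GL n"
  and d: "!!x z. x : X ==> \<rho> x = Some z ==> EX U G. sect X \<rho> U G & z : U & G z = x &
   (ALL i<n. ALL j<n. ((%z. Y (G z) $$ (i,j)) hfd (A z * Y x) $$ (i,j)) (at z))"
 shows "system_solution n A (finite_part X \<rho>) \<rho> Y"
 unfolding system_solution_def
proof (intro ballI conjI)
 fix x assume x: "x : finite_part X \<rho>"
 thus "Y x : GL n" using GLn by (auto simp: finite_part_def)
 obtain z where z: "x : X" "\<rho> x = Some z" using x by (auto simp: finite_part_def)
 obtain U G where G: "sect X \<rho> U G" "z : U" "G z = x"
  "ALL i<n. ALL j<n. ((%z. Y (G z) $$ (i,j)) hfd (A z * Y x) $$ (i,j)) (at z)" using d[OF z] by blast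
 have "open U" using G(1) by (simp add: sect_def)
 then obtain r where r: "r > 0" "ball z r <= U" using G(2) open_contains_ball by blast
 have in_U: "z + h : U" if "norm h < r" for h by (rule subsetD[OF r(2) add_in_ball[OF that]])
 have "continuous_on (ball 0 r) (%h. G (z + h))"
  by (rule continuous_on_translate[of U]) (use G(1) in_U in "auto simp: sect_def")
 hence "local_lift (finite_part X \<rho>) \<rho> x r (%h. G (z + h))"
  using G(1,3) r(1) in_U z by (intro local_liftI) (auto simp: sect_def finite_part_def)
 moreover have "((%h. Y (G (z + h)) $$ (i,j)) hfd (A z * Y x) $$ (i,j)) (at 0)" if "i < n" "j < n" for i j
 proof -
  have "((%z. Y (G z) $$ (i,j)) hfd (A z * Y x) $$ (i,j)) (at (0 + z))" using G(4) that by simp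
  thus ?thesis unfolding DERIV_shift by (simp only: add.commute)
 qed
 ultimately show "EX z r g. \<rho> x = Some z & local_lift (finite_part X \<rho>) \<rho> x r g &
      (ALL i<n. ALL j<n. ((%h. Y (g h) $$ (i,j)) hfd (A z * Y x) $$ (i,j)) (at 0))"
  using z(2) by blast
qed

text \<open>One chart is fixed at each point; by uniqueness of lifts only its radius depends on the
  choice.\<close>

definition lift_at :: "'a => complex => 'a" where
 "lift_at x = (SOME g. EX r. local_lift X \<rho> x r g)"

lemma lift_at:
 assumes x: "x : X"
 shows "EX r. local_lift X \<rho> x r (lift_at x)"
proof -
 obtain r g where "local_lift X \<rho> x r g" by (rule local_lift_exists[OF cov finF x])
 hence "EX g r. local_lift X \<rho> x r g" by blast
 thus ?thesis unfolding lift_at_def by (rule someI_ex)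
qed

text \<open>At points over the finite plane this is a derivative with respect to \<open>z\<close>,
  turned into a function on the surface whose monodromy can be discussed.\<close>

definition sd :: "nat => ('a => complex) => 'a => complex" where
 "sd k y x = (deriv ^^ k) (%h. y (lift_at x h)) 0"

lemma sd_sect:
 assumes G: "sect X \<rho> U G" and z: "z : U"
 shows "sd k y (G z) = (deriv ^^ k) (%z. y (G z)) z"
proof -
 have "G z : X" using G z by (auto simp: sect_def)
 then obtain r where g: "local_lift X \<rho> (G z) r (lift_at (G z))" using lift_at by blast
 have ev: "\<forall>\<^sub>F z' in nhds z. y (G z') = y (lift_at (G z) (- z + z'))"
  using sect_eq_near[OF G z g] by eventually_elim simp
 have "(deriv ^^ k) (%z. y (G z)) z = (deriv ^^ k) (%z'. y (lift_at (G z) (- z + z'))) z"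
  by (rule higher_deriv_cong_ev[OF ev refl])
 also have "... = (deriv ^^ k) (%h. y (lift_at (G z) h)) (- z + z)" by (rule higher_deriv_shift)
 finally show ?thesis by (simp add: sd_def)
qed

lemma point_over_infinity: obtains x where "x : X" "\<rho> x = None"
proof -
 have "\<rho> ` X = UNIV - Some ` F" using cov unfolding covering_space_def by blast
 hence "None : \<rho> ` X" by auto
 thus ?thesis using that by auto
qed

end

lemma higher_deriv_zero_fun: "(deriv ^^ k) (%_. 0 :: complex) = (%_. 0)"
 by (induction k) auto

lemma higher_deriv_sum:
 fixes f :: "'i => complex => complex"
 assumes S: "open S" "z : S" and f: "!!i. i : I ==> f i hol S"
 shows "(deriv ^^ k) (%w. SUM i:I. f i w) z = (SUM i:I. (deriv ^^ k) (f i) z)"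
 using f
proof (induction I rule: infinite_finite_induct)
 case (insert i I)
 have "(deriv ^^ k) (%w. f i w + (SUM i:I. f i w)) z = (deriv ^^ k) (f i) z + (deriv ^^ k) (%w. SUM i:I. f i w) z"
  using insert.prems S by (intro higher_deriv_add[of _ S] holomorphic_on_sum) auto
 thus ?case using insert by simp
qed (auto simp: higher_deriv_zero_fun)

text \<open>A solution with vanishing initial data is zero: look at its first nonvanishing derivative.\<close>

lemma ode_zero_initial_data:
 assumes f: "f hol ball z r" and q: "!!k. k : {1..n} ==> q k hol ball z r"
  and ode: "!!u. u : ball z r ==> ode_lhs n q u f u = 0" and z0: "!!i. i < n ==> (deriv ^^ i) f z = 0" and u: "u : ball z r"
 shows "f u = 0"
proof -
 have r: "z : ball z r" using u by (auto simp: order.strict_trans1[OF zero_le_dist])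
 have "(deriv ^^ N) f z = 0" for N
 proof (induction N rule: less_induct)
  case (less N)
  show ?case
  proof (cases "N < n")
   case False
   \<comment> \<open>Differentiating the equation \<open>M\<close> times expresses the derivative of
     order \<open>N\<close> at \<open>z\<close> by derivatives of lower order, all of which vanish
     by induction.\<close>
   define M where "M = N - n"
   have N: "N = M + n" using False by (simp add: M_def)
   have "(deriv ^^ n) f w = - (\<Sum>k=1..n. q k w * (deriv ^^ (n - k)) f w)" if "w : ball z r" for w
    using ode[OF that] unfolding ode_lhs_def by (simp add: eq_neg_iff_add_eq_0)
   hence "\<forall>\<^sub>F w in nhds z. (deriv ^^ n) f w = - (\<Sum>k=1..n. q k w * (deriv ^^ (n - k)) f w)"
    using eventually_nhds_in_open[OF open_ball r] by (auto elim: eventually_mono)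
   hence "(deriv ^^ M) ((deriv ^^ n) f) z = (deriv ^^ M) (%w. - (\<Sum>k=1..n. q k w * (deriv ^^ (n - k)) f w)) z"
    by (rule higher_deriv_cong_ev) simp
   also have "... = - (deriv ^^ M) (%w. \<Sum>k=1..n. q k w * (deriv ^^ (n - k)) f w) z"
    using f q r by (intro higher_deriv_uminus[of _ "ball z r"] holomorphic_on_sum holomorphic_on_mult holomorphic_higher_deriv) auto
   also have "(deriv ^^ M) (%w. \<Sum>k=1..n. q k w * (deriv ^^ (n - k)) f w) z = (\<Sum>k=1..n. (deriv ^^ M) (%w. q k w * (deriv ^^ (n - k)) f w) z)"
    using f q r by (intro higher_deriv_sum[of "ball z r"] holomorphic_on_mult holomorphic_higher_deriv) auto
   also have "... = 0"
   proof (intro sum.neutral ballI)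
    fix k assume k: "k : {1..n}"
    have "(deriv ^^ M) (%w. q k w * (deriv ^^ (n - k)) f w) z =
      (\<Sum>i=0..M. of_nat (M choose i) * (deriv ^^ i) (q k) z * (deriv ^^ (M - i)) ((deriv ^^ (n - k)) f) z)"
     using f q[OF k] r by (intro higher_deriv_mult[of _ "ball z r"] holomorphic_higher_deriv) auto
    also have "... = 0"
    proof (intro sum.neutral ballI)
     fix i
     have "(deriv ^^ (M - i)) ((deriv ^^ (n - k)) f) z = (deriv ^^ (M - i + (n - k))) f z" by (simp add: funpow_add)
     also have "... = 0" by (rule less) (use k N in auto)
     finally show "of_nat (M choose i) * (deriv ^^ i) (q k) z * (deriv ^^ (M - i)) ((deriv ^^ (n - k)) f) z = 0" by simp
    qed
    finally show "(deriv ^^ M) (%w. q k w * (deriv ^^ (n - k)) f w) z = 0" .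
   qed
   finally show ?thesis unfolding N funpow_add by simp
  qed (use z0 in auto)
 qed
 thus ?thesis using holomorphic_fun_eq_0_on_ball[OF f u] by blast
qed

definition diagm :: "nat => (nat => complex) => complex mat" where
 "diagm n f = Matrix.mat n n (%(i,j). if i = j then f i else 0)"

lemma diagm_carrier [simp]: "diagm n f : sq_mat n"
 by (simp add: diagm_def)

lemma diagm_mult_entry:
 assumes "Y : sq_mat n" "i < n" "j < n"
 shows "(diagm n f * Y) $$ (i,j) = f i * Y $$ (i,j)"
proof -
 have "(diagm n f * Y) $$ (i,j) = (\<Sum>k<n. diagm n f $$ (i,k) * Y $$ (k,j))"
  by (rule mult_mat_entry[OF diagm_carrier assms])
 also have "... = (\<Sum>k<n. if k = i then f i * Y $$ (i,j) else 0)"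
  using assms(2) by (intro sum.cong refl) (auto simp: diagm_def)
 finally show ?thesis using assms(2) by simp
qed

lemma diagm_GL:
 assumes "!!i. i < n ==> f i ~= 0"
 shows "diagm n f : GL n"
proof (rule GL_I(1)[where B="diagm n (%i. 1 / f i)"])
 show "diagm n f * diagm n (%i. 1 / f i) = 1\<^sub>m n"
 proof (rule eq_matI)
  fix i j assume "i < dim_row (1\<^sub>m n :: complex mat)" "j < dim_col (1\<^sub>m n :: complex mat)"
  thus "(diagm n f * diagm n (%i. 1 / f i)) $$ (i,j) = 1\<^sub>m n $$ (i,j)"
   using diagm_mult_entry[of "diagm n (%i. 1 / f i)" n i j f] assms[of i]
   by (cases "i = j") (auto simp: diagm_def simp del: index_mult_mat(1))
 qed (simp_all add: diagm_def)
qed simp_all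

text \<open>Infinity is treated as a singularity with zero residue; this makes the non-resonance
  condition there trivial.\<close>

lemma eigenvalue_zero_mat: "eigenvalue (zmat n :: complex mat) x ==> x = 0"
proof -
 assume "eigenvalue (zmat n :: complex mat) x"
 then obtain v where v: "v : carrier_vec n" "v ~= 0\<^sub>v n" "zmat n *\<^sub>v v = x \<cdot>\<^sub>v v"
  unfolding eigenvalue_def eigenvector_def by auto
 show "x = 0"
 proof (rule ccontr)
  assume "x ~= 0"
  have "v = 0\<^sub>v n"
  proof (rule eq_vecI)
   fix i assume "i < dim_vec (0\<^sub>v n :: complex vec)"
   hence i: "i < n" by simp
   have "(x \<cdot>\<^sub>v v) $ i = (zmat n *\<^sub>v v) $ i" using v(3) by simp
   hence "x * v $ i = 0" using i v(1) by simp
   thus "v $ i = 0\<^sub>v n $ i" using \<open>x ~= 0\<close> i by simp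
  qed (use v(1) in auto)
  thus False using v(2) by blast
 qed
qed

lemma linear_ode_rhs_entry':
 assumes "A : sq_mat n" "Y : sq_mat n" "i < n" "j < n"
 shows "(A * Y - Y * zmat n) $$ (i,j) = (A * Y :: complex mat) $$ (i,j)"
proof -
 have "1 \<cdot> A = A" by (intro eq_matI) auto
 thus ?thesis using linear_ode_rhs_entry[OF assms, of 1] by simp
qed

lemma holomorphic_on_if_const:
 assumes "c ==> f hol S" "~ c ==> h hol S"
 shows "(%z. if c then f z else h z) hol S"
 using assms by (cases c) auto

text \<open>A scalar gauge change: the power adds a multiple of the identity with a simple pole,
  moving the exponents at \<open>c\<close> by \<open>k\<close>.\<close>

lemma mat_ode_powi:
 assumes Y: "mat_ode n U A1 (%_. zmat n) Y" and U: "open U" "!!z. z : U ==> z ~= c"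
  and A2: "!!z. z : U ==> A2 z = A1 z + (of_int k / (z - c)) \<cdot> 1\<^sub>m n"
 shows "mat_ode n U A2 (%_. zmat n) (%z. (z - c) powi k \<cdot> Y z)"
 unfolding mat_ode_def
proof (intro ballI conjI allI impI)
 fix z assume z: "z : U"
 note cc = mat_odeD(1,3)[OF Y z]
 show A2c: "A2 z : sq_mat n" using cc by (simp add: A2[OF z])
 show sY: "(z - c) powi k \<cdot> Y z : sq_mat n" using cc by simp
 fix i j assume ij: "i < n" "j < n"
 have zc: "z - c ~= 0" using U(2)[OF z] by simp
 have AY: "A1 z * Y z : sq_mat n" using cc by simp
 have d: "((%z. Y z $$ (i,j)) hfd (A1 z * Y z) $$ (i,j)) (at z)"
  using mat_odeD(4)[OF Y z ij] unfolding linear_ode_rhs_entry'[OF cc ij] .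
 have p: "((%z. (z - c) powi k) hfd of_int k * (z - c) powi (k - 1)) (at z)"
  using zc by (auto intro!: derivative_eq_intros)
 have "((%z. (z - c) powi k * Y z $$ (i,j)) hfd
   of_int k * (z - c) powi (k - 1) * Y z $$ (i,j) + (A1 z * Y z) $$ (i,j) * (z - c) powi k) (at z)"
  by (rule DERIV_mult[OF p d])
 also have "of_int k * (z - c) powi (k - 1) * Y z $$ (i,j) + (A1 z * Y z) $$ (i,j) * (z - c) powi k
   = (z - c) powi k * ((A1 z * Y z) $$ (i,j) + of_int k / (z - c) * Y z $$ (i,j))"
  using zc by (simp add: power_int_diff algebra_simps del: index_mult_mat(1))
 also have "(A1 z * Y z) $$ (i,j) + of_int k / (z - c) * Y z $$ (i,j) = (A2 z * Y z) $$ (i,j)"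
 proof -
  let ?I = "(of_int k / (z - c)) \<cdot> 1\<^sub>m n"
  have "A2 z * Y z = A1 z * Y z + ?I * Y z"
   unfolding A2[OF z] by (rule add_mult_distrib_mat[OF cc(1) _ cc(2)]) simp
  moreover have "?I * Y z = (of_int k / (z - c)) \<cdot> Y z"
   using mult_smult_assoc_mat[of "1\<^sub>m n" n n "Y z" n] cc(2) by simp
  ultimately show ?thesis using AY cc(2) ij by (simp del: index_mult_mat(1))
 qed
 also have "(z - c) powi k * (A2 z * Y z) $$ (i,j) = (A2 z * ((z - c) powi k \<cdot> Y z)) $$ (i,j)"
 proof -
  have "A2 z * ((z - c) powi k \<cdot> Y z) = (z - c) powi k \<cdot> (A2 z * Y z)" by (rule mult_smult_distrib[OF A2c cc(2)])
  moreover have "A2 z * Y z : sq_mat n" using A2c cc(2) by simp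
  ultimately show ?thesis using smult_mat_entry[OF _ ij] by metis
 qed
 also have "... = (A2 z * ((z - c) powi k \<cdot> Y z) - (z - c) powi k \<cdot> Y z * zmat n) $$ (i,j)"
  by (rule linear_ode_rhs_entry'[OF A2c sY ij, symmetric])
 finally show "((%z. ((z - c) powi k \<cdot> Y z) $$ (i,j)) hfd
   (A2 z * ((z - c) powi k \<cdot> Y z) - (z - c) powi k \<cdot> Y z * zmat n) $$ (i,j)) (at z)"
  by (rule has_field_derivative_transform_within_open[OF _ U(1) z]) (use smult_mat_entry[OF mat_odeD(3)[OF Y] ij] in simp)
qed auto

section \<open>Hessenberg systems with prescribed poles and their scalar equations\<close>

lemma sum_monic_form:
 fixes c D :: "nat => complex"
 assumes "c n ~= 0"
 shows "(SUM i<=n. c i * D i) = c n * (D n + (\<Sum>k=1..n. c (n - k) / c n * D (n - k)))"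
proof -
 have "(\<Sum>k=1..n. c (n - k) / c n * D (n - k)) = (\<Sum>i<n. c i / c n * D i)"
  using sum.nat_diff_reindex[of "%i. c i / c n * D i" n] by (simp add: sum.atLeast1_atMost_eq)
 thus ?thesis using assms
  by (simp add: distrib_left sum_distrib_left flip: lessThan_Suc_atMost)
qed

text \<open>The monic coefficients of the scalar equation obtained by setting the function with
  index \<open>n\<close> of the chain to zero.\<close>

definition hq :: "nat => (nat => nat => complex => complex) => (nat => complex => complex) => nat => complex => complex" where
 "hq n b g k z = chain1 b g n (n - k) z / chain1 b g n n z"

lemma chain_apply_ode:
 assumes "!!l. l < n ==> g l z ~= 0"
 shows "chain_apply (%_. 1) 0 b g y n z = (\<Prod>l<n. 1 / g l z) * ode_lhs n (hq n b g) z y z"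
proof -
 have "chain1 b g n n z ~= 0" using assms by (simp add: chain_top)
 from sum_monic_form[of "%i. chain1 b g n i z", OF this, of "%i. (deriv ^^ i) y z"]
 show ?thesis by (simp add: chain_apply_def ode_lhs_def hq_def chain_top)
qed

text \<open>The matrix of a Hessenberg system, whose components are the chain in reverse order.\<close>

definition hA :: "nat => (nat => nat => complex => complex) => (nat => complex => complex) => complex => complex mat" where
 "hA n b g z = Matrix.mat n n (%(i,j). if i <= j then b (n - 1 - i) (n - 1 - j) z else if i = j + 1 then g (n - 1 - i) z else 0)"

lemma hA_carrier [simp]: "hA n b g z : sq_mat n"
 by (simp add: hA_def)

lemma hA_mult_entry:
 assumes Y: "Y : sq_mat n" and l: "l < n" and j: "j < n"
 shows "(hA n b g z * Y) $$ (n - 1 - l, j) = (SUM k<=l. b l k z * Y $$ (n - 1 - k, j))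
  + (if Suc l < n then g l z * Y $$ (n - 1 - Suc l, j) else 0)"
proof -
 have "(hA n b g z * Y) $$ (n - 1 - l, j) = (\<Sum>k<n. hA n b g z $$ (n - 1 - l, k) * Y $$ (k, j))"
  by (rule mult_mat_entry[OF hA_carrier Y]) (use l j in auto)
 also have "... = (\<Sum>k<n. hA n b g z $$ (n - 1 - l, n - 1 - k) * Y $$ (n - 1 - k, j))"
  using sum.nat_diff_reindex[of "%k. hA n b g z $$ (n - 1 - l, k) * Y $$ (k, j)" n] by simp
 also have "... = (\<Sum>k<n. (if k <= l then b l k z * Y $$ (n - 1 - k, j) else if k = Suc l then g l z * Y $$ (n - 1 - k, j) else 0))"
 proof (intro sum.cong refl)
  fix k assume "k : {..<n}"
  hence "n - 1 - l <= n - 1 - k \<longleftrightarrow> k <= l" "n - 1 - l = n - 1 - k + 1 \<longleftrightarrow> k = Suc l" "n - 1 - (n - 1 - l) = l" "n - 1 - (n - 1 - k) = k"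
   "n - 1 - l < n" "n - 1 - k < n"
   using l by auto
  thus "hA n b g z $$ (n - 1 - l, n - 1 - k) * Y $$ (n - 1 - k, j) = (if k <= l then b l k z * Y $$ (n - 1 - k, j) else if k = Suc l then g l z * Y $$ (n - 1 - k, j) else 0)"
   unfolding hA_def by simp
 qed
 also have "... = (\<Sum>k<n. if k <= l then b l k z * Y $$ (n - 1 - k, j) else 0) + (\<Sum>k<n. if k = Suc l then g l z * Y $$ (n - 1 - Suc l, j) else 0)"
  unfolding sum.distrib[symmetric] by (intro sum.cong refl) auto
 also have "(\<Sum>k<n. if k <= l then b l k z * Y $$ (n - 1 - k, j) else 0) = (SUM k<=l. b l k z * Y $$ (n - 1 - k, j))"
  by (rule sum.mono_neutral_cong_right) (use l in auto)
 finally show ?thesis using l by simp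
qed

text \<open>The functions \<open>r k\<close> are determined near \<open>a\<close> off the point
  itself, hence at \<open>a\<close> by continuity.\<close>

lemma fuchsian_exponents_unique:
 assumes "fuchsian_with_exponents n q a R" "fuchsian_with_exponents n q a R'"
 shows "R = R'"
proof -
 obtain r where r: "!!k. k : {1..n} ==> r k analytic_on {a}" "!!k. k : {1..n} ==> \<forall>\<^sub>F z in at a. q k z = r k z / (z - a) ^ k"
  "proots (indicial_poly n (%k. r k a)) = R" using assms(1) unfolding fuchsian_with_exponents_def by blast
 obtain s where s: "!!k. k : {1..n} ==> s k analytic_on {a}" "!!k. k : {1..n} ==> \<forall>\<^sub>F z in at a. q k z = s k z / (z - a) ^ k"
  "proots (indicial_poly n (%k. s k a)) = R'" using assms(2) unfolding fuchsian_with_exponents_def by blast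
 have "r k a = s k a" if k: "k : {1..n}" for k
 proof -
  have c: "(r k \<longlongrightarrow> r k a) (at a)" "(s k \<longlongrightarrow> s k a) (at a)"
   using analytic_at_imp_isCont[OF r(1)[OF k]] analytic_at_imp_isCont[OF s(1)[OF k]] by (auto simp: isCont_def)
  have "\<forall>\<^sub>F z in at a. z ~= a" by (simp add: eventually_at_filter)
  hence "\<forall>\<^sub>F z in at a. r k z = s k z"
   using r(2)[OF k] s(2)[OF k] by eventually_elim auto
  thus ?thesis using c tendsto_cong tendsto_unique[OF at_neq_bot] by metis
 qed
 hence "indicial_poly n (%k. r k a) = indicial_poly n (%k. s k a)"
  unfolding indicial_poly_def by (intro arg_cong2[where f="(+)"] sum.cong refl) simp
 thus ?thesis using r(3) s(3) by simp
qed

lemma fuchsian_cong: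
 assumes "fuchsian_with_exponents n q a R" "!!k. k : {1..n} ==> \<forall>\<^sub>F z in at a. q k z = q' k z"
 shows "fuchsian_with_exponents n q' a R"
proof -
 obtain r where r: "!!k. k : {1..n} ==> r k analytic_on {a}" "!!k. k : {1..n} ==> \<forall>\<^sub>F z in at a. q k z = r k z / (z - a) ^ k"
  "proots (indicial_poly n (%k. r k a)) = R" using assms(1) unfolding fuchsian_with_exponents_def by blast
 have "\<forall>\<^sub>F z in at a. q' k z = r k z / (z - a) ^ k" if "k : {1..n}" for k
  using r(2)[OF that] assms(2)[OF that] by eventually_elim simp
 thus ?thesis unfolding fuchsian_with_exponents_def using r by blast
qed

text \<open>Each side says that the last function of a chain vanishes, and inversion relates the two
  chains up to nonvanishing factors.\<close>

lemma chain_apply_inversion: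
 assumes W: "open W" "w : W" "!!w. w : W ==> w ~= 0" and US: "!!w. w : W ==> c + 1 / w : S" and u: "u hol W"
  and b: "!!l i. l < n ==> chain1 b g l i hol S" and g: "!!l z. l < n ==> z : S ==> g l z ~= 0"
  and b': "!!l j w. l < n ==> j <= l ==> w : W ==> binf d c b l j w = b' l j w"
  and g': "!!l w. l < n ==> w : W ==> ginf d c g l w = g' l w"
  and c': "!!l i. l < n ==> chain1 b' g' l i hol W"
 shows "ode_lhs n (hq n b' g') w u w = 0 \<longleftrightarrow> ode_lhs n (hq n b g) (c + 1 / w) (%z. u (1 / (z - c))) (c + 1 / w) = 0"
proof -
 define U where "U = - {c} Int (%z. 1 / (z - c)) -` W"
 have U: "open U" unfolding U_def
  by (rule continuous_open_preimage) (auto intro!: continuous_intros W(1))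
 have USS: "U <= S"
 proof
  fix z assume "z : U"
  hence "c + 1 / (1 / (z - c)) : S" unfolding U_def by (intro US) auto
  thus "z : S" by simp
 qed
 define y where "y z = u (1 / (z - c))" for z
 have y: "y hol U" unfolding y_def
  by (rule holomorphic_on_compose_gen[of "%z. 1 / (z - c)" U u W, unfolded o_def])
   (use u in "auto simp: U_def intro!: holomorphic_intros")
 have WU: "w' ~= 0 & c + 1 / w' : U" if "w' : W" for w' using W(3)[OF that] that by (simp add: U_def)
 have yu: "(%w. y (c + 1 / w)) = u" by (simp add: y_def fun_eq_iff)
 have cong: "chain1 (binf d c b) (ginf d c g) l i w' = chain1 b' g' l i w'"
  if "l <= n" "w' : W" for l i w'
  by (rule chain_cong[OF W(1) b' g' that])
 have gU: "g l z ~= 0" if "l < n" "z : U" for l z using g[OF that(1)] that(2) USS by blast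
 have "w powi (d * int n) * chain_apply (%_. 1) 0 b g y n (c + 1 / w)
   = chain_apply (%_. 1) 0 (binf d c b) (ginf d c g) (%w. y (c + 1 / w)) n w"
 proof (rule chain_inversion[OF U W(1) WU y _ gU _ order.refl W(2)])
  show "chain1 b g l i hol U" if "l < n" for l i
   by (rule holomorphic_on_subset[OF b[OF that] USS])
  show "chain1 (binf d c b) (ginf d c g) l i hol W" if "l < n" for l i
   by (rule holomorphic_transform[OF c'[OF that]]) (use cong that in simp)
 qed
 also have "... = chain_apply (%_. 1) 0 b' g' u n w"
  unfolding yu chain_apply_def by (intro sum.cong refl) (use cong W(2) in simp)
 also have "... = (\<Prod>l<n. 1 / g' l w) * ode_lhs n (hq n b' g') w u w"
 proof (rule chain_apply_ode)
  show "g' l w ~= 0" if "l < n" for l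
   using g'[OF that W(2)] gU[OF that, of "c + 1 / w"] WU[OF W(2)] by (auto simp: ginf_def)
 qed
 also have "chain_apply (%_. 1) 0 b g y n (c + 1 / w) = (\<Prod>l<n. 1 / g l (c + 1 / w)) * ode_lhs n (hq n b g) (c + 1 / w) y (c + 1 / w)"
  by (rule chain_apply_ode) (use gU WU[OF W(2)] in auto)
 finally have e: "w powi (d * int n) * ((\<Prod>l<n. 1 / g l (c + 1 / w)) * ode_lhs n (hq n b g) (c + 1 / w) y (c + 1 / w))
   = (\<Prod>l<n. 1 / g' l w) * ode_lhs n (hq n b' g') w u w" .
 have "(\<Prod>l<n. 1 / g' l w) ~= 0"
  unfolding g'[OF _ W(2), symmetric] using gU WU[OF W(2)] by (auto simp: prod_zero_iff g'[OF _ W(2), symmetric] ginf_def)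
 moreover have "(\<Prod>l<n. 1 / g l (c + 1 / w)) ~= 0" "w powi (d * int n) ~= 0"
  using gU WU[OF W(2)] by (auto simp: prod_zero_iff)
 ultimately show ?thesis using e unfolding y_def by (metis mult_eq_0_iff)
qed

text \<open>The index \<open>l\<close> counts rows from the bottom, so the chain starts with the
  last component. Row \<open>l\<close> is normalised to have index \<open>(m - 2) * l\<close> at
  infinity, hence index 0 for the last component. The value \<open>\<alpha> (n - 1)\<close> scales
  the closing step of the chain, above the last subdiagonal entry.\<close>

locale hess_data =
 fixes a :: "nat => complex" and m n :: nat and P :: "nat => nat => complex poly" and \<alpha> :: "nat => complex"
 assumes m: "m >= 1" and n: "n >= 1" and inj: "inj_on a {1..m}" and \<alpha>: "!!l. l < n ==> \<alpha> l ~= 0"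
  and degP: "!!l j. l < n ==> j <= l ==> P l j = 0 | int (degree (P l j)) <= (int m - 2) * (1 + int l - int j)"
begin

definition num :: "nat => nat => complex => complex" where
 "num l j z = (if l = j then of_int ((int m - 2) * int l) * z ^ (m - 1) else 0) + poly (P l j) z"

definition b :: "nat => nat => complex => complex" where "b l j z = num l j z / (\<Prod>k=1..m. z - a k)"
definition g :: "nat => complex => complex" where "g l z = \<alpha> l / (\<Prod>k=1..m. z - a k)"

lemma num_holomorphic: "num l j hol U"
 unfolding num_def by (cases "l = j") (auto intro!: holomorphic_intros)

lemma p_nonzero: "z ~: a ` {1..m} ==> (\<Prod>k=1..m. z - a k) ~= 0"
 by (auto simp: prod_zero_iff)

lemma open_S: "open (UNIV - a ` {1..m})"
 by (simp add: open_Diff finite_imp_closed)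

lemma bg_holomorphic: "b l j hol UNIV - a ` {1..m}" "g l hol UNIV - a ` {1..m}"
 unfolding b_def g_def using num_holomorphic p_nonzero by (auto intro!: holomorphic_intros)

lemma g_nonzero: "l < n ==> z ~: a ` {1..m} ==> g l z ~= 0"
 using \<alpha> p_nonzero by (simp add: g_def)

lemma L_holomorphic: "l <= n ==> chain1 b g l i hol UNIV - a ` {1..m}"
 by (rule chain_holomorphic[where N=n, OF open_S holomorphic_on_const bg_holomorphic]) (use g_nonzero in blast)+

lemma hq_holomorphic: "hq n b g k hol UNIV - a ` {1..m}"
 unfolding hq_def
 by (intro holomorphic_on_divide L_holomorphic) (use g_nonzero in "auto simp: chain_top")

lemma hA_holomorphic: "mat_hol n (hA n b g) (UNIV - a ` {1..m})"
 unfolding mat_holomorphic_on_def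
proof (intro allI impI)
 fix i j assume ij: "i < n" "j < n"
 have "(%z. if i <= j then b (n - 1 - i) (n - 1 - j) z else if i = j + 1 then g (n - 1 - i) z else 0) hol UNIV - a ` {1..m}"
  by (intro holomorphic_on_if_const bg_holomorphic holomorphic_on_const)
 thus "(%z. hA n b g z $$ (i, j)) hol UNIV - a ` {1..m}"
  by (rule holomorphic_transform) (use ij in "simp add: hA_def")
qed

lemma infinity_data:
 obtains r B where "r > 0" "!!w. norm w < r ==> poly (pinf m a c) w ~= 0"
  "!!w. norm w < r ==> w ~= 0 ==> c + 1 / w ~: a ` {1..m}"
  "!!l j. l < n ==> j <= l ==> B l j hol ball 0 r"
  "!!l j w. l < n ==> j <= l ==> w : ball 0 r - {0} ==> binf (int m - 2) c b l j w = B l j w"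
proof -
 obtain r where r: "r > 0" "!!w. norm w < r ==> poly (pinf m a c) w ~= 0"
  "!!w. norm w < r ==> w ~= 0 ==> c + 1 / w ~: a ` {1..m}"
 proof (rule pinf_nonzero[of m a c])
  fix r :: real assume r: "r > 0" "!!w. norm w < r ==> poly (pinf m a c) w ~= 0"
   "!!w. norm w < r ==> w ~= 0 ==> c + 1 / w ~: a ` {1..m}"
  show thesis by (rule that[OF r])
 qed
 have ex: "EX B. B hol ball 0 r & (ALL w:ball 0 r - {0}. binf (int m - 2) c b l j w = B w)" if "l < n" "j <= l" for l j
  by (rule binf_holomorphic[OF m refl r(2,3) _ degP[OF that]]) (auto simp: b_def num_def)
 define B where "B l j = (SOME B. B hol ball 0 r & (ALL w:ball 0 r - {0}. binf (int m - 2) c b l j w = B w))" for l j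
 have B: "B l j hol ball 0 r & (ALL w:ball 0 r - {0}. binf (int m - 2) c b l j w = B l j w)" if "l < n" "j <= l" for l j
  unfolding B_def by (rule someI_ex[OF ex[OF that]])
 show ?thesis by (rule that[OF r, of B]) (use B in blast)+
qed

text \<open>The form of \<open>ginf\<close> that remains holomorphic and nonzero at
  \<open>w = 0\<close>.\<close>

definition gi :: "complex => nat => complex => complex" where "gi c l w = - \<alpha> l / poly (pinf m a c) w"

lemma ginf_gi:
 assumes "w ~= 0" "poly (pinf m a c) w ~= 0"
 shows "ginf (int m - 2) c g l w = gi c l w"
 unfolding gi_def by (rule ginf_eq[OF assms refl]) (simp add: g_def)

text \<open>In the coordinate \<open>w\<close> the rescaled chain has holomorphic coefficients and
  nonvanishing \<open>gi\<close> up to \<open>w = 0\<close>, so its monic coefficients are analytic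
  there. They belong to the inverted equation because both operators have the same kernel.\<close>

lemma hq_nonsingular_at_infinity: "nonsingular_at_infinity n (hq n b g)"
 unfolding nonsingular_at_infinity_def
proof
 fix c
 obtain r B where r: "r > 0" "!!w. norm w < r ==> poly (pinf m a c) w ~= 0"
  "!!w. norm w < r ==> w ~= 0 ==> c + 1 / w ~: a ` {1..m}"
  and B: "!!l j. l < n ==> j <= l ==> B l j hol ball 0 r"
  "!!l j w. l < n ==> j <= l ==> w : ball 0 r - {0} ==> binf (int m - 2) c b l j w = B l j w"

 proof (rule infinity_data[of c], goal_cases)
  case (1 r B)
  show thesis by (rule that[OF 1(2-)])
 qed
 let ?Q = "hq n B (gi c)"
 have gi0: "gi c l w ~= 0" if "l < n" "norm w < r" for l w using r(2)[OF that(2)] \<alpha>[OF that(1)] by (simp add: gi_def)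
 have gih: "gi c l hol ball 0 r" for l
  unfolding gi_def using r(2) by (auto intro!: holomorphic_intros)
 have ch: "chain1 B (gi c) l i hol ball 0 r" if "l <= n" for l i
  by (rule chain_holomorphic[OF open_ball _ _ _ _ that]) (use B gih gi0 in auto)
 have Qan: "?Q k analytic_on {0}" for k
 proof -
  have "?Q k hol ball 0 r" unfolding hq_def
   by (intro holomorphic_on_divide ch) (use gi0 in "auto simp: chain_top")
  thus ?thesis using r(1) by (metis analytic_at centre_in_ball open_ball)
 qed
 have "inverted_equation n c (hq n b g) ?Q"
  unfolding inverted_equation_def
 proof -
  have "\<forall>\<^sub>F w in at 0. w : ball 0 r - {0}" using r(1) by (intro eventually_at_in_open) auto
  thus "\<forall>\<^sub>F w in at 0. ALL u. u analytic_on {w} --> (ode_lhs n ?Q w u w = 0 \<longleftrightarrow>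
     ode_lhs n (hq n b g) (c + 1 / w) (%z. u (1 / (z - c))) (c + 1 / w) = 0)"
  proof eventually_elim
   case (elim w)
   show ?case
   proof (intro allI impI)
    fix u assume "u analytic_on {w}"
    then obtain W0 where W0: "open W0" "w : W0" "u hol W0" unfolding analytic_at by blast
    show "ode_lhs n ?Q w u w = 0 \<longleftrightarrow> ode_lhs n (hq n b g) (c + 1 / w) (%z. u (1 / (z - c))) (c + 1 / w) = 0"
    proof (rule chain_apply_inversion[where W="W0 Int (ball 0 r - {0})" and S="UNIV - a ` {1..m}" and d="int m - 2"])
     show "open (W0 Int (ball 0 r - {0}))" using W0 by (auto simp: open_delete)
     show "u hol W0 Int (ball 0 r - {0})" using W0(3) by (rule holomorphic_on_subset) blast
     show "chain1 B (gi c) l i hol W0 Int (ball 0 r - {0})" if "l < n" for l i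
      by (rule holomorphic_on_subset[OF ch]) (use that in auto)
     show "chain1 b g l i hol UNIV - a ` {1..m}" if "l < n" for l i
      using L_holomorphic[of l i] that by simp
    qed (use W0(2) elim r(3) g_nonzero B(2) ginf_gi r(2) in auto)
   qed
  qed
 qed
 thus "EX Q. inverted_equation n c (hq n b g) Q & (ALL k:{1..n}. Q k analytic_on {0})"
  using Qan by blast
qed

text \<open>Rescaling the rows by powers of \<open>w = 1 / z\<close> gives a system whose matrix
  \<open>C\<close> is holomorphic at \<open>w = 0\<close>. Written as a singularity of the first
  kind it has residue 0, so the rescaled solution, an intertwiner with the zero system, extends
  invertibly. One \<open>r0\<close> serves for all smaller radii, as the definition of the form at
  infinity demands.\<close>

lemma solution_at_infinity:
 obtains r0 where "r0 > 0" "!!z. norm z > 1 / r0 ==> z ~: a ` {1..m}"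
  "!!r Y. 0 < r ==> r <= r0 ==> mat_ode n {z. norm z > 1 / r} (hA n b g) (%_. zmat n) Y ==>
   (!!z. norm z > 1 / r ==> Y z : GL n) ==>
   EX V. mat_hol n V (ball 0 r) & (ALL h:ball 0 r. V h : GL n) &
    (ALL z. norm z > 1 / r --> Y z = diagm n (%i. z powi ((int m - 2) * int (n - 1 - i))) * V (1 / z))"
proof -
 obtain r0 B where r: "r0 > 0" "!!w. norm w < r0 ==> poly (pinf m a 0) w ~= 0"
  "!!w. norm w < r0 ==> w ~= 0 ==> 0 + 1 / w ~: a ` {1..m}"
  and B: "!!l j. l < n ==> j <= l ==> B l j hol ball 0 r0"
  "!!l j w. l < n ==> j <= l ==> w : ball 0 r0 - {0} ==> binf (int m - 2) 0 b l j w = B l j w"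

 proof (rule infinity_data[of 0], goal_cases)
  case (1 r B)
  show thesis by (rule that[OF 1(2-)])
 qed
 let ?d = "int m - 2"
 have inv: "norm (1 / z) < r & z ~= 0" if "norm z > 1 / r" "r > 0" for z :: complex and r
 proof -
  have "norm z > 0" using that by (smt (verit) divide_pos_pos)
  thus ?thesis using that by (auto simp: norm_divide field_simps)
 qed
 show thesis
 proof (rule that[OF r(1)])
  show "z ~: a ` {1..m}" if "norm z > 1 / r0" for z using r(3)[of "1 / z"] inv[OF that r(1)] by simp
  fix dl Y assume dl: "0 < dl" "dl <= r0" and Y: "mat_ode n {z. norm z > 1 / dl} (hA n b g) (%_. zmat n) Y"
   and GLn: "!!z. norm z > 1 / dl ==> Y z : GL n"
  define C where "C = hA n B (gi 0)"
  have Cc: "C w : sq_mat n" for w by (simp add: C_def)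
  have Ch: "mat_hol n (%w. w \<cdot> C w) (ball 0 dl)"
   unfolding mat_holomorphic_on_def
  proof (intro allI impI)
   fix i j assume ij: "i < n" "j < n"
   have "B (n - 1 - i) (n - 1 - j) hol ball 0 dl" if "i <= j"
    by (rule holomorphic_on_subset[OF B(1)]) (use that ij dl in auto)
   moreover have "gi 0 (n - 1 - i) hol ball 0 dl"
    unfolding gi_def using r(2) dl by (auto intro!: holomorphic_intros)
   ultimately have "(%w. w * (if i <= j then B (n - 1 - i) (n - 1 - j) w else if i = j + 1 then gi 0 (n - 1 - i) w else 0)) hol ball 0 dl"
    by (intro holomorphic_on_mult holomorphic_on_ident holomorphic_on_if_const holomorphic_on_const)
   thus "(%w. (w \<cdot> C w) $$ (i,j)) hol ball 0 dl"
    by (rule holomorphic_transform) (use ij in "simp add: C_def hA_def")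
  qed
  define W where "W w = diagm n (%i. w powi (?d * int (n - 1 - i))) * Y (1 / w)" for w
  have big: "norm (1 / w) > 1 / dl" "w ~= 0" "norm w < r0" "1 / w ~: a ` {1..m}" if "w : ball 0 dl - {0}" for w
   using that dl r(3)[of w] by (auto simp: norm_divide frac_less2)
  have Yc: "Y (1 / w) : sq_mat n" if "w : ball 0 dl - {0}" for w using GLn[OF big(1)[OF that]] by blast
  have WGL: "W w : GL n" if "w : ball 0 dl - {0}" for w
   unfolding W_def by (intro GL_mult diagm_GL GLn big(1)[OF that]) (use big(2)[OF that] in simp)
  \<comment> \<open>The transformed matrix entry by entry. On and above the diagonal this is
    \<open>binf\<close>; on the subdiagonal the exponent collapses to \<open>- d - 2\<close>, which
    is \<open>ginf\<close>.\<close>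
  have CA: "C w $$ (i,k) = (if i = k then of_int (?d * int (n - 1 - i)) / w else 0) - w powi (?d * (int k - int i) - 2) * hA n b g (1 / w) $$ (i,k)"
   if w: "w : ball 0 dl - {0}" and ik: "i < n" "k < n" for w i k
  proof -
   note bw = big[OF w]
   consider "i <= k" | "i = k + 1" | "i > k + 1" by linarith
   thus ?thesis
   proof cases
    case 1
    have "C w $$ (i,k) = binf ?d 0 b (n - 1 - i) (n - 1 - k) w"
     using B(2)[of "n - 1 - i" "n - 1 - k" w] 1 ik bw by (simp add: C_def hA_def)
    moreover have "int (n - 1 - i) - int (n - 1 - k) = int k - int i" "n - 1 - i = n - 1 - k \<longleftrightarrow> i = k" using ik by auto
    ultimately show ?thesis using 1 ik by (simp add: binf_def hA_def)
   next
    case 2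
    hence e: "?d * (int k - int i) - 2 = - ?d - 2" by simp
    have "C w $$ (i,k) = ginf ?d 0 g (n - 1 - i) w"
     using 2 ik ginf_gi[OF bw(2) r(2)[OF bw(3)]] by (simp add: C_def hA_def)
    thus ?thesis using 2 ik unfolding e by (simp add: ginf_def hA_def)
   next
    case 3
    thus ?thesis using ik by (simp add: C_def hA_def)
   qed
  qed
  have ode: "((%w. W w $$ (i,j)) hfd (w \<cdot> C w * W w - W w * zmat n) $$ (i,j) / w) (at w)"
   if w: "w : ball 0 dl - {0}" and ij: "i < n" "j < n" for w i j
  proof -
   note bw = big[OF w]
   let ?l = "int (n - 1 - i)"
   have w0: "w ~= 0" using bw by simp
   have We: "W w $$ (k,j) = w powi (?d * int (n - 1 - k)) * Y (1 / w) $$ (k,j)" if "k < n" "w : ball 0 dl - {0}" for k w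
    unfolding W_def by (rule diagm_mult_entry[OF Yc[OF that(2)] that(1) ij(2)])
   have AY: "((%z. Y z $$ (i,j)) hfd (hA n b g (1 / w) * Y (1 / w)) $$ (i,j)) (at (1 / w))"
    using mat_odeD(4)[OF Y _ ij, of "1 / w"] bw(1) linear_ode_rhs_entry'[OF hA_carrier Yc[OF w] ij]
    by (simp del: index_mult_mat(1))
   have "((%w. 1 / w) hfd - (1 / w ^ 2)) (at w)"
    using w0 by (auto intro!: derivative_eq_intros simp: power2_eq_square)
   from DERIV_chain2[where f="%z. Y z $$ (i,j)" and g="%w. 1 / w", OF AY this]
   have d1: "((%w. Y (1 / w) $$ (i,j)) hfd (hA n b g (1 / w) * Y (1 / w)) $$ (i,j) * - (1 / w ^ 2)) (at w)" .
   have "((%w. w powi (?d * ?l)) hfd of_int (?d * ?l) * w powi (?d * ?l - 1)) (at w)"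
    using w0 by (auto intro!: derivative_eq_intros)
   from DERIV_mult[OF this d1]
   have "((%w. w powi (?d * ?l) * Y (1 / w) $$ (i,j)) hfd
     of_int (?d * ?l) * w powi (?d * ?l - 1) * Y (1 / w) $$ (i,j)
     + (hA n b g (1 / w) * Y (1 / w)) $$ (i,j) * - (1 / w ^ 2) * w powi (?d * ?l)) (at w)" .
   also have "of_int (?d * ?l) * w powi (?d * ?l - 1) * Y (1 / w) $$ (i,j)
     + (hA n b g (1 / w) * Y (1 / w)) $$ (i,j) * - (1 / w ^ 2) * w powi (?d * ?l)
     = of_int (?d * ?l) / w * W w $$ (i,j) - w powi (?d * ?l - 2) * (hA n b g (1 / w) * Y (1 / w)) $$ (i,j)"
    using w0 by (simp add: We[OF ij(1) w] power_int_diff power2_eq_square mult_ac del: index_mult_mat(1))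
   also have "... = (C w * W w) $$ (i,j)"
   proof -
    have Wc: "W w : sq_mat n" using WGL[OF w] by blast
    have "(C w * W w) $$ (i,j) = (\<Sum>k<n. C w $$ (i,k) * W w $$ (k,j))" by (rule mult_mat_entry[OF Cc Wc ij])
    also have "... = (\<Sum>k<n. (if k = i then of_int (?d * ?l) / w * W w $$ (i,j) else 0)
      - w powi (?d * ?l - 2) * (hA n b g (1 / w) $$ (i,k) * Y (1 / w) $$ (k,j)))"
    proof (intro sum.cong refl)
     fix k assume "k : {..<n}"
     hence k: "k < n" by simp
     have "?d * (int k - int i) - 2 + ?d * int (n - 1 - k) = ?d * ?l - 2"
     proof -
      have "int (n - 1 - k) = int n - 1 - int k" "?l = int n - 1 - int i" using k ij by auto
      thus ?thesis by (simp add: algebra_simps)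
     qed
     hence p: "w powi (?d * (int k - int i) - 2) * w powi (?d * int (n - 1 - k)) = w powi (?d * ?l - 2)"
      using power_int_add[of w "?d * (int k - int i) - 2" "?d * int (n - 1 - k)"] w0 by (simp only: simp_thms)
     have h: "w powi (?d * (int k - int i) - 2) * hA n b g (1 / w) $$ (i,k) * W w $$ (k,j)
       = w powi (?d * ?l - 2) * (hA n b g (1 / w) $$ (i,k) * Y (1 / w) $$ (k,j))"
      unfolding We[OF k w] p[symmetric] by (simp only: mult_ac)
     have "C w $$ (i,k) * W w $$ (k,j) = (if i = k then of_int (?d * ?l) / w else 0) * W w $$ (k,j)
       - w powi (?d * (int k - int i) - 2) * hA n b g (1 / w) $$ (i,k) * W w $$ (k,j)"
      unfolding CA[OF w ij(1) k] by (rule left_diff_distrib)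
     moreover have "(if i = k then of_int (?d * ?l) / w else 0) * W w $$ (k,j) = (if k = i then of_int (?d * ?l) / w * W w $$ (i,j) else 0)"
      by (cases "k = i") simp_all
     ultimately show "C w $$ (i,k) * W w $$ (k,j) = (if k = i then of_int (?d * ?l) / w * W w $$ (i,j) else 0)
      - w powi (?d * ?l - 2) * (hA n b g (1 / w) $$ (i,k) * Y (1 / w) $$ (k,j))"
      unfolding h by (simp only:)
    qed
    also have "... = of_int (?d * ?l) / w * W w $$ (i,j) - w powi (?d * ?l - 2) * (hA n b g (1 / w) * Y (1 / w)) $$ (i,j)"
     unfolding sum_subtractf mult_mat_entry[OF hA_carrier Yc[OF w] ij] sum_distrib_left[symmetric] using ij(1) by simp
    finally show ?thesis by simp
   qed
   also have "... = (w \<cdot> C w * W w - W w * zmat n) $$ (i,j) / w"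
    using linear_ode_rhs_entry[OF Cc _ ij, of "W w" w w] WGL[OF w] w0 by auto
   finally show ?thesis
    by (rule has_field_derivative_transform_within_open[of _ _ _ "ball 0 dl - {0}"])
     (use w We[OF ij(1)] in "auto simp: open_delete")
  qed
  have "EX V. mat_hol n V (ball 0 dl) & (ALL z:ball 0 dl. V z : GL n) & (ALL z:ball 0 dl - {0}. V z = W z)"
  proof (rule intertwiner_extends_GL[OF dl(1) Ch _ _ WGL ode])
   show "mat_hol n (%_. zmat n) (ball 0 dl)" by (simp add: mat_holomorphic_on_def)
   have "0 \<cdot> C 0 = zmat n" using Cc[of 0] by (intro eq_matI) auto
   thus "x = y" if "eigenvalue (0 \<cdot> C 0) x" "eigenvalue (zmat n) y" for x y
    using that eigenvalue_zero_mat by metis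
  qed (use Cc in auto)
  then obtain V where V: "mat_hol n V (ball 0 dl)" "ALL z:ball 0 dl. V z : GL n" "ALL z:ball 0 dl - {0}. V z = W z" by blast
  have "Y z = diagm n (%i. z powi (?d * int (n - 1 - i))) * V (1 / z)" if z: "norm z > 1 / dl" for z
  proof (rule eq_matI)
   have zz: "1 / z : ball 0 dl - {0}" using inv[OF z dl(1)] by auto
   have Vz: "V (1 / z) = W (1 / z)" using V(3) zz by blast
   have Yz: "Y z : sq_mat n" using GLn[OF z] by blast
   have Vc: "V (1 / z) : sq_mat n" using V(2) zz by blast
   fix i j assume "i < dim_row (diagm n (%i. z powi (?d * int (n - 1 - i))) * V (1 / z))"
    "j < dim_col (diagm n (%i. z powi (?d * int (n - 1 - i))) * V (1 / z))"
   hence ij: "i < n" "j < n" using Vc by (auto simp: diagm_def)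
   have "(diagm n (%i. z powi (?d * int (n - 1 - i))) * V (1 / z)) $$ (i,j) = z powi (?d * int (n - 1 - i)) * ((1 / z) powi (?d * int (n - 1 - i)) * Y z $$ (i,j))"
    using diagm_mult_entry[OF Vc ij] diagm_mult_entry[OF Yz ij] Vz by (simp add: W_def)
   also have "... = Y z $$ (i,j)"
    using inv[OF z dl(1)] by (simp add: power_int_divide_distrib)
   finally show "Y z $$ (i,j) = (diagm n (%i. z powi (?d * int (n - 1 - i))) * V (1 / z)) $$ (i,j)" ..
  next
   have "1 / z : ball 0 dl" using inv[OF z dl(1)] by auto
   hence "V (1 / z) : sq_mat n" using V(2) by blast
   thus "dim_row (Y z) = dim_row (diagm n (%i. z powi (?d * int (n - 1 - i))) * V (1 / z))"
    "dim_col (Y z) = dim_col (diagm n (%i. z powi (?d * int (n - 1 - i))) * V (1 / z))"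
    using GLn[OF z] by (auto simp: diagm_def)
  qed
  thus "EX V. mat_hol n V (ball 0 dl) & (ALL h:ball 0 dl. V h : GL n) &
    (ALL z. norm z > 1 / dl --> Y z = diagm n (%i. z powi (?d * int (n - 1 - i))) * V (1 / z))" using V by blast
 qed
qed

text \<open>Used to cancel the factor \<open>z - a k\<close> of the denominator: \<open>bk\<close>
  and \<open>gk\<close> extend \<open>(z - a k) * b\<close> and \<open>(z - a k) * g\<close> over
  the puncture, as the Euler form of the chain requires.\<close>

definition pk :: "nat => complex => complex" where "pk k z = (PROD j:{1..m} - {k}. z - a j)"
definition bk :: "nat => nat => nat => complex => complex" where "bk k l j z = num l j z / pk k z"
definition gk :: "nat => nat => complex => complex" where "gk k l z = \<alpha> l / pk k z"

lemma pk_eq: "k : {1..m} ==> (\<Prod>j=1..m. z - a j) = (z - a k) * pk k z"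
 unfolding pk_def by (rule prod.remove) auto

lemma pk_nonzero: "k : {1..m} ==> z ~: a ` ({1..m} - {k}) ==> pk k z ~= 0"
 unfolding pk_def by (auto simp: prod_zero_iff)

lemma Vk: "open (UNIV - a ` ({1..m} - {k}))" "k : {1..m} ==> a k : UNIV - a ` ({1..m} - {k})"
proof -
 show "open (UNIV - a ` ({1..m} - {k}))" by (intro open_Diff open_UNIV finite_imp_closed) auto
 show "a k : UNIV - a ` ({1..m} - {k})" if "k : {1..m}"
  using inj_onD[OF inj _ that] by blast
qed

lemma bgk_holomorphic:
 assumes "k : {1..m}"
 shows "bk k l j hol UNIV - a ` ({1..m} - {k})" "gk k l hol UNIV - a ` ({1..m} - {k})"
 unfolding bk_def gk_def using pk_nonzero[OF assms] num_holomorphic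
 by (auto simp: pk_def intro!: holomorphic_intros)

lemma bgk_eq:
 assumes "k : {1..m}" "z ~= a k"
 shows "bk k l j z = (z - a k) * b l j z" "gk k l z = (z - a k) * g l z"
 unfolding bk_def gk_def b_def g_def pk_eq[OF assms(1)] using assms(2) by simp_all

lemma hAk_eq:
 assumes "k : {1..m}" "z ~= a k"
 shows "hA n (bk k) (gk k) z = (z - a k) \<cdot> hA n b g z"
 by (rule eq_matI) (auto simp: hA_def bgk_eq[OF assms])

text \<open>The Euler chain is regular at \<open>a k\<close>, and its coefficients differ from those
  of the plain chain by powers of \<open>z - a k\<close>. The exponents then come from
  \<open>euler_char_poly\<close>.\<close>

lemma hq_fuchsian:
 assumes k: "k : {1..m}"
 shows "fuchsian_with_exponents n (hq n b g) (a k) (proots (char_poly (hA n (bk k) (gk k) (a k))))"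
proof -
 let ?V = "UNIV - a ` ({1..m} - {k})" and ?c = "chain (%z. z - a k) 1 (bk k) (gk k)"
 define r where "r i z = ?c n (n - i) z / ?c n n z" for i z
 have gk0: "gk k l z ~= 0" if "l < n" "z : ?V" for l z
  using that \<alpha> pk_nonzero[OF k] by (simp add: gk_def)
 have ch: "?c l i hol ?V" if "l <= n" for l i
  by (rule chain_holomorphic[OF Vk(1) _ _ _ _ that]) (use bgk_holomorphic[OF k] gk0 in "auto intro!: holomorphic_intros")
 have top: "?c n n z ~= 0" if "z : ?V" for z using gk0[OF _ that] by (simp add: chain_top)
 have "r i analytic_on {a k}" for i
 proof -
  have "r i hol ?V" unfolding r_def using ch top by (intro holomorphic_on_divide) auto
  thus ?thesis using Vk k by (metis analytic_at)
 qed
 moreover have "\<forall>\<^sub>F z in at (a k). hq n b g i z = r i z / (z - a k) ^ i" if i: "i : {1..n}" for i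
 proof -
  have "\<forall>\<^sub>F z in at (a k). z : ?V - {a k}" using Vk k by (intro eventually_at_in_open) auto
  thus ?thesis
  proof eventually_elim
   case (elim z)
   have e: "chain1 b g n i z = ?c n i z * (z - a k) ^ i" for i
   proof (rule chain_euler[of "?V - {a k}", OF _ _ _ _ _ order.refl elim])
    show "?c l i hol ?V - {a k}" if "l < n" for l i
     using ch[of l i] that by (auto intro: holomorphic_on_subset)
   qed (use Vk(1) bgk_eq[OF k] in auto)
   have "(z - a k) ^ n = (z - a k) ^ (n - i) * (z - a k) ^ i" using i by (simp flip: power_add)
   thus ?case unfolding hq_def r_def e using elim by simp
  qed
 qed
 moreover have "char_poly (hA n (bk k) (gk k) (a k)) = indicial_poly n (%i. r i (a k))"
  unfolding r_def
 proof (rule euler_char_poly[OF Vk(1) Vk(2)[OF k]])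
  show "gk k l (a k) ~= 0" if "l < n" for l using gk0[OF that Vk(2)[OF k]] .
  show "n > 0" using n by simp
 qed (auto simp: hA_def)
 ultimately show ?thesis unfolding fuchsian_with_exponents_def by (intro exI[of _ r]) auto
qed

text \<open>Read from the bottom, each row expresses the next component by the previous ones and a
  derivative; the top row closes the chain and is the scalar equation.\<close>

lemma solution_last_component:
 assumes Y: "mat_ode n U (hA n b g) (%_. zmat n) Y" and U: "open U" "U <= UNIV - a ` {1..m}" and j: "j < n"
 shows "(%z. Y z $$ (n - 1, j)) hol U"
  "!!z. z : U ==> ode_lhs n (hq n b g) z (%z. Y z $$ (n - 1, j)) z = 0"
  "!!z l. z : U ==> l < n ==> Y z $$ (n - 1 - l, j) = chain_apply (%_. 1) 0 b g (%z. Y z $$ (n - 1, j)) l z"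
proof -
 \<comment> \<open>The value 0 beyond the top row turns the closing equation into one more step of
   the chain.\<close>
 define u where "u l z = (if l < n then Y z $$ (n - 1 - l, j) else 0)" for l z
 have d: "((%z. Y z $$ (n - 1 - l, j)) hfd (hA n b g z * Y z) $$ (n - 1 - l, j)) (at z)"
  if "z : U" "l < n" for z l
 proof -
  have i: "n - 1 - l < n" using that by simp
  show ?thesis using mat_odeD(4)[OF Y that(1) i j] unfolding linear_ode_rhs_entry'[OF hA_carrier mat_odeD(3)[OF Y that(1)] i j] .
 qed
 have u0: "u 0 = (%z. Y z $$ (n - 1, j))" using n by (simp add: u_def fun_eq_iff)
 have hol: "u 0 hol U"
  unfolding holomorphic_on_def field_differentiable_def
 proof
  fix z assume "z : U"
  from d[OF this, of 0] n have "(u 0 hfd (hA n b g z * Y z) $$ (n - 1, j)) (at z)"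
   unfolding u0 by (simp del: index_mult_mat(1))
  thus "EX f'. (u 0 hfd f') (at z within U)" using has_field_derivative_at_within by blast
 qed
 thus "(%z. Y z $$ (n - 1, j)) hol U" unfolding u0 .
 have gU: "g l z ~= 0" if "l < n" "z : U" for l z using g_nonzero[OF that(1)] that(2) U(2) by blast
 have step: "g l z * u (Suc l) z = 1 * deriv (u l) z - (SUM k<=l. b l k z * u k z)" if l: "l < n" and z: "z : U" for l z
 proof -
  have "deriv (u l) z = (hA n b g z * Y z) $$ (n - 1 - l, j)"
  proof (rule DERIV_imp_deriv)
   have "u l = (%z. Y z $$ (n - 1 - l, j))" using l by (simp add: u_def fun_eq_iff)
   thus "(u l hfd (hA n b g z * Y z) $$ (n - 1 - l, j)) (at z)" using d[OF z l] by simp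
  qed
  also have "... = (SUM k<=l. b l k z * Y z $$ (n - 1 - k, j)) + (if Suc l < n then g l z * Y z $$ (n - 1 - Suc l, j) else 0)"
   by (rule hA_mult_entry[OF mat_odeD(3)[OF Y z] l j])
  also have "(SUM k<=l. b l k z * Y z $$ (n - 1 - k, j)) = (SUM k<=l. b l k z * u k z)"
   using l by (intro sum.cong refl) (simp add: u_def)
  also have "(if Suc l < n then g l z * Y z $$ (n - 1 - Suc l, j) else 0) = g l z * u (Suc l) z" by (simp add: u_def)
  finally show ?thesis by simp
 qed
 have ch: "chain1 b g l i hol U" if "l < n" for l i
  by (rule holomorphic_on_subset[OF L_holomorphic U(2)]) (use that in simp)
 have eq: "u l z = chain_apply (%_. 1) 0 b g (u 0) l z" if "l <= n" "z : U" for l z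
  by (rule chain_apply_unique[OF U(1) _ hol ch gU step that]) auto
 show "Y z $$ (n - 1 - l, j) = chain_apply (%_. 1) 0 b g (%z. Y z $$ (n - 1, j)) l z" if "z : U" "l < n" for z l
  using eq[of l z] that unfolding u0 by (simp add: u_def)
 show "ode_lhs n (hq n b g) z (%z. Y z $$ (n - 1, j)) z = 0" if z: "z : U" for z
 proof -
  have "chain_apply (%_. 1) 0 b g (u 0) n z = 0" using eq[OF order.refl z] by (simp add: u_def)
  moreover have "chain_apply (%_. 1) 0 b g (u 0) n z = (\<Prod>l<n. 1 / g l z) * ode_lhs n (hq n b g) z (u 0) z"
   by (rule chain_apply_ode) (use gU z in auto)
  moreover have "(\<Prod>l<n. 1 / g l z) ~= 0" using gU z by (auto simp: prod_zero_iff)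
  ultimately show ?thesis unfolding u0 by simp
 qed
qed

text \<open>The chain generated by a scalar solution fills a column; the top row holds because the
  function with index \<open>n\<close> of this chain vanishes.\<close>

lemma system_from_scalar:
 assumes f: "!!j. j < n ==> f j hol U" and U: "open U" "U <= UNIV - a ` {1..m}"
  and ode: "!!j z. j < n ==> z : U ==> ode_lhs n (hq n b g) z (f j) z = 0"
 shows "mat_ode n U (hA n b g) (%_. zmat n) (%z. Matrix.mat n n (%(i,j). chain_apply (%_. 1) 0 b g (f j) (n - 1 - i) z))"
  (is "mat_ode n U _ _ ?Y")
 unfolding mat_ode_def
proof (intro ballI conjI allI impI)
 fix z i j assume z: "z : U" and ij: "i < n" "j < n"
 let ?F = "chain_apply (%_. 1) 0 b g (f j)"
 define l where "l = n - 1 - i"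
 have l: "l < n" "i = n - 1 - l" using ij by (auto simp: l_def)
 have gU: "g l z ~= 0" if "l < n" for l using g_nonzero[OF that] z U(2) by blast
 have ch: "chain1 b g l i hol U" if "l < n" for l i
  by (rule holomorphic_on_subset[OF L_holomorphic U(2)]) (use that in simp)
 have Yc: "?Y z : sq_mat n" by simp
 have "?F l hol U" by (rule chain_apply_holomorphic[OF U(1) _ f[OF ij(2)] ch[OF l(1)]]) auto
 hence "(?F l hfd deriv (?F l) z) (at z)" using U(1) z by (rule holomorphic_derivI)
 also have "deriv (?F l) z = (SUM k<=l. b l k z * ?F k z) + g l z * ?F (Suc l) z"
  using chain_apply_step[OF U(1) z _ f[OF ij(2)] ch[OF l(1)] gU[OF l(1)]] by simp
 also have "g l z * ?F (Suc l) z = (if Suc l < n then g l z * ?Y z $$ (n - 1 - Suc l, j) else 0)"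
 proof (cases "Suc l < n")
  case False
  hence "Suc l = n" using l by simp
  moreover have "?F n z = 0" using chain_apply_ode[where g=g and z=z and n=n, OF gU] ode[OF ij(2) z] by simp
  ultimately show ?thesis using False by simp
 qed (use ij in simp)
 also have "(SUM k<=l. b l k z * ?F k z) = (SUM k<=l. b l k z * ?Y z $$ (n - 1 - k, j))"
  using l ij by (intro sum.cong refl) simp
 also have "(SUM k<=l. b l k z * ?Y z $$ (n - 1 - k, j)) + (if Suc l < n then g l z * ?Y z $$ (n - 1 - Suc l, j) else 0)
   = (hA n b g z * ?Y z) $$ (n - 1 - l, j)"
  by (rule hA_mult_entry[OF Yc l(1) ij(2), symmetric])
 also have "... = (hA n b g z * ?Y z - ?Y z * zmat n) $$ (i, j)"
  unfolding l(2)[symmetric] by (rule linear_ode_rhs_entry'[OF hA_carrier Yc ij, symmetric])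
 finally show "((%z. ?Y z $$ (i, j)) hfd (hA n b g z * ?Y z - ?Y z * zmat n) $$ (i, j)) (at z)"
  by (rule has_field_derivative_transform_within_open[OF _ U(1) z]) (use ij in "simp add: l_def")
qed simp_all

end

section \<open>Hessenberg systems on the covering surface\<close>

lemma at_right_0_small: "c > 0 ==> \<forall>\<^sub>F dl in at_right (0::real). 0 < dl & dl < c"
 unfolding eventually_at_right_field by (intro exI[of _ c]) auto

lemma eventually_ball_avoids:
 fixes x :: complex
 assumes "finite K"
 shows "\<forall>\<^sub>F dl in at_right 0. 0 < dl & ball x dl Int K <= {x}"
proof -
 obtain d where d: "d > 0" "ALL y:K. y ~= x --> d <= dist x y" using finite_set_avoid[OF assms] by blast
 show ?thesis using at_right_0_small[OF d(1)]
  by eventually_elim (use d(2) in force)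
qed

text \<open>All that remains of the curve and the paths is \<open>half\<close>: near each puncture a
  half-plane maps to the surface so that translation by \<open>tpi\<close> becomes
  \<open>\<sigma> k\<close>. It is stated for all small radii, like the local forms it is combined
  with.\<close>

locale punctured_covering = covered_surface X \<rho> "a ` {1..m}"
 for X :: "'a::topological_space set" and \<rho> :: "'a => csphere" and a :: "nat => complex" and m :: nat +
 fixes \<sigma> :: "nat => 'a => 'a"
 assumes conn: "connected X" and deck: "!!k. k : {1..m} ==> deck_transformation X \<rho> (\<sigma> k)"
  and half: "!!k. k : {1..m} ==> \<forall>\<^sub>F dl in at_right 0. EX et. continuous_on {w. Re w < ln dl} et &
   et ` {w. Re w < ln dl} <= X & (ALL w. Re w < ln dl --> \<rho> (et w) = Some (a k + exp w) &
    et (w + tpi) = \<sigma> k (et w))"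

text \<open>The scalar part with its pole at \<open>a m\<close> carries the last index
  \<open>\<kappa>0\<close>; splitting it off normalises that index to 0 and is the origin of the
  shifted exponents at \<open>a m\<close>.\<close>

locale hess_surface = hess_data a m n P \<alpha> + punctured_covering X \<rho> a m \<sigma>
 for a m n P \<alpha> and X :: "'a::topological_space set" and \<rho> \<sigma> +
 fixes \<kappa>0 :: int and A :: "complex => complex mat"
 assumes A: "A z : sq_mat n"
  and AS: "z ~: a ` {1..m} ==> A z = hA n b g z + (of_int \<kappa>0 / (z - a m)) \<cdot> 1\<^sub>m n"
begin

text \<open>The matrix \<open>A (a k + t)\<close> times \<open>t\<close>, with the removable
  singularity at \<open>t = 0\<close> filled in. At \<open>t = 0\<close> the scalar part survives
  only for \<open>k = m\<close>.\<close>

definition Bk :: "nat => complex => complex mat" where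
 "Bk k t = hA n (bk k) (gk k) (a k + t) + (of_int \<kappa>0 * (if k = m then 1 else t / (a k + t - a m))) \<cdot> 1\<^sub>m n"

lemma Bk_carrier [simp]: "Bk k t : sq_mat n"
 unfolding Bk_def by (rule add_carrier_mat) simp

lemma Bk_eq:
 assumes k: "k : {1..m}" and t: "t ~= 0" and S: "a k + t ~: a ` {1..m}"
 shows "Bk k t = t \<cdot> A (a k + t)"
proof -
 have 1: "hA n (bk k) (gk k) (a k + t) = t \<cdot> hA n b g (a k + t)"
  using hAk_eq[OF k, of "a k + t"] t by simp
 have 2: "of_int \<kappa>0 * (if k = m then 1 else t / (a k + t - a m)) = t * (of_int \<kappa>0 / (a k + t - a m))"
  using t by simp
 show ?thesis unfolding Bk_def 1 2 AS[OF S]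
  by (rule eq_matI) (auto simp: hA_def distrib_left)
qed

lemma Bk_holomorphic:
 assumes k: "k : {1..m}" and dl: "ball (a k) dl Int a ` {1..m} <= {a k}"
 shows "mat_hol n (Bk k) (ball 0 dl)"
 unfolding mat_holomorphic_on_def
proof (intro allI impI)
 fix i j assume ij: "i < n" "j < n"
 have inV: "a k + t : UNIV - a ` ({1..m} - {k})" if "norm t < dl" for t
 proof -
  have "a k + t : ball (a k) dl" by (rule add_in_ball[OF that])
  show ?thesis
  proof (rule DiffI[OF UNIV_I], rule notI)
   assume im: "a k + t : a ` ({1..m} - {k})"
   hence "a k + t : a ` {1..m}" by (rule subsetD[OF image_mono, rotated]) simp
   hence "a k + t : {a k}" by (intro subsetD[OF dl] IntI \<open>a k + t : ball (a k) dl\<close>)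
   hence e: "a k + t = a k" by (rule singletonD)
   have "a k : a ` ({1..m} - {k})" using im unfolding e .
   thus False by (rule DiffD2[OF Vk(2)[OF k]])
  qed
 qed
 have sh: "(%t. f (a k + t)) hol ball 0 dl" if "f hol UNIV - a ` ({1..m} - {k})" for f
 proof (rule holomorphic_on_compose_gen[of "%t. a k + t" "ball 0 dl" f, unfolded o_def, OF _ that])
  show "(%t. a k + t) ` ball 0 dl <= UNIV - a ` ({1..m} - {k})" by (rule image_subsetI) (use inV in simp)
 qed (intro holomorphic_intros)
 have q: "(%t. of_int \<kappa>0 * (if k = m then 1 else t / (a k + t - a m))) hol ball 0 dl"
 proof (cases "k = m")
  case False
  hence "m : {1..m} - {k}" using m by auto
  hence am: "a m : a ` ({1..m} - {k})" by (rule imageI[of m _ a])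
  have "a k + t ~= a m" if "norm t < dl" for t
  proof
   assume e: "a k + t = a m"
   show False by (rule DiffD2[OF inV[OF that, unfolded e] am])
  qed
  thus ?thesis using False by (auto intro!: holomorphic_intros)
 qed simp
 have "(%t. (if i <= j then bk k (n - 1 - i) (n - 1 - j) (a k + t) else if i = j + 1 then gk k (n - 1 - i) (a k + t) else 0)
   + (of_int \<kappa>0 * (if k = m then 1 else t / (a k + t - a m))) * (if i = j then 1 else 0)) hol ball 0 dl"
  by (intro holomorphic_on_add holomorphic_on_mult q holomorphic_on_const holomorphic_on_if_const sh bgk_holomorphic k)
 thus "(%t. Bk k t $$ (i,j)) hol ball 0 dl"
  by (rule holomorphic_transform) (use ij in "simp add: Bk_def hA_def")
qed

lemma avoid:
 assumes k: "k : {1..m}"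
 shows "\<forall>\<^sub>F dl in at_right 0. 0 < dl & ball (a k) dl Int a ` {1..m} <= {a k}"
 by (rule eventually_ball_avoids) simp

lemma half_plane_system:
 assumes k: "k : {1..m}" and dl: "dl > 0" "ball (a k) dl Int a ` {1..m} <= {a k}" and w: "Re w < ln dl"
 shows "a k + exp w ~: a ` {1..m}" "deriv (%w. a k + exp w) w \<cdot> A (a k + exp w) = Bk k (exp w)"
proof -
 have "norm (exp w) < dl" using w dl(1) by (metis exp_less_cancel_iff exp_ln norm_exp_eq_Re)
 hence "a k + exp w : ball (a k) dl" by (rule add_in_ball)
 moreover have "a k + exp w ~= a k" by simp
 ultimately show S: "a k + exp w ~: a ` {1..m}" using dl(2) by blast
 have "deriv (%w. a k + exp w) w = exp w" by (rule DERIV_imp_deriv) (auto intro!: derivative_eq_intros)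
 thus "deriv (%w. a k + exp w) w \<cdot> A (a k + exp w) = Bk k (exp w)" using Bk_eq[OF k _ S] by simp
qed

lemma half_plane_solution:
 assumes k: "k : {1..m}" and dl: "dl > 0" "ball (a k) dl Int a ` {1..m} <= {a k}"
 shows "system_solution n A {w. Re w < ln dl} (%w. Some (a k + exp w)) Y \<longleftrightarrow>
  (ALL w. Re w < ln dl --> Y w : GL n) & mat_ode n {w. Re w < ln dl} (%w. Bk k (exp w)) (%_. zmat n) Y"
proof -
 let ?U = "{w. Re w < ln dl}"
 have "system_solution n A ?U (%w. Some (a k + exp w)) Y \<longleftrightarrow> (ALL w:?U. Y w : GL n) &
   mat_ode n ?U (%w. deriv (%w. a k + exp w) w \<cdot> A (a k + exp w)) (%_. zmat n) Y"
 proof (rule system_solution_planar[OF Re_less_half_plane(1)])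
  show "deriv (%w. a k + exp w) w ~= 0" for w
  proof -
   have "deriv (%w. a k + exp w) w = exp w" by (rule DERIV_imp_deriv) (auto intro!: derivative_eq_intros)
   thus ?thesis by simp
  qed
 qed (auto intro!: holomorphic_intros A)
 also have "mat_ode n ?U (%w. deriv (%w. a k + exp w) w \<cdot> A (a k + exp w)) (%_. zmat n) Y
   \<longleftrightarrow> mat_ode n ?U (%w. Bk k (exp w)) (%_. zmat n) Y"
  unfolding mat_ode_def using half_plane_system(2)[OF k dl] by (intro ball_cong) simp_all
 finally show ?thesis by simp
qed

lemma lifted_half_plane_solution:
 assumes k: "k : {1..m}" and dl: "dl > 0" "ball (a k) dl Int a ` {1..m} <= {a k}"
  and Y: "system_solution n A (finite_part X \<rho>) \<rho> Y"
  and et: "continuous_on {w. Re w < ln dl} et" "et ` {w. Re w < ln dl} <= X" "!!w. Re w < ln dl ==> \<rho> (et w) = Some (a k + exp w)"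
 shows "mat_ode n {w. Re w < ln dl} (%w. Bk k (exp w)) (%_. zmat n) (%w. Y (et w))" "Re w < ln dl ==> Y (et w) : GL n"
proof -
 let ?U = "{w. Re w < ln dl}"
 have et3: "w : ?U ==> \<rho> (et w) = Some (a k + exp w)" for w using et(3) by simp
 have h: "(%w. a k + exp w) hol ?U" by (intro holomorphic_intros)
 note s = system_solution_ode[OF Y A Re_less_half_plane(1) et(1,2) et3 h]
 show "mat_ode n ?U (%w. Bk k (exp w)) (%_. zmat n) (%w. Y (et w))"
  by (rule mat_ode_cong[OF s(1) Re_less_half_plane(1)]) (use half_plane_system(2)[OF k dl] in auto)
 show "Re w < ln dl ==> Y (et w) : GL n" using s(2) by simp
qed

text \<open>Some radius is small enough for the half-plane map and for the local form at once. There
  the surface solution, pulled back to the half-plane, is a solution to which the local form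
  applies.\<close>

lemma residue_char_poly:
 assumes k: "k : {1..m}" and E: "E : sq_mat n" and loc: "local_form_at n A (a k) E"
  and Y: "system_solution n A (finite_part X \<rho>) \<rho> Y"
 shows "char_poly (Bk k 0) = char_poly E"
proof -
 have "EX dl. (0 < dl & ball (a k) dl Int a ` {1..m} <= {a k}) & (EX et. continuous_on {w. Re w < ln dl} et &
   et ` {w. Re w < ln dl} <= X & (ALL w. Re w < ln dl --> \<rho> (et w) = Some (a k + exp w) &
    et (w + tpi) = \<sigma> k (et w))) & (ALL Y.
    system_solution n A {w. Re w < ln dl} (%w. Some (a k + exp w)) Y -->
    (EX Z C. mat_hol n Z (ball (a k) dl) & (ALL z:ball (a k) dl. Z z : GL n) & C : GL n &
      (ALL w. Re w < ln dl --> Y w = Z (a k + exp w) * mat_exp n (w \<cdot> E) * C)))"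
  by (rule eventually_happens'[OF trivial_limit_at_right_real eventually_conj[OF avoid[OF k]
    eventually_conj[OF half[OF k] loc[unfolded local_form_at_def]]]])
 then obtain dl et where dl: "0 < dl" "ball (a k) dl Int a ` {1..m} <= {a k}"
  and et: "continuous_on {w. Re w < ln dl} et" "et ` {w. Re w < ln dl} <= X"
   "ALL w. Re w < ln dl --> \<rho> (et w) = Some (a k + exp w) & et (w + tpi) = \<sigma> k (et w)"
  and lf: "ALL Y. system_solution n A {w. Re w < ln dl} (%w. Some (a k + exp w)) Y -->
    (EX Z C. mat_hol n Z (ball (a k) dl) & (ALL z:ball (a k) dl. Z z : GL n) & C : GL n &
      (ALL w. Re w < ln dl --> Y w = Z (a k + exp w) * mat_exp n (w \<cdot> E) * C))"
  by (elim exE conjE) (rule that)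
 have et3: "\<rho> (et w) = Some (a k + exp w)" if "Re w < ln dl" for w using et(3) that by blast
 have s: "mat_ode n {w. Re w < ln dl} (%w. Bk k (exp w)) (%_. zmat n) (%w. Y (et w))"
  by (rule lifted_half_plane_solution(1)[OF k dl Y et(1,2)]) (rule et3)
 have sG: "Y (et w) : GL n" if "Re w < ln dl" for w
  by (rule lifted_half_plane_solution(2)[OF k dl Y et(1,2) _ that]) (rule et3)
 have "system_solution n A {w. Re w < ln dl} (%w. Some (a k + exp w)) (%w. Y (et w))"
  unfolding half_plane_solution[OF k dl] using s sG by (intro conjI allI impI)
 from lf[rule_format, OF this] obtain Z C where Z: "mat_hol n Z (ball (a k) dl)" "ALL z:ball (a k) dl. Z z : GL n" "C : GL n"
  and form: "ALL w. Re w < ln dl --> Y (et w) = Z (a k + exp w) * mat_exp n (w \<cdot> E) * C"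
  by (elim exE conjE) (rule that)
 show ?thesis
 proof (rule local_form_residue[OF dl(1) Bk_holomorphic[OF k dl(2)] Bk_carrier E s, where Z="%t. Z (a k + t)", OF _ _ Z(3)])
  show "mat_hol n (%t. Z (a k + t)) (ball 0 dl)"
   unfolding mat_holomorphic_on_def
  proof (intro allI impI)
   fix i j assume "i < n" "j < n"
   hence "(%z. Z z $$ (i,j)) hol ball (a k) dl" using Z(1) unfolding mat_holomorphic_on_def by blast
   thus "(%t. Z (a k + t) $$ (i,j)) hol ball 0 dl"
   proof (rule holomorphic_on_compose_gen[of "%t. a k + t" "ball 0 dl" "%z. Z z $$ (i,j)", unfolded o_def, rotated])
    show "(%t. a k + t) ` ball 0 dl <= ball (a k) dl" by (rule image_subsetI) (use add_in_ball in simp)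
   qed (intro holomorphic_intros)
  qed
  show "Z (a k + t) : GL n" if "t : ball 0 dl" for t using Z(2) add_in_ball[of t dl "a k"] that by simp
  show "Y (et w) = Z (a k + exp w) * mat_exp n (w \<cdot> E) * C" if "Re w < ln dl" for w using form that by blast
 qed
qed

lemma proots_residue:
 assumes k: "k : {1..m}"
 shows "proots (char_poly (hA n (bk k) (gk k) (a k))) =
  image_mset (%x. x - (if k = m then of_int \<kappa>0 else 0)) (proots (char_poly (Bk k 0)))"
proof -
 have "hA n (bk k) (gk k) (a k) = Bk k 0 - (if k = m then of_int \<kappa>0 else 0) \<cdot> 1\<^sub>m n"
  by (rule eq_matI) (auto simp: Bk_def hA_def)
 thus ?thesis using proots_char_poly_shift[OF Bk_carrier] by metis
qed

lemma normalised_solution: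
 assumes Y: "mat_ode n U A (%_. zmat n) Y" and U: "open U" "U <= UNIV - a ` {1..m}"
 shows "mat_ode n U (hA n b g) (%_. zmat n) (%z. (z - a m) powi (- \<kappa>0) \<cdot> Y z)"
proof (rule mat_ode_powi[OF Y U(1)])
 have am: "a m : a ` {1..m}" using m by auto
 show "z ~= a m" if "z : U" for z using that U(2) am by blast
 show "hA n b g z = A z + (of_int (- \<kappa>0) / (z - a m)) \<cdot> 1\<^sub>m n" if "z : U" for z
 proof -
  have "z ~: a ` {1..m}" using that U(2) by blast
  thus ?thesis unfolding AS[OF \<open>z ~: a ` {1..m}\<close>] by (intro eq_matI) (auto simp: hA_def)
 qed
qed

lemma denormalised_solution:
 assumes Y: "mat_ode n U (hA n b g) (%_. zmat n) Y" and U: "open U" "U <= UNIV - a ` {1..m}"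
 shows "mat_ode n U A (%_. zmat n) (%z. (z - a m) powi \<kappa>0 \<cdot> Y z)"
proof (rule mat_ode_powi[OF Y U(1)])
 have am: "a m : a ` {1..m}" using m by auto
 show "z ~= a m" if "z : U" for z using that U(2) am by blast
qed (use AS U(2) in blast)

lemma smult_GL:
 assumes "c ~= 0" "Y : GL n"
 shows "c \<cdot> Y : GL n"
 using assms unfolding GL_iff_det by (auto simp: det_smult)

lemma powi_am: "z ~: a ` {1..m} ==> (z - a m) powi k ~= 0"
proof -
 assume "z ~: a ` {1..m}"
 moreover have "a m : a ` {1..m}" using m by auto
 ultimately have "z - a m ~= 0" by force
 thus ?thesis by simp
qed

end

section \<open>From the system to the scalar equation\<close>

lemma Lim_at_0:
 fixes f :: "complex => complex"
 assumes "V hol ball 0 r" "r > 0" "!!h. norm h < r ==> h ~= 0 ==> f h = V h"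
 shows "Lim (at 0) f = V 0"
proof -
 have "isCont V 0" using assms(1,2) holomorphic_on_imp_continuous_on continuous_on_eq_continuous_at
  by (metis centre_in_ball open_ball)
 hence "(V \<longlongrightarrow> V 0) (at 0)" by (simp add: isCont_def)
 moreover have "\<forall>\<^sub>F h in at 0. h : ball 0 r - {0}" using assms(2) by (intro eventually_at_in_open) auto
 hence "\<forall>\<^sub>F h in at 0. V h = f h" by eventually_elim (use assms(3) in auto)
 ultimately have "(f \<longlongrightarrow> V 0) (at 0)" by (rule Lim_transform_eventually)
 thus ?thesis by (simp add: tendsto_Lim)
qed

context hess_surface
begin

text \<open>The scalar solutions are the last row of the normalised fundamental matrix; this row has
  index 0 and so extends over infinity. The normalising factor depends on \<open>\<rho> x\<close>
  only, which leaves the monodromy matrices unchanged. A vanishing combination of the last row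
  generates, through the chain, a vanishing combination of all rows, contrary to
  invertibility.\<close>

lemma equation_from_system:
 assumes Y: "system_solution n A (finite_part X \<rho>) \<rho> Y"
  and Chi: "!!k. k : {1..m} ==> Chi k : sq_mat n"
   "!!k x. k : {1..m} ==> x : finite_part X \<rho> ==> Y x = Y (\<sigma> k x) * Chi k"
  and sim: "simultaneously_similar m Chi M"
 shows "equation_monodromy n m (hq n b g) X \<rho> \<sigma> M"
proof -
 define yf where "yf j x = (the (\<rho> x) - a m) powi (- \<kappa>0) * Y x $$ (n - 1, j)" for j x
 \<comment> \<open>The system lives over the finite plane; over infinity the value is supplied as
   the limit in the fixed chart.\<close>
 define y where "y j x = (if \<rho> x = None then Lim (at 0) (%h. yf j (lift_at x h)) else yf j x)" for j x
 have n1: "n - 1 < n" using n by simp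
 have Yc: "Y x : sq_mat n" if "x : finite_part X \<rho>" for x using Y that unfolding system_solution_def by blast
 have S: "U <= UNIV - a ` {1..m}" if "sect X \<rho> U G" for U G using section_avoids[OF that] by blast
 have op: "open U" if "sect X \<rho> U G" for U G using that by (simp add: sect_def)
 have ode: "mat_ode n U (hA n b g) (%_. zmat n) (%z. (z - a m) powi (- \<kappa>0) \<cdot> Y (G z))" if G: "sect X \<rho> U G" for U G
  by (rule normalised_solution[OF system_solution_sect[OF Y A G] op[OF G] S[OF G]])
 have yG: "y j (G z) = ((z - a m) powi (- \<kappa>0) \<cdot> Y (G z)) $$ (n - 1, j)" if G: "sect X \<rho> U G" and z: "z : U" and j: "j < n" for U G z j
 proof -
  have "\<rho> (G z) = Some z" using G z by (simp add: sect_def)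
  thus ?thesis using smult_mat_entry[OF Yc[OF sect_finite[OF G z]] n1 j] by (simp add: y_def yf_def)
 qed
 have holG: "(%z. y j (G z)) hol U" and odeG: "!!z. z : U ==> ode_lhs n (hq n b g) z (%z. y j (G z)) z = 0"
  if G: "sect X \<rho> U G" and j: "j < n" for U G j
 proof -
  note s = solution_last_component[OF ode[OF G] op[OF G] S[OF G] j]
  show "(%z. y j (G z)) hol U"
   by (rule holomorphic_transform[OF s(1)]) (simp only: yG[OF G _ j])
  show "ode_lhs n (hq n b g) z (%z. y j (G z)) z = 0" if z: "z : U" for z
  proof -
   have "\<forall>\<^sub>F z' in nhds z. y j (G z') = ((z' - a m) powi (- \<kappa>0) \<cdot> Y (G z')) $$ (n - 1, j)"
    using eventually_nhds_in_open[OF op[OF G] z] by eventually_elim (simp only: yG[OF G _ j])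
   hence "(deriv ^^ i) (%z. y j (G z)) z = (deriv ^^ i) (%z. ((z - a m) powi (- \<kappa>0) \<cdot> Y (G z)) $$ (n - 1, j)) z" for i
    by (rule higher_deriv_cong_ev) simp
   thus ?thesis using s(2)[OF z] unfolding ode_lhs_def by simp
  qed
 qed
 have inf: "EX r>0. local_lift X \<rho> x r (lift_at x) & (ALL j<n. (%h. y j (lift_at x h)) hol ball 0 r)"
  if x: "x : X" "\<rho> x = None" for x
 proof (rule solution_at_infinity)
  fix r0 :: real assume r0: "r0 > 0" "!!z. norm z > 1 / r0 ==> z ~: a ` {1..m}"
   and ext: "!!r Y. 0 < r ==> r <= r0 ==> mat_ode n {z. norm z > 1 / r} (hA n b g) (%_. zmat n) Y ==>
   (!!z. norm z > 1 / r ==> Y z : GL n) ==>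
   EX V. mat_hol n V (ball 0 r) & (ALL h:ball 0 r. V h : GL n) &
    (ALL z. norm z > 1 / r --> Y z = diagm n (%i. z powi ((int m - 2) * int (n - 1 - i))) * V (1 / z))"
  obtain r1 where "local_lift X \<rho> x r1 (lift_at x)" using lift_at[OF x(1)] by blast
  define r where "r = min r0 r1"
  have r: "0 < r" "r <= r0" using r0(1) local_liftD(1)[OF \<open>local_lift X \<rho> x r1 (lift_at x)\<close>] by (auto simp: r_def)
  have g: "local_lift X \<rho> x r (lift_at x)"
   by (rule local_lift_shrink[OF \<open>local_lift X \<rho> x r1 (lift_at x)\<close> r(1)]) (simp add: r_def)
  let ?G = "%z. lift_at x (1 / z)"
  have G: "sect X \<rho> {z. norm z > 1 / r} ?G" by (rule local_lift_sect_infinity[OF g x(2)])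
  have "(z - a m) powi (- \<kappa>0) \<cdot> Y (?G z) : GL n" if z: "norm z > 1 / r" for z
  proof (rule smult_GL)
   have "z : {z. norm z > 1 / r}" using z by simp
   thus "(z - a m) powi (- \<kappa>0) ~= 0" using powi_am S[OF G] by blast
   show "Y (?G z) : GL n" using Y sect_finite[OF G \<open>z : _\<close>] unfolding system_solution_def by blast
  qed
  from ext[OF r ode[OF G] this] obtain V where V: "mat_hol n V (ball 0 r)" "ALL h:ball 0 r. V h : GL n"
   "ALL z. norm z > 1 / r --> (z - a m) powi (- \<kappa>0) \<cdot> Y (?G z) = diagm n (%i. z powi ((int m - 2) * int (n - 1 - i))) * V (1 / z)" by blast
  have "(%h. y j (lift_at x h)) hol ball 0 r" if j: "j < n" for j
  proof -
   have Vh: "(%h. V h $$ (n - 1, j)) hol ball 0 r" using V(1) n1 j unfolding mat_holomorphic_on_def by blast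
   have yV: "y j (lift_at x h) = V h $$ (n - 1, j)" if h: "norm h < r" "h ~= 0" for h
   proof -
    have z: "norm (1 / h) > 1 / r" using h r(1) by (simp add: norm_divide frac_less2)
    hence "1 / h : {z. norm z > 1 / r}" by simp
    from yG[OF G this j] have "y j (lift_at x h) = ((1 / h - a m) powi (- \<kappa>0) \<cdot> Y (?G (1 / h))) $$ (n - 1, j)" by simp
    also have "... = (diagm n (%i. (1 / h) powi ((int m - 2) * int (n - 1 - i))) * V (1 / (1 / h))) $$ (n - 1, j)"
     using V(3) z by metis
    also have "... = (1 / h) powi ((int m - 2) * int (n - 1 - (n - 1))) * V (1 / (1 / h)) $$ (n - 1, j)"
     by (rule diagm_mult_entry) (use V(2) h(1) n1 j in auto)
    finally show ?thesis by simp
   qed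
   have yn: "y j (lift_at x h) = yf j (lift_at x h)" if h: "norm h < r" "h ~= 0" for h
    using local_liftD(5)[OF g h(1)] x(2) h(2) by (simp add: y_def)
   have "y j (lift_at x 0) = V 0 $$ (n - 1, j)"
   proof -
    have "y j x = Lim (at 0) (%h. yf j (lift_at x h))" using x(2) by (simp add: y_def)
    also have "... = V 0 $$ (n - 1, j)" by (rule Lim_at_0[OF Vh r(1)]) (use yV yn in metis)
    finally show ?thesis using local_liftD(3)[OF g] by simp
   qed
   hence "y j (lift_at x h) = V h $$ (n - 1, j)" if "h : ball 0 r" for h using yV[of h] that by (cases "h = 0") auto
   thus ?thesis using holomorphic_transform[OF Vh] by metis
  qed
  thus ?thesis using r(1) g by blast
 qed
 have sol: "equation_solution n (hq n b g) X \<rho> (y j)" if j: "j < n" for j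
 proof (rule equation_solutionI)
  fix x z assume x: "x : X" "\<rho> x = Some z"
  obtain r G where G: "r > 0" "sect X \<rho> (ball z r) G" "G z = x" by (rule section_exists[OF x])
  hence z: "z : ball z r" by simp
  show "EX U G. sect X \<rho> U G & z : U & G z = x & (%z. y j (G z)) hol U & ode_lhs n (hq n b g) z (%z. y j (G z)) z = 0"
   using G(2,3) z holG[OF G(2) j] odeG[OF G(2) j z] by blast
 next
  fix x assume x: "x : X" "\<rho> x = None"
  show "EX r g. local_lift X \<rho> x r g & (%h. y j (g h)) hol ball 0 r" using inf[OF x] j by blast
 qed
 have indep: "ALL i<n. c i = 0" if zero: "ALL x:X. (\<Sum>i<n. c i * y i x) = 0" for c
 proof (intro allI impI)
  fix i assume i: "i < n"
  obtain x where "x : X" "\<rho> x = None" by (rule point_over_infinity)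
  then obtain r where "r > 0" "local_lift X \<rho> x r (lift_at x)" using inf by blast
  have "sect X \<rho> {z. norm z > 1 / r} (%z. lift_at x (1 / z))"
   by (rule local_lift_sect_infinity) fact+
  then obtain U G where G: "sect X \<rho> U G" and Udef: "U = {z. norm z > 1 / r}" by blast
  define z :: complex where "z = of_real (1 / r + 1)"
  have z: "z : U" using \<open>r > 0\<close> unfolding z_def Udef mem_Collect_eq norm_of_real by simp
  \<comment> \<open>The coefficients are placed in the first column of a square matrix, so that the
    combination is again a matrix solution.\<close>
  define Cm where "Cm = Matrix.mat n n (%(i,j). if j = 0 then c i else 0)"
  have Cm: "Cm : sq_mat n" by (simp add: Cm_def)
  let ?Y = "%z. (z - a m) powi (- \<kappa>0) \<cdot> Y (G z)"
  have Yc: "?Y z : sq_mat n" if "z : U" for z using mat_odeD(3)[OF ode[OF G] that] .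
  have odeC: "mat_ode n U (hA n b g) (%_. zmat n) (%z. ?Y z * Cm)"
   by (rule mat_ode_mult[OF ode[OF G] mat_ode_const0[OF Cm] op[OF G]])
  have n0: "0 < n" using n by simp
  have last: "(?Y z * Cm) $$ (n - 1, 0) = 0" if z: "z : U" for z
  proof -
   have "(?Y z * Cm) $$ (n - 1, 0) = (\<Sum>k<n. ?Y z $$ (n - 1, k) * Cm $$ (k, 0))"
    by (rule mult_mat_entry[OF Yc[OF z] Cm n1 n0])
   also have "... = (\<Sum>k<n. c k * y k (G z))"
    by (intro sum.cong refl) (use yG[OF G z] n0 in "simp add: Cm_def")
   also have "... = 0" using zero G z by (auto simp: sect_def)
   finally show ?thesis .
  qed
  have col: "(?Y z * Cm) $$ (l, 0) = 0" if l: "l < n" for l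
  proof -
   have "(?Y z * Cm) $$ (n - 1 - (n - 1 - l), 0) = chain_apply (%_. 1) 0 b g (%z. (?Y z * Cm) $$ (n - 1, 0)) (n - 1 - l) z"
    by (rule solution_last_component(3)[OF odeC op[OF G] S[OF G] n0 z]) (use l in simp)
   also have "... = 0"
   proof -
    have "\<forall>\<^sub>F z' in nhds z. (?Y z' * Cm) $$ (n - 1, 0) = 0"
     using eventually_nhds_in_open[OF op[OF G] z] by eventually_elim (rule last)
    hence "(deriv ^^ i) (%z. (?Y z * Cm) $$ (n - 1, 0)) z = (deriv ^^ i) (%_. 0) z" for i
     by (rule higher_deriv_cong_ev) simp
    thus ?thesis unfolding chain_apply_def by (simp add: higher_deriv_zero_fun)
   qed
   finally show ?thesis using l by simp
  qed
  have YGL: "?Y z : GL n"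
   by (rule smult_GL) (use powi_am S[OF G] z Y sect_finite[OF G z] in "auto simp: system_solution_def")
  have "c i = Cm $$ (i, 0)" using i n0 by (simp add: Cm_def)
  also have "... = (minv (?Y z) * (?Y z * Cm)) $$ (i, 0)" using GL_cancel(1)[OF YGL Cm] by simp
  also have "... = (\<Sum>k<n. minv (?Y z) $$ (i,k) * (?Y z * Cm) $$ (k,0))"
   by (rule mult_mat_entry[OF minv(4)[OF YGL] mult_carrier_mat[OF Yc[OF z] Cm] i n0])
  also have "... = 0" by (intro sum.neutral ballI) (use col in simp)
  finally show "c i = 0" .
 qed
 have mon: "y j x = (\<Sum>i<n. y i (\<sigma> k x) * Chi k $$ (i,j))" if k: "k : {1..m}" and x: "x : X" and j: "j < n" for k x j
 proof -
  have d: "!!x. x : X ==> \<sigma> k x : X" "!!x. x : X ==> \<rho> (\<sigma> k x) = \<rho> x"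
   using deck[OF k] unfolding deck_transformation_def homeomorphism_def by auto
  have fin: "y j x = (\<Sum>i<n. y i (\<sigma> k x) * Chi k $$ (i,j))" if x: "x : X" "\<rho> x = Some z" for x z
  proof -
   have f: "x : finite_part X \<rho>" "\<sigma> k x : finite_part X \<rho>" using x d by (auto simp: finite_part_def)
   have "Y x $$ (n - 1, j) = (\<Sum>i<n. Y (\<sigma> k x) $$ (n - 1, i) * Chi k $$ (i,j))"
    unfolding Chi(2)[OF k f(1)] by (rule mult_mat_entry[OF Yc[OF f(2)] Chi(1)[OF k] n1 j])
   thus ?thesis using x d(2)[OF x(1)] by (simp add: y_def yf_def sum_distrib_left mult.assoc)
  qed
  show ?thesis
  proof (cases "\<rho> x")
   case None
   \<comment> \<open>Over infinity the relation follows by passing to the limit in the chart at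
     \<open>x\<close> and its image under \<open>\<sigma> k\<close>.\<close>
   obtain r where r: "r > 0" "local_lift X \<rho> x r (lift_at x)" "ALL j<n. (%h. y j (lift_at x h)) hol ball 0 r"
    using inf[OF x None] by blast
   have "\<rho> (\<sigma> k x) = None" using d(2)[OF x] None by simp
   then obtain r' where r': "r' > 0" "local_lift X \<rho> (\<sigma> k x) r' (lift_at (\<sigma> k x))"
    "ALL j<n. (%h. y j (lift_at (\<sigma> k x) h)) hol ball 0 r'"
    using inf[OF d(1)[OF x]] by blast
   have s: "local_lift X \<rho> (\<sigma> k x) r (\<sigma> k \<circ> lift_at x)" by (rule local_lift_deck[OF r(2) deck[OF k] x])
   define R where "R = min r r'"
   have R: "R > 0" "R <= r" "R <= r'" using r(1) r'(1) by (auto simp: R_def)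
   have eq: "y j (lift_at x h) = (\<Sum>i<n. y i (lift_at (\<sigma> k x) h) * Chi k $$ (i,j))" if h: "norm h < R" "h ~= 0" for h
   proof -
    have hr: "norm h < r" "norm h < r'" using h R by auto
    have "\<sigma> k (lift_at x h) = lift_at (\<sigma> k x) h" using local_lift_unique[OF cov s r'(2) hr] by simp
    moreover have "\<rho> (lift_at x h) = Some (1 / h)" using local_liftD(5)[OF r(2) hr(1)] None h(2) by simp
    ultimately show ?thesis using fin[OF local_liftD(4)[OF r(2) hr(1)]] by simp
   qed
   have cx: "(%h. y j (lift_at x h)) hol ball 0 R" if "j < n" for j
    using r(3) that R(2) by (auto intro: holomorphic_on_subset)
   have cs: "(%h. \<Sum>i<n. y i (lift_at (\<sigma> k x) h) * Chi k $$ (i,j)) hol ball 0 R"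
    using r'(3) R(3) by (intro holomorphic_on_sum holomorphic_on_mult holomorphic_on_const) (auto intro: holomorphic_on_subset)
   have "y j (lift_at x 0) = Lim (at 0) (%h. y j (lift_at x h))"
    by (rule Lim_at_0[OF cx[OF j] R(1), symmetric]) simp
   also have "... = (\<Sum>i<n. y i (lift_at (\<sigma> k x) 0) * Chi k $$ (i,j))"
    by (rule Lim_at_0[OF cs R(1)]) (rule eq)
   finally show ?thesis using local_liftD(3)[OF r(2)] local_liftD(3)[OF r'(2)] by simp
  qed (use fin x in auto)
 qed
 show ?thesis
  unfolding equation_monodromy_def
  by (intro exI[of _ y] exI[of _ Chi] conjI allI impI ballI) (use sol indep mon Chi(1) sim in blast)+
qed

end

section \<open>From the scalar equation to a system of standard form\<close>

lemma higher_deriv_lincomb: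
 fixes f :: "'i => complex => complex"
 assumes S: "open S" and f: "!!i. i : I ==> f i hol S"
 shows "z : S ==> (deriv ^^ k) (%w. SUM i:I. f i w * c i) z = (SUM i:I. (deriv ^^ k) (f i) z * c i)"
proof (induction k arbitrary: z)
 case (Suc k)
 have "(deriv ^^ Suc k) (%w. SUM i:I. f i w * c i) z = deriv (%z. SUM i:I. (deriv ^^ k) (f i) z * c i) z"
  using eventually_nhds_in_open[OF S Suc.prems]
  by (auto intro!: deriv_cong_ev elim!: eventually_mono simp: Suc.IH)
 also have "... = (SUM i:I. (deriv ^^ Suc k) (f i) z * c i)"
 proof (rule DERIV_imp_deriv, rule DERIV_sum)
  fix i assume i: "i : I"
  have "((deriv ^^ k) (f i) hfd (deriv ^^ Suc k) (f i) z) (at z)"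
   using holomorphic_derivI[OF holomorphic_higher_deriv[OF f[OF i] S] S Suc.prems] by simp
  thus "((%z. (deriv ^^ k) (f i) z * c i) hfd (deriv ^^ Suc k) (f i) z * c i) (at z)"
   by (rule DERIV_cmult_right)
 qed
 finally show ?case .
qed simp

lemma ode_lhs_lincomb:
 fixes f :: "'i => complex => complex"
 assumes S: "open S" "z : S" and f: "!!i. i : I ==> f i hol S"
 shows "ode_lhs n q u (%w. SUM i:I. f i w * c i) z = (SUM i:I. ode_lhs n q u (f i) z * c i)"
proof -
 note h = higher_deriv_lincomb[OF S(1) f S(2), of I]
 have "ode_lhs n q u (%w. SUM i:I. f i w * c i) z = (SUM i:I. (deriv ^^ n) (f i) z * c i)
   + (\<Sum>k=1..n. q k u * (SUM i:I. (deriv ^^ (n - k)) (f i) z * c i))" unfolding ode_lhs_def by (simp only: h)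
 also have "(\<Sum>k=1..n. q k u * (SUM i:I. (deriv ^^ (n - k)) (f i) z * c i))
   = (SUM i:I. (\<Sum>k=1..n. q k u * (deriv ^^ (n - k)) (f i) z) * c i)"
  unfolding sum_distrib_left sum_distrib_right by (subst sum.swap) (simp only: mult.assoc)
 finally show ?thesis by (simp add: ode_lhs_def sum.distrib distrib_right)
qed

context hess_surface
begin

lemma sd_monodromy:
 assumes y: "!!i. i < n ==> equation_solution n q X \<rho> (y i)" and k: "k : {1..m}" and j: "j < n"
  and mon: "!!x. x : X ==> y j x = (\<Sum>i<n. y i (\<sigma> k x) * C $$ (i,j))" and x: "x : X" "\<rho> x = Some z"
 shows "sd l (y j) x = (\<Sum>i<n. sd l (y i) (\<sigma> k x) * C $$ (i,j))"
proof -
 obtain r G where G: "r > 0" "sect X \<rho> (ball z r) G" "G z = x" by (rule section_exists[OF x])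
 have z: "z : ball z r" using G(1) by simp
 note G' = sect_deck[OF G(2) deck[OF k]]
 have "sd l (y j) x = (deriv ^^ l) (%z. y j (G z)) z" using sd_sect[OF G(2) z] G(3) by simp
 also have "... = (deriv ^^ l) (%z. \<Sum>i<n. y i (\<sigma> k (G z)) * C $$ (i,j)) z"
 proof (rule higher_deriv_cong_ev[OF _ refl])
  show "\<forall>\<^sub>F z' in nhds z. y j (G z') = (\<Sum>i<n. y i (\<sigma> k (G z')) * C $$ (i,j))"
   using eventually_nhds_in_open[OF open_ball z] by eventually_elim (use mon G(2) in "auto simp: sect_def")
 qed
 also have "... = (\<Sum>i<n. (deriv ^^ l) (%z. y i (\<sigma> k (G z))) z * C $$ (i,j))"
  by (rule higher_deriv_lincomb[OF open_ball _ z]) (use equation_solution_sect(1)[OF y G'] in auto)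
 also have "... = (\<Sum>i<n. sd l (y i) (\<sigma> k x) * C $$ (i,j))"
  using sd_sect[OF G' z] G(3) by simp
 finally show ?thesis .
qed

lemma equation_solution_analytic:
 assumes y: "equation_solution n q X \<rho> y" and x: "x : X"
 shows "(%h. y (lift_at x h)) analytic_on {0}"
proof -
 obtain r0 where l: "local_lift X \<rho> x r0 (lift_at x)" using lift_at[OF x] by blast
 obtain r g where g: "local_lift X \<rho> x r g" "(%h. y (g h)) hol ball 0 r"
  using y x unfolding equation_solution_def by blast
 let ?r = "min r0 r"
 have "(%h. y (g h)) hol ball 0 ?r" using g(2) by (rule holomorphic_on_subset) auto
 hence "(%h. y (lift_at x h)) hol ball 0 ?r"
  by (rule holomorphic_transform) (use local_lift_unique[OF cov g(1) l] in simp)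
 moreover have "0 < ?r" using local_liftD(1)[OF l] local_liftD(1)[OF g(1)] by simp
 ultimately show ?thesis unfolding analytic_at by (intro exI[of _ "ball 0 ?r"]) simp
qed

text \<open>A kernel vector gives a combination of solutions whose chain functions all vanish at
  \<open>x\<close>. Triangularity of the chain coefficients turns this into vanishing initial data,
  so the combination is zero near \<open>x\<close>, hence on the connected surface, against
  independence.\<close>

lemma wronskian_nonzero:
 assumes y: "!!i. i < n ==> equation_solution n (hq n b g) X \<rho> (y i)"
  and indep: "!!c. ALL x:X. (\<Sum>i<n. c i * y i x) = 0 ==> ALL i<n. c i = 0"
  and x: "x : X" "\<rho> x = Some z"
 shows "Matrix.mat n n (%(i,j). SUM k<=n - 1 - i. chain1 b g (n - 1 - i) k z * sd k (y j) x) : GL n" (is "?W : _")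
proof (rule ccontr)
 assume "?W ~: GL n"
 hence "det ?W = 0" unfolding GL_iff_det by auto
 then obtain v where v: "v : carrier_vec n" "v ~= 0\<^sub>v n" "?W *\<^sub>v v = 0\<^sub>v n"
  using det_0_iff_vec_prod_zero[of ?W n] by auto
 obtain r g0 where g0: "local_lift X \<rho> x r g0" by (rule local_lift_exists[OF cov finF x(1)])
 let ?G = "%z'. g0 (z' - z)"
 have G: "sect X \<rho> (ball z r) ?G" by (rule local_lift_sect[OF g0 x(2)])
 have z: "z : ball z r" using local_liftD(1)[OF g0] by simp
 have S: "ball z r <= UNIV - a ` {1..m}" using section_avoids[OF G] by blast
 have Gz: "?G z = x" using local_liftD(3)[OF g0] by simp
 define D where "D k = (\<Sum>j<n. sd k (y j) x * v $ j)" for k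
 have eq: "(SUM k<=l. chain1 b g l k z * D k) = 0" if l: "l < n" for l
 proof -
  have i: "n - 1 - l < n" "n - 1 - (n - 1 - l) = l" using l by auto
  have "(?W *\<^sub>v v) $ (n - 1 - l) = (\<Sum>j<n. (SUM k<=l. chain1 b g l k z * sd k (y j) x) * v $ j)"
   using i v(1) by (simp add: scalar_prod_def lessThan_atLeast0)
  also have "... = (SUM k<=l. chain1 b g l k z * D k)"
   unfolding D_def sum_distrib_left sum_distrib_right by (subst sum.swap) (simp only: mult.assoc)
  finally have "(?W *\<^sub>v v) $ (n - 1 - l) = (SUM k<=l. chain1 b g l k z * D k)" .
  thus ?thesis unfolding v(3) using i(1) by simp
 qed
 have D0: "D l = 0" if "l < n" for l
  using that
 proof (induction l rule: less_induct)
  case (less l)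
  have "(SUM k<=l. chain1 b g l k z * D k) = chain1 b g l l z * D l"
   using less by (subst lessThan_Suc_atMost[symmetric]) (simp add: sum.neutral)
  moreover have "z ~: a ` {1..m}" using S z by blast
  hence "chain1 b g l l z ~= 0"
   unfolding chain_top using g_nonzero[OF less_trans[OF _ less.prems]] by (auto simp: prod_zero_iff)
  ultimately show ?case using eq[OF less.prems] by simp
 qed
 let ?f = "%z'. \<Sum>j<n. y j (?G z') * v $ j"
 have hol: "(%z. y j (?G z)) hol ball z r" if "j : {..<n}" for j
  using equation_solution_sect(1)[OF y G] that by simp
 have f0: "?f u = 0" if u: "u : ball z r" for u
 proof (rule ode_zero_initial_data[where q="hq n b g" and n=n, OF _ _ _ _ u])
  show "?f hol ball z r" using hol by (intro holomorphic_on_sum holomorphic_on_mult holomorphic_on_const)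
  show "hq n b g k hol ball z r" for k using hq_holomorphic S by (rule holomorphic_on_subset)
  show "ode_lhs n (hq n b g) u ?f u = 0" if "u : ball z r" for u
   using ode_lhs_lincomb[where I="{..<n}" and f="%j z. y j (?G z)", OF open_ball that hol, where n=n and q="hq n b g" and u=u and c="%j. v $ j"] equation_solution_sect(2)[OF y G that] by simp
  show "(deriv ^^ i) ?f z = 0" if "i < n" for i
  proof -
   have "(deriv ^^ i) ?f z = (\<Sum>j<n. (deriv ^^ i) (%z. y j (?G z)) z * v $ j)"
    by (rule higher_deriv_lincomb[OF open_ball hol z])
   also have "... = D i" unfolding D_def using sd_sect[OF G z] unfolding Gz by simp
   finally show ?thesis using D0[OF that] by simp
  qed
 qed
 have "(\<Sum>j<n. y j x' * v $ j) = 0" if x': "x' : X" for x'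
 proof (rule surface_identity_principle[OF cov conn _ x(1) g0 _ x'])
  show "(\<Sum>j<n. y j (g0 h) * v $ j) = 0" if "norm h < r" for h
   using f0[OF add_in_ball[OF that]] by simp
  fix x' assume x': "x' : X"
  obtain r0 where l: "local_lift X \<rho> x' r0 (lift_at x')" using lift_at[OF x'] by blast
  have "(%h. \<Sum>j<n. y j (lift_at x' h) * v $ j) analytic_on {0}"
   using equation_solution_analytic[OF y x'] by (intro analytic_on_sum analytic_on_mult analytic_on_const) auto
  then obtain T where T: "open T" "0 : T" "(%h. \<Sum>j<n. y j (lift_at x' h) * v $ j) hol T"
   unfolding analytic_at by blast
  then obtain e where e: "e > 0" "ball 0 e <= T" using open_contains_ball by blast
  let ?e = "min e r0"
  have "local_lift X \<rho> x' ?e (lift_at x')" by (rule local_lift_shrink[OF l]) (use e(1) local_liftD(1)[OF l] in auto)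
  moreover have "(%h. \<Sum>j<n. y j (lift_at x' h) * v $ j) hol ball 0 ?e"
   using T(3) by (rule holomorphic_on_subset) (use e(2) in auto)
  ultimately show "EX r g. local_lift X \<rho> x' r g & (%h. \<Sum>j<n. y j (g h) * v $ j) hol ball 0 r" by blast
 qed
 hence "ALL x:X. (\<Sum>i<n. v $ i * y i x) = 0" by (simp add: mult.commute)
 from indep[OF this] have "v = 0\<^sub>v n" using v(1) by (intro eq_vecI) auto
 thus False using v(2) by blast
qed

text \<open>Each column is the chain generated by one scalar solution, times the scalar gauge
  factor. Derivatives in \<open>z\<close> have the monodromy matrices of the solutions themselves
  because deck transformations preserve \<open>z\<close>.\<close>

lemma system_from_equation:
 assumes eq: "equation_monodromy n m (hq n b g) X \<rho> \<sigma> M"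
 obtains Y Chi where "system_solution n A (finite_part X \<rho>) \<rho> Y"
  "!!k. k : {1..m} ==> Chi k : sq_mat n"
  "!!k x. k : {1..m} ==> x : finite_part X \<rho> ==> Y x = Y (\<sigma> k x) * Chi k"
  "simultaneously_similar m Chi M"
proof -
 obtain y Chi where y: "!!i. i < n ==> equation_solution n (hq n b g) X \<rho> (y i)"
  and indep: "!!c. ALL x:X. (\<Sum>i<n. c i * y i x) = 0 ==> ALL i<n. c i = 0"
  and Chi: "!!k. k : {1..m} ==> Chi k : sq_mat n"
  and mon: "!!k x j. k : {1..m} ==> x : X ==> j < n ==> y j x = (\<Sum>i<n. y i (\<sigma> k x) * Chi k $$ (i,j))"
  and sim: "simultaneously_similar m Chi M"
  using eq unfolding equation_monodromy_def by blast
 define W where "W x = Matrix.mat n n (%(i,j). SUM k<=n - 1 - i. chain1 b g (n - 1 - i) k (the (\<rho> x)) * sd k (y j) x)" for x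
 have Wc: "W x : sq_mat n" for x by (simp add: W_def)
 define Y where "Y x = (the (\<rho> x) - a m) powi \<kappa>0 \<cdot> W x" for x
 have WGL: "W x : GL n" if "x : X" "\<rho> x = Some z" for x z
  using wronskian_nonzero[OF y indep that] that(2) by (simp add: W_def)
 have odeY: "mat_ode n U A (%_. zmat n) (%z. Y (G z))" if G: "sect X \<rho> U G" for U G
 proof -
  have U: "open U" "U <= UNIV - a ` {1..m}" using G section_avoids[OF G] by (auto simp: sect_def)
  have WG: "W (G z) = Matrix.mat n n (%(i,j). chain_apply (%_. 1) 0 b g (%z. y j (G z)) (n - 1 - i) z)" if z: "z : U" for z
  proof -
   have "\<rho> (G z) = Some z" using G z by (simp add: sect_def)
   thus ?thesis unfolding W_def chain_apply_def using sd_sect[OF G z] by simp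
  qed
  have "mat_ode n U (hA n b g) (%_. zmat n) (%z. W (G z))"
   by (rule mat_ode_cong[OF system_from_scalar[where f="%j z. y j (G z)", OF _ U] U(1) refl refl WG[symmetric]])
    (use equation_solution_sect[OF y G] in auto)
  hence o: "mat_ode n U A (%_. zmat n) (%z. (z - a m) powi \<kappa>0 \<cdot> W (G z))" by (rule denormalised_solution[OF _ U])
  have Yz: "(z - a m) powi \<kappa>0 \<cdot> W (G z) = Y (G z)" if "z : U" for z
  proof -
   have "\<rho> (G z) = Some z" using G that by (simp add: sect_def)
   thus ?thesis by (simp add: Y_def)
  qed
  show ?thesis by (rule mat_ode_cong[OF o U(1) refl refl Yz])
 qed
 have am: "z ~: a ` {1..m}" if "x : X" "\<rho> x = Some z" for x z
  using cov that unfolding covering_space_def by (metis DiffD2 image_eqI)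
 have "system_solution n A (finite_part X \<rho>) \<rho> Y"
 proof (rule system_solutionI)
  show "Y x : GL n" if x: "x : X" "\<rho> x ~= None" for x
  proof -
   obtain z where z: "\<rho> x = Some z" using x(2) by blast
   thus ?thesis unfolding Y_def using WGL[OF x(1) z] powi_am[OF am[OF x(1) z]] by (intro smult_GL) auto
  qed
  fix x z assume x: "x : X" "\<rho> x = Some z"
  obtain r G where G: "r > 0" "sect X \<rho> (ball z r) G" "G z = x" by (rule section_exists[OF x])
  hence z: "z : ball z r" by simp
  have "((%z. Y (G z) $$ (i,j)) hfd (A z * Y x) $$ (i,j)) (at z)" if ij: "i < n" "j < n" for i j
   by (rule mat_odeD(4)[OF odeY[OF G(2)] z ij, unfolded linear_ode_rhs_entry'[OF A mat_odeD(3)[OF odeY[OF G(2)] z] ij], unfolded G(3)])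
  thus "EX U G. sect X \<rho> U G & z : U & G z = x &
   (ALL i<n. ALL j<n. ((%z. Y (G z) $$ (i,j)) hfd (A z * Y x) $$ (i,j)) (at z))" using G z by blast
 qed
 moreover have "Y x = Y (\<sigma> k x) * Chi k" if k: "k : {1..m}" and x: "x : finite_part X \<rho>" for k x
 proof -
  obtain z where z: "x : X" "\<rho> x = Some z" using x by (auto simp: finite_part_def)
  have r: "\<rho> (\<sigma> k x) = Some z" using deck[OF k] z unfolding deck_transformation_def by simp
  have "W x = W (\<sigma> k x) * Chi k"
  proof (rule eq_matI)
   fix i j assume "i < dim_row (W (\<sigma> k x) * Chi k)" "j < dim_col (W (\<sigma> k x) * Chi k)"
   hence ij: "i < n" "j < n" using Wc Chi[OF k] by (auto simp: W_def)
   have "(W (\<sigma> k x) * Chi k) $$ (i,j) = (\<Sum>l<n. W (\<sigma> k x) $$ (i,l) * Chi k $$ (l,j))"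
    by (rule mult_mat_entry[OF Wc Chi[OF k] ij])
   also have "... = (\<Sum>l<n. (SUM c<=n - 1 - i. chain1 b g (n - 1 - i) c z * sd c (y l) (\<sigma> k x)) * Chi k $$ (l,j))"
    using ij r by (intro sum.cong refl) (simp add: W_def)
   also have "... = (SUM c<=n - 1 - i. chain1 b g (n - 1 - i) c z * (\<Sum>l<n. sd c (y l) (\<sigma> k x) * Chi k $$ (l,j)))"
    unfolding sum_distrib_left sum_distrib_right by (subst sum.swap) (simp only: mult.assoc)
   also have "... = W x $$ (i,j)"
    using sd_monodromy[OF y k ij(2) mon[OF k _ ij(2)] z] ij z by (simp add: W_def)
   finally show "W x $$ (i,j) = (W (\<sigma> k x) * Chi k) $$ (i,j)" ..
  qed (use Wc Chi[OF k] in "auto simp: W_def")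
  thus ?thesis unfolding Y_def r z(2) using mult_smult_assoc_mat[OF Wc Chi[OF k]] by simp
 qed
 ultimately show thesis using Chi sim by (intro that)
qed

text \<open>At the punctures, and for the absence of branching at infinity, one surface solution is
  pulled back; any other local solution differs from it by a constant matrix. The form at infinity
  comes from \<open>solution_at_infinity\<close>. As the eigenvalues of the residue are eigenvalues
  of \<open>E k\<close>, non-resonance of \<open>E k\<close> alone gives the mutual non-resonance
  that the extension needs.\<close>

lemma standard_form_from_equation:
 assumes eq: "equation_monodromy n m (hq n b g) X \<rho> \<sigma> M"
  and Ahol: "mat_hol n A (UNIV - a ` {1..m})"
  and E: "!!k. k : {1..m} ==> E k : sq_mat n" "!!k. k : {1..m} ==> non_resonant (E k)"
   "!!k x. k : {1..m} ==> eigenvalue (Bk k 0) x ==> eigenvalue (E k) x"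
   "!!k. k : {1..m} ==> M k : sq_mat n"
   "!!k. k : {1..m} ==> similar_mat (M k) (mat_exp n ((- 2 * of_real pi * \<i>) \<cdot> E k))"
  and \<kappa>: "!!i. i < n ==> \<kappa> (i + 1) = \<kappa>0 + (int m - 2) * int (n - 1 - i)"
 shows "standard_form n m a X \<rho> \<sigma> M E \<kappa> A"
proof -
 obtain Y Chi where Y: "system_solution n A (finite_part X \<rho>) \<rho> Y"
  and Chi: "!!k. k : {1..m} ==> Chi k : sq_mat n"
  and mon: "!!k x. k : {1..m} ==> x : finite_part X \<rho> ==> Y x = Y (\<sigma> k x) * Chi k"
  and sim: "simultaneously_similar m Chi M"
  using system_from_equation[OF eq] by blast
 have "system_monodromy n m A X \<rho> \<sigma> M"
  unfolding system_monodromy_def using Y Chi mon sim by blast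
 moreover have "local_form_at n A (a k) (E k)" if k: "k : {1..m}" for k
  unfolding local_form_at_def using avoid[OF k] half[OF k]
 proof eventually_elim
  case (elim dl)
  hence dl: "0 < dl" "ball (a k) dl Int a ` {1..m} <= {a k}" by auto
  from elim(2) obtain et where et: "continuous_on {w. Re w < ln dl} et" "et ` {w. Re w < ln dl} <= X"
   "ALL w. Re w < ln dl --> \<rho> (et w) = Some (a k + exp w) & et (w + tpi) = \<sigma> k (et w)" by (elim exE conjE) (rule that)
  have et3: "\<rho> (et w) = Some (a k + exp w)" if "Re w < ln dl" for w using et(3) that by blast
  have s: "mat_ode n {w. Re w < ln dl} (%w. Bk k (exp w)) (%_. zmat n) (%w. Y (et w))"
   by (rule lifted_half_plane_solution(1)[OF k dl Y et(1,2)]) (rule et3)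
  have sG: "Y (et w) : GL n" if "Re w < ln dl" for w
   by (rule lifted_half_plane_solution(2)[OF k dl Y et(1,2) _ that]) (rule et3)
  have per: "Y (et w) = Y (et (w + tpi)) * Chi k" if w: "Re w < ln dl" for w
  proof -
   have "et w : X" using et(2) w by blast
   hence "et w : finite_part X \<rho>" using et3[OF w] by (simp add: finite_part_def)
   thus ?thesis using mon[OF k] et(3) w by metis
  qed
  have simk: "similar_mat (Chi k) (mat_exp n ((- 2 * of_real pi * \<i>) \<cdot> E k))"
  proof (rule similar_mat_trans[OF _ E(5)[OF k]])
   show "similar_mat (Chi k) (M k)" using sim k unfolding simultaneously_similar_def similar_mat_def by blast
  qed
  have nonres: "x = y" if "eigenvalue (Bk k 0) x" "eigenvalue (E k) y" "x - y : \<int>" for x y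
   using E(2)[OF k] E(3)[OF k that(1)] that(2,3) unfolding non_resonant_def by blast
  obtain Z C where Z: "mat_hol n Z (ball 0 dl)" "ALL z:ball 0 dl. Z z : GL n" "C : GL n"
   "ALL w. Re w < ln dl --> Y (et w) = Z (exp w) * mat_exp n (w \<cdot> E k) * C"
   using local_form_solution[OF dl(1) Bk_holomorphic[OF k dl(2)] Bk_carrier E(1)[OF k] s sG Chi[OF k] per simk nonres] by blast
  show ?case
  proof (intro allI impI)
   fix Y' assume "system_solution n A {w. Re w < ln dl} (%w. Some (a k + exp w)) Y'"
   hence Y': "!!w. Re w < ln dl ==> Y' w : GL n" "mat_ode n {w. Re w < ln dl} (%w. Bk k (exp w)) (%_. zmat n) Y'"
    unfolding half_plane_solution[OF k dl] by auto
   obtain D where D: "D : GL n" "!!w. w : {w. Re w < ln dl} ==> Y' w = Y (et w) * D"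
    by (rule solutions_differ_by_constant[OF s Y'(2) Re_less_half_plane]) (use sG Y'(1) in auto)
   have Dc: "D : sq_mat n" "C : sq_mat n" using D(1) Z(3) by auto
   show "EX Z C. mat_hol n Z (ball (a k) dl) & (ALL z:ball (a k) dl. Z z : GL n) & C : GL n &
      (ALL w. Re w < ln dl --> Y' w = Z (a k + exp w) * mat_exp n (w \<cdot> E k) * C)"
   proof (intro exI[of _ "%z. Z (z - a k)"] exI[of _ "C * D"] conjI allI impI ballI)
    have sub: "z - a k : ball 0 dl" if "z : ball (a k) dl" for z using that by (simp add: dist_norm norm_minus_commute)
    show "mat_hol n (%z. Z (z - a k)) (ball (a k) dl)"
     unfolding mat_holomorphic_on_def
    proof (intro allI impI)
     fix i j assume "i < n" "j < n"
     hence "(%z. Z z $$ (i,j)) hol ball 0 dl" using Z(1) unfolding mat_holomorphic_on_def by blast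
     thus "(%z. Z (z - a k) $$ (i,j)) hol ball (a k) dl"
     proof (rule holomorphic_on_compose_gen[of "%z. z - a k" "ball (a k) dl" "%z. Z z $$ (i,j)", unfolded o_def, rotated])
      show "(%z. z - a k) ` ball (a k) dl <= ball 0 dl" by (rule image_subsetI) (rule sub)
     qed (intro holomorphic_intros)
    qed
    show "Z (z - a k) : GL n" if "z : ball (a k) dl" for z using Z(2) sub[OF that] by blast
    show "C * D : GL n" by (rule GL_mult[OF Z(3) D(1)])
    fix w assume w: "Re w < ln dl"
    have "norm (exp w) < dl" using w dl(1) by (metis exp_less_cancel_iff exp_ln norm_exp_eq_Re)
    hence Zc: "Z (exp w) : sq_mat n" using Z(2) by auto
    have "Y' w = Z (exp w) * mat_exp n (w \<cdot> E k) * C * D" using D(2) Z(4) w by simp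
    also have "... = Z (exp w) * mat_exp n (w \<cdot> E k) * (C * D)"
     by (rule assoc_mult_mat[OF mult_carrier_mat[OF Zc mat_exp_carrier] Dc(2,1)])
    finally show "Y' w = Z (a k + exp w - a k) * mat_exp n (w \<cdot> E k) * (C * D)" by simp
   qed
  qed
 qed
 moreover have "local_form_at_infinity n A \<kappa>"
 proof (rule solution_at_infinity)
  fix r0 :: real assume r0: "r0 > 0" "!!z. norm z > 1 / r0 ==> z ~: a ` {1..m}"
   and ext: "!!r Y. 0 < r ==> r <= r0 ==> mat_ode n {z. norm z > 1 / r} (hA n b g) (%_. zmat n) Y ==>
   (!!z. norm z > 1 / r ==> Y z : GL n) ==>
   EX V. mat_hol n V (ball 0 r) & (ALL h:ball 0 r. V h : GL n) &
    (ALL z. norm z > 1 / r --> Y z = diagm n (%i. z powi ((int m - 2) * int (n - 1 - i))) * V (1 / z))"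
  show ?thesis
   unfolding local_form_at_infinity_def using at_right_0_small[OF r0(1)]
  proof eventually_elim
   case (elim dl)
   show ?case
   proof (intro allI impI)
    fix Y assume Y: "system_solution n A {z. norm z > 1 / dl} Some Y"
    let ?U = "{z :: complex. norm z > 1 / dl}"
    have U: "open ?U" by (intro open_Collect_less continuous_intros)
    have z0: "norm (1 / z) < dl & z ~= 0" if "z : ?U" for z
    proof -
     have "norm z > 0" using that elim by (smt (verit) divide_pos_pos mem_Collect_eq)
     thus ?thesis using that elim by (auto simp: norm_divide field_simps)
    qed
    have US: "?U <= UNIV - a ` {1..m}"
    proof -
     have "1 / r0 < 1 / dl" using elim by (simp add: frac_less2)
     thus ?thesis using r0(2) by force
    qed
    have "(ALL w:?U. Y w : GL n) & mat_ode n ?U (%w. deriv (%z. z) w \<cdot> A w) (%_. zmat n) Y"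
     using Y system_solution_planar[OF U, of "%z. z" A n Y] A by (simp add: holomorphic_on_ident eta_contract_eq)
    hence GL: "!!w. w : ?U ==> Y w : GL n" and o: "mat_ode n ?U (%w. deriv (%z. z) w \<cdot> A w) (%_. zmat n) Y" by blast+
    have oA: "mat_ode n ?U A (%_. zmat n) Y" by (rule mat_ode_cong[OF o U]) (use A in auto)
    have "(z - a m) powi (- \<kappa>0) \<cdot> Y z : GL n" if "norm z > 1 / dl" for z
     by (rule smult_GL) (use powi_am US GL that in auto)
    then obtain V where V: "mat_hol n V (ball 0 dl)" "ALL h:ball 0 dl. V h : GL n"
     "ALL z. norm z > 1 / dl --> (z - a m) powi (- \<kappa>0) \<cdot> Y z = diagm n (%i. z powi ((int m - 2) * int (n - 1 - i))) * V (1 / z)"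
     using ext[of dl, OF _ _ normalised_solution[OF oA U US]] elim by auto
    have nz: "1 - a m * h ~= 0" if "h : ball 0 dl" for h
    proof (cases "h = 0")
     case False
     have "norm (1 / h) > 1 / dl" using that False elim by (simp add: norm_divide frac_less2)
     hence "1 / h ~: a ` {1..m}" using US by blast
     moreover have "a m : a ` {1..m}" using m by auto
     ultimately have "1 / h ~= a m" by metis
     thus ?thesis using False by (auto simp: field_simps)
    qed simp
    \<comment> \<open>The gauge factor splits as \<open>z powi \<kappa>0\<close> times
      \<open>(1 - a m / z) powi \<kappa>0\<close>: the first part completes the indices, the second
      is holomorphic and nonzero at infinity and joins \<open>H\<close>.\<close>
    show "EX H C. mat_hol n H (ball 0 dl) & (ALL h:ball 0 dl. H h : GL n) & C : GL n &
      (ALL z. norm z > 1 / dl --> Y z = Matrix.mat n n (%(i,j). if i = j then z powi \<kappa> (i + 1) else 0) * H (1 / z) * C)"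
    proof (intro exI[of _ "%h. (1 - a m * h) powi \<kappa>0 \<cdot> V h"] exI[of _ "1\<^sub>m n"] conjI allI impI ballI GL_one)
     show "mat_hol n (%h. (1 - a m * h) powi \<kappa>0 \<cdot> V h) (ball 0 dl)"
      unfolding mat_holomorphic_on_def
     proof (intro allI impI)
      fix i j assume ij: "i < n" "j < n"
      hence "(%h. V h $$ (i,j)) hol ball 0 dl" using V(1) unfolding mat_holomorphic_on_def by blast
      hence "(%h. (1 - a m * h) powi \<kappa>0 * V h $$ (i,j)) hol ball 0 dl"
       using nz by (intro holomorphic_intros) auto
      thus "(%h. ((1 - a m * h) powi \<kappa>0 \<cdot> V h) $$ (i,j)) hol ball 0 dl"
      proof (rule holomorphic_transform)
       fix h :: complex assume "h : ball 0 dl"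
       hence "V h : sq_mat n" using V(2) by blast
       thus "(1 - a m * h) powi \<kappa>0 * V h $$ (i,j) = ((1 - a m * h) powi \<kappa>0 \<cdot> V h) $$ (i,j)"
        using smult_mat_entry ij by metis
      qed
     qed
     show "(1 - a m * h) powi \<kappa>0 \<cdot> V h : GL n" if "h : ball 0 dl" for h
      by (rule smult_GL) (use nz[OF that] V(2) that in auto)
     fix z :: complex assume z: "norm z > 1 / dl"
     hence zU: "z : ?U" by simp
     have h: "1 / z : ball 0 dl" "z ~= 0" using z0[OF zU] by auto
     have Vc: "V (1 / z) : sq_mat n" using V(2) h(1) by blast
     let ?c = "(1 - a m * (1 / z)) powi \<kappa>0"
     have Yc: "Y z : sq_mat n" using GL[OF zU] by blast
     have zm: "z - a m ~= 0" using US zU m by force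
     have dg: "Matrix.mat n n (%(i,j). if i = j then z powi \<kappa> (i + 1) else 0) = diagm n (%i. z powi \<kappa> (i + 1))" by (simp only: diagm_def)
     have cV: "?c \<cdot> V (1 / z) : sq_mat n" using Vc by simp
     have "Y z = diagm n (%i. z powi \<kappa> (i + 1)) * (?c \<cdot> V (1 / z))"
     proof (rule eq_matI)
      fix i j assume "i < dim_row (diagm n (%i. z powi \<kappa> (i + 1)) * (?c \<cdot> V (1 / z)))"
       "j < dim_col (diagm n (%i. z powi \<kappa> (i + 1)) * (?c \<cdot> V (1 / z)))"
      hence ij: "i < n" "j < n" using Vc by (auto simp: diagm_def)
      have "(z - a m) powi (- \<kappa>0) * Y z $$ (i,j) = ((z - a m) powi (- \<kappa>0) \<cdot> Y z) $$ (i,j)"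
       using smult_mat_entry[OF Yc ij] by simp
      also have "... = z powi ((int m - 2) * int (n - 1 - i)) * V (1 / z) $$ (i,j)"
       using V(3)[rule_format, OF z] diagm_mult_entry[OF Vc ij] by simp
      finally have "(z - a m) powi \<kappa>0 * ((z - a m) powi (- \<kappa>0) * Y z $$ (i,j))
        = (z - a m) powi \<kappa>0 * (z powi ((int m - 2) * int (n - 1 - i)) * V (1 / z) $$ (i,j))" by simp
      moreover have "(z - a m) powi \<kappa>0 * ((z - a m) powi (- \<kappa>0) * Y z $$ (i,j)) = Y z $$ (i,j)"
       using zm by (simp add: power_int_minus)
      moreover have "(z - a m) powi \<kappa>0 = z powi \<kappa>0 * ?c"
      proof -
       have "z - a m = z * (1 - a m * (1 / z))" using h(2) by (simp add: field_simps)
       thus ?thesis by (simp only: power_int_mult_distrib)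
      qed
      moreover have "z powi \<kappa> (i + 1) = z powi \<kappa>0 * z powi ((int m - 2) * int (n - 1 - i))"
       unfolding \<kappa>[OF ij(1)] by (rule power_int_add) (use h(2) in simp)
      ultimately have "Y z $$ (i,j) = z powi \<kappa> (i + 1) * (?c * V (1 / z) $$ (i,j))" by (simp only: mult_ac)
      also have "... = (diagm n (%i. z powi \<kappa> (i + 1)) * (?c \<cdot> V (1 / z))) $$ (i,j)"
       unfolding diagm_mult_entry[OF cV ij] smult_mat_entry[OF Vc ij] ..
      finally show "Y z $$ (i,j) = (diagm n (%i. z powi \<kappa> (i + 1)) * (?c \<cdot> V (1 / z))) $$ (i,j)" .
     qed (use Yc Vc in "auto simp: diagm_def")
     thus "Y z = Matrix.mat n n (%(i,j). if i = j then z powi \<kappa> (i + 1) else 0) * (?c \<cdot> V (1 / z)) * 1\<^sub>m n"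
      unfolding dg using right_mult_one_mat[OF mult_carrier_mat[OF diagm_carrier cV]] by simp
    qed
   qed
  qed
 qed
 moreover have "apparent_at_infinity n A"
 proof -
  \<comment> \<open>A chart at a point over infinity makes the pulled back solution a function of
    \<open>exp w\<close>, hence periodic.\<close>
  obtain x where x: "x : X" "\<rho> x = None" by (rule point_over_infinity)
  obtain r0 where g0: "local_lift X \<rho> x r0 (lift_at x)" using lift_at[OF x(1)] by blast
  show ?thesis
   unfolding apparent_at_infinity_def using at_right_0_small[OF local_liftD(1)[OF g0]]
  proof eventually_elim
   case (elim dl)
   let ?U = "{w. Re w > - ln dl}"
   have U: "open ?U" "connected ?U" "?U ~= {}"
   proof -
    show "open ?U" by (rule open_halfspace_Re_gt)
    show "connected ?U" by (rule convex_connected[OF convex_halfspace_Re_gt])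
    have "of_real (1 - ln dl) : ?U" by simp
    thus "?U ~= {}" by blast
   qed
   have gd: "local_lift X \<rho> x dl (lift_at x)" by (rule local_lift_shrink[OF g0]) (use elim in auto)
   let ?V = "{z :: complex. norm z > 1 / dl}" and ?G = "%z. lift_at x (1 / z)"
   have G: "sect X \<rho> ?V ?G" by (rule local_lift_sect_infinity[OF gd x(2)])
   have ex: "exp w : ?V" if "w : ?U" for w
   proof -
    have "exp (- ln dl) < exp (Re w)" using that by simp
    thus ?thesis using elim by (simp add: exp_minus inverse_eq_divide)
   qed
   have et: "continuous_on ?U (%w. ?G (exp w))" "(%w. ?G (exp w)) ` ?U <= X" "!!w. w : ?U ==> \<rho> (?G (exp w)) = Some (exp w)"
   proof -
    have "exp ` ?U <= ?V" using ex by blast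
    thus "continuous_on ?U (%w. ?G (exp w))"
     by (rule continuous_on_compose2[of ?V ?G, rotated 2]) (use G in "auto simp: sect_def intro!: continuous_intros")
    show "(%w. ?G (exp w)) ` ?U <= X" "!!w. w : ?U ==> \<rho> (?G (exp w)) = Some (exp w)"
     using G ex unfolding sect_def by blast+
   qed
   have dexp: "deriv exp w = exp w" for w :: complex by (rule DERIV_imp_deriv) (rule DERIV_exp)
   have he: "exp hol ?U" by (intro holomorphic_intros)
   have s: "mat_ode n ?U (%w. deriv exp w \<cdot> A (exp w)) (%_. zmat n) (%w. Y (?G (exp w)))"
    by (rule system_solution_ode(1)[OF Y A U(1) et(1,2) _ he]) (rule et(3))
   have sG: "Y (?G (exp w)) : GL n" if "w : ?U" for w
    by (rule system_solution_ode(2)[OF Y A U(1) et(1,2) _ he that]) (rule et(3))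
   show ?case
   proof (intro allI impI)
    fix Y' w assume Y': "system_solution n A ?U (%w. Some (exp w)) Y'" and w: "Re w > - ln dl"
    have "(ALL w:?U. Y' w : GL n) & mat_ode n ?U (%w. deriv exp w \<cdot> A (exp w)) (%_. zmat n) Y'"
     using Y' system_solution_planar[OF U(1) he _ A, where Y=Y'] dexp by simp
    hence Y2: "!!w. w : ?U ==> Y' w : GL n" "mat_ode n ?U (%w. deriv exp w \<cdot> A (exp w)) (%_. zmat n) Y'" by blast+
    obtain D where D: "D : GL n" "!!w. w : ?U ==> Y' w = Y (?G (exp w)) * D"
     by (rule solutions_differ_by_constant[OF s Y2(2) U]) (use sG Y2(1) in auto)
    have "w : ?U" "w + tpi : ?U" using w by auto
    moreover have "exp (w + tpi) = exp w" by (simp add: exp_add exp_two_pi_i mult_ac)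
    ultimately show "Y' (w + tpi) = Y' w" using D(2) by metis
   qed
  qed
 qed
 ultimately show ?thesis unfolding standard_form_def using A Ahol by blast
qed

end

section \<open>A Hessenberg system for a given scalar equation\<close>

lemma higher_deriv_shifted_power:
 "(deriv ^^ i) (%s. (s - w) ^ j) = (%s :: complex. of_nat (\<Prod>k<i. j - k) * (s - w) ^ (j - i))"
proof (induction i)
 case (Suc i)
 have "deriv (%s. of_nat (\<Prod>k<i. j - k) * (s - w) ^ (j - i)) s
   = of_nat (\<Prod>k<i. j - k) * (of_nat (j - i) * (s - w) ^ (j - i - 1))" for s
  by (rule DERIV_imp_deriv) (auto intro!: derivative_eq_intros)
 thus ?case by (simp add: Suc fun_eq_iff mult_ac)
qed simp

lemma higher_deriv_shifted_power_at:
 "(deriv ^^ i) (%s. (s - w) ^ j) w = (if i = j then of_nat (\<Prod>k<j. j - k) else (0 :: complex))"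
proof -
 have "(\<Prod>k<i. j - k) = 0" if "j < i" using that by (auto simp: prod_zero_iff)
 thus ?thesis unfolding higher_deriv_shifted_power by (cases i j rule: linorder_cases) auto
qed

text \<open>
  A monic differential operator is determined at a point by its kernel there; the test functions
  are combinations of powers of \<open>s - w\<close>.
\<close>

lemma monic_operator_unique:
 assumes "!!u. u analytic_on {w} ==> ode_lhs n q w u w = 0 ==> ode_lhs n q' w u w = 0" and k: "k : {1..n}"
 shows "q k w = q' k w"
proof -
 define c :: "nat => complex" where "c j = of_nat (\<Prod>k<j. j - k)" for j
 have c0: "c j ~= 0" for j by (auto simp: c_def prod_zero_iff)
 define p where "p i s = (s - w) ^ (if i then n - k else n)" for i and s :: complex
 \<comment> \<open>At \<open>w\<close> the derivative of order \<open>n - k\<close> of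
   \<open>u\<close> is then 1, that of order \<open>n\<close> is \<open>- q k w\<close>, and all
   others vanish. So \<open>q\<close> annihilates \<open>u\<close>, and \<open>q'\<close> takes the
   value \<open>q' k w - q k w\<close> on it.\<close>
 define d where "d i = (if i then 1 / c (n - k) else - q k w / c n)" for i
 define u where "u s = (SUM i:UNIV. p i s * d i)" for s
 have ph: "p i hol UNIV" for i unfolding p_def by (intro holomorphic_intros)
 have uh: "u hol UNIV" unfolding u_def using ph by (intro holomorphic_on_sum holomorphic_on_mult) auto
 have dp: "(deriv ^^ l) (p i) w = (if l = (if i then n - k else n) then c l else 0)" for l i
 proof -
  have "p i = (%s. (s - w) ^ (if i then n - k else n))" by (simp add: p_def fun_eq_iff)
  thus ?thesis using higher_deriv_shifted_power_at[of l w "if i then n - k else n"] by (simp add: c_def)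
 qed
 have nk: "n - k ~= n" "n - k < n" using k by auto
 have lhs: "ode_lhs n Q w u w = Q k w - q k w" for Q
 proof -
  have du: "(deriv ^^ l) u w = (if l = n - k then 1 else 0) - (if l = n then q k w else 0)" for l
  proof -
   have "(deriv ^^ l) u w = (SUM i:UNIV. (deriv ^^ l) (p i) w * d i)"
    unfolding u_def by (rule higher_deriv_lincomb[OF open_UNIV ph UNIV_I])
   thus ?thesis using c0 nk unfolding dp d_def by (auto simp: UNIV_bool)
  qed
  have "(\<Sum>j=1..n. Q j w * (deriv ^^ (n - j)) u w) = (\<Sum>j=1..n. if j = k then Q k w else 0)"
   using nk k unfolding du by (intro sum.cong refl) auto
  also have "... = Q k w" using k by simp
  finally show ?thesis using nk unfolding ode_lhs_def du by simp
 qed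
 have "u analytic_on {w}" using uh analytic_on_open[OF open_UNIV] analytic_on_subset by blast
 hence "ode_lhs n q' w u w = 0" using assms(1) lhs[of q] by simp
 thus ?thesis using lhs[of q'] by simp
qed

lemma analytic_at_nearby: "f analytic_on {z} ==> \<forall>\<^sub>F w in nhds z. f analytic_on {w}"
 unfolding analytic_at eventually_nhds by blast

lemma entire_extension:
 fixes f :: "complex => complex"
 assumes K: "finite K" and f: "f hol UNIV - K"
  and ext: "!!x. x : K ==> EX h r. r > 0 & h hol ball x r & (ALL z:ball x r - {x}. z ~: K --> f z = h z)"
 shows "EX F. F hol UNIV & (ALL z. z ~: K --> F z = f z)"
proof -
 have "EX h. ALL x:K. EX r>0. h x hol ball x r & (ALL z:ball x r - {x}. z ~: K --> f z = h x z)"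
  using ext by (intro bchoice) metis
 then obtain h where h: "ALL x:K. EX r>0. h x hol ball x r & (ALL z:ball x r - {x}. z ~: K --> f z = h x z)" by blast
 define F where "F z = (if z : K then h z z else f z)" for z
 have "F field_differentiable (at x)" for x
 proof (cases "x : K")
  case True
  obtain r where r: "r > 0" "h x hol ball x r" "ALL z:ball x r - {x}. z ~: K --> f z = h x z" using h True by blast
  obtain d where d: "d > 0" "ALL z:K. z ~= x --> d <= dist x z" using finite_set_avoid[OF K] by blast
  have "(h x hfd deriv (h x) x) (at x)" using holomorphic_derivI[OF r(2)] r(1) by simp
  hence "(F hfd deriv (h x) x) (at x)"
   by (rule has_field_derivative_transform_within_open[of _ _ _ "ball x (min r d)"])
    (use r d True in "auto simp: F_def")
  thus ?thesis unfolding field_differentiable_def by blast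
 next
  case False
  have o: "open (UNIV - K)" using K by (simp add: open_Diff finite_imp_closed)
  have "(f hfd deriv f x) (at x)" using holomorphic_derivI[OF f o] False by simp
  hence "(F hfd deriv f x) (at x)"
   by (rule has_field_derivative_transform_within_open[OF _ o]) (use False in "auto simp: F_def")
  thus ?thesis unfolding field_differentiable_def by blast
 qed
 hence "F hol UNIV" unfolding holomorphic_on_def using field_differentiable_at_within by blast
 thus ?thesis by (intro exI[of _ F]) (simp add: F_def)
qed

text \<open>Over the full denominator, \<open>1 / (z - a m)\<close> has the product of the other
  factors as numerator. Its leading power \<open>z ^ (m - 1)\<close> belongs to the index part of
  the diagonal, and this polynomial is the rest.\<close>

definition dpoly :: "(nat => complex) => nat => complex poly" where
 "dpoly a m = (PROD k:{1..<m}. [:- a k, 1:]) - monom 1 (m - 1)"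

lemma poly_dpoly: "(PROD k:{1..<m}. z - a k) = z ^ (m - 1) + poly (dpoly a m) z"
 by (simp add: dpoly_def poly_prod poly_monom)

text \<open>The leading powers cancel. The zero alternative is what holds for \<open>m = 1\<close>,
  where the bound is negative.\<close>

lemma degree_dpoly:
 assumes m: "m >= 1"
 shows "dpoly a m = 0 | int (degree (dpoly a m)) <= int m - 2"
proof (cases "m = 1")
 case True
 thus ?thesis by (simp add: dpoly_def)
next
 case False
 let ?R = "PROD k:{1..<m}. [:- a k, 1:]"
 have d: "degree ?R = m - 1" by (subst degree_prod_eq_sum_degree) auto
 have l: "lead_coeff ?R = 1" by (simp add: lead_coeff_prod)
 have "coeff (dpoly a m) i = 0" if "i > m - 2" for i
 proof (cases "i = m - 1")
  case True
  thus ?thesis using l d by (simp add: dpoly_def)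
 next
  case False
  hence "i > m - 1" using that by simp
  thus ?thesis using d by (simp add: dpoly_def coeff_eq_0)
 qed
 hence "degree (dpoly a m) <= m - 2" by (intro degree_le) auto
 thus ?thesis using False m by auto
qed

lemma prod_split_last: "m >= 1 ==> (\<Prod>k=1..m. f k) = (PROD k:{1..<m}. f k) * f m" for f :: "nat => complex"
 by (cases m) (auto simp: prod.atLeastLessThan_Suc atLeastLessThanSuc_atLeastAtMost[symmetric])

text \<open>With all rows but the top one fixed, \<open>chain_closing_row\<close> solves for the top
  row. At each puncture and at infinity the same row is solved once more from the analytic data of
  the equation there, in Euler form and in the coordinate \<open>w\<close>, and uniqueness
  identifies the results. So the numerators of the top row are entire with the growth that the
  degree bounds demand.\<close>

lemma hess_data_from_equation:
 fixes a :: "nat => complex"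
 assumes m: "m >= 1" and n: "n >= 1" and inj: "inj_on a {1..m}"
  and q: "!!k. k : {1..n} ==> q k hol UNIV - a ` {1..m}"
  and inf: "nonsingular_at_infinity n q"
  and fuchs: "!!k. k : {1..m} ==> EX R. fuchsian_with_exponents n q (a k) R"
 obtains P where "hess_data a m n P (%_. 1)"
  "!!k z. k : {1..n} ==> z ~: a ` {1..m} ==> hq n (hess_data.b a m P) (hess_data.g a m (%_. 1)) k z = q k z"
proof -
 define N where "N = n - 1"
 have N: "n = Suc N" using n by (simp add: N_def)
 define d where "d = int m - 2"
 \<comment> \<open>Off the punctures this makes the diagonal entry of row \<open>l\<close>, counted
   from below, equal to \<open>d * l / (z - a m)\<close>, with zeros to its right.\<close>
 define P0 where "P0 l j = (if l = j then psmult (of_int (d * int l)) (dpoly a m) else 0)" for l j :: nat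
 interpret H: hess_data a m n P0 "%_. 1"
 proof
  show "P0 l j = 0 | int (degree (P0 l j)) <= (int m - 2) * (1 + int l - int j)" for l j
   using degree_dpoly[OF m, of a] by (auto simp: P0_def intro: order.trans[OF of_nat_mono[OF degree_smult_le]])
 qed (use m n inj in auto)
 let ?S = "UNIV - a ` {1..m}" and ?g = H.g
 let ?p = "%z. \<Prod>k=1..m. z - a k"
 have qh: "q (n - i) hol ?S" if "i <= N" for i by (rule q) (use that N in auto)
 have "EX be. (ALL j<=N. be j hol ?S) & (ALL b' z. (ALL l<N. ALL j<=l. ALL z. b' l j z = H.b l j z) --> z : ?S -->
  ((ALL i<=N. chain1 b' ?g (Suc N) i z = chain1 b' ?g (Suc N) (Suc N) z * q (n - i) z) \<longleftrightarrow> (ALL j<=N. b' N j z = be j z)))"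
 proof (rule chain_closing_row[OF H.open_S holomorphic_on_const H.bg_holomorphic _ qh])
  show "?g l z ~= 0" if "l <= N" "z : ?S" for l z
   by (rule H.g_nonzero) (use that N in auto)
 qed
 then obtain be where be1: "ALL j<=N. be j hol ?S"
  and be2: "ALL b' z. (ALL l<N. ALL j<=l. ALL z. b' l j z = H.b l j z) --> z : ?S -->
  ((ALL i<=N. chain1 b' ?g (Suc N) i z = chain1 b' ?g (Suc N) (Suc N) z * q (n - i) z) \<longleftrightarrow> (ALL j<=N. b' N j z = be j z))"
  by (elim exE conjE) (rule that)
 note beh = be1[THEN spec, THEN mp] and be = be2[THEN spec, THEN spec, THEN mp, THEN mp]
 define b where "b l j z = (if l < N then H.b l j z else be j z)" for l j z
 have bS: "b l j hol ?S" if "l < n" "j <= l" for l j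
  unfolding b_def using H.bg_holomorphic(1) beh[of j] that N by (cases "l < N") auto
 have Lh: "chain1 b ?g l i hol ?S" if "l <= n" for l i
  by (rule chain_holomorphic[OF H.open_S holomorphic_on_const bS H.bg_holomorphic(2) _ that]) (use H.g_nonzero in blast)+
 have close: "chain1 b ?g n i z = chain1 b ?g n n z * q (n - i) z" if z: "z : ?S" and i: "i <= N" for i z
  using be[of b z] z i unfolding N by (simp add: b_def)
 have gS: "?g l z ~= 0" if "l < n" "z : ?S" for l z using H.g_nonzero[OF that(1)] that(2) by blast
 have top: "chain1 b ?g n n z ~= 0" if "z : ?S" for z
  unfolding chain_top using gS that by (auto simp: prod_zero_iff)
 have hqq: "hq n b ?g k z = q k z" if k: "k : {1..n}" and z: "z : ?S" for k z
 proof -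
  have "n - k <= N" "n - (n - k) = k" using k N by auto
  hence "chain1 b ?g n (n - k) z = chain1 b ?g n n z * q k z" using close[OF z, of "n - k"] by simp
  thus ?thesis unfolding hq_def using top[OF z] by simp
 qed
 \<comment> \<open>Near \<open>a k\<close> the row solved from the analytic \<open>r i\<close> is
   holomorphic at the puncture, and off \<open>a k\<close> it equals
   \<open>(z - a k) * be j\<close>.\<close>
 have local: "EX h r. r > 0 & h hol ball x r & (ALL z:ball x r - {x}. z ~: a ` {1..m} --> ?p z * be j z = h z)"
  if x: "x : a ` {1..m}" and j: "j <= N" for x j
 proof -
  obtain k where k: "k : {1..m}" "x = a k" using x by blast
  obtain R where "fuchsian_with_exponents n q (a k) R" using fuchs[OF k(1)] by blast
  then obtain r where r: "!!i. i : {1..n} ==> r i analytic_on {a k}"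
   "!!i. i : {1..n} ==> \<forall>\<^sub>F z in at (a k). q i z = r i z / (z - a k) ^ i"
   unfolding fuchsian_with_exponents_def by blast
  have "\<forall>\<^sub>F z in nhds (a k). ALL i:{1..n}. r i analytic_on {z}"
   using r(1) by (intro eventually_ball_finite) (auto intro: analytic_at_nearby)
  moreover have "\<forall>\<^sub>F z in nhds (a k). ALL i:{1..n}. z ~= a k --> q i z = r i z / (z - a k) ^ i"
   using r(2) by (intro eventually_ball_finite) (auto simp: eventually_at_filter)
  moreover have "\<forall>\<^sub>F z in nhds (a k). z : UNIV - a ` ({1..m} - {k})"
   by (rule eventually_nhds_in_open[OF H.Vk(1) H.Vk(2)[OF k(1)]])
  ultimately have "\<forall>\<^sub>F z in nhds (a k). (ALL i:{1..n}. r i analytic_on {z}) & (ALL i:{1..n}. z ~= a k --> q i z = r i z / (z - a k) ^ i)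
    & z : UNIV - a ` ({1..m} - {k})" by eventually_elim blast
  then obtain dl where dl: "dl > 0" "!!z. z : ball (a k) dl ==> (ALL i:{1..n}. r i analytic_on {z}) & (ALL i:{1..n}. z ~= a k --> q i z = r i z / (z - a k) ^ i)
    & z : UNIV - a ` ({1..m} - {k})" unfolding eventually_nhds_metric by (auto simp: dist_commute)
  let ?W = "ball (a k) dl"
  have WV: "?W <= UNIV - a ` ({1..m} - {k})" using dl(2) by blast
  have rh: "r (n - i) hol ?W" if "i <= N" for i
  proof (rule analytic_imp_holomorphic, rule analytic_on_analytic_at[THEN iffD2], rule ballI)
   fix z assume "z : ?W"
   thus "r (n - i) analytic_on {z}" using dl(2) that N by auto
  qed
  have bkh: "H.bk k l j hol ?W" "H.gk k l hol ?W" for l j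
   using H.bgk_holomorphic[OF k(1)] WV holomorphic_on_subset by blast+
  have gk0: "H.gk k l z ~= 0" if "z : ?W" for l z
  proof -
   have "z ~: a ` ({1..m} - {k})" using that WV by blast
   thus ?thesis using H.pk_nonzero[OF k(1)] by (simp add: H.gk_def)
  qed
  have "EX be'. (ALL j<=N. be' j hol ?W) & (ALL b' z. (ALL l<N. ALL j<=l. ALL z. b' l j z = H.bk k l j z) --> z : ?W -->
   ((ALL i<=N. chain (%z. z - a k) 1 b' (H.gk k) (Suc N) i z = chain (%z. z - a k) 1 b' (H.gk k) (Suc N) (Suc N) z * r (n - i) z) \<longleftrightarrow> (ALL j<=N. b' N j z = be' j z)))"
   by (rule chain_closing_row[OF open_ball _ bkh gk0 rh]) (auto intro!: holomorphic_intros)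
  then obtain be' where be'h: "!!j. j <= N ==> be' j hol ?W"
   and be': "!!b' z. (ALL l<N. ALL j<=l. ALL z. b' l j z = H.bk k l j z) ==> z : ?W ==>
   ((ALL i<=N. chain (%z. z - a k) 1 b' (H.gk k) (Suc N) i z = chain (%z. z - a k) 1 b' (H.gk k) (Suc N) (Suc N) z * r (n - i) z) \<longleftrightarrow> (ALL j<=N. b' N j z = be' j z))"
   by blast
  define bb where "bb l j z = (if l < N then H.bk k l j z else (z - a k) * be j z)" for l j z
  have bbl: "bb l j = H.bk k l j" if "l < N" for l j using that by (simp add: bb_def fun_eq_iff)
  let ?c = "chain (%z. z - a k) 1 bb (H.gk k)"
  have ch: "?c l i hol ?W" if "l <= N" for l i
   by (rule chain_holomorphic[where N=N, OF open_ball _ _ _ _ that]) (use bkh gk0 in "auto simp: bbl intro!: holomorphic_intros")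
  have eul: "chain1 b ?g l i z = ?c l i z * (z - a k) ^ i" if l: "l <= n" and z: "z : ?W - {a k}" for l i z
  proof (rule chain_euler[where U="?W - {a k}", OF _ _ _ _ _ l z])
   show "bb l j z = (z - a k) * b l j z" if "z : ?W - {a k}" for l j z
    using that H.bgk_eq(1)[OF k(1), of z] by (simp add: bb_def b_def)
   show "H.gk k l z = (z - a k) * ?g l z" if "z : ?W - {a k}" for l z
    using that H.bgk_eq(2)[OF k(1), of z] by simp
   show "?c l i hol ?W - {a k}" if "l < n" for l i
    by (rule holomorphic_on_subset[OF ch]) (use that N in auto)
  qed (auto simp: open_delete)
  have eq: "(z - a k) * be j z = be' j z" if z: "z : ?W - {a k}" for z
  proof -
   have t: "z - a k ~= 0" "z : ?W" using z by auto
   have zS: "z : ?S"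
   proof (rule DiffI[OF UNIV_I], rule notI)
    assume "z : a ` {1..m}"
    then obtain i where i: "i : {1..m}" "z = a i" by blast
    hence "i : {1..m} - {k}" using t(1) by auto
    thus False using WV t(2) i(2) by blast
   qed
   have "?c (Suc N) i z = ?c (Suc N) (Suc N) z * r (n - i) z" if i: "i <= N" for i
   proof -
    have "?c n i z * (z - a k) ^ i = ?c n n z * (z - a k) ^ n * q (n - i) z"
     using close[OF zS i] unfolding eul[OF order.refl z] .
    also have "q (n - i) z = r (n - i) z / (z - a k) ^ (n - i)" using dl(2)[OF t(2)] t(1) i N by auto
    also have "(z - a k) ^ n = (z - a k) ^ i * (z - a k) ^ (n - i)" using i N by (simp flip: power_add)
    finally have "?c n i z * (z - a k) ^ i = ?c n n z * r (n - i) z * (z - a k) ^ i" using t(1) by simp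
    thus ?thesis using t(1) unfolding N by simp
   qed
   hence "ALL j<=N. bb N j z = be' j z" using be'[of bb z] t(2) by (simp add: bb_def)
   thus ?thesis using j by (simp add: bb_def)
  qed
  have "(%z. H.pk k z * be' j z) hol ball x dl"
   unfolding k(2) H.pk_def using be'h[OF j] by (auto intro!: holomorphic_intros)
  moreover have "?p z * be j z = H.pk k z * be' j z" if "z : ball x dl - {x}" for z
   unfolding H.pk_eq[OF k(1)] using eq[of z] that k(2) by (simp add: mult_ac flip: eq)
  ultimately show ?thesis using dl(1) by blast
 qed
 have ph: "?p hol ?S" by (intro holomorphic_intros)
 have "EX F. F hol UNIV & (ALL z. z ~: a ` {1..m} --> F z = ?p z * be j z)" if j: "j <= N" for j
  by (rule entire_extension[OF _ holomorphic_on_mult[OF ph beh[OF j]] local[OF _ j]]) auto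
 hence "ALL j. EX F. j <= N --> F hol UNIV & (ALL z. z ~: a ` {1..m} --> F z = ?p z * be j z)" by blast
 from choice[OF this] obtain F where F: "!!j. j <= N ==> F j hol UNIV"
  "!!j z. j <= N ==> z ~: a ` {1..m} ==> F j z = ?p z * be j z" by blast
 obtain Q where Q: "inverted_equation n 0 q Q" "ALL k:{1..n}. Q k analytic_on {0}"
  using inf unfolding nonsingular_at_infinity_def by blast
 obtain r1 B where r1: "r1 > 0" "!!w. norm w < r1 ==> poly (pinf m a 0) w ~= 0"
  "!!w. norm w < r1 ==> w ~= 0 ==> 0 + 1 / w ~: a ` {1..m}"
  and B: "!!l j. l < n ==> j <= l ==> B l j hol ball 0 r1"
  "!!l j w. l < n ==> j <= l ==> w : ball 0 r1 - {0} ==> binf (int m - 2) 0 H.b l j w = B l j w"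
 proof (rule H.infinity_data[of 0], goal_cases)
  case (1 r B)
  show thesis by (rule that[OF 1(2-)])
 qed
 have "\<forall>\<^sub>F w in nhds 0. ALL i:{1..n}. Q i analytic_on {w}"
  using Q(2) by (intro eventually_ball_finite) (auto intro: analytic_at_nearby)
 moreover have "\<forall>\<^sub>F w in nhds 0. w ~= 0 --> (ALL u. u analytic_on {w} -->
    (ode_lhs n Q w u w = 0 \<longleftrightarrow> ode_lhs n q (0 + 1 / w) (%z. u (1 / (z - 0))) (0 + 1 / w) = 0))"
  using Q(1) unfolding inverted_equation_def eventually_at_filter by (auto elim: eventually_mono)
 moreover have "\<forall>\<^sub>F w in nhds 0. w : ball (0::complex) r1" by (rule eventually_nhds_in_open) (use r1 in auto)
 ultimately have "\<forall>\<^sub>F w in nhds 0. (ALL i:{1..n}. Q i analytic_on {w}) & (w ~= 0 --> (ALL u. u analytic_on {w} -->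
    (ode_lhs n Q w u w = 0 \<longleftrightarrow> ode_lhs n q (0 + 1 / w) (%z. u (1 / (z - 0))) (0 + 1 / w) = 0))) & w : ball 0 r1"
  by eventually_elim blast
 then obtain r where r: "r > 0" "!!w. dist w 0 < r ==> (ALL i:{1..n}. Q i analytic_on {w}) & (w ~= 0 --> (ALL u. u analytic_on {w} -->
    (ode_lhs n Q w u w = 0 \<longleftrightarrow> ode_lhs n q (0 + 1 / w) (%z. u (1 / (z - 0))) (0 + 1 / w) = 0))) & w : ball 0 r1"
  unfolding eventually_nhds_metric by blast
 let ?W = "ball (0::complex) r"
 have WB: "?W <= ball 0 r1" using r(2) by (auto simp: dist_commute)
 have Qh: "Q (n - i) hol ?W" if "i <= N" for i
 proof (rule analytic_imp_holomorphic, rule analytic_on_analytic_at[THEN iffD2], rule ballI)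
  fix z assume "z : ?W"
  thus "Q (n - i) analytic_on {z}" using r(2)[of z] that N by (auto simp: dist_commute)
 qed
 have Bh: "B l j hol ?W" if "l < n" "j <= l" for l j by (rule holomorphic_on_subset[OF B(1)[OF that] WB])
 have gih: "H.gi 0 l hol ?W" for l
  unfolding H.gi_def using r1(2) WB by (auto intro!: holomorphic_intros simp: subset_iff)
 have gi0: "H.gi 0 l w ~= 0" if "w : ?W" for l w
  using r1(2)[of w] WB that by (auto simp: H.gi_def subset_iff)
 have "EX be'. (ALL j<=N. be' j hol ?W) & (ALL b' z. (ALL l<N. ALL j<=l. ALL z. b' l j z = B l j z) --> z : ?W -->
   ((ALL i<=N. chain1 b' (H.gi 0) (Suc N) i z = chain1 b' (H.gi 0) (Suc N) (Suc N) z * Q (n - i) z) \<longleftrightarrow> (ALL j<=N. b' N j z = be' j z)))"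
  by (rule chain_closing_row[OF open_ball holomorphic_on_const Bh gih gi0 Qh]) (use N in auto)
 then obtain be' where be'h: "!!j. j <= N ==> be' j hol ?W"
  and be': "!!b' z. (ALL l<N. ALL j<=l. ALL z. b' l j z = B l j z) ==> z : ?W ==>
   ((ALL i<=N. chain1 b' (H.gi 0) (Suc N) i z = chain1 b' (H.gi 0) (Suc N) (Suc N) z * Q (n - i) z) \<longleftrightarrow> (ALL j<=N. b' N j z = be' j z))"
  by blast
 define bb where "bb l j w = (if l < N then B l j w else binf d 0 b N j w)" for l j w
 have bbl: "bb l j = B l j" if "l < N" for l j using that by (simp add: bb_def fun_eq_iff)
 \<comment> \<open>The inverted equation is given only through its kernel at points near 0.
   \<open>monic_operator_unique\<close> recovers its coefficients there, so the transformed top row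
   is the one solved from the analytic \<open>Q\<close>.\<close>
 have inv: "binf d 0 b N j w = be' j w" if w: "w : ?W - {0}" and j: "j <= N" for w j
 proof -
  let ?W' = "?W - {0}"
  have W': "open ?W'" by (simp add: open_delete)
  have S': "0 + 1 / w : ?S" if "w : ?W'" for w using r1(3)[of w] that WB by (auto simp: subset_iff)
  have bbeq: "binf d 0 b l j w = bb l j w" if "l < n" "j <= l" "w : ?W'" for l j w
  proof (cases "l < N")
   case True
   have "binf d 0 b l j w = binf (int m - 2) 0 H.b l j w" using True by (simp add: binf_def b_def d_def)
   also have "... = B l j w" by (rule B(2)[OF that(1,2)]) (use that(3) WB in blast)
   finally show ?thesis using True by (simp add: bb_def)
  next
   case False
   hence "l = N" using that N by simp
   thus ?thesis by (simp add: bb_def)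
  qed
  have gg: "ginf d 0 ?g l w = H.gi 0 l w" if "w : ?W'" for l w
   unfolding d_def by (rule H.ginf_gi) (use that WB r1(2) in "auto simp: subset_iff")
  have ch: "chain1 bb (H.gi 0) l i hol ?W" if "l <= N" for l i
   by (rule chain_holomorphic[where N=N, OF open_ball holomorphic_on_const _ gih gi0 that]) (use Bh N in "auto simp: bbl")
  have Qh: "Q k w = hq n bb (H.gi 0) k w" if k: "k : {1..n}" for k
  proof (rule monic_operator_unique[where q=Q and q'="hq n bb (H.gi 0)" and w=w, OF _ k])
   fix u assume u: "u analytic_on {w}" "ode_lhs n Q w u w = 0"
   have "ode_lhs n q (0 + 1 / w) (%z. u (1 / (z - 0))) (0 + 1 / w) = 0" using r(2)[of w] w u by (auto simp: dist_commute)
   hence o: "ode_lhs n (hq n b ?g) (0 + 1 / w) (%z. u (1 / (z - 0))) (0 + 1 / w) = 0"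
    unfolding ode_lhs_def using hqq[OF _ S'[OF w]] by simp
   obtain T where T: "open T" "w : T" "u hol T" using u(1) unfolding analytic_at by blast
   show "ode_lhs n (hq n bb (H.gi 0)) w u w = 0"
   proof (rule chain_apply_inversion[where W="T Int ?W'" and S="?S" and b=b and g="?g" and d=d and c=0, THEN iffD2, OF _ _ _ _ _ _ _ _ _ _ o])
    show "open (T Int ?W')" using T W' by blast
    show "u hol T Int ?W'" using T(3) by (rule holomorphic_on_subset) blast
    show "chain1 bb (H.gi 0) l i hol T Int ?W'" if "l < n" for l i
     by (rule holomorphic_on_subset[OF ch]) (use that N in auto)
    show "chain1 b ?g l i hol ?S" if "l < n" for l i using Lh that by simp
   qed (use T(2) w S' gS bbeq gg in auto)
  qed
  have "chain1 bb (H.gi 0) (Suc N) i w = chain1 bb (H.gi 0) (Suc N) (Suc N) w * Q (n - i) w" if i: "i <= N" for i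
  proof -
   have "chain1 bb (H.gi 0) n n w ~= 0" unfolding chain_top using gi0 w by (auto simp: prod_zero_iff)
   moreover have "n - i : {1..n}" "n - (n - i) = i" using i N by auto
   ultimately show ?thesis
    using Qh[of "n - i"] unfolding hq_def N by simp
  qed
  hence "ALL j<=N. bb N j w = be' j w" using be'[of bb w] w by (simp add: bb_def)
  thus ?thesis using j by (simp add: bb_def)
 qed
 have "EX P. (ALL z. F j z - (if N = j then of_int (d * int N) * z ^ (m - 1) else 0) = poly P z) & (P = 0 | int (degree P) <= d * (1 + int N - int j))"
  if j: "j <= N" for j
 proof -
  let ?e = "%z. if N = j then of_int (d * int N) * z ^ (m - 1) else 0"
  let ?D = "d * (1 + int N - int j)"
  obtain S where S: "!!w. poly (pinf m a 0) w - (1 + 0 * w) ^ (m - 1) = w * poly S w" using pinf_divides by blast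
  \<comment> \<open>\<open>binf_eq\<close> solved for the numerator of the top row; with
    \<open>be'\<close> in place of the transformed entry the expression is holomorphic, hence
    bounded, near 0.\<close>
  define V where "V w = (if N = j then of_int (d * int N) * poly S w else 0) - be' j w * poly (pinf m a 0) w" for w
  have Vh: "V hol ?W" unfolding V_def using be'h[OF j] by (cases "N = j") (auto intro!: holomorphic_intros)
  have e: "w powi ?D * (F j (1 / w) - ?e (1 / w)) = V w" if w: "w : ?W - {0}" for w
  proof -
   have w: "w ~= 0" "norm w < r1" using w WB by (auto simp: subset_iff)
   have p0: "poly (pinf m a 0) w ~= 0" by (rule r1(2)[OF w(2)])
   have zS: "0 + 1 / w ~: a ` {1..m}" by (rule r1(3)[OF w(2,1)])
   have "b N j (0 + 1 / w) = ((if N = j then of_int (d * int N) * (0 + 1 / w) ^ (m - 1) else 0) + (F j (0 + 1 / w) - ?e (0 + 1 / w))) / ?p (0 + 1 / w)"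
    using F(2)[OF j zS] H.p_nonzero[OF zS] by (simp add: b_def)
   from binf_eq[where b=b and x="F j (0 + 1 / w) - ?e (0 + 1 / w)", OF w(1) p0 m d_def this] inv[OF that j]
   have "be' j w * poly (pinf m a 0) w = (if N = j then of_int (d * int N) * poly S w else 0) - w powi ?D * (F j (1 / w) - ?e (1 / w))"
    unfolding S using p0 w(1) by simp
   thus ?thesis by (simp add: V_def)
  qed
  obtain C where C: "!!w. w : cball 0 (r / 2) ==> norm (V w) <= C"
  proof -
   have "continuous_on (cball 0 (r / 2)) V"
    by (rule continuous_on_subset[OF holomorphic_on_imp_continuous_on[OF Vh]]) (use r(1) in auto)
   hence "bounded (V ` cball 0 (r / 2))" by (intro compact_imp_bounded compact_continuous_image) auto
   thus thesis using that unfolding bounded_iff by blast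
  qed
  have Ph: "(%z. F j z - ?e z) hol UNIV"
   using F(1)[OF j] by (cases "N = j") (auto intro!: holomorphic_intros)
  obtain P where "!!z. F j z - ?e z = poly P z" "P = 0 | int (degree P) <= ?D"
  proof (rule entire_growth_polynomial[OF Ph, of "r / 2" ?D C])
   fix w :: complex assume w: "w ~= 0" "norm w < r / 2"
   thus "norm (w powi ?D * (F j (1 / w) - ?e (1 / w))) <= C" using e[of w] C[of w] r(1) by simp
  qed (use r(1) that in auto)
  thus ?thesis by blast
 qed
 hence "ALL j. EX P. j <= N --> (ALL z. F j z - (if N = j then of_int (d * int N) * z ^ (m - 1) else 0) = poly P z) & (P = 0 | int (degree P) <= d * (1 + int N - int j))" by blast
 from choice[OF this] obtain PN where PN: "!!j z. j <= N ==> F j z - (if N = j then of_int (d * int N) * z ^ (m - 1) else 0) = poly (PN j) z"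
  "!!j. j <= N ==> PN j = 0 | int (degree (PN j)) <= d * (1 + int N - int j)" by blast
 define P where "P l j = (if l < N then P0 l j else PN j)" for l j
 have HP: "hess_data a m n P (%_. 1)"
 proof
  show "P l j = 0 | int (degree (P l j)) <= (int m - 2) * (1 + int l - int j)" if "l < n" "j <= l" for l j
  proof (cases "l < N")
   case True
   thus ?thesis using H.degP[OF that] by (simp add: P_def)
  next
   case False
   hence "l = N" using that N by simp
   thus ?thesis using PN(2)[of j] that by (simp add: P_def d_def)
  qed
 qed (use m n inj in auto)
 interpret HP: hess_data a m n P "%_. 1" by (rule HP)
 have bP: "HP.b l j z = b l j z" if "l < n" "j <= l" "z : ?S" for l j z
 proof (cases "l < N")
  case True
  thus ?thesis by (simp add: HP.b_def H.b_def HP.num_def H.num_def P_def b_def)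
 next
  case False
  hence l: "l = N" using that N by simp
  have zS: "z ~: a ` {1..m}" using that(3) by blast
  have "HP.num N j z = F j z" using PN(1)[of j z] that l unfolding HP.num_def P_def d_def by (simp add: algebra_simps split: if_splits)
  thus ?thesis using F(2)[of j z] H.p_nonzero[OF zS] that l zS by (simp add: HP.b_def b_def)
 qed
 have "hq n HP.b HP.g k z = q k z" if k: "k : {1..n}" and z: "z ~: a ` {1..m}" for k z
 proof -
  have zS: "z : ?S" using z by blast
  have "chain1 HP.b HP.g n i z = chain1 b ?g n i z" for i
   by (rule chain_cong[OF H.open_S bP _ order.refl zS]) (simp_all add: HP.g_def H.g_def)
  thus ?thesis using hqq[OF k zS] by (simp add: hq_def)
 qed
 thus thesis using that[OF HP] by blast
qed

text \<open>Every marked point lies on both closed arcs that end at \<open>a k\<close>: its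
  parameter, or that parameter increased by one period of \<open>m\<close> indices, falls into the
  range. The radii that avoid the other punctures then serve in
  \<open>encircling_deck\<close>.\<close>

lemma punctured_coveringI:
 fixes \<rho> :: "'a::topological_space => csphere"
 assumes m: "m >= 1"
  and curve: "smooth_jordan_curve ga" "cyclically_ordered_on ga t m a"
  and covering: "universal_covering X \<rho> (UNIV - Some ` a ` {1..m})"
  and base: "x0 : X" "\<rho> x0 : Some ` inside (path_image ga)"
  and deck: "!!k. k : {1..m} ==> deck_transformation X \<rho> (\<sigma> k) &
         (EX c. encircling_path X \<rho> ga t x0 k c & \<sigma> k x0 = pathfinish c)"
 shows "punctured_covering X \<rho> a m \<sigma>"
proof -
 have cov: "covering_space X \<rho> (UNIV - Some ` a ` {1..m})" and sc: "simply_connected X"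
  using covering unfolding universal_covering_def by auto
 interpret C: smooth_curve ga by unfold_locales (rule curve(1))
 have t: "strict_mono t" "!!k. t (k + m) = t k + 1" "!!k. k : {1..m} ==> ga (t k) = a k"
  using curve(2) unfolding cyclically_ordered_on_def by auto
 have tle: "t i <= t j" if "i <= j" for i j using t(1) that by (simp add: strict_mono_less_eq)
 have per: "ga (t (j + m)) = ga (t j)" for j unfolding t(2) using C.per_nat[of "t j" 1] by simp
 show ?thesis
 proof
  show "connected X" by (rule simply_connected_imp_connected'[OF sc])
  show "deck_transformation X \<rho> (\<sigma> k)" if "k : {1..m}" for k using deck[OF that] by blast
  fix k assume k: "k : {1..m}"
  have arc: "a ` {1..m} <= ga ` {t i..t (i' + m)}" if i: "i <= m + 1" "i' + 1 = i | i' = i - 1 & 1 <= i" for i i'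
  proof
   fix x assume "x : a ` {1..m}"
   then obtain j where j: "j : {1..m}" "x = ga (t j)" using t(3) by force
   show "x : ga ` {t i..t (i' + m)}"
   proof (cases "i <= j")
    case True
    hence "t j : {t i..t (i' + m)}" using j i tle by auto
    thus ?thesis using j(2) by blast
   next
    case False
    hence "t (j + m) : {t i..t (i' + m)}" using j i tle by auto
    thus ?thesis using j(2) per[of j] by (metis imageI)
   qed
  qed
  obtain c where c: "encircling_path X \<rho> ga t x0 k c" "\<sigma> k x0 = pathfinish c" using deck[OF k] by blast
  have fin: "finite (a ` {1..m})" by simp
  show "\<forall>\<^sub>F dl in at_right 0. EX et. continuous_on {w. Re w < ln dl} et & et ` {w. Re w < ln dl} <= X &
    (ALL w. Re w < ln dl --> \<rho> (et w) = Some (a k + exp w) & et (w + tpi) = \<sigma> k (et w))"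
   using eventually_ball_avoids[OF fin, of "a k"]
  proof eventually_elim
   case (elim dl)
   have k1: "k - 1 + m = m + (k - 1)" "1 <= k" "k <= m" using k by auto
   have "EX et. continuous_on {w. Re w < ln dl} et & et ` {w. Re w < ln dl} <= X &
     (ALL w. Re w < ln dl --> \<rho> (et w) = Some (ga (t k) + exp w) & et (w + tpi) = \<sigma> k (et w))"
   proof (rule C.encircling_deck[OF cov fin _ _ _ _ _ _ _ base conjunct1[OF deck[OF k]] c])
    show "a ` {1..m} <= ga ` {t k..t (k - 1) + 1}" using arc[of k "k - 1"] k1 unfolding t(2) by simp
    show "a ` {1..m} <= ga ` {t (k + 1)..t k + 1}" using arc[of "k + 1" k] k1 unfolding t(2) by simp
    show "ga (t k) : a ` {1..m}" using t(3)[OF k] k by simp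
    show "t (k - 1) < t k" "t k < t (k + 1)" using t(1) k1 by (simp_all add: strict_mono_less)
    show "t k <= t (k - 1) + 1" "t (k + 1) <= t k + 1" using tle[of k "k - 1 + m"] tle[of "k + 1" "k + m"] k1 m unfolding t(2) by simp_all
    show "dl > 0" "ball (ga (t k)) dl Int a ` {1..m} <= {ga (t k)}" using elim t(3)[OF k] by auto
   qed
   thus ?case unfolding t(3)[OF k] .
  qed
 qed (use cov in auto)
qed

section \<open>The stated matrix form and the two implications\<close>

lemma degree_diff_bound:
 fixes p q :: "complex poly"
 assumes "p = 0 | int (degree p) <= D" "q = 0 | int (degree q) <= D"
 shows "p - q = 0 | int (degree (p - q)) <= D"
proof (cases "p = 0 | q = 0")
 case False
 thus ?thesis using assms degree_diff_le_max[of p q] by linarith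
qed (use assms in auto)

lemma degree_smult_bound:
 fixes p :: "complex poly"
 assumes "p = 0 | int (degree p) <= D"
 shows "psmult c p = 0 | int (degree (psmult c p)) <= D"
 using assms by auto

context hess_data
begin

text \<open>Matrix row \<open>i\<close> is chain row \<open>n - 1 - i\<close>. On the diagonal the
  scalar part raises the leading coefficient to \<open>\<kappa> (i + 1)\<close> and adds a multiple
  of \<open>dpoly\<close>, which the hypothesis on \<open>P\<close> has subtracted
  beforehand.\<close>

lemma hA_form:
 fixes p :: "nat => nat => complex poly"
 assumes P: "!!l j. l < n ==> j <= l ==> P l j = p (n - l) (n - j) - (if l = j then psmult (of_int k0) (dpoly a m) else 0)"
  and \<alpha>': "!!l. l < n - 1 ==> \<alpha> l = \<alpha>' (n - 1 - l)" and \<kappa>: "!!i. i < n ==> \<kappa> (i + 1) = k0 + (int m - 2) * int (n - 1 - i)"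
  and z: "z ~: a ` {1..m}"
 shows "hA n b g z + (of_int k0 / (z - a m)) \<cdot> 1\<^sub>m n = (1 / (\<Prod>k=1..m. z - a k)) \<cdot> Matrix.mat n n (%(i,j).
       if i = j then of_int (\<kappa> (i + 1)) * z ^ (m - 1) + poly (p (i + 1) (j + 1)) z
       else if i < j then poly (p (i + 1) (j + 1)) z
       else if i = j + 1 then \<alpha>' (j + 1)
       else 0)" (is "?L = ?R")
proof (rule eq_matI)
 let ?p = "\<Prod>k=1..m. z - a k"
 have p0: "?p ~= 0" by (rule p_nonzero[OF z])
 have zm: "z - a m ~= 0" using z m by force
 have pm: "?p = (z ^ (m - 1) + poly (dpoly a m) z) * (z - a m)"
  unfolding poly_dpoly[symmetric] by (rule prod_split_last[OF m])
 fix i j assume "i < dim_row ?R" "j < dim_col ?R"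
 hence ij: "i < n" "j < n" by auto
 consider "i = j" | "i < j" | "i = j + 1" | "i > j + 1" by linarith
 thus "?L $$ (i,j) = ?R $$ (i,j)"
 proof cases
  case 1
  define l where "l = n - 1 - i"
  have l: "l < n" "n - l = i + 1" using ij by (auto simp: l_def)
  have e1: "?L $$ (i,j) = b l l z + of_int k0 / (z - a m)" using 1 ij by (simp add: hA_def l_def)
  have e2: "b l l z = (of_int ((int m - 2) * int l) * z ^ (m - 1) + (poly (p (i + 1) (i + 1)) z - of_int k0 * poly (dpoly a m) z)) / ?p"
   unfolding b_def num_def using P[OF l(1) order.refl] l(2) by simp
  have e3: "of_int k0 / (z - a m) = of_int k0 * (z ^ (m - 1) + poly (dpoly a m) z) / ?p"
   using p0 zm unfolding pm by simp
  have e4: "(of_int ((int m - 2) * int l) * z ^ (m - 1) + (poly (p (i + 1) (i + 1)) z - of_int k0 * poly (dpoly a m) z)) / ?p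
    + of_int k0 * (z ^ (m - 1) + poly (dpoly a m) z) / ?p
    = (1 / ?p) * (of_int (k0 + (int m - 2) * int l) * z ^ (m - 1) + poly (p (i + 1) (i + 1)) z)"
   by (simp add: add_divide_distrib[symmetric] diff_divide_distrib[symmetric]) (simp add: algebra_simps)
  have e5: "(1 / ?p) * (of_int (k0 + (int m - 2) * int l) * z ^ (m - 1) + poly (p (i + 1) (i + 1)) z) = ?R $$ (i,j)"
   using 1 ij \<kappa>[OF ij(1)] by (simp add: l_def)
  show ?thesis by (rule trans[OF e1 trans[OF arg_cong2[where f="(+)", OF e2 e3] trans[OF e4 e5]]])
 next
  case 2
  have e: "n - (n - 1 - i) = i + 1" "n - (n - 1 - j) = j + 1" "n - 1 - i ~= n - 1 - j" "n - 1 - j <= n - 1 - i" "n - 1 - i < n" using ij 2 by auto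
  have "?L $$ (i,j) = b (n - 1 - i) (n - 1 - j) z" using 2 ij by (simp add: hA_def)
  also have "... = poly (p (i + 1) (j + 1)) z / ?p"
   unfolding b_def num_def P[OF e(5,4)] e(1,2) if_not_P[OF e(3)] by simp
  also have "... = ?R $$ (i,j)" using 2 ij by simp
  finally show ?thesis .
 next
  case 3
  have "?L $$ (i,j) = g (n - 1 - i) z" using 3 ij by (simp add: hA_def)
  also have "... = \<alpha>' (j + 1) / ?p" using \<alpha>'[of "n - 1 - i"] 3 ij by (simp add: g_def)
  also have "... = ?R $$ (i,j)" using 3 ij by simp
  finally show ?thesis .
 next
  case 4
  thus ?thesis using ij by (simp add: hA_def)
 qed
qed auto

end

text \<open>Splitting off the scalar part takes a multiple of \<open>dpoly\<close> from the diagonal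
  polynomials, and the closing constant of the chain is set to 1. The local forms yield the spectra
  of the residues, and one fundamental solution yields the monodromy.\<close>

lemma equation_from_standard_form:
 fixes p :: "nat => nat => complex poly"
 assumes cov: "punctured_covering X \<rho> a m \<sigma>" and n: "n >= 1" and m: "m >= 1" and inj: "inj_on a {1..m}"
  and E: "!!k. k : {1..m} ==> E k : sq_mat n"
  and \<kappa>: "!!i. i < n ==> \<kappa> (i + 1) = \<kappa> n + (int m - 2) * int (n - 1 - i)"
  and eig: "!!k. k : {1..m} ==> image_mset (ep k) (mset_set {1..n}) = proots (char_poly (E k))"
  and sf: "standard_form n m a X \<rho> \<sigma> M E \<kappa> A"
  and deg: "ALL i j. 1 <= i & i <= j & j <= n --> p i j = 0 | int (degree (p i j)) <= (int m - 2) * (1 + int j - int i)"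
  and \<alpha>: "(PROD k:{1..<n}. \<alpha> k) ~= 0"
  and form: "ALL z. z ~: a ` {1..m} --> A z = (1 / (\<Prod>k=1..m. z - a k)) \<cdot> Matrix.mat n n (%(i,j).
       if i = j then of_int (\<kappa> (i + 1)) * z ^ (m - 1) + poly (p (i + 1) (j + 1)) z
       else if i < j then poly (p (i + 1) (j + 1)) z
       else if i = j + 1 then \<alpha> (j + 1)
       else 0)"
 shows "EX q. (ALL k:{1..n}. q k hol (UNIV - a ` {1..m})) & nonsingular_at_infinity n q &
  (ALL k:{1..m}. fuchsian_with_exponents n q (a k)
   (image_mset (%i. ep k i - (if k = m then of_int (\<kappa> n) else 0)) (mset_set {1..n}))) &
  equation_monodromy n m q X \<rho> \<sigma> M"
proof -
 define P where "P l j = p (n - l) (n - j) - (if l = j then psmult (of_int (\<kappa> n)) (dpoly a m) else 0)" for l j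
 define \<alpha>' where "\<alpha>' l = (if l < n - 1 then \<alpha> (n - 1 - l) else 1)" for l
 have H: "hess_data a m n P \<alpha>'"
 proof
  show "\<alpha>' l ~= 0" if "l < n" for l
  proof (cases "l < n - 1")
   case True
   hence "n - 1 - l : {1..<n}" by auto
   thus ?thesis using \<alpha> True by (auto simp: \<alpha>'_def prod_zero_iff)
  qed (simp add: \<alpha>'_def)
  show "P l j = 0 | int (degree (P l j)) <= (int m - 2) * (1 + int l - int j)" if "l < n" "j <= l" for l j
  proof -
   have e: "1 + int (n - j) - int (n - l) = 1 + int l - int j" using that by auto
   have "p (n - l) (n - j) = 0 | int (degree (p (n - l) (n - j))) <= (int m - 2) * (1 + int (n - j) - int (n - l))"
    using deg that by (intro deg[rule_format]) auto
   hence 1: "p (n - l) (n - j) = 0 | int (degree (p (n - l) (n - j))) <= (int m - 2) * (1 + int l - int j)" unfolding e .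
   show ?thesis
   proof (cases "l = j")
    case True
    have "P l j = 0 | int (degree (P l j)) <= int m - 2"
     unfolding P_def if_P[OF True]
     by (rule degree_diff_bound[OF _ degree_smult_bound[OF degree_dpoly[OF m]]]) (use 1 True in simp)
    thus ?thesis using True by simp
   qed (use 1 in "simp add: P_def")
  qed
 qed (use m n inj in auto)
 interpret hess_data a m n P \<alpha>' by (rule H)
 interpret C: punctured_covering X \<rho> a m \<sigma> by (rule cov)
 interpret hess_surface a m n P \<alpha>' X \<rho> \<sigma> "\<kappa> n" A
 proof
  show "A z : sq_mat n" for z using sf unfolding standard_form_def by blast
  show "A z = hA n b g z + (of_int (\<kappa> n) / (z - a m)) \<cdot> 1\<^sub>m n" if z: "z ~: a ` {1..m}" for z
   unfolding form[rule_format, OF z] by (rule hA_form[symmetric, OF _ _ \<kappa> z]) (auto simp: P_def \<alpha>'_def)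
 qed
 obtain Y Chi where Y: "system_solution n A (finite_part X \<rho>) \<rho> Y"
  "ALL k:{1..m}. Chi k : sq_mat n & (ALL x:finite_part X \<rho>. Y x = Y (\<sigma> k x) * Chi k)"
  "simultaneously_similar m Chi M"
  using sf unfolding standard_form_def system_monodromy_def by blast
 have "fuchsian_with_exponents n (hq n b g) (a k)
   (image_mset (%i. ep k i - (if k = m then of_int (\<kappa> n) else 0)) (mset_set {1..n}))" if k: "k : {1..m}" for k
 proof -
  have "local_form_at n A (a k) (E k)" using sf k unfolding standard_form_def by blast
  hence "char_poly (Bk k 0) = char_poly (E k)" by (rule residue_char_poly[OF k E[OF k] _ Y(1)])
  hence "proots (char_poly (hA n (bk k) (gk k) (a k)))
    = image_mset (%x. x - (if k = m then of_int (\<kappa> n) else 0)) (image_mset (ep k) (mset_set {1..n}))"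
   unfolding proots_residue[OF k] eig[OF k] by simp
  also have "... = image_mset (%i. ep k i - (if k = m then of_int (\<kappa> n) else 0)) (mset_set {1..n})"
   by (simp add: multiset.map_comp comp_def)
  finally show ?thesis using hq_fuchsian[OF k] by simp
 qed
 moreover have "equation_monodromy n m (hq n b g) X \<rho> \<sigma> M"
  by (rule equation_from_system[OF Y(1) _ _ Y(3)]) (use Y(2) in auto)
 ultimately show ?thesis using hq_holomorphic hq_nonsingular_at_infinity by blast
qed

text \<open>The constructed system has its exponents given by its residues. Uniqueness of exponents,
  with the shift at \<open>a m\<close> undone, shows that the residue at \<open>a k\<close> has the
  same spectrum as \<open>E k\<close>, as \<open>standard_form_from_equation\<close>
  requires.\<close>

lemma standard_form_of_equation:
 assumes cov: "punctured_covering X \<rho> a m \<sigma>" and n: "n >= 1" and m: "m >= 1" and inj: "inj_on a {1..m}"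
  and data: "admissible_data n m M E"
  and \<kappa>: "!!i. i < n ==> \<kappa> (i + 1) = \<kappa> n + (int m - 2) * int (n - 1 - i)"
  and eig: "!!k. k : {1..m} ==> image_mset (ep k) (mset_set {1..n}) = proots (char_poly (E k))"
  and q: "!!k. k : {1..n} ==> q k hol (UNIV - a ` {1..m})" and inf: "nonsingular_at_infinity n q"
  and fuchs: "!!k. k : {1..m} ==> fuchsian_with_exponents n q (a k)
   (image_mset (%i. ep k i - (if k = m then of_int (\<kappa> n) else 0)) (mset_set {1..n}))"
  and mon: "equation_monodromy n m q X \<rho> \<sigma> M"
 shows "EX A (p :: nat => nat => complex poly) \<alpha>. standard_form n m a X \<rho> \<sigma> M E \<kappa> A &
    (ALL i j. 1 <= i & i <= j & j <= n --> p i j = 0 | int (degree (p i j)) <= (int m - 2) * (1 + int j - int i)) &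
    (PROD k:{1..<n}. \<alpha> k) ~= 0 &
    (ALL z. z ~: a ` {1..m} -->
      A z = (1 / (\<Prod>k=1..m. z - a k)) \<cdot> Matrix.mat n n (%(i,j).
       if i = j then of_int (\<kappa> (i + 1)) * z ^ (m - 1) + poly (p (i + 1) (j + 1)) z
       else if i < j then poly (p (i + 1) (j + 1)) z
       else if i = j + 1 then \<alpha> (j + 1)
       else 0))"
proof -
 have D: "!!k. k : {1..m} ==> M k : sq_mat n" "!!k. k : {1..m} ==> E k : sq_mat n"
  "!!k. k : {1..m} ==> similar_mat (M k) (mat_exp n ((- 2 * of_real pi * \<i>) \<cdot> E k))"
  "!!k. k : {1..m} ==> non_resonant (E k)"
  using data unfolding admissible_data_def by blast+
 obtain P where P: "hess_data a m n P (%_. 1)"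
  and hq: "!!k z. k : {1..n} ==> z ~: a ` {1..m} ==> hq n (hess_data.b a m P) (hess_data.g a m (%_. 1)) k z = q k z"
 proof (rule hess_data_from_equation[OF m n inj q inf])
  fix P assume 1: "hess_data a m n P (%_. 1)"
   and 2: "!!k z. k : {1..n} ==> z ~: a ` {1..m} ==> hq n (hess_data.b a m P) (hess_data.g a m (%_. 1)) k z = q k z"
  show thesis by (rule that[OF 1 2])
 qed (use fuchs in blast)+
 interpret hess_data a m n P "%_. 1" by (rule P)
 interpret C: punctured_covering X \<rho> a m \<sigma> by (rule cov)
 define A where "A z = hA n b g z + (of_int (\<kappa> n) / (z - a m)) \<cdot> 1\<^sub>m n" for z
 interpret hess_surface a m n P "%_. 1" X \<rho> \<sigma> "\<kappa> n" A
  by unfold_locales (simp_all add: A_def)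
 define p where "p i j = P (n - i) (n - j) + (if i = j then psmult (of_int (\<kappa> n)) (dpoly a m) else 0)" for i j
 have form: "A z = (1 / (\<Prod>k=1..m. z - a k)) \<cdot> Matrix.mat n n (%(i,j).
       if i = j then of_int (\<kappa> (i + 1)) * z ^ (m - 1) + poly (p (i + 1) (j + 1)) z
       else if i < j then poly (p (i + 1) (j + 1)) z
       else if i = j + 1 then 1
       else 0)" if z: "z ~: a ` {1..m}" for z
  unfolding A_def
 proof (rule hA_form[of p, where \<alpha>'="%_. 1", OF _ _ \<kappa> z])
  show "P l j = p (n - l) (n - j) - (if l = j then psmult (of_int (\<kappa> n)) (dpoly a m) else 0)" if lj: "l < n" "j <= l" for l j
  proof -
   have "n - (n - l) = l" "n - (n - j) = j" "n - l = n - j \<longleftrightarrow> l = j" using lj by auto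
   thus ?thesis by (simp add: p_def)
  qed
 qed auto
 have deg: "p i j = 0 | int (degree (p i j)) <= (int m - 2) * (1 + int j - int i)" if ij: "1 <= i" "i <= j" "j <= n" for i j
 proof -
  have e: "1 + int (n - i) - int (n - j) = 1 + int j - int i" using ij by auto
  have 1: "P (n - i) (n - j) = 0 | int (degree (P (n - i) (n - j))) <= (int m - 2) * (1 + int j - int i)"
   using degP[of "n - i" "n - j"] ij n unfolding e by auto
  show ?thesis
  proof (cases "i = j")
   case True
   have "P (n - i) (n - j) - psmult (- of_int (\<kappa> n)) (dpoly a m) = 0 |
     int (degree (P (n - i) (n - j) - psmult (- of_int (\<kappa> n)) (dpoly a m))) <= int m - 2"
    by (rule degree_diff_bound[OF _ degree_smult_bound[OF degree_dpoly[OF m]]]) (use 1 True in simp)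
   thus ?thesis using True by (simp add: p_def)
  qed (use 1 in "simp add: p_def")
 qed
 have am: "z ~: a ` {1..m}" if "x : X" "\<rho> x = Some z" for x z
  using C.cov that unfolding covering_space_def by (metis DiffD2 image_eqI)
 \<comment> \<open>The constructed coefficients agree with \<open>q\<close> off the punctures, which
   is where the equation is imposed on solutions.\<close>
 have sol: "equation_solution n (hq n b g) X \<rho> y" if y: "equation_solution n q X \<rho> y" for y
  unfolding equation_solution_def
 proof
  fix x assume x: "x : X"
  obtain r g0 where g0: "local_lift X \<rho> x r g0" "(%h. y (g0 h)) hol ball 0 r"
   "ALL z. \<rho> x = Some z --> ode_lhs n q z (%h. y (g0 h)) 0 = 0" using y x unfolding equation_solution_def by blast
  have "ode_lhs n (hq n b g) z (%h. y (g0 h)) 0 = 0" if z: "\<rho> x = Some z" for z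
  proof -
   have "ode_lhs n (hq n b g) z (%h. y (g0 h)) 0 = ode_lhs n q z (%h. y (g0 h)) 0"
    unfolding ode_lhs_def using hq[OF _ am[OF x z]] by simp
   thus ?thesis using g0(3) z by simp
  qed
  thus "EX r g'. local_lift X \<rho> x r g' & (%h. y (g' h)) hol ball 0 r &
    (ALL z. \<rho> x = Some z --> ode_lhs n (hq n b g) z (%h. y (g' h)) 0 = 0)" using g0(1,2) by blast
 qed
 have mon': "equation_monodromy n m (hq n b g) X \<rho> \<sigma> M"
  using mon unfolding equation_monodromy_def by (elim ex_forward conj_forward) (use sol in "blast | assumption")+
 have eigB: "eigenvalue (E k) x" if k: "k : {1..m}" and x: "eigenvalue (Bk k 0) x" for k x
 proof -
  define s where "s = (if k = m then of_int (\<kappa> n) else 0 :: complex)"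
  have "fuchsian_with_exponents n (hq n b g) (a k) (image_mset (%i. ep k i - s) (mset_set {1..n}))"
  proof (rule fuchsian_cong[OF fuchs[OF k, folded s_def]])
   fix i assume i: "i : {1..n}"
   have "\<forall>\<^sub>F z in at (a k). z : UNIV - a ` ({1..m} - {k}) - {a k}"
    using Vk[of k] k by (intro eventually_at_in_open) auto
   thus "\<forall>\<^sub>F z in at (a k). q i z = hq n b g i z"
   proof eventually_elim
    case (elim z)
    hence "z ~: a ` {1..m}" by blast
    thus ?case using hq[OF i] by simp
   qed
  qed
  from fuchsian_exponents_unique[OF this hq_fuchsian[OF k]]
  have "image_mset (%i. ep k i - s) (mset_set {1..n}) = image_mset (%x. x - s) (proots (char_poly (Bk k 0)))"
   unfolding proots_residue[OF k] s_def .
  hence "image_mset (%x. x + s) (image_mset (%i. ep k i - s) (mset_set {1..n}))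
    = image_mset (%x. x + s) (image_mset (%x. x - s) (proots (char_poly (Bk k 0))))" by simp
  hence "image_mset (ep k) (mset_set {1..n}) = proots (char_poly (Bk k 0))"
   by (simp add: multiset.map_comp comp_def)
  thus ?thesis using x eig[OF k] eigenvalue_iff_proots[OF Bk_carrier] eigenvalue_iff_proots[OF D(2)[OF k]] by simp
 qed
 have Ahol: "mat_hol n A (UNIV - a ` {1..m})"
  unfolding mat_holomorphic_on_def
 proof (intro allI impI)
  fix i j assume ij: "i < n" "j < n"
  have "a m : a ` {1..m}" using m by auto
  hence "z - a m ~= 0" if "z : UNIV - a ` {1..m}" for z using that by auto
  moreover have "(%z. hA n b g z $$ (i,j)) hol UNIV - a ` {1..m}"
   using hA_holomorphic ij unfolding mat_holomorphic_on_def by blast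
  ultimately have "(%z. hA n b g z $$ (i,j) + of_int (\<kappa> n) / (z - a m) * (if i = j then 1 else 0)) hol UNIV - a ` {1..m}"
   by (intro holomorphic_intros) auto
  thus "(%z. A z $$ (i,j)) hol UNIV - a ` {1..m}"
   by (rule holomorphic_transform) (use ij in "simp add: A_def")
 qed
 have "standard_form n m a X \<rho> \<sigma> M E \<kappa> A"
  by (rule standard_form_from_equation[OF mon' Ahol D(2) D(4) eigB D(1) D(3) \<kappa>])
 thus ?thesis using deg form by (intro exI[of _ A] exI[of _ p] exI[of _ "%_. 1"]) simp
qed

theorem theorem5p4:
  fixes n m :: nat
    and M E :: "nat \<Rightarrow> complex mat"
    and a :: "nat \<Rightarrow> complex"
    and \<kappa> :: "nat \<Rightarrow> int"
    and \<epsilon> :: "nat \<Rightarrow> nat \<Rightarrow> complex"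
    and \<gamma> :: "real \<Rightarrow> complex"
    and t :: "nat \<Rightarrow> real"
    and S' :: "'a::topological_space set"
    and \<rho> :: "'a \<Rightarrow> csphere"
    and x0 :: 'a
    and \<sigma> :: "nat \<Rightarrow> 'a \<Rightarrow> 'a"
  assumes "n \<ge> 1" and "m \<ge> 1"
    and a_distinct: "inj_on a {1..m}"
    and curve: "smooth_jordan_curve \<gamma>" "cyclically_ordered_on \<gamma> t m a"
    and covering: "universal_covering S' \<rho> (UNIV - Some ` a ` {1..m})"
    and base_point: "x0 \<in> S'" "\<rho> x0 \<in> Some ` inside (path_image \<gamma>)"
    and deck: "\<And>k. k \<in> {1..m} \<Longrightarrow> deck_transformation S' \<rho> (\<sigma> k) \<and>
                 (\<exists>c. encircling_path S' \<rho> \<gamma> t x0 k c \<and> \<sigma> k x0 = pathfinish c)"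
    and data: "admissible_data n m M E"
    and kappa_decreasing: "\<And>i j. 1 \<le> i \<Longrightarrow> i \<le> j \<Longrightarrow> j \<le> n \<Longrightarrow> \<kappa> j \<le> \<kappa> i"
    and kappa_diff: "\<And>k. k \<in> {1..<n} \<Longrightarrow> \<kappa> k - \<kappa> (k + 1) = int m - 2"
    and eigenvalues: "\<And>k. k \<in> {1..m} \<Longrightarrow>
                        image_mset (\<epsilon> k) (mset_set {1..n}) = proots (char_poly (E k))"
  shows
    "(\<exists>A (p :: nat \<Rightarrow> nat \<Rightarrow> complex poly) \<alpha>.
        standard_form n m a S' \<rho> \<sigma> M E \<kappa> A \<and>
        (\<forall>i j. 1 \<le> i \<and> i \<le> j \<and> j \<le> n \<longrightarrow>
           p i j = 0 \<or> int (degree (p i j)) \<le> (int m - 2) * (1 + int j - int i)) \<and>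
        (\<Prod>k\<in>{1..<n}. \<alpha> k) \<noteq> 0 \<and>
        (\<forall>z. z \<notin> a ` {1..m} \<longrightarrow>
           A z = (1 / (\<Prod>k=1..m. z - a k)) \<cdot>\<^sub>m Matrix.mat n n (\<lambda>(i,j).
             if i = j then of_int (\<kappa> (i + 1)) * z ^ (m - 1) + poly (p (i + 1) (j + 1)) z
             else if i < j then poly (p (i + 1) (j + 1)) z
             else if i = j + 1 then \<alpha> (j + 1)
             else 0)))
     \<longleftrightarrow>
     (\<exists>q. (\<forall>k\<in>{1..n}. q k holomorphic_on (UNIV - a ` {1..m})) \<and>
        nonsingular_at_infinity n q \<and>
        (\<forall>k\<in>{1..<m}. fuchsian_with_exponents n q (a k)
                         (image_mset (\<epsilon> k) (mset_set {1..n}))) \<and>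
        fuchsian_with_exponents n q (a m)
          (image_mset (\<lambda>i. \<epsilon> m i - of_int (\<kappa> n)) (mset_set {1..n})) \<and>
        equation_monodromy n m q S' \<rho> \<sigma> M)"
proof -
 have cov: "punctured_covering S' \<rho> a m \<sigma>"
  by (rule punctured_coveringI[OF \<open>m >= 1\<close> curve covering base_point deck])
 have \<kappa>: "\<kappa> (i + 1) = \<kappa> n + (int m - 2) * int (n - 1 - i)" if "i < n" for i
  using that
 proof (induction "n - 1 - i" arbitrary: i)
  case 0
  hence "i + 1 = n" by simp
  thus ?case by simp
 next
  case (Suc l)
  have "\<kappa> (i + 1) - \<kappa> (i + 1 + 1) = int m - 2" by (rule kappa_diff) (use Suc in auto)
  moreover have "\<kappa> (i + 1 + 1) = \<kappa> n + (int m - 2) * int (n - 1 - (i + 1))" by (rule Suc) (use Suc in auto)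
  moreover have "int (n - 1 - i) = int (n - 1 - (i + 1)) + 1" using Suc by simp
  ultimately show ?case by (simp add: algebra_simps)
 qed
 have E: "E k : sq_mat n" if "k : {1..m}" for k
  using data that unfolding admissible_data_def by blast
 have split: "(ALL k:{1..m}. fuchsian_with_exponents n q (a k)
   (image_mset (%i. \<epsilon> k i - (if k = m then of_int (\<kappa> n) else 0)) (mset_set {1..n}))) \<longleftrightarrow>
   (ALL k:{1..<m}. fuchsian_with_exponents n q (a k) (image_mset (\<epsilon> k) (mset_set {1..n}))) &
   fuchsian_with_exponents n q (a m) (image_mset (%i. \<epsilon> m i - of_int (\<kappa> n)) (mset_set {1..n}))" for q
 proof -
  have "{1..m} = insert m {1..<m}" using \<open>m >= 1\<close> by auto
  moreover have "k ~= m" if "k : {1..<m}" for k using that by simp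
  ultimately show ?thesis by auto
 qed
 show ?thesis (is "?L \<longleftrightarrow> ?R")
 proof
  assume ?L
  then obtain A p \<alpha> where L: "standard_form n m a S' \<rho> \<sigma> M E \<kappa> A"
   "ALL i j. 1 <= i & i <= j & j <= n --> p i j = 0 | int (degree (p i j)) <= (int m - 2) * (1 + int j - int i)"
   "(PROD k:{1..<n}. \<alpha> k) ~= 0"
   "ALL z. z ~: a ` {1..m} -->
      A z = (1 / (\<Prod>k=1..m. z - a k)) \<cdot> Matrix.mat n n (%(i,j).
       if i = j then of_int (\<kappa> (i + 1)) * z ^ (m - 1) + poly (p (i + 1) (j + 1)) z
       else if i < j then poly (p (i + 1) (j + 1)) z
       else if i = j + 1 then \<alpha> (j + 1)
       else 0)" by (elim exE conjE) (rule that)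
  from equation_from_standard_form[OF cov \<open>n >= 1\<close> \<open>m >= 1\<close> a_distinct E \<kappa> eigenvalues L]
  show ?R unfolding split by blast
 next
  assume ?R
  then obtain q where q: "ALL k:{1..n}. q k hol (UNIV - a ` {1..m})" "nonsingular_at_infinity n q"
   and f: "ALL k:{1..<m}. fuchsian_with_exponents n q (a k) (image_mset (\<epsilon> k) (mset_set {1..n}))"
   "fuchsian_with_exponents n q (a m) (image_mset (%i. \<epsilon> m i - of_int (\<kappa> n)) (mset_set {1..n}))"
   and mon: "equation_monodromy n m q S' \<rho> \<sigma> M" by blast
  have fu: "ALL k:{1..m}. fuchsian_with_exponents n q (a k)
   (image_mset (%i. \<epsilon> k i - (if k = m then of_int (\<kappa> n) else 0)) (mset_set {1..n}))" unfolding split using f by blast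
  show ?L
   by (rule standard_form_of_equation[OF cov \<open>n >= 1\<close> \<open>m >= 1\<close> a_distinct data \<kappa> eigenvalues bspec[OF q(1)] q(2) bspec[OF fu] mon])
 qed
qed

end
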